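(* Let $G$ be a finite group and write $N=N(\mathbb{Q}(\widetilde G))$. There is a short exact sequence of $\mathbb{Q}[G^{ab}]$-modules $$0\longrightarrow \frac{E(G)}{E(G)\cap N}+\frac{P(G)}{P(G)\cap N}+\sum_{G'\leq H\lneq G}\overline{\Phi_H^G}\big(\mathbb{Q}(\widetilde H)/N(\mathbb{Q}(\widetilde H))\big)\ \xrightarrow{\ \Psi\ }\ \mathbb{Q}(\widetilde G)/N\ \longrightarrow\ \frac{R(G)}{R(G)\cap N}\longrightarrow 0,$$ where the left-hand module is the sum of the indicated submodules inside $\mathbb{Q}(\widetilde G)/N$ and $\Psi$ is the embedding.
   Context: $K$ is an algebraically closed field of characteristic $0$; groups are finite; $G'=[G,G]$, $G^{ab}=G/G'$. Gliders. A glider of length at most $1$ of $G$ (for $K\subset K[G]$) is a $K[G]$-module $\Omega$ with finite-dimensional $K$-subspaces $M_{-1}\subseteq M_0\subseteq\Omega$ with $K[G]M_{-1}\subseteq M_0$; it has length $0$ if $M_{-1}=0$ and length $1$ otherwise. A morphism to $(N_{-1}\subseteq N_0)$ is a $K$-linear $f:M_0\to N_0$ with $f(M_{-1})\subseteq N_{-1}$ and $f(xm)=xf(m)$ for $x\in K[G]$, $m\in M_{-1}$. Direct sums and tensor products (diagonal $G$-action) are formed levelwise. A glider of length $1$ is irreducible iff $\dim M_{-1}=1$ and $M_0=K[G]M_{-1}$. The reduced glider representation ring $\overline{R}_1(\widetilde G)$ is the subring generated by the classes of irreducible gliders of length $1$ in the quotient of the split Grothendieck ring of gliders of length $\le 1$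 by the ideal additively generated by gliders of length $0$. In it $[Ku\subset U]\cdot[Kv\subset V]=[K(u\otimes v)\subset K[G](u\otimes v)]$. Put $\mathbb{Q}(\widetilde G)=\mathbb{Q}\otimes_{\mathbb Z}\overline R_1(\widetilde G)$, and let $N(\cdot)$ denote the nilradical. Parametrization. For every group fix an isomorphism $z\mapsto T_z$ from $G^{ab}$ to the group of one-dimensional $K[G]$-modules. $\mathcal{S}_G$ is the set of subsets $B$ of $\bigsqcup_{U\in\mathrm{Irr}(G),\dim U>1}\mathrm{Gr}(U)$, $\mathrm{Gr}(U)=\bigsqcup_{j=1}^{\dim U}\mathrm{Gr}(j,U)$, containing at most one point $W_U$ of each $\mathrm{Gr}(U)$. For $A\subseteq G^{ab}$, $B\in\mathcal S_G$, not both empty, $M_{(A,B)}$ is the class of the irreducible glider $Kv\subset\bigoplus_{z\in A}T_z\oplus\bigoplus_U U^{\oplus m_U}$ with $m_U=\dim W_U$ ($0$ if $B\cap\mathrm{Gr}(U)=\emptyset$), where $v$ has nonzero component in each $T_z$ and its components in the copies of $U$ form a basis of $W_U$. Every irreducible glider of length $1$ is isomorphic to exactly one of these. Obstruction modules. $P(G)$ is the $\mathbb{Q}$-span of those $M_{(A,B)}$ whose powers form an infinite cyclic semigroup $\langle M_{(A,B)}\rangle$. If $M_{(A,B)}\notin P(G)$, the finite semigroup $\langle M_{(A,B)}\rangle$ contains a unique idempotent, denoted $e(A,B)$. $R(G)$ is the $\mathbb{Q}$-span of those $M_{(A,B)}$ for which $e(A,B)=M_{(\{e\},D)}$ for some $D\in\mathcal{S}_G$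 ($e$ the identity of $G^{ab}$, $T_e$ trivial). $E(G)$ is the $\mathbb{Q}$-span of those $M_{(A,B)}$ for which $e(A,B)=M_{(\emptyset,D)}$ for some $D$. Induction and module structure. For $H\le G$, $\Phi_H^G:\mathbb{Q}(\widetilde H)\to\mathbb{Q}(\widetilde G)$ is the (injective) $\mathbb{Q}$-algebra map induced by $(Ku\subset U)\mapsto(K(1\otimes u)\subset K[G]\otimes_{K[H]}U)$, and $\overline{\Phi_H^G}$ is the induced map modulo nilradicals. $z\in G^{ab}$ acts on $\mathbb{Q}(\widetilde G)$ by multiplication by $M_{(\{z\},\emptyset)}$ and on $\mathbb{Q}(\widetilde H)$ by multiplication by the class of the restriction of $T_z$ to $H$. Each quotient $X/(X\cap N)$ is identified with the image of $X$ in $\mathbb{Q}(\widetilde G)/N$. *)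

theory Defs
  imports
    "HOL-Algebra.Module"
    "HOL-Algebra.QuotRing"
    "HOL-Algebra.Generated_Rings"
    "HOL-Algebra.Generated_Groups"
    "HOL-Algebra.Free_Abelian_Groups"
    "HOL-Library.Function_Algebras"
    "HOL-Computational_Algebra.Polynomial"
begin

section \<open>Coordinate spaces and representations\<close>

text \<open>
  The space \<open>K\<^sup>n\<close> is the set of sequences vanishing from index \<open>n\<close> on, inside the vector
  space of all sequences over \<open>K\<close>.
\<close>

definition vscale :: "'k::field \<Rightarrow> (nat \<Rightarrow> 'k) \<Rightarrow> nat \<Rightarrow> 'k"
  where "vscale c v = (\<lambda>i. c * v i)"

global_interpretation kv: vector_space "vscale :: 'k::field \<Rightarrow> (nat \<Rightarrow> 'k) \<Rightarrow> (nat \<Rightarrow> 'k)"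
  by unfold_locales (auto simp: vscale_def fun_eq_iff algebra_simps)

definition kspace :: "nat \<Rightarrow> (nat \<Rightarrow> 'k::field) set"
  where "kspace n = {v. \<forall>i\<ge>n. v i = 0}"

definition klinear_on :: "(nat \<Rightarrow> 'k::field) set \<Rightarrow> ((nat \<Rightarrow> 'k) \<Rightarrow> nat \<Rightarrow> 'k) \<Rightarrow> bool"
  where "klinear_on S f \<longleftrightarrow>
    (\<forall>u\<in>S. \<forall>v\<in>S. f (u + v) = f u + f v) \<and> (\<forall>c. \<forall>u\<in>S. f (vscale c u) = vscale c (f u))"

text \<open>
  A finite-dimensional \<open>K[G]\<close>-module in coordinates: a matrix for each group element. Entries
  at indices beyond the dimension, and matrices of elements outside the group, are irrelevant.
\<close>

record ('g, 'k) rep =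
  rdim :: nat
  rmat :: "'g \<Rightarrow> nat \<Rightarrow> nat \<Rightarrow> 'k"

definition is_rep :: "('g, 'm) monoid_scheme \<Rightarrow> ('g, 'k::field) rep \<Rightarrow> bool"
  where "is_rep G V \<longleftrightarrow>
    (\<forall>i<rdim V. \<forall>j<rdim V. rmat V \<one>\<^bsub>G\<^esub> i j = (if i = j then 1 else 0)) \<and>
    (\<forall>g\<in>carrier G. \<forall>h\<in>carrier G. \<forall>i<rdim V. \<forall>j<rdim V.
       rmat V (g \<otimes>\<^bsub>G\<^esub> h) i j = (\<Sum>k<rdim V. rmat V g i k * rmat V h k j))"

definition act :: "('g, 'k::field) rep \<Rightarrow> 'g \<Rightarrow> (nat \<Rightarrow> 'k) \<Rightarrow> nat \<Rightarrow> 'k"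
  where "act V g v = (\<lambda>i. if i < rdim V then \<Sum>j<rdim V. rmat V g i j * v j else 0)"

text \<open>An element \<open>\<Sum>\<^sub>g x\<^sub>g g\<close> of \<open>K[G]\<close> is given by its coefficient function \<open>x\<close>.\<close>

definition kG_act ::
    "('g, 'm) monoid_scheme \<Rightarrow> ('g, 'k::field) rep \<Rightarrow> ('g \<Rightarrow> 'k) \<Rightarrow> (nat \<Rightarrow> 'k) \<Rightarrow> nat \<Rightarrow> 'k"
  where "kG_act G V x v = (\<Sum>g\<in>carrier G. vscale (x g) (act V g v))"

definition kG_span ::
    "('g, 'm) monoid_scheme \<Rightarrow> ('g, 'k::field) rep \<Rightarrow> (nat \<Rightarrow> 'k) set \<Rightarrow> (nat \<Rightarrow> 'k) set"
  where "kG_span G V S = kv.span {kG_act G V x v |x v. v \<in> S}"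

definition rep_iso ::
    "('g, 'm) monoid_scheme \<Rightarrow> ('g, 'k::field) rep \<Rightarrow> ('g, 'k) rep \<Rightarrow> bool"
  where "rep_iso G V W \<longleftrightarrow> (\<exists>f. klinear_on (kspace (rdim V)) f \<and>
    bij_betw f (kspace (rdim V)) (kspace (rdim W)) \<and>
    (\<forall>x. \<forall>v\<in>kspace (rdim V). f (kG_act G V x v) = kG_act G W x (f v)))"

definition irreducible_rep :: "('g, 'm) monoid_scheme \<Rightarrow> ('g, 'k::field) rep \<Rightarrow> bool"
  where "irreducible_rep G V \<longleftrightarrow> is_rep G V \<and> rdim V > 0 \<and>
    (\<forall>S. kv.subspace S \<and> S \<subseteq> kspace (rdim V) \<and> kG_span G V S \<subseteq> S \<longrightarrow>
         S = {0} \<or> S = kspace (rdim V))"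

text \<open>A set of representatives of the isomorphism classes of irreducible \<open>K[G]\<close>-modules.\<close>

definition irr_system :: "('g, 'm) monoid_scheme \<Rightarrow> ('g, 'k::field) rep set \<Rightarrow> bool"
  where "irr_system G I \<longleftrightarrow> (\<forall>U\<in>I. irreducible_rep G U) \<and>
    (\<forall>V. irreducible_rep G V \<longrightarrow> (\<exists>!U. U \<in> I \<and> rep_iso G V U))"

definition vec_dsum :: "nat \<Rightarrow> (nat \<Rightarrow> 'k::field) \<Rightarrow> (nat \<Rightarrow> 'k) \<Rightarrow> nat \<Rightarrow> 'k"
  where "vec_dsum n u v = (\<lambda>i. if i < n then u i else v (i - n))"

definition rep_dsum :: "('g, 'k::field) rep \<Rightarrow> ('g, 'k) rep \<Rightarrow> ('g, 'k) rep"
  where "rep_dsum V W =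
    \<lparr>rdim = rdim V + rdim W,
     rmat = (\<lambda>g i j.
       if i < rdim V \<and> j < rdim V then rmat V g i j
       else if i \<ge> rdim V \<and> j \<ge> rdim V then rmat W g (i - rdim V) (j - rdim V)
       else 0)\<rparr>"

definition zero_rep :: "('g, 'k::field) rep"
  where "zero_rep = \<lparr>rdim = 0, rmat = (\<lambda>g i j. 0)\<rparr>"

text \<open>
  \<open>K\<^sup>n \<otimes> K\<^sup>m\<close> is \<open>K\<^bsup>nm\<^esup>\<close>, with \<open>e\<^sub>a \<otimes> e\<^sub>b\<close> at index \<open>a m + b\<close>.
\<close>

definition vec_tensor :: "nat \<Rightarrow> (nat \<Rightarrow> 'k::field) \<Rightarrow> (nat \<Rightarrow> 'k) \<Rightarrow> nat \<Rightarrow> 'k"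
  where "vec_tensor m u v = (\<lambda>i. u (i div m) * v (i mod m))"

definition rep_tensor :: "('g, 'k::field) rep \<Rightarrow> ('g, 'k) rep \<Rightarrow> ('g, 'k) rep"
  where "rep_tensor V W =
    \<lparr>rdim = rdim V * rdim W,
     rmat = (\<lambda>g i j. rmat V g (i div rdim W) (j div rdim W) *
                     rmat W g (i mod rdim W) (j mod rdim W))\<rparr>"

definition linear_rep :: "('g \<Rightarrow> 'k::field) \<Rightarrow> ('g, 'k) rep"
  where "linear_rep \<chi> = \<lparr>rdim = 1, rmat = (\<lambda>g i j. \<chi> g)\<rparr>"

definition unit_vec0 :: "'k::field \<Rightarrow> nat \<Rightarrow> 'k"
  where "unit_vec0 c = (\<lambda>i. if i = 0 then c else 0)"

text \<open>
  Left coset representatives of \<open>H\<close> in \<open>G\<close>, the first one being the identity. In terms of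
  them, \<open>K[G] \<otimes>\<^bsub>K[H]\<^esub> K\<^sup>n\<close> is the direct sum of the blocks \<open>r\<^sub>i \<otimes> K\<^sup>n\<close>, with
  \<open>r\<^sub>i \<otimes> e\<^sub>k\<close> at index \<open>i n + k\<close>, and \<open>g (r\<^sub>i \<otimes> w) = r\<^sub>j \<otimes> h w\<close> if \<open>g r\<^sub>i = r\<^sub>j h\<close>
  with \<open>h\<close> in \<open>H\<close>.
\<close>

definition coset_reps :: "('g, 'm) monoid_scheme \<Rightarrow> 'g set \<Rightarrow> 'g list"
  where "coset_reps G H = (SOME rs. rs \<noteq> [] \<and> hd rs = \<one>\<^bsub>G\<^esub> \<and> distinct rs \<and>
    set rs \<subseteq> carrier G \<and> (\<forall>g\<in>carrier G. \<exists>!r. r \<in> set rs \<and> inv\<^bsub>G\<^esub> r \<otimes>\<^bsub>G\<^esub> g \<in> H))"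

definition rep_ind ::
    "('g, 'm) monoid_scheme \<Rightarrow> 'g set \<Rightarrow> ('g, 'k::field) rep \<Rightarrow> ('g, 'k) rep"
  where "rep_ind G H V = (let rs = coset_reps G H; n = rdim V in
    \<lparr>rdim = length rs * n,
     rmat = (\<lambda>g p q.
       let h = inv\<^bsub>G\<^esub> (rs ! (p div n)) \<otimes>\<^bsub>G\<^esub> g \<otimes>\<^bsub>G\<^esub> (rs ! (q div n))
       in if h \<in> H then rmat V h (p mod n) (q mod n) else 0)\<rparr>)"


section \<open>Gliders of length at most one\<close>

text \<open>
  \<open>gsub\<close>, \<open>gtop\<close> and \<open>gamb\<close> are \<open>M\<^bsub>-1\<^esub> \<subseteq> M\<^sub>0 \<subseteq> \<Omega>\<close>. Taking the ambient module finite
  dimensional loses nothing up to isomorphism: \<open>\<Omega>\<close> may be replaced by \<open>K[G]M\<^sub>0\<close>.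
\<close>

record ('g, 'k) glider =
  gamb :: "('g, 'k) rep"
  gsub :: "(nat \<Rightarrow> 'k) set"
  gtop :: "(nat \<Rightarrow> 'k) set"

definition is_glider :: "('g, 'm) monoid_scheme \<Rightarrow> ('g, 'k::field) glider \<Rightarrow> bool"
  where "is_glider G X \<longleftrightarrow> is_rep G (gamb X) \<and>
    kv.subspace (gsub X) \<and> kv.subspace (gtop X) \<and>
    gsub X \<subseteq> gtop X \<and> gtop X \<subseteq> kspace (rdim (gamb X)) \<and>
    kG_span G (gamb X) (gsub X) \<subseteq> gtop X"

definition length_zero :: "('g, 'm) monoid_scheme \<Rightarrow> ('g, 'k::field) glider \<Rightarrow> bool"
  where "length_zero G X \<longleftrightarrow> is_glider G X \<and> gsub X = {0}"

definition irreducible_glider :: "('g, 'm) monoid_scheme \<Rightarrow> ('g, 'k::field) glider \<Rightarrow> bool"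
  where "irreducible_glider G X \<longleftrightarrow> is_glider G X \<and> kv.dim (gsub X) = 1 \<and>
    gtop X = kG_span G (gamb X) (gsub X)"

definition glider_mor ::
    "('g, 'm) monoid_scheme \<Rightarrow> ('g, 'k::field) glider \<Rightarrow> ('g, 'k) glider \<Rightarrow>
     ((nat \<Rightarrow> 'k) \<Rightarrow> nat \<Rightarrow> 'k) \<Rightarrow> bool"
  where "glider_mor G X Y f \<longleftrightarrow> klinear_on (gtop X) f \<and>
    f ` gtop X \<subseteq> gtop Y \<and> f ` gsub X \<subseteq> gsub Y \<and>
    (\<forall>x. \<forall>m\<in>gsub X. f (kG_act G (gamb X) x m) = kG_act G (gamb Y) x (f m))"

definition glider_iso ::
    "('g, 'm) monoid_scheme \<Rightarrow> ('g, 'k::field) glider \<Rightarrow> ('g, 'k) glider \<Rightarrow> bool"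
  where "glider_iso G X Y \<longleftrightarrow> (\<exists>f g. glider_mor G X Y f \<and> glider_mor G Y X g \<and>
    (\<forall>m\<in>gtop X. g (f m) = m) \<and> (\<forall>m\<in>gtop Y. f (g m) = m))"

definition glider_dsum ::
    "('g, 'k::field) glider \<Rightarrow> ('g, 'k) glider \<Rightarrow> ('g, 'k) glider"
  where "glider_dsum X Y =
    \<lparr>gamb = rep_dsum (gamb X) (gamb Y),
     gsub = {vec_dsum (rdim (gamb X)) u v |u v. u \<in> gsub X \<and> v \<in> gsub Y},
     gtop = {vec_dsum (rdim (gamb X)) u v |u v. u \<in> gtop X \<and> v \<in> gtop Y}\<rparr>"

definition glider_tensor ::
    "('g, 'k::field) glider \<Rightarrow> ('g, 'k) glider \<Rightarrow> ('g, 'k) glider"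
  where "glider_tensor X Y =
    \<lparr>gamb = rep_tensor (gamb X) (gamb Y),
     gsub = kv.span {vec_tensor (rdim (gamb Y)) u v |u v. u \<in> gsub X \<and> v \<in> gsub Y},
     gtop = kv.span {vec_tensor (rdim (gamb Y)) u v |u v. u \<in> gtop X \<and> v \<in> gtop Y}\<rparr>"

text \<open>The glider \<open>Kv \<subset> V\<close>.\<close>

definition line_glider :: "('g, 'k::field) rep \<Rightarrow> (nat \<Rightarrow> 'k) \<Rightarrow> ('g, 'k) glider"
  where "line_glider V v = \<lparr>gamb = V, gsub = kv.span {v}, gtop = kspace (rdim V)\<rparr>"

definition linear_glider :: "('g \<Rightarrow> 'k::field) \<Rightarrow> ('g, 'k) glider"
  where "linear_glider \<chi> = line_glider (linear_rep \<chi>) (unit_vec0 1)"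

definition trivial_glider :: "('g, 'k::field) glider"
  where "trivial_glider = linear_glider (\<lambda>g. 1)"

text \<open>
  Since the first coset representative is the identity, \<open>u \<mapsto> 1 \<otimes> u\<close> is the inclusion of
  \<open>K\<^sup>n\<close> as the initial block; so the bottom space \<open>1 \<otimes> M\<^bsub>-1\<^esub>\<close> is literally \<open>M\<^bsub>-1\<^esub>\<close>. The
  top space is \<open>K[G] \<otimes>\<^bsub>K[H]\<^esub> M\<^sub>0\<close>, which makes sense for an irreducible glider, where \<open>M\<^sub>0\<close> is
  a \<open>K[H]\<close>-module.
\<close>

definition glider_ind ::
    "('g, 'm) monoid_scheme \<Rightarrow> 'g set \<Rightarrow> ('g, 'k::field) glider \<Rightarrow> ('g, 'k) glider"
  where "glider_ind G H X = (let n = rdim (gamb X) in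
    \<lparr>gamb = rep_ind G H (gamb X),
     gsub = gsub X,
     gtop = {w \<in> kspace (length (coset_reps G H) * n).
       \<forall>i < length (coset_reps G H). (\<lambda>k. if k < n then w (i * n + k) else 0) \<in> gtop X}\<rparr>)"


section \<open>Rings presented by generators and additive relations\<close>

text \<open>The integral monoid ring of the monoid with carrier \<open>B\<close>, product \<open>m\<close> and unit \<open>e\<close>.\<close>

definition free_ring :: "'b set \<Rightarrow> ('b \<Rightarrow> 'b \<Rightarrow> 'b) \<Rightarrow> 'b \<Rightarrow> ('b \<Rightarrow>\<^sub>0 int) ring"
  where "free_ring B m e =
    \<lparr>carrier = {x. Poly_Mapping.keys x \<subseteq> B},
     monoid.mult = (\<lambda>x y. frag_extend (\<lambda>a. frag_extend (\<lambda>b. frag_of (m a b)) y) x),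
     monoid.one = frag_of e, ring.zero = 0, ring.add = (+)\<rparr>"

abbreviation add_span :: "('a, 'm) ring_scheme \<Rightarrow> 'a set \<Rightarrow> 'a set"
  where "add_span R S \<equiv> generate (add_monoid R) S"

subsection \<open>Extension of scalars from the integers to the rationals\<close>

definition tensor_free :: "('a, 'm) ring_scheme \<Rightarrow> (rat \<times> 'a \<Rightarrow>\<^sub>0 int) ring"
  where "tensor_free R =
    free_ring (UNIV \<times> carrier R) (\<lambda>(q, a) (p, b). (q * p, a \<otimes>\<^bsub>R\<^esub> b)) (1, \<one>\<^bsub>R\<^esub>)"

definition tensor_rel :: "('a, 'm) ring_scheme \<Rightarrow> (rat \<times> 'a \<Rightarrow>\<^sub>0 int) set"
  where "tensor_rel R = add_span (tensor_free R)
    ({frag_of (q + p, a) - frag_of (q, a) - frag_of (p, a) |q p a. a \<in> carrier R} \<union>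
     {frag_of (q, a \<oplus>\<^bsub>R\<^esub> b) - frag_of (q, a) - frag_of (q, b) |q a b.
        a \<in> carrier R \<and> b \<in> carrier R})"

definition rat_tensor :: "('a, 'm) ring_scheme \<Rightarrow> (rat \<times> 'a \<Rightarrow>\<^sub>0 int) set ring"
  where "rat_tensor R = tensor_free R Quot tensor_rel R"

definition pure_tensor :: "('a, 'm) ring_scheme \<Rightarrow> rat \<Rightarrow> 'a \<Rightarrow> (rat \<times> 'a \<Rightarrow>\<^sub>0 int) set"
  where "pure_tensor R q a = tensor_rel R +>\<^bsub>tensor_free R\<^esub> frag_of (q, a)"

subsection \<open>Nilradical and powers\<close>

definition nilradical :: "('a, 'm) ring_scheme \<Rightarrow> 'a set"
  where "nilradical R = {x \<in> carrier R. \<exists>n::nat. x [^]\<^bsub>R\<^esub> n = \<zero>\<^bsub>R\<^esub>}"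

definition cyclic_semigroup :: "('a, 'm) ring_scheme \<Rightarrow> 'a \<Rightarrow> 'a set"
  where "cyclic_semigroup R x = {x [^]\<^bsub>R\<^esub> n |n::nat. n \<ge> 1}"

definition the_idempotent :: "('a, 'm) ring_scheme \<Rightarrow> 'a \<Rightarrow> 'a"
  where "the_idempotent R x = (THE e. e \<in> cyclic_semigroup R x \<and> e \<otimes>\<^bsub>R\<^esub> e = e)"


section \<open>The reduced glider representation ring\<close>

type_synonym ('g, 'k) glider_class = "('g, 'k) glider set"

definition iso_class ::
    "('g, 'm) monoid_scheme \<Rightarrow> ('g, 'k::field) glider \<Rightarrow> ('g, 'k) glider_class"
  where "iso_class G X = {Y. is_glider G Y \<and> glider_iso G X Y}"

definition class_tensor ::
    "('g, 'm) monoid_scheme \<Rightarrow> ('g, 'k::field) glider_class \<Rightarrow> ('g, 'k) glider_class \<Rightarrow>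
     ('g, 'k) glider_class"
  where "class_tensor G a b = (\<Union>X\<in>a. \<Union>Y\<in>b. iso_class G (glider_tensor X Y))"

definition class_ring ::
    "('g, 'm) monoid_scheme \<Rightarrow> (('g, 'k::field) glider_class \<Rightarrow>\<^sub>0 int) ring"
  where "class_ring G =
    free_ring {iso_class G X |X. is_glider G X} (class_tensor G) (iso_class G trivial_glider)"

definition split_rel ::
    "('g, 'm) monoid_scheme \<Rightarrow> (('g, 'k::field) glider_class \<Rightarrow>\<^sub>0 int) set"
  where "split_rel G = add_span (class_ring G)
    {frag_of (iso_class G (glider_dsum X Y)) - frag_of (iso_class G X) - frag_of (iso_class G Y)
      |X Y. is_glider G X \<and> is_glider G Y}"

definition split_groth ::
    "('g, 'm) monoid_scheme \<Rightarrow> (('g, 'k::field) glider_class \<Rightarrow>\<^sub>0 int) set ring"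
  where "split_groth G = class_ring G Quot split_rel G"

definition groth_class ::
    "('g, 'm) monoid_scheme \<Rightarrow> ('g, 'k::field) glider \<Rightarrow> (('g, 'k) glider_class \<Rightarrow>\<^sub>0 int) set"
  where "groth_class G X = split_rel G +>\<^bsub>class_ring G\<^esub> frag_of (iso_class G X)"

definition zero_length_ideal ::
    "('g, 'm) monoid_scheme \<Rightarrow> (('g, 'k::field) glider_class \<Rightarrow>\<^sub>0 int) set set"
  where "zero_length_ideal G =
    add_span (split_groth G) {groth_class G X |X. length_zero G X}"

type_synonym ('g, 'k) red_elem = "(('g, 'k) glider_class \<Rightarrow>\<^sub>0 int) set set"

definition red_class ::
    "('g, 'm) monoid_scheme \<Rightarrow> ('g, 'k::field) glider \<Rightarrow> ('g, 'k) red_elem"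
  where "red_class G X = zero_length_ideal G +>\<^bsub>split_groth G\<^esub> groth_class G X"

definition reduced_ring ::
    "('g, 'm) monoid_scheme \<Rightarrow> ('g, 'k::field) red_elem ring"
  where "reduced_ring G = (let S = split_groth G Quot zero_length_ideal G in
    S\<lparr>carrier := generate_ring S {red_class G X |X. irreducible_glider G X}\<rparr>)"

type_synonym ('g, 'k) rat_elem = "(rat \<times> ('g, 'k) red_elem \<Rightarrow>\<^sub>0 int) set"

definition glider_alg ::
    "('g, 'm) monoid_scheme \<Rightarrow> ('g, 'k::field) rat_elem ring"
  where "glider_alg G = rat_tensor (reduced_ring G)"

definition glider_cls ::
    "('g, 'm) monoid_scheme \<Rightarrow> ('g, 'k::field) glider \<Rightarrow> ('g, 'k) rat_elem"
  where "glider_cls G X = pure_tensor (reduced_ring G) 1 (red_class G X)"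

definition scal :: "('g, 'm) monoid_scheme \<Rightarrow> rat \<Rightarrow> ('g, 'k::field) rat_elem"
  where "scal G q = pure_tensor (reduced_ring G) q \<one>\<^bsub>reduced_ring G\<^esub>"

definition qspan ::
    "('g, 'm) monoid_scheme \<Rightarrow> ('g, 'k::field) rat_elem set \<Rightarrow> ('g, 'k) rat_elem set"
  where "qspan G S = add_span (glider_alg G) {scal G q \<otimes>\<^bsub>glider_alg G\<^esub> s |q s. s \<in> S}"

definition nil :: "('g, 'm) monoid_scheme \<Rightarrow> ('g, 'k::field) rat_elem set"
  where "nil G = nilradical (glider_alg G)"

definition red_alg ::
    "('g, 'm) monoid_scheme \<Rightarrow> ('g, 'k::field) rat_elem set ring"
  where "red_alg G = glider_alg G Quot nil G"

definition mod_nil ::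
    "('g, 'm) monoid_scheme \<Rightarrow> ('g, 'k::field) rat_elem \<Rightarrow> ('g, 'k) rat_elem set"
  where "mod_nil G x = nil G +>\<^bsub>glider_alg G\<^esub> x"


section \<open>Parametrization of the irreducible gliders\<close>

definition abelianization :: "('g, 'm) monoid_scheme \<Rightarrow> 'g set monoid"
  where "abelianization G = G Mod derived G (carrier G)"

text \<open>
  One-dimensional modules up to isomorphism, under the tensor product, are the linear
  characters under pointwise multiplication.
\<close>

definition linear_characters :: "('g, 'm) monoid_scheme \<Rightarrow> ('g \<Rightarrow> 'k::field) monoid"
  where "linear_characters G =
    \<lparr>carrier = {\<chi> \<in> extensional (carrier G). (\<forall>g\<in>carrier G. \<chi> g \<noteq> 0) \<and>
       (\<forall>g\<in>carrier G. \<forall>h\<in>carrier G. \<chi> (g \<otimes>\<^bsub>G\<^esub> h) = \<chi> g * \<chi> h)},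
     monoid.mult = (\<lambda>\<chi> \<psi>. restrict (\<lambda>g. \<chi> g * \<psi> g) (carrier G)),
     monoid.one = restrict (\<lambda>g. 1) (carrier G)\<rparr>"

definition Gr :: "nat \<Rightarrow> ('g, 'k::field) rep \<Rightarrow> (nat \<Rightarrow> 'k) set set"
  where "Gr j U = {W. kv.subspace W \<and> W \<subseteq> kspace (rdim U) \<and> kv.dim W = j}"

text \<open>A point \<open>W\<close> of \<open>Gr(U)\<close> in the disjoint union over \<open>U\<close> is the pair \<open>(U, W)\<close>.\<close>

definition pointsets ::
    "('g, 'k::field) rep set \<Rightarrow> (('g, 'k) rep \<times> (nat \<Rightarrow> 'k) set) set set"
  where "pointsets I = {B.
    B \<subseteq> (SIGMA U : {U \<in> I. rdim U > 1}. \<Union>j\<in>{1..rdim U}. Gr j U) \<and>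
    (\<forall>U W W'. (U, W) \<in> B \<and> (U, W') \<in> B \<longrightarrow> W = W')}"

definition is_index ::
    "('g, 'm) monoid_scheme \<Rightarrow> ('g, 'k::field) rep set \<Rightarrow> 'g set set \<Rightarrow>
     (('g, 'k) rep \<times> (nat \<Rightarrow> 'k) set) set \<Rightarrow> bool"
  where "is_index G I A B \<longleftrightarrow>
    A \<subseteq> carrier (abelianization G) \<and> B \<in> pointsets I \<and> \<not> (A = {} \<and> B = {})"

text \<open>
  A list of pairs (module, vector) is read as the direct sum of the modules together with the
  vector having the given components.
\<close>

definition rep_of_list :: "(('g, 'k::field) rep \<times> (nat \<Rightarrow> 'k)) list \<Rightarrow> ('g, 'k) rep"
  where "rep_of_list L = foldr (\<lambda>(V, v) W. rep_dsum V W) L zero_rep"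

definition vec_of_list :: "(('g, 'k::field) rep \<times> (nat \<Rightarrow> 'k)) list \<Rightarrow> nat \<Rightarrow> 'k"
  where "vec_of_list L = foldr (\<lambda>(V, v) w. vec_dsum (rdim V) v w) L 0"

text \<open>
  \<open>L\<close> lists the modules \<open>T\<^sub>z\<close> for \<open>z\<close> in \<open>A\<close>, each with a nonzero vector, and for every
  \<open>(U, W)\<close> in \<open>B\<close> one copy of \<open>U\<close> for each vector of a basis of \<open>W\<close>, with that vector as
  component.
\<close>

definition presents ::
    "('g set \<Rightarrow> 'g \<Rightarrow> 'k::field) \<Rightarrow> 'g set set \<Rightarrow> (('g, 'k) rep \<times> (nat \<Rightarrow> 'k) set) set \<Rightarrow>
     (('g, 'k) rep \<times> (nat \<Rightarrow> 'k)) list \<Rightarrow> bool"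
  where "presents T A B L \<longleftrightarrow> (\<exists>zs c bs \<beta>.
    distinct zs \<and> set zs = A \<and> (\<forall>z\<in>A. c z \<noteq> 0) \<and>
    distinct bs \<and> set bs = B \<and>
    (\<forall>(U, W)\<in>B. distinct (\<beta> (U, W)) \<and> kv.independent (set (\<beta> (U, W))) \<and>
       kv.span (set (\<beta> (U, W))) = W) \<and>
    L = map (\<lambda>z. (linear_rep (T z), unit_vec0 (c z))) zs @
        concat (map (\<lambda>(U, W). map (\<lambda>w. (U, w)) (\<beta> (U, W))) bs))"

definition M_cls ::
    "('g, 'm) monoid_scheme \<Rightarrow> ('g set \<Rightarrow> 'g \<Rightarrow> 'k::field) \<Rightarrow> 'g set set \<Rightarrow>
     (('g, 'k) rep \<times> (nat \<Rightarrow> 'k) set) set \<Rightarrow> ('g, 'k) rat_elem"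
  where "M_cls G T A B =
    (SOME m. \<exists>L. presents T A B L \<and>
       m = glider_cls G (line_glider (rep_of_list L) (vec_of_list L)))"


section \<open>Obstruction modules\<close>

definition P_mod ::
    "('g, 'm) monoid_scheme \<Rightarrow> ('g set \<Rightarrow> 'g \<Rightarrow> 'k::field) \<Rightarrow> ('g, 'k) rep set \<Rightarrow>
     ('g, 'k) rat_elem set"
  where "P_mod G T I = qspan G {M_cls G T A B |A B. is_index G I A B \<and>
    infinite (cyclic_semigroup (glider_alg G) (M_cls G T A B))}"

definition R_mod ::
    "('g, 'm) monoid_scheme \<Rightarrow> ('g set \<Rightarrow> 'g \<Rightarrow> 'k::field) \<Rightarrow> ('g, 'k) rep set \<Rightarrow>
     ('g, 'k) rat_elem set"
  where "R_mod G T I = qspan G {M_cls G T A B |A B. is_index G I A B \<and>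
    M_cls G T A B \<notin> P_mod G T I \<and>
    (\<exists>D\<in>pointsets I. the_idempotent (glider_alg G) (M_cls G T A B) =
       M_cls G T {\<one>\<^bsub>abelianization G\<^esub>} D)}"

definition E_mod ::
    "('g, 'm) monoid_scheme \<Rightarrow> ('g set \<Rightarrow> 'g \<Rightarrow> 'k::field) \<Rightarrow> ('g, 'k) rep set \<Rightarrow>
     ('g, 'k) rat_elem set"
  where "E_mod G T I = qspan G {M_cls G T A B |A B. is_index G I A B \<and>
    M_cls G T A B \<notin> P_mod G T I \<and>
    (\<exists>D\<in>pointsets I. D \<noteq> {} \<and>
       the_idempotent (glider_alg G) (M_cls G T A B) = M_cls G T {} D)}"


section \<open>Induction\<close>

abbreviation (input) subgrp :: "('g, 'm) monoid_scheme \<Rightarrow> 'g set \<Rightarrow> ('g, 'm) monoid_scheme"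
  where "subgrp G H \<equiv> G\<lparr>carrier := H\<rparr>"

text \<open>
  The multiplicative \<open>\<rat>\<close>-linear map determined by its values on the classes of irreducible
  gliders. It need not preserve the unit: the unit goes to the class of \<open>K(1 \<otimes> 1) \<subset> K[G/H]\<close>.
\<close>

definition ind_map ::
    "('g, 'm) monoid_scheme \<Rightarrow> 'g set \<Rightarrow> ('g, 'k::field) rat_elem \<Rightarrow> ('g, 'k) rat_elem"
  where "ind_map G H = (let QH = glider_alg (subgrp G H); QG = glider_alg G in
    (THE \<phi>. \<phi> \<in> carrier QH \<rightarrow>\<^sub>E carrier QG \<and>
      (\<forall>x\<in>carrier QH. \<forall>y\<in>carrier QH.
         \<phi> (x \<oplus>\<^bsub>QH\<^esub> y) = \<phi> x \<oplus>\<^bsub>QG\<^esub> \<phi> y \<and> \<phi> (x \<otimes>\<^bsub>QH\<^esub> y) = \<phi> x \<otimes>\<^bsub>QG\<^esub> \<phi> y) \<and>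
      (\<forall>q. \<forall>x\<in>carrier QH.
         \<phi> (scal (subgrp G H) q \<otimes>\<^bsub>QH\<^esub> x) = scal G q \<otimes>\<^bsub>QG\<^esub> \<phi> x) \<and>
      (\<forall>X. irreducible_glider (subgrp G H) X \<longrightarrow>
         \<phi> (glider_cls (subgrp G H) X) = glider_cls G (glider_ind G H X))))"

definition ind_map_red ::
    "('g, 'm) monoid_scheme \<Rightarrow> 'g set \<Rightarrow> ('g, 'k::field) rat_elem set \<Rightarrow> ('g, 'k) rat_elem set"
  where "ind_map_red G H C = (\<Union>x\<in>C. mod_nil G (ind_map G H x))"


section \<open>Module structures\<close>

text \<open>The rational group algebra of a finite group.\<close>

definition group_alg :: "('a, 'm) monoid_scheme \<Rightarrow> ('a \<Rightarrow> rat) ring"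
  where "group_alg \<Gamma> =
    \<lparr>carrier = {x. \<forall>a. a \<notin> carrier \<Gamma> \<longrightarrow> x a = 0},
     monoid.mult = (\<lambda>x y c. if c \<in> carrier \<Gamma>
               then \<Sum>a\<in>carrier \<Gamma>. x a * y (inv\<^bsub>\<Gamma>\<^esub> a \<otimes>\<^bsub>\<Gamma>\<^esub> c) else 0),
     monoid.one = (\<lambda>c. if c = \<one>\<^bsub>\<Gamma>\<^esub> then 1 else 0),
     ring.zero = (\<lambda>c. 0),
     ring.add = (\<lambda>x y c. x c + y c)\<rparr>"

text \<open>
  The module over the group algebra of \<open>\<Gamma>\<close> with underlying group that of the ring \<open>Y\<close>, where
  rationals act through \<open>s\<close> and \<open>z\<close> in \<open>\<Gamma>\<close> acts as multiplication by \<open>c z\<close>.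
\<close>

definition mult_module ::
    "('a, 'm) monoid_scheme \<Rightarrow> ('b, 'n) ring_scheme \<Rightarrow> (rat \<Rightarrow> 'b) \<Rightarrow> ('a \<Rightarrow> 'b) \<Rightarrow>
     ('a \<Rightarrow> rat, 'b) module"
  where "mult_module \<Gamma> Y s c =
    \<lparr>carrier = carrier Y, monoid.mult = monoid.mult Y, monoid.one = monoid.one Y,
     ring.zero = ring.zero Y, ring.add = ring.add Y,
     module.smult = (\<lambda>f x. \<Oplus>\<^bsub>Y\<^esub>z\<in>carrier \<Gamma>. s (f z) \<otimes>\<^bsub>Y\<^esub> (c z \<otimes>\<^bsub>Y\<^esub> x))\<rparr>"

definition red_module ::
    "('g, 'm) monoid_scheme \<Rightarrow> ('g set \<Rightarrow> 'g \<Rightarrow> 'k::field) \<Rightarrow>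
     ('g set \<Rightarrow> rat, ('g, 'k) rat_elem set) module"
  where "red_module G T = mult_module (abelianization G) (red_alg G)
    (\<lambda>q. mod_nil G (scal G q)) (\<lambda>z. mod_nil G (M_cls G T {z} {}))"

text \<open>
  Here \<open>z\<close> acts through the restriction of \<open>T\<^sub>z\<close> to \<open>H\<close>: the same matrices, read as a glider
  of \<open>H\<close>.
\<close>

definition red_module_sub ::
    "('g, 'm) monoid_scheme \<Rightarrow> ('g set \<Rightarrow> 'g \<Rightarrow> 'k::field) \<Rightarrow> 'g set \<Rightarrow>
     ('g set \<Rightarrow> rat, ('g, 'k) rat_elem set) module"
  where "red_module_sub G T H = mult_module (abelianization G) (red_alg (subgrp G H))
    (\<lambda>q. mod_nil (subgrp G H) (scal (subgrp G H) q))
    (\<lambda>z. mod_nil (subgrp G H) (glider_cls (subgrp G H) (linear_glider (T z))))"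

definition mod_hom ::
    "('a, 'm) ring_scheme \<Rightarrow> ('a, 'b, 'n) module_scheme \<Rightarrow> ('a, 'c, 'o) module_scheme \<Rightarrow>
     ('b \<Rightarrow> 'c) set"
  where "mod_hom R M N = {f \<in> carrier M \<rightarrow> carrier N.
    (\<forall>x\<in>carrier M. \<forall>y\<in>carrier M. f (x \<oplus>\<^bsub>M\<^esub> y) = f x \<oplus>\<^bsub>N\<^esub> f y) \<and>
    (\<forall>a\<in>carrier R. \<forall>x\<in>carrier M. f (a \<odot>\<^bsub>M\<^esub> x) = a \<odot>\<^bsub>N\<^esub> f x)}"

definition short_exact ::
    "('a, 'm) ring_scheme \<Rightarrow> ('a, 'b, 'n) module_scheme \<Rightarrow> ('a, 'c, 'o) module_scheme \<Rightarrow>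
     ('a, 'd, 'p) module_scheme \<Rightarrow> ('b \<Rightarrow> 'c) \<Rightarrow> ('c \<Rightarrow> 'd) \<Rightarrow> bool"
  where "short_exact R L M N f g \<longleftrightarrow>
    module R L \<and> module R M \<and> module R N \<and>
    f \<in> mod_hom R L M \<and> g \<in> mod_hom R M N \<and>
    inj_on f (carrier L) \<and>
    f ` carrier L = {x \<in> carrier M. g x = \<zero>\<^bsub>N\<^esub>} \<and>
    g ` carrier M = carrier N"

definition intermediate :: "('g, 'm) monoid_scheme \<Rightarrow> 'g set set"
  where "intermediate G =
    {H. subgroup H G \<and> derived G (carrier G) \<subseteq> H \<and> H \<noteq> carrier G}"

text \<open>The sum of a family of submodules is the additive subgroup generated by their union.\<close>

definition left_part ::
    "('g, 'm) monoid_scheme \<Rightarrow> ('g set \<Rightarrow> 'g \<Rightarrow> 'k::field) \<Rightarrow> ('g, 'k) rep set \<Rightarrow>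
     ('g, 'k) rat_elem set set"
  where "left_part G T I = add_span (red_alg G)
    (mod_nil G ` E_mod G T I \<union> mod_nil G ` P_mod G T I \<union>
     (\<Union>H\<in>intermediate G. ind_map_red G H ` carrier (red_alg (subgrp G H))))"

end

theory Submission
  imports Defs
begin

text \<open>
  The class of an irreducible glider \<open>Kv \<subset> K[G]v\<close> is determined by the annihilator of \<open>v\<close> in
  \<open>K[G]\<close>, and these classes form a multiplicative basis of \<open>\<rat>(G~)\<close>. Let the type of such a glider
  be the stabilizer \<open>H\<close> of the line \<open>Kv\<close> together with the character \<open>\<chi>\<close> by which \<open>H\<close> acts on it.
  A product of \<open>n \<ge> |G|\<close> gliders of the same type \<open>(H, \<chi>)\<close> is the glider
  \<open>K(1 \<otimes> 1) \<subset> K[G] \<otimes>\<^bsub>K[H]\<^esub> K\<^bsub>\<chi>\<^sup>n\<^esub>\<close>, so it depends on the type only. Three consequences: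
  two basis elements of the same type differ by a nilpotent element; since distinct types are
  separated by characters of the algebra, the nilradical consists of the elements whose
  coefficients sum to zero over each type; and all powers of a basis element form a finite
  semigroup, with idempotent \<open>K(1 \<otimes> 1) \<subset> K[G/H]\<close>. As \<open>K[G/H]\<close> contains the trivial module,
  \<open>P(G)\<close> and \<open>E(G)\<close> vanish, and \<open>R(G)\<close> is spanned by the gliders for which no nontrivial linear
  character of \<open>G\<close> is trivial on \<open>H\<close>.

  Induction preserves types, and a glider whose stabilizer lies in \<open>L\<close> has the same type as the
  glider induced from its restriction to \<open>L\<close>. Hence modulo the nilradical the images of the
  inductions from the \<open>L\<close> with \<open>G' \<le> L < G\<close> span the gliders with \<open>H\<close> in some such \<open>L\<close>.
  By counting characters these are exactly the gliders outside \<open>R(G)\<close>, so the sequence is the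
  splitting of the set of types into two parts.
\<close>

section \<open>Linear algebra in coordinates\<close>

text \<open>The ring is a stack of quotients of free abelian groups, so the obstacle is to show that
  anything in it is nonzero. Independence comes from additive functionals carried down through the
  quotients. The basis is indexed by annihilators rather than by pairs \<open>(A, B)\<close>,
  because annihilators turn tensor products, types and induction into conditions on functions on the
  group. Pairs return only when \<open>P(G)\<close>, \<open>E(G)\<close> and \<open>R(G)\<close>
  have to be identified, and there \<open>A\<close> is recovered by testing an annihilator on the
  elements \<open>ez z\<close>. The bound \<open>|G|\<close> on the number of factors comes from
  spending one factor on each group element outside a given coset of the stabilizer. The characters
  of the algebra send a type \<open>(H, \<chi>)\<close> to \<open>\<chi> l\<close> if
  \<open>H\<close> contains a fixed subgroup \<open>L\<close> with \<open>l\<close> in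
  \<open>L\<close>, and to 0 otherwise. Taking for \<open>L\<close> a largest stabilizer among the
  types with nonzero sum isolates the types with that stabilizer, and independence of the characters
  of \<open>L\<close> separates them.\<close>

global_interpretation kk: vector_space_pair "vscale :: 'k::field \<Rightarrow> _" "vscale :: 'k::field \<Rightarrow> _"
  by unfold_locales

abbreviation klin :: "((nat \<Rightarrow> 'k::field) \<Rightarrow> nat \<Rightarrow> 'k) \<Rightarrow> bool"
  where "klin f \<equiv> Vector_Spaces.linear vscale vscale f"

lemma klinI:
  "(\<And>u v. f (u + v) = f u + f v) \<Longrightarrow> (\<And>c u. f (vscale c u) = vscale c (f u)) \<Longrightarrow> klin f"
  by (simp add: Vector_Spaces.linear_iff kv.vector_space_axioms)

lemma klin_compose: "klin f \<Longrightarrow> klin g \<Longrightarrow> klin (\<lambda>x. g (f x))"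
  by (simp add: Vector_Spaces.linear_iff)

lemma vscale_apply: "vscale c v i = c * v i"
  by (simp add: vscale_def)

lemma klin_on: "klin f \<Longrightarrow> klinear_on S f"
  by (auto simp: Vector_Spaces.linear_iff klinear_on_def)

lemma subspace_kspace [simp]: "kv.subspace (kspace n)"
  by (auto simp: kv.subspace_def kspace_def vscale_def)

lemma kspace_zero [simp]: "0 \<in> kspace n"
  by (simp add: kspace_def)

lemma kspaceD: "v \<in> kspace n \<Longrightarrow> n \<le> i \<Longrightarrow> v i = 0"
  by (simp add: kspace_def)

definition ev :: "nat \<Rightarrow> nat \<Rightarrow> 'k::field"
  where "ev j = (\<lambda>i. if i = j then 1 else 0)"

lemma ev_kspace: "j < n \<Longrightarrow> ev j \<in> kspace n"
  by (auto simp: ev_def kspace_def)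

lemma sum_fun_apply: "(\<Sum>x\<in>A. f x) i = (\<Sum>x\<in>A. (f x :: nat \<Rightarrow> 'k::field) i)"
  by (induction A rule: infinite_finite_induct) auto

lemma kspace_expand: "v \<in> kspace n \<Longrightarrow> v = (\<Sum>j<n. vscale (v j) (ev j))"
  by (auto simp: fun_eq_iff sum_fun_apply vscale_def ev_def kspace_def
      if_distrib[of "\<lambda>x. _ * x"] cong: if_cong)

lemma span_ev: "kv.span (ev ` {..<n}) = (kspace n :: (nat \<Rightarrow> 'k::field) set)"
proof (rule kv.span_unique)
  show "ev ` {..<n} \<subseteq> kspace n" by (auto intro: ev_kspace)
  show "kv.subspace (kspace n :: (nat \<Rightarrow> 'k) set)" by simp
  fix T' :: "(nat \<Rightarrow> 'k) set" assume T: "ev ` {..<n} \<subseteq> T'" "kv.subspace T'"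
  show "kspace n \<subseteq> T'"
  proof
    fix v :: "nat \<Rightarrow> 'k" assume "v \<in> kspace n"
    then have "v = (\<Sum>j<n. vscale (v j) (ev j))" by (rule kspace_expand)
    also have "\<dots> \<in> T'" using T by (intro kv.subspace_sum kv.subspace_scale) auto
    finally show "v \<in> T'" .
  qed
qed

section \<open>Bases, matrices and projections for subspaces of K^n\<close>

lemma kspace_finite_basis:
  assumes "S \<subseteq> (kspace n :: (nat \<Rightarrow> 'k::field) set)"
  obtains B where "finite B" "B \<subseteq> S" "kv.independent B" "kv.span B = kv.span S" "card B = kv.dim S"
proof -
  obtain B where B: "B \<subseteq> S" "kv.independent B" "S \<subseteq> kv.span B" "card B = kv.dim S"
    using kv.basis_exists by blast
  have "finite B"
    using kv.independent_span_bound[of "ev ` {..<n}" B] B assms span_ev by blast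
  moreover have "kv.span B = kv.span S"
    using B by (simp add: kv.span_eq kv.span_mono) (meson kv.span_superset subset_trans)
  ultimately show ?thesis using that B by blast
qed

definition matapp :: "nat \<Rightarrow> nat \<Rightarrow> (nat \<Rightarrow> nat \<Rightarrow> 'k::field) \<Rightarrow> (nat \<Rightarrow> 'k) \<Rightarrow> nat \<Rightarrow> 'k"
  where "matapp n m F v = (\<lambda>i. if i < n then \<Sum>j<m. F i j * v j else 0)"

lemma act_matapp: "act V g = matapp (rdim V) (rdim V) (rmat V g)"
  by (auto simp: act_def matapp_def fun_eq_iff)

lemma klin_matapp: "klin (matapp n m F)"
  by (intro klinI) (auto simp: matapp_def vscale_def fun_eq_iff sum.distrib algebra_simps sum_distrib_left)

lemma matapp_kspace: "matapp n m F v \<in> kspace n"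
  by (auto simp: matapp_def kspace_def)

lemma klin_act: "klin (act V g)"
  unfolding act_matapp by (rule klin_matapp)

lemma act_kspace: "act V g v \<in> kspace (rdim V)"
  unfolding act_matapp by (rule matapp_kspace)

text \<open>Glider morphisms are linear on the top space only. Extending from a basis of that space
  gives a map linear on all sequences, to which the theory of \<open>klin\<close> applies.\<close>

lemma klinear_on_extend:
  assumes S: "kv.subspace S" and f: "klinear_on S f"
  shows "\<exists>g. klin g \<and> (\<forall>u\<in>S. g u = f u)"
proof -
  obtain B where B: "B \<subseteq> S" "kv.independent B" "S \<subseteq> kv.span B"
    using kv.maximal_independent_subset by blast
  obtain g where g: "klin g" "\<forall>x\<in>B. g x = f x"
    using kk.linear_independent_extend[OF B(2), of f] by blast
  have f0: "f 0 = 0"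
  proof -
    have "f 0 + f 0 = f 0"
      using f kv.subspace_0[OF S] unfolding klinear_on_def by (metis add.right_neutral)
    then show ?thesis by simp
  qed
  \<comment> \<open>\<open>f\<close> is linear on \<open>S\<close> only, so agreement with
    \<open>g\<close> is propagated from \<open>B\<close> as membership in a subspace of
    \<open>S\<close>.\<close>
  have "kv.subspace {x \<in> S. g x = f x}"
    using S f f0 kk.linear_0[OF g(1)] g(1) kv.subspace_add[OF S] kv.subspace_scale[OF S]
    by (auto simp: kv.subspace_def klinear_on_def Vector_Spaces.linear_iff)
  then have "kv.span B \<subseteq> {x \<in> S. g x = f x}"
    using B g by (intro kv.span_minimal) auto
  then show ?thesis using B g by blast
qed

lemma klin_matrix:
  fixes g :: "(nat \<Rightarrow> 'k::field) \<Rightarrow> nat \<Rightarrow> 'k"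
  assumes "klin g"
  shows "\<exists>F. \<forall>u\<in>kspace m. \<forall>i<n. g u i = matapp n m F u i"
proof (intro exI ballI allI impI)
  fix u :: "nat \<Rightarrow> 'k" and i assume u: "u \<in> kspace m" and i: "i < n"
  have "g u = (\<Sum>j<m. vscale (u j) (g (ev j)))"
    using arg_cong[OF kspace_expand[OF u], of g]
    by (simp only: kk.linear_sum[OF assms] kk.linear_scale[OF assms])
  then have "g u i = (\<Sum>j<m. u j * g (ev j) i)" by (simp add: sum_fun_apply vscale_def)
  then show "g u i = matapp n m (\<lambda>i j. g (ev j) i) u i"
    using i by (simp add: matapp_def mult.commute)
qed

text \<open>A map known only on a subspace has no canonical tensor product with another one, whereas
  two matrices always have a Kronecker product; this is why morphisms are put into matrix
  form.\<close>

lemma klinear_on_matrix: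
  assumes S: "kv.subspace S" "S \<subseteq> kspace m" and f: "klinear_on S f" "f ` S \<subseteq> kspace n"
  shows "\<exists>F. \<forall>u\<in>S. f u = matapp n m F u"
proof -
  obtain g where g: "klin g" "\<forall>u\<in>S. g u = f u"
    using klinear_on_extend[OF S(1) f(1)] by blast
  obtain F where F: "\<forall>u\<in>kspace m. \<forall>i<n. g u i = matapp n m F u i"
    using klin_matrix[OF g(1)] by blast
  have "f u = matapp n m F u" if u: "u \<in> S" for u
  proof
    fix i
    show "f u i = matapp n m F u i"
    proof (cases "i < n")
      case True
      then show ?thesis using F g u S by force
    next
      case False
      then have "f u i = 0" using f(2) u kspaceD by (metis imageI not_less subsetD)
      then show ?thesis using False by (simp add: matapp_def)
    qed
  qed
  then show ?thesis by blast
qed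

lemma klin_eq_on_span: "klin f \<Longrightarrow> klin g \<Longrightarrow> (\<And>b. b \<in> B \<Longrightarrow> f b = g b) \<Longrightarrow> x \<in> kv.span B \<Longrightarrow> f x = g x"
  by (rule kk.linear_eq_on)

lemma klin_id: "klin (\<lambda>x. x)"
  by (rule klinI) auto

lemma klin_span_image: "klin f \<Longrightarrow> f ` kv.span S = kv.span (f ` S)"
  using kk.linear_span_image by metis

lemma projection_exists:
  assumes "kv.subspace S"
  obtains p where "klin p" "\<And>u. p u \<in> S" "\<And>u. u \<in> S \<Longrightarrow> p u = u"
  using kk.linear_exists_left_inverse_on[OF klin_id assms] by (auto simp: image_subset_iff)

subsection \<open>Tensor products and direct sums of vectors\<close>

lemma sum_divmod:
  fixes f :: "nat \<Rightarrow> nat \<Rightarrow> 'a::comm_monoid_add"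
  shows "(\<Sum>j<n*m. f (j div m) (j mod m)) = (\<Sum>a<n. \<Sum>b<m. f a b)"
proof (cases "m = 0")
  case False
  have "(\<Sum>j<n*m. f (j div m) (j mod m)) = (\<Sum>(a,b)\<in>{..<n}\<times>{..<m}. f a b)"
  proof (rule sum.reindex_bij_witness[where j = "\<lambda>j. (j div m, j mod m)" and i = "\<lambda>(a,b). a * m + b"])
    fix b assume "b \<in> {..<n} \<times> {..<m}"
    then obtain x y where b: "b = (x, y)" "x < n" "y < m" by auto
    have "x * m + y < (x + 1) * m" using b by simp
    also have "\<dots> \<le> n * m" using b by (intro mult_right_mono) auto
    finally show "(case b of (a, b) \<Rightarrow> a * m + b) \<in> {..<n * m}" using b by simp
  qed (use False in \<open>auto simp: less_mult_imp_div_less\<close>)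
  then show ?thesis by (simp add: sum.cartesian_product)
qed auto

lemma vec_tensor_kspace: "u \<in> kspace n \<Longrightarrow> v \<in> kspace m \<Longrightarrow> vec_tensor m u v \<in> kspace (n * m)"
  unfolding kspace_def vec_tensor_def
proof (clarsimp)
  fix i assume u: "\<forall>i\<ge>n. u i = 0" and v: "\<forall>i\<ge>m. v i = 0" and i: "n * m \<le> i" and vi: "v (i mod m) \<noteq> 0"
  have "m \<noteq> 0" using v vi by (metis le0)
  then have "n \<le> i div m" using i by (simp add: less_eq_div_iff_mult_less_eq)
  then show "u (i div m) = 0" using u by simp
qed

lemma vec_tensor_zero [simp]: "vec_tensor m 0 v = 0" "vec_tensor m u 0 = 0"
  by (auto simp: vec_tensor_def)

lemma klin_tensor_l: "klin (\<lambda>u. vec_tensor m u v)"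
  by (intro klinI) (auto simp: vec_tensor_def vscale_def fun_eq_iff algebra_simps)

lemma klin_tensor_r: "klin (\<lambda>v. vec_tensor m u v)"
  by (intro klinI) (auto simp: vec_tensor_def vscale_def fun_eq_iff algebra_simps)

text \<open>The Kronecker product for the index convention of \<open>vec_tensor\<close>, where the
  tensor of the unit vectors \<open>a\<close> and \<open>b\<close> sits at
  \<open>a * m + b\<close>.\<close>

definition kron :: "nat \<Rightarrow> nat \<Rightarrow> (nat \<Rightarrow> nat \<Rightarrow> 'k::field) \<Rightarrow> (nat \<Rightarrow> nat \<Rightarrow> 'k) \<Rightarrow> nat \<Rightarrow> nat \<Rightarrow> 'k"
  where "kron m' m F E = (\<lambda>p q. F (p div m') (q div m) * E (p mod m') (q mod m))"

lemma matapp_kron: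
  "matapp (n' * m') (n * m) (kron m' m F E) (vec_tensor m u v) =
    vec_tensor m' (matapp n' n F u) (matapp m' m E v)"
proof
  fix i
  show "matapp (n' * m') (n * m) (kron m' m F E) (vec_tensor m u v) i =
    vec_tensor m' (matapp n' n F u) (matapp m' m E v) i"
  proof (cases "i < n' * m'")
    case True
    then have m': "m' > 0" by (cases m') auto
    have i: "i div m' < n'" using True less_mult_imp_div_less by blast
    have "matapp (n' * m') (n * m) (kron m' m F E) (vec_tensor m u v) i =
       (\<Sum>j<n*m. (F (i div m') (j div m) * u (j div m)) * (E (i mod m') (j mod m) * v (j mod m)))"
      using True by (simp add: matapp_def kron_def vec_tensor_def mult_ac)
    also have "\<dots> = (\<Sum>a<n. \<Sum>b<m. (F (i div m') a * u a) * (E (i mod m') b * v b))"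
      by (rule sum_divmod)
    also have "\<dots> = vec_tensor m' (matapp n' n F u) (matapp m' m E v) i"
      using m' i by (simp add: vec_tensor_def matapp_def sum_product)
    finally show ?thesis .
  next
    case False
    have "vec_tensor m' (matapp n' n F u) (matapp m' m E v) \<in> kspace (n' * m')"
      by (intro vec_tensor_kspace matapp_kspace)
    then show ?thesis using False by (simp add: matapp_def kspaceD)
  qed
qed

lemma act_tensor:
  "act (rep_tensor V W) g (vec_tensor (rdim W) u v) = vec_tensor (rdim W) (act V g u) (act W g v)"
  unfolding act_matapp matapp_kron[symmetric] by (simp add: rep_tensor_def kron_def)

lemma vec_dsum_kspace: "v \<in> kspace m \<Longrightarrow> vec_dsum n u v \<in> kspace (n + m)"
  by (auto simp: vec_dsum_def kspace_def)

lemma vec_dsum_zero [simp]: "vec_dsum n 0 0 = 0"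
  by (auto simp: vec_dsum_def)

lemma vec_dsum_add: "vec_dsum n (u + u') (v + v') = vec_dsum n u v + vec_dsum n u' v'"
  by (auto simp: vec_dsum_def fun_eq_iff)

lemma vec_dsum_scale: "vec_dsum n (vscale c u) (vscale c v) = vscale c (vec_dsum n u v)"
  by (auto simp: vec_dsum_def vscale_def fun_eq_iff)

lemma vec_dsum_inj:
  assumes "u \<in> kspace n" "u' \<in> kspace n"
  shows "vec_dsum n u v = vec_dsum n u' v' \<longleftrightarrow> u = u' \<and> v = v'"
proof
  assume eq: "vec_dsum n u v = vec_dsum n u' v'"
  have "u i = u' i" for i
    using fun_cong[OF eq, of i] assms by (cases "i < n") (auto simp: vec_dsum_def kspace_def)
  moreover have "v i = v' i" for i
    using fun_cong[OF eq, of "i + n"] by (auto simp: vec_dsum_def)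
  ultimately show "u = u' \<and> v = v'" by auto
qed auto

lemma vec_dsum_eq_0: "u \<in> kspace n \<Longrightarrow> vec_dsum n u v = 0 \<longleftrightarrow> u = 0 \<and> v = 0"
  using vec_dsum_inj[of u n 0 v 0] by simp

lemma act_dsum:
  fixes V W :: "('g, 'k::field) rep"
  shows "act (rep_dsum V W) g (vec_dsum (rdim V) u v) = vec_dsum (rdim V) (act V g u) (act W g v)"
proof
  fix i
  let ?n = "rdim V" and ?m = "rdim W"
  have split: "(\<Sum>j<?n+?m. h j) = (\<Sum>j<?n. h j) + (\<Sum>j<?m. h (j + ?n))" for h :: "nat \<Rightarrow> 'k"
  proof -
    have "{..<?n + ?m} = {..<?n} \<union> {?n..<?n+?m}" by auto
    then have "(\<Sum>j<?n+?m. h j) = (\<Sum>j<?n. h j) + (\<Sum>j=?n..<?n+?m. h j)"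
      by (simp add: sum.union_disjoint ivl_disj_int)
    moreover have "(\<Sum>j=?n..<?n+?m. h j) = (\<Sum>j<?m. h (j + ?n))"
      using sum.shift_bounds_nat_ivl[of h 0 ?n ?m] by (simp add: add.commute lessThan_atLeast0)
    ultimately show ?thesis by simp
  qed
  show "act (rep_dsum V W) g (vec_dsum (rdim V) u v) i = vec_dsum (rdim V) (act V g u) (act W g v) i"
    by (auto simp: act_def rep_dsum_def vec_dsum_def split)
qed

text \<open>The images of a basis of \<open>S\<close> and of a basis of \<open>T\<close> together
  form a basis. The additivity of \<open>mult_of\<close> on direct sums of gliders rests on this
  count.\<close>

lemma dim_vec_dsum:
  fixes S T :: "(nat \<Rightarrow> 'k::field) set"
  assumes S: "kv.subspace S" "S \<subseteq> kspace n" and T: "kv.subspace T" "T \<subseteq> kspace m"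
  shows "kv.dim {vec_dsum n u v |u v. u \<in> S \<and> v \<in> T} = kv.dim S + kv.dim T"
proof -
  obtain B where B: "finite B" "B \<subseteq> S" "kv.independent B" "kv.span B = kv.span S" "card B = kv.dim S"
    using kspace_finite_basis[OF S(2)] .
  obtain C where C: "finite C" "C \<subseteq> T" "kv.independent C" "kv.span C = kv.span T" "card C = kv.dim T"
    using kspace_finite_basis[OF T(2)] .
  let ?f = "\<lambda>u. vec_dsum n u 0" and ?g = "\<lambda>v. vec_dsum n 0 v"
  have lf: "klin ?f" and lg: "klin ?g"
    by (intro klinI; simp add: fun_eq_iff vec_dsum_def vscale_def)+
  have eq: "{vec_dsum n u v |u v. u \<in> S \<and> v \<in> T} = kv.span (?f ` B \<union> ?g ` C)"
  proof -
    have "kv.span (?f ` B \<union> ?g ` C) = {x + y |x y. x \<in> ?f ` kv.span B \<and> y \<in> ?g ` kv.span C}"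
      by (simp add: kv.span_Un klin_span_image[OF lf] klin_span_image[OF lg])
    also have "\<dots> = {vec_dsum n u v |u v. u \<in> S \<and> v \<in> T}"
    proof -
      have 1: "kv.span B = S" "kv.span C = T" using S T B(4) C(4) kv.span_eq_iff by metis+
      have 2: "vec_dsum n u v = vec_dsum n u 0 + vec_dsum n 0 v" for u v :: "nat \<Rightarrow> 'k"
        using vec_dsum_add[of n u 0 0 v] by simp
      show ?thesis unfolding 1
      proof (intro equalityI subsetI)
        fix x assume "x \<in> {x + y |x y. x \<in> ?f ` S \<and> y \<in> ?g ` T}"
        then obtain u v where "u \<in> S" "v \<in> T" "x = ?f u + ?g v" by blast
        then have "x = vec_dsum n u v" by (simp only: 2[of u v])
        then show "x \<in> {vec_dsum n u v |u v. u \<in> S \<and> v \<in> T}"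
          using \<open>u \<in> S\<close> \<open>v \<in> T\<close> by blast
      next
        fix x assume "x \<in> {vec_dsum n u v |u v. u \<in> S \<and> v \<in> T}"
        then obtain u v where uv: "u \<in> S" "v \<in> T" "x = vec_dsum n u v" by blast
        then have "x = ?f u + ?g v" by (simp only: 2[of u v])
        then show "x \<in> {x + y |x y. x \<in> ?f ` S \<and> y \<in> ?g ` T}" using uv by blast
      qed
    qed
    finally show ?thesis by simp
  qed
  have inter: "?f ` B \<inter> ?g ` C = {}"
  proof (rule ccontr)
    assume "\<not> ?thesis"
    then obtain u v where uv: "u \<in> B" "v \<in> C" "vec_dsum n u 0 = vec_dsum n 0 v" by blast
    then have "u = 0" using vec_dsum_inj[of u n 0 0 v] B S by auto
    then show False using uv B kv.dependent_zero by blast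
  qed
  have injf: "inj_on ?f B" using B S by (intro inj_onI) (auto simp: vec_dsum_inj subset_iff)
  have injg: "inj_on ?g C" by (intro inj_onI) (auto simp: vec_dsum_inj)
  have ind: "kv.independent (?f ` B \<union> ?g ` C)"
    unfolding kv.dependent_finite[OF finite_UnI[OF finite_imageI[OF B(1)] finite_imageI[OF C(1)]]]
  proof (clarify)
    fix c w assume sum0: "(\<Sum>v\<in>?f ` B \<union> ?g ` C. vscale (c v) v) = 0"
      and w: "w \<in> ?f ` B \<union> ?g ` C" "c w \<noteq> 0"
    have "(\<Sum>v\<in>?f ` B \<union> ?g ` C. vscale (c v) v) =
       (\<Sum>u\<in>B. vscale (c (?f u)) (?f u)) + (\<Sum>v\<in>C. vscale (c (?g v)) (?g v))"
      using B C inter injf injg by (simp add: sum.union_disjoint sum.reindex)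
    also have "\<dots> = ?f (\<Sum>u\<in>B. vscale (c (?f u)) u) + ?g (\<Sum>v\<in>C. vscale (c (?g v)) v)"
      by (simp add: kk.linear_sum[OF lf] kk.linear_sum[OF lg] kk.linear_scale[OF lf] kk.linear_scale[OF lg])
    also have "\<dots> = vec_dsum n (\<Sum>u\<in>B. vscale (c (?f u)) u) (\<Sum>v\<in>C. vscale (c (?g v)) v)"
      by (simp flip: vec_dsum_add)
    finally have "vec_dsum n (\<Sum>u\<in>B. vscale (c (?f u)) u) (\<Sum>v\<in>C. vscale (c (?g v)) v) = 0"
      using sum0 by simp
    moreover have "(\<Sum>u\<in>B. vscale (c (?f u)) u) \<in> kspace n"
      using B S by (intro kv.subspace_sum kv.subspace_scale) auto
    ultimately have 1: "(\<Sum>u\<in>B. vscale (c (?f u)) u) = 0" and 2: "(\<Sum>v\<in>C. vscale (c (?g v)) v) = 0"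
      by (simp_all add: vec_dsum_eq_0)
    from w(1) show False
    proof
      assume "w \<in> ?f ` B"
      then obtain u where "u \<in> B" "w = ?f u" by blast
      then show False
        using kv.independentD[OF B(3) B(1) subset_refl 1] w(2) by blast
    next
      assume "w \<in> ?g ` C"
      then obtain u where "u \<in> C" "w = ?g u" by blast
      then show False
        using kv.independentD[OF C(3) C(1) subset_refl 2] w(2) by blast
    qed
  qed
  have "kv.dim {vec_dsum n u v |u v. u \<in> S \<and> v \<in> T} = card (?f ` B \<union> ?g ` C)"
    unfolding eq kv.dim_span using ind by (rule kv.dim_eq_card_independent)
  also have "\<dots> = card B + card C"
    using B C inter injf injg by (simp add: card_Un_disjoint card_image)
  finally show ?thesis using B C by simp
qed

section \<open>Gliders up to isomorphism\<close>

locale fin_grp = group G for G (structure) +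
  assumes fin: "finite (carrier G)"
begin

text \<open>The group element \<open>a\<close> seen inside \<open>K[G]\<close>; through it
  conditions on all of \<open>K[G]\<close> are tested on group elements.\<close>

definition delta :: "'a \<Rightarrow> 'a \<Rightarrow> 'k::field"
  where "delta a = (\<lambda>g. if g = a then 1 else 0)"

lemma kG_act_delta: "a \<in> carrier G \<Longrightarrow> kG_act G V (delta a) v = act V a v"
proof -
  assume a: "a \<in> carrier G"
  have "kG_act G V (delta a) v = (\<Sum>g\<in>carrier G. if g = a then act V a v else 0)"
    unfolding kG_act_def delta_def by (intro sum.cong refl) (auto simp: vscale_def fun_eq_iff)
  then show ?thesis using a fin by simp
qed

lemma kG_act_apply: "kG_act G V x v i = (\<Sum>g\<in>carrier G. x g * act V g v i)"
  by (simp add: kG_act_def sum_fun_apply vscale_def)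

lemma klin_kG_act: "klin (kG_act G V x)"
  by (intro klinI ext)
    (simp_all add: kG_act_apply kk.linear_add[OF klin_act] kk.linear_scale[OF klin_act] sum.distrib
      algebra_simps vscale_apply sum_distrib_left)

lemma kG_act_subspace:
  "kv.subspace S \<Longrightarrow> (\<And>a. a \<in> carrier G \<Longrightarrow> act V a v \<in> S) \<Longrightarrow> kG_act G V x v \<in> S"
  unfolding kG_act_def by (intro kv.subspace_sum kv.subspace_scale) auto

lemma kG_act_kspace: "kG_act G V x v \<in> kspace (rdim V)"
  by (intro kG_act_subspace act_kspace) simp

lemma kG_act_commute:
  assumes "klin f" and "\<And>a. a \<in> carrier G \<Longrightarrow> f (act V a m) = act W a (f m)"
  shows "f (kG_act G V x m) = kG_act G W x (f m)"
  unfolding kG_act_def kk.linear_sum[OF assms(1)] kk.linear_scale[OF assms(1)]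
  by (rule sum.cong[OF refl]) (simp add: assms(2))

lemma kG_span_least:
  assumes "kv.subspace T" and "\<And>a v. a \<in> carrier G \<Longrightarrow> v \<in> S \<Longrightarrow> act V a v \<in> T"
  shows "kG_span G V S \<subseteq> T"
  unfolding kG_span_def using assms by (intro kv.span_minimal) (auto intro!: kG_act_subspace)

lemma kG_act_in_span: "v \<in> S \<Longrightarrow> kG_act G V x v \<in> kG_span G V S"
  unfolding kG_span_def by (intro kv.span_base) auto

lemma act_in_span: "a \<in> carrier G \<Longrightarrow> v \<in> S \<Longrightarrow> act V a v \<in> kG_span G V S"
  using kG_act_in_span kG_act_delta by metis

text \<open>\<open>K[G]M\<close> is spanned by the translates of \<open>M\<close> under single group
  elements, so stability need only be tested on those.\<close>

lemma is_glider_iff: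
  "is_glider G X \<longleftrightarrow> is_rep G (gamb X) \<and> kv.subspace (gsub X) \<and> kv.subspace (gtop X) \<and>
    gsub X \<subseteq> gtop X \<and> gtop X \<subseteq> kspace (rdim (gamb X)) \<and>
    (\<forall>a\<in>carrier G. \<forall>v\<in>gsub X. act (gamb X) a v \<in> gtop X)"
proof -
  have "kG_span G (gamb X) (gsub X) \<subseteq> gtop X \<longleftrightarrow> (\<forall>a\<in>carrier G. \<forall>v\<in>gsub X. act (gamb X) a v \<in> gtop X)"
    if "kv.subspace (gtop X)"
  proof
    assume "kG_span G (gamb X) (gsub X) \<subseteq> gtop X"
    then show "\<forall>a\<in>carrier G. \<forall>v\<in>gsub X. act (gamb X) a v \<in> gtop X"
      by (intro ballI, elim subsetD) (rule act_in_span)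
  next
    assume "\<forall>a\<in>carrier G. \<forall>v\<in>gsub X. act (gamb X) a v \<in> gtop X"
    then show "kG_span G (gamb X) (gsub X) \<subseteq> gtop X"
      by (intro kG_span_least that) auto
  qed
  then show ?thesis unfolding is_glider_def by argo
qed

lemma glider_kG_act: "is_glider G X \<Longrightarrow> v \<in> gsub X \<Longrightarrow> kG_act G (gamb X) x v \<in> gtop X"
  unfolding is_glider_iff by (intro kG_act_subspace) auto

section \<open>Matrix representations: tensor products, direct sums, linear characters\<close>

lemma rmat_act: "i < rdim V \<Longrightarrow> j < rdim V \<Longrightarrow> rmat V g i j = act V g (ev j) i"
  by (simp add: act_def ev_def if_distrib[of "\<lambda>x. _ * x"] cong: if_cong)

lemma act_one: "is_rep G V \<Longrightarrow> v \<in> kspace (rdim V) \<Longrightarrow> act V \<one> v = v"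
  by (auto simp: act_def is_rep_def fun_eq_iff kspace_def if_distrib[of "\<lambda>x. x * _"] cong: if_cong)

lemma act_mult:
  assumes "is_rep G V" "g \<in> carrier G" "h \<in> carrier G"
  shows "act V (g \<otimes> h) v = act V g (act V h v)"
proof
  fix i
  show "act V (g \<otimes> h) v i = act V g (act V h v) i"
  proof (cases "i < rdim V")
    case True
    then have "act V (g \<otimes> h) v i = (\<Sum>j<rdim V. (\<Sum>k<rdim V. rmat V g i k * rmat V h k j) * v j)"
      using assms by (simp add: act_def is_rep_def)
    also have "\<dots> = (\<Sum>j<rdim V. \<Sum>k<rdim V. rmat V g i k * (rmat V h k j * v j))"
      by (simp add: sum_distrib_right mult.assoc)
    also have "\<dots> = (\<Sum>k<rdim V. rmat V g i k * (\<Sum>j<rdim V. rmat V h k j * v j))"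
      by (subst sum.swap) (simp add: sum_distrib_left)
    finally show ?thesis using True by (simp add: act_def)
  qed (simp add: act_def)
qed

text \<open>Matrix identities are tested on unit vectors, so that sums and tensor products can be
  treated through their action instead of their entries.\<close>

lemma is_repI:
  assumes "\<And>j. j < rdim V \<Longrightarrow> act V \<one> (ev j) = ev j"
    and "\<And>g h j. j < rdim V \<Longrightarrow> g \<in> carrier G \<Longrightarrow> h \<in> carrier G \<Longrightarrow>
      act V (g \<otimes> h) (ev j) = act V g (act V h (ev j))"
  shows "is_rep G V"
  unfolding is_rep_def
proof (intro conjI ballI allI impI)
  fix i j assume ij: "i < rdim V" "j < rdim V"
  show "rmat V \<one> i j = (if i = j then 1 else 0)"
    using rmat_act[OF ij] assms(1) ij by (simp add: ev_def)
next
  fix g h i j assume ij: "i < rdim V" "j < rdim V" and gh: "g \<in> carrier G" "h \<in> carrier G"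
  have "rmat V (g \<otimes> h) i j = act V g (act V h (ev j)) i"
    using rmat_act[OF ij] assms(2) ij gh by simp
  also have "\<dots> = (\<Sum>k<rdim V. rmat V g i k * rmat V h k j)"
    using ij by (simp add: act_def[of V g] rmat_act)
  finally show "rmat V (g \<otimes> h) i j = (\<Sum>k<rdim V. rmat V g i k * rmat V h k j)" .
qed

lemma is_rep_tensor:
  fixes V W :: "('a, 'k::field) rep"
  assumes V: "is_rep G V" and W: "is_rep G W"
  shows "is_rep G (rep_tensor V W)"
proof (rule is_repI)
  fix j assume "j < rdim (rep_tensor V W)"
  then have j: "j < rdim V * rdim W" by (simp add: rep_tensor_def)
  then have m: "rdim W > 0" by (cases "rdim W") auto
  have b: "j div rdim W < rdim V" "j mod rdim W < rdim W"
    using j m less_mult_imp_div_less by auto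
  have "vec_tensor (rdim W) (ev (j div rdim W)) (ev (j mod rdim W)) i = (ev j i :: 'k)" for i
  proof -
    have "i = j" if "i div rdim W = j div rdim W" "i mod rdim W = j mod rdim W"
      using that by (metis div_mult_mod_eq)
    then show ?thesis by (auto simp: vec_tensor_def ev_def)
  qed
  then obtain u v :: "nat \<Rightarrow> 'k" where e: "ev j = vec_tensor (rdim W) u v"
      "u \<in> kspace (rdim V)" "v \<in> kspace (rdim W)"
    using b ev_kspace by (metis ext)
  show "act (rep_tensor V W) \<one> (ev j) = ev j"
    unfolding e(1) using e(2,3) by (simp add: act_tensor act_one[OF V] act_one[OF W])
  fix g h assume "g \<in> carrier G" "h \<in> carrier G"
  then show "act (rep_tensor V W) (g \<otimes> h) (ev j) = act (rep_tensor V W) g (act (rep_tensor V W) h (ev j))"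
    unfolding e(1) by (simp add: act_tensor act_mult[OF V] act_mult[OF W])
qed

lemma is_rep_dsum:
  fixes V W :: "('a, 'k::field) rep"
  assumes V: "is_rep G V" and W: "is_rep G W"
  shows "is_rep G (rep_dsum V W)"
proof (rule is_repI)
  fix j assume j: "j < rdim (rep_dsum V W)"
  obtain u v :: "nat \<Rightarrow> 'k" where e: "ev j = vec_dsum (rdim V) u v"
      "u \<in> kspace (rdim V)" "v \<in> kspace (rdim W)"
  proof (cases "j < rdim V")
    case True
    then have "ev j = (vec_dsum (rdim V) (ev j) 0 :: nat \<Rightarrow> 'k)" by (auto simp: ev_def vec_dsum_def)
    then show ?thesis using that[of "ev j" 0] True ev_kspace kspace_zero by metis
  next
    case False
    then have "ev j = (vec_dsum (rdim V) 0 (ev (j - rdim V)) :: nat \<Rightarrow> 'k)"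
      by (auto simp: ev_def vec_dsum_def fun_eq_iff)
    moreover have "j - rdim V < rdim W" using False j by (auto simp: rep_dsum_def)
    ultimately show ?thesis using that[of 0 "ev (j - rdim V)"] ev_kspace kspace_zero by metis
  qed
  show "act (rep_dsum V W) \<one> (ev j) = ev j"
    unfolding e by (simp add: act_dsum act_one[OF V] act_one[OF W] e)
  fix g h assume "g \<in> carrier G" "h \<in> carrier G"
  then show "act (rep_dsum V W) (g \<otimes> h) (ev j) = act (rep_dsum V W) g (act (rep_dsum V W) h (ev j))"
    unfolding e by (simp add: act_dsum act_mult[OF V] act_mult[OF W])
qed

lemma is_rep_linear:
  assumes "\<chi> \<one> = 1" "\<And>g h. g \<in> carrier G \<Longrightarrow> h \<in> carrier G \<Longrightarrow> \<chi> (g \<otimes> h) = \<chi> g * \<chi> h"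
  shows "is_rep G (linear_rep \<chi>)"
  using assms by (auto simp: is_rep_def linear_rep_def)

subsection \<open>Isomorphisms\<close>

text \<open>Equivariance of the inverse is automatic: apply \<open>g\<close> to the equation for
  \<open>f\<close> at \<open>g m\<close>. For \<open>f\<close> it suffices to test group elements,
  since these span \<open>K[G]\<close>.\<close>

lemma glider_isoI:
  assumes X: "is_glider G X" and Y: "is_glider G Y" and f: "klin f" and g: "klin g"
    and "f ` gtop X \<subseteq> gtop Y" "f ` gsub X \<subseteq> gsub Y" "g ` gtop Y \<subseteq> gtop X" "g ` gsub Y \<subseteq> gsub X"
    and gf: "\<And>u. u \<in> gtop X \<Longrightarrow> g (f u) = u" and fg: "\<And>u. u \<in> gtop Y \<Longrightarrow> f (g u) = u"
    and eq: "\<And>a m. a \<in> carrier G \<Longrightarrow> m \<in> gsub X \<Longrightarrow> f (act (gamb X) a m) = act (gamb Y) a (f m)"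
  shows "glider_iso G X Y"
  unfolding glider_iso_def
proof (rule exI[of _ f], rule exI[of _ g], intro conjI ballI)
  have eqx: "f (kG_act G (gamb X) x m) = kG_act G (gamb Y) x (f m)" if "m \<in> gsub X" for x m
    by (rule kG_act_commute[OF f]) (use eq that in auto)
  show "glider_mor G X Y f"
    unfolding glider_mor_def using assms eqx by (auto intro: klin_on)
  show "glider_mor G Y X g"
    unfolding glider_mor_def
  proof (intro conjI allI ballI)
    fix x m assume m: "m \<in> gsub Y"
    have gm: "g m \<in> gsub X" using m assms by auto
    have "g (kG_act G (gamb Y) x m) = g (kG_act G (gamb Y) x (f (g m)))"
      using m Y fg unfolding is_glider_iff by auto
    also have "\<dots> = g (f (kG_act G (gamb X) x (g m)))" using eqx gm by simp
    also have "\<dots> = kG_act G (gamb X) x (g m)" using gf glider_kG_act[OF X gm] by simp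
    finally show "g (kG_act G (gamb Y) x m) = kG_act G (gamb X) x (g m)" .
  qed (use assms in \<open>auto intro: klin_on\<close>)
qed (use gf fg in auto)

text \<open>Equivariance is recorded both for group elements and for \<open>K[G]\<close>, since
  tensor products use the first form and annihilators the second.\<close>

definition mat_iso ::
    "('a, 'k::field) glider \<Rightarrow> ('a, 'k) glider \<Rightarrow> (nat \<Rightarrow> nat \<Rightarrow> 'k) \<Rightarrow> (nat \<Rightarrow> nat \<Rightarrow> 'k) \<Rightarrow> bool"
  where "mat_iso X Y F F' \<longleftrightarrow>
    (let f = matapp (rdim (gamb Y)) (rdim (gamb X)) F; g = matapp (rdim (gamb X)) (rdim (gamb Y)) F'
     in f ` gtop X \<subseteq> gtop Y \<and> f ` gsub X \<subseteq> gsub Y \<and> g ` gtop Y \<subseteq> gtop X \<and> g ` gsub Y \<subseteq> gsub X \<and>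
       (\<forall>u\<in>gtop X. g (f u) = u) \<and> (\<forall>u\<in>gtop Y. f (g u) = u) \<and>
       (\<forall>a\<in>carrier G. \<forall>m\<in>gsub X. f (act (gamb X) a m) = act (gamb Y) a (f m)) \<and>
       (\<forall>x. \<forall>m\<in>gsub X. f (kG_act G (gamb X) x m) = kG_act G (gamb Y) x (f m)))"

lemma glider_isoE:
  fixes X Y :: "('a, 'k::field) glider"
  assumes "glider_iso G X Y" and X: "is_glider G X" and Y: "is_glider G Y"
  obtains F F' where "mat_iso X Y F F'"
proof -
  obtain f g where f: "glider_mor G X Y f" and g: "glider_mor G Y X g"
    and gf: "\<forall>m\<in>gtop X. g (f m) = m" and fg: "\<forall>m\<in>gtop Y. f (g m) = m"
    using assms(1) unfolding glider_iso_def by blast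
  have fgim: "klinear_on (gtop X) f" "f ` gtop X \<subseteq> gtop Y" "klinear_on (gtop Y) g" "g ` gtop Y \<subseteq> gtop X"
      "f ` gsub X \<subseteq> gsub Y" "g ` gsub Y \<subseteq> gsub X"
    using f g by (simp_all add: glider_mor_def)
  have XY: "kv.subspace (gtop X)" "gtop X \<subseteq> kspace (rdim (gamb X))"
    "kv.subspace (gtop Y)" "gtop Y \<subseteq> kspace (rdim (gamb Y))"
    using X Y by (simp_all add: is_glider_def)
  obtain F where F: "\<And>u. u \<in> gtop X \<Longrightarrow> f u = matapp (rdim (gamb Y)) (rdim (gamb X)) F u"
    using klinear_on_matrix[OF XY(1,2) fgim(1) subset_trans[OF fgim(2) XY(4)]] by metis
  obtain F' where F': "\<And>u. u \<in> gtop Y \<Longrightarrow> g u = matapp (rdim (gamb X)) (rdim (gamb Y)) F' u"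
    using klinear_on_matrix[OF XY(3,4) fgim(3) subset_trans[OF fgim(4) XY(2)]] by metis
  let ?f = "matapp (rdim (gamb Y)) (rdim (gamb X)) F" and ?g = "matapp (rdim (gamb X)) (rdim (gamb Y)) F'"
  have sub: "gsub X \<subseteq> gtop X" "gsub Y \<subseteq> gtop Y" using X Y by (auto simp: is_glider_def)
  have eqx: "?f (kG_act G (gamb X) x m) = kG_act G (gamb Y) x (?f m)" if m: "m \<in> gsub X" for x m
    using f m F[of m] F[of "kG_act G (gamb X) x m"] glider_kG_act[OF X m] sub
    unfolding glider_mor_def by auto
  have eqa: "?f (act (gamb X) a m) = act (gamb Y) a (?f m)" if "a \<in> carrier G" "m \<in> gsub X" for a m
    using eqx[OF that(2), of "delta a"] by (simp only: kG_act_delta[OF that(1)])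
  have im: "?f ` gtop X \<subseteq> gtop Y" "?f ` gsub X \<subseteq> gsub Y" "?g ` gtop Y \<subseteq> gtop X" "?g ` gsub Y \<subseteq> gsub X"
  proof -
    have "?f ` A = f ` A" if "A \<subseteq> gtop X" for A
      by (rule image_cong[OF refl]) (rule F[symmetric], use that in blast)
    moreover have "?g ` A = g ` A" if "A \<subseteq> gtop Y" for A
      by (rule image_cong[OF refl]) (rule F'[symmetric], use that in blast)
    ultimately show "?f ` gtop X \<subseteq> gtop Y" "?f ` gsub X \<subseteq> gsub Y"
      "?g ` gtop Y \<subseteq> gtop X" "?g ` gsub Y \<subseteq> gsub X"
      using fgim sub by simp_all
  qed
  have "?g (?f u) = u" if u: "u \<in> gtop X" for u
  proof -
    have "f u \<in> gtop Y" using fgim(2) u by blast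
    then have "?g (f u) = u" using gf u F'[of "f u"] by simp
    then show ?thesis using F[OF u] by simp
  qed
  moreover have "?f (?g u) = u" if u: "u \<in> gtop Y" for u
  proof -
    have "g u \<in> gtop X" using fgim(4) u by blast
    then have "?f (g u) = u" using fg u F[of "g u"] by simp
    then show ?thesis using F'[OF u] by simp
  qed
  ultimately show thesis
    using im eqa eqx by (intro that[of F F']) (simp add: mat_iso_def)
qed

lemma glider_iso_refl: "is_glider G X \<Longrightarrow> glider_iso G X X"
  by (rule glider_isoI[where f = "\<lambda>x. x" and g = "\<lambda>x. x"]) (auto intro: klin_id)

lemma glider_iso_sym: "glider_iso G X Y \<Longrightarrow> glider_iso G Y X"
  unfolding glider_iso_def by blast

lemma glider_mor_comp: "glider_mor G X Y f \<Longrightarrow> glider_mor G Y Z g \<Longrightarrow> glider_mor G X Z (g \<circ> f)"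
  unfolding glider_mor_def klinear_on_def by (simp add: image_subset_iff)

lemma glider_iso_trans:
  assumes "glider_iso G X Y" "glider_iso G Y Z"
  shows "glider_iso G X Z"
proof -
  obtain f f' where f: "glider_mor G X Y f" "glider_mor G Y X f'"
    "\<forall>m\<in>gtop X. f' (f m) = m" "\<forall>m\<in>gtop Y. f (f' m) = m"
    using assms(1) unfolding glider_iso_def by blast
  obtain g g' where g: "glider_mor G Y Z g" "glider_mor G Z Y g'"
    "\<forall>m\<in>gtop Y. g' (g m) = m" "\<forall>m\<in>gtop Z. g (g' m) = m"
    using assms(2) unfolding glider_iso_def by blast
  have "f ` gtop X \<subseteq> gtop Y" "g' ` gtop Z \<subseteq> gtop Y" using f g unfolding glider_mor_def by auto
  then have "\<forall>m\<in>gtop X. (f' \<circ> g') ((g \<circ> f) m) = m" "\<forall>m\<in>gtop Z. (g \<circ> f) ((f' \<circ> g') m) = m"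
    using f g by auto
  then show ?thesis
    unfolding glider_iso_def using glider_mor_comp[OF f(1) g(1)] glider_mor_comp[OF g(2) f(2)] by blast
qed

subsection \<open>Tensor products\<close>

lemma span_subset_image:
  assumes "klin f" "\<And>x. x \<in> S \<Longrightarrow> f x \<in> T"
  shows "f ` kv.span S \<subseteq> kv.span T"
  unfolding klin_span_image[OF assms(1)] using assms(2) by (intro kv.span_mono) auto

lemma span_tensor_l:
  "kv.span {vec_tensor m u v |u v. u \<in> kv.span S \<and> v \<in> T} = kv.span {vec_tensor m u v |u v. u \<in> S \<and> v \<in> T}"
  (is "?L = ?R")
proof
  have "vec_tensor m u v \<in> ?R" if "u \<in> kv.span S" "v \<in> T" for u v
  proof -
    have "(\<lambda>u. vec_tensor m u v) ` kv.span S \<subseteq> kv.span {vec_tensor m u v |u v. u \<in> S \<and> v \<in> T}"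
      by (rule span_subset_image[OF klin_tensor_l]) (use that in auto)
    then show ?thesis using that by blast
  qed
  then show "?L \<subseteq> ?R" by (intro kv.span_minimal) auto
  show "?R \<subseteq> ?L" using kv.span_superset by (intro kv.span_mono) blast
qed

lemma span_tensor_r:
  "kv.span {vec_tensor m u v |u v. u \<in> S \<and> v \<in> kv.span T} = kv.span {vec_tensor m u v |u v. u \<in> S \<and> v \<in> T}"
  (is "?L = ?R")
proof
  have "vec_tensor m u v \<in> ?R" if "u \<in> S" "v \<in> kv.span T" for u v
  proof -
    have "(\<lambda>v. vec_tensor m u v) ` kv.span T \<subseteq> kv.span {vec_tensor m u v |u v. u \<in> S \<and> v \<in> T}"
      by (rule span_subset_image[OF klin_tensor_r]) (use that in auto)
    then show ?thesis using that by blast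
  qed
  then show "?L \<subseteq> ?R" by (intro kv.span_minimal) auto
  show "?R \<subseteq> ?L" using kv.span_superset by (intro kv.span_mono) blast
qed

lemma tensor_setI:
  "u \<in> A \<Longrightarrow> v \<in> B \<Longrightarrow> vec_tensor m u v \<in> {vec_tensor m u v |u v. u \<in> A \<and> v \<in> B}"
  by blast

lemma dsum_setI:
  "u \<in> A \<Longrightarrow> v \<in> B \<Longrightarrow> vec_dsum m u v \<in> {vec_dsum m u v |u v. u \<in> A \<and> v \<in> B}"
  by blast

lemma is_glider_tensor:
  assumes X: "is_glider G X" and Y: "is_glider G Y"
  shows "is_glider G (glider_tensor X Y)"
  unfolding is_glider_iff
proof (intro conjI ballI)
  let ?m = "rdim (gamb Y)" and ?A = "gamb (glider_tensor X Y)"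
  note X' = X[unfolded is_glider_iff] and Y' = Y[unfolded is_glider_iff]
  show "is_rep G ?A" using X' Y' by (simp add: glider_tensor_def is_rep_tensor)
  show "kv.subspace (gsub (glider_tensor X Y))" "kv.subspace (gtop (glider_tensor X Y))"
    by (simp_all add: glider_tensor_def)
  show "gsub (glider_tensor X Y) \<subseteq> gtop (glider_tensor X Y)"
    unfolding glider_tensor_def glider.simps using X' Y' by (intro kv.span_mono) blast
  show "gtop (glider_tensor X Y) \<subseteq> kspace (rdim ?A)"
    unfolding glider_tensor_def glider.simps rep_tensor_def rep.simps using X' Y'
    by (intro kv.span_minimal) (auto intro!: vec_tensor_kspace)
  fix a v assume a: "a \<in> carrier G" and v: "v \<in> gsub (glider_tensor X Y)"
  have "act ?A a ` kv.span {vec_tensor ?m u v |u v. u \<in> gsub X \<and> v \<in> gsub Y} \<subseteq>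
      kv.span {vec_tensor ?m u v |u v. u \<in> gtop X \<and> v \<in> gtop Y}"
  proof (rule span_subset_image[OF klin_act])
    fix x assume "x \<in> {vec_tensor ?m u v |u v. u \<in> gsub X \<and> v \<in> gsub Y}"
    then obtain u v where x: "x = vec_tensor ?m u v" "u \<in> gsub X" "v \<in> gsub Y" by blast
    have "act ?A a x = vec_tensor ?m (act (gamb X) a u) (act (gamb Y) a v)"
      unfolding x(1) by (simp add: glider_tensor_def act_tensor)
    then show "act ?A a x \<in> {vec_tensor ?m u v |u v. u \<in> gtop X \<and> v \<in> gtop Y}"
      using tensor_setI[of "act (gamb X) a u" "gtop X" "act (gamb Y) a v" "gtop Y"] X' Y' a x by simp
  qed
  then show "act ?A a v \<in> gtop (glider_tensor X Y)"
    using v by (auto simp: glider_tensor_def)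
qed

text \<open>All conditions on an isomorphism are linear, so for gliders given by spanning sets they
  are checked on the spanning vectors, in practice on pure tensors.\<close>

lemma glider_tensor_isoI:
  assumes Y: "is_glider G Y" and X: "is_glider G X" and f: "klin f" and g: "klin g"
    and st: "gsub X = kv.span S" "gtop X = kv.span T" "gsub Y = kv.span S'" "gtop Y = kv.span T'"
    and f1: "\<And>u. u \<in> T \<Longrightarrow> f u \<in> T'" "\<And>u. u \<in> S \<Longrightarrow> f u \<in> S'"
    and g1: "\<And>u. u \<in> T' \<Longrightarrow> g u \<in> T" "\<And>u. u \<in> S' \<Longrightarrow> g u \<in> S"
    and gf: "\<And>u. u \<in> T \<Longrightarrow> g (f u) = u" and fg: "\<And>u. u \<in> T' \<Longrightarrow> f (g u) = u"
    and eq: "\<And>a m. a \<in> carrier G \<Longrightarrow> m \<in> S \<Longrightarrow> f (act (gamb X) a m) = act (gamb Y) a (f m)"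
  shows "glider_iso G X Y"
proof (rule glider_isoI[OF X Y f g])
  show "f ` gtop X \<subseteq> gtop Y" "f ` gsub X \<subseteq> gsub Y" "g ` gtop Y \<subseteq> gtop X" "g ` gsub Y \<subseteq> gsub X"
    unfolding st by (intro span_subset_image f g; use f1 g1 in blast)+
  show "g (f u) = u" if "u \<in> gtop X" for u
    by (rule klin_eq_on_span[OF klin_compose[OF f g] klin_id]) (use gf that st in auto)
  show "f (g u) = u" if "u \<in> gtop Y" for u
    by (rule klin_eq_on_span[OF klin_compose[OF g f] klin_id]) (use fg that st in auto)
  show "f (act (gamb X) a m) = act (gamb Y) a (f m)" if "a \<in> carrier G" "m \<in> gsub X" for a m
    by (rule klin_eq_on_span[OF klin_compose[OF klin_act f] klin_compose[OF f klin_act]])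
      (use eq that st in auto)
qed

text \<open>The Kronecker product of two matrix isomorphisms does the job, because
  \<open>matapp_kron\<close> computes it on pure tensors.\<close>

lemma glider_tensor_cong:
  assumes XX: "glider_iso G X X'" and YY: "glider_iso G Y Y'"
    and X: "is_glider G X" and X': "is_glider G X'" and Y: "is_glider G Y" and Y': "is_glider G Y'"
  shows "glider_iso G (glider_tensor X Y) (glider_tensor X' Y')"
proof -
  let ?n = "rdim (gamb X)" and ?n' = "rdim (gamb X')" and ?m = "rdim (gamb Y)" and ?m' = "rdim (gamb Y')"
  obtain F F' where "mat_iso X X' F F'" by (rule glider_isoE[OF XX X X'])
  then have F: "matapp ?n' ?n F ` gtop X \<subseteq> gtop X'" "matapp ?n' ?n F ` gsub X \<subseteq> gsub X'"
    "matapp ?n ?n' F' ` gtop X' \<subseteq> gtop X" "matapp ?n ?n' F' ` gsub X' \<subseteq> gsub X"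
    "\<And>u. u \<in> gtop X \<Longrightarrow> matapp ?n ?n' F' (matapp ?n' ?n F u) = u"
    "\<And>u. u \<in> gtop X' \<Longrightarrow> matapp ?n' ?n F (matapp ?n ?n' F' u) = u"
    "\<And>a m. a \<in> carrier G \<Longrightarrow> m \<in> gsub X \<Longrightarrow>
       matapp ?n' ?n F (act (gamb X) a m) = act (gamb X') a (matapp ?n' ?n F m)"
    unfolding mat_iso_def Let_def by blast+
  obtain E E' where "mat_iso Y Y' E E'" by (rule glider_isoE[OF YY Y Y'])
  then have E: "matapp ?m' ?m E ` gtop Y \<subseteq> gtop Y'" "matapp ?m' ?m E ` gsub Y \<subseteq> gsub Y'"
    "matapp ?m ?m' E' ` gtop Y' \<subseteq> gtop Y" "matapp ?m ?m' E' ` gsub Y' \<subseteq> gsub Y"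
    "\<And>u. u \<in> gtop Y \<Longrightarrow> matapp ?m ?m' E' (matapp ?m' ?m E u) = u"
    "\<And>u. u \<in> gtop Y' \<Longrightarrow> matapp ?m' ?m E (matapp ?m ?m' E' u) = u"
    "\<And>a m. a \<in> carrier G \<Longrightarrow> m \<in> gsub Y \<Longrightarrow>
       matapp ?m' ?m E (act (gamb Y) a m) = act (gamb Y') a (matapp ?m' ?m E m)"
    unfolding mat_iso_def Let_def by blast+
  let ?f = "matapp (?n' * ?m') (?n * ?m) (kron ?m' ?m F E)"
  let ?g = "matapp (?n * ?m) (?n' * ?m') (kron ?m ?m' F' E')"
  let ?st = "\<lambda>X Y. {vec_tensor (rdim (gamb Y)) u v |u v. u \<in> gsub X \<and> v \<in> gsub Y}"
  let ?tt = "\<lambda>X Y. {vec_tensor (rdim (gamb Y)) u v |u v. u \<in> gtop X \<and> v \<in> gtop Y}"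
  show ?thesis
  proof (rule glider_tensor_isoI[where f = ?f and g = ?g and S = "?st X Y" and T = "?tt X Y"
        and S' = "?st X' Y'" and T' = "?tt X' Y'"])
    show "is_glider G (glider_tensor X Y)" "is_glider G (glider_tensor X' Y')"
      using X Y X' Y' by (simp_all add: is_glider_tensor)
    show "klin ?f" "klin ?g" by (rule klin_matapp)+
    show "?f u \<in> ?tt X' Y'" if "u \<in> ?tt X Y" for u
      using that F(1) E(1) by (clarsimp simp only: mem_Collect_eq matapp_kron) blast
    show "?f u \<in> ?st X' Y'" if "u \<in> ?st X Y" for u
      using that F(2) E(2) by (clarsimp simp only: mem_Collect_eq matapp_kron) blast
    show "?g u \<in> ?tt X Y" if "u \<in> ?tt X' Y'" for u
      using that F(3) E(3) by (clarsimp simp only: mem_Collect_eq matapp_kron) blast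
    show "?g u \<in> ?st X Y" if "u \<in> ?st X' Y'" for u
      using that F(4) E(4) by (clarsimp simp only: mem_Collect_eq matapp_kron) blast
    show "?g (?f u) = u" if "u \<in> ?tt X Y" for u
      using that F(5) E(5) by (clarsimp simp: matapp_kron)
    show "?f (?g u) = u" if "u \<in> ?tt X' Y'" for u
      using that F(6) E(6) by (clarsimp simp: matapp_kron)
    show "?f (act (gamb (glider_tensor X Y)) a u) = act (gamb (glider_tensor X' Y')) a (?f u)"
      if "a \<in> carrier G" "u \<in> ?st X Y" for a u
      using that F(7) E(7) by (clarsimp simp: matapp_kron glider_tensor_def act_tensor)
  qed (simp_all add: glider_tensor_def)
qed

lemma glider_tensor_comm:
  assumes X: "is_glider G X" and Y: "is_glider G Y"
  shows "glider_iso G (glider_tensor X Y) (glider_tensor Y X)"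
proof -
  let ?n = "rdim (gamb X)" and ?m = "rdim (gamb Y)"
  \<comment> \<open>Coordinate swap: the index \<open>i = b * n + a\<close> of
    \<open>v \<otimes> u\<close> reads the entry \<open>a * m + b\<close> of
    \<open>u \<otimes> v\<close>.\<close>
  define sw where "sw n m w = (\<lambda>i. if i < n * m then w ((i mod n) * m + i div n) else 0)"
    for n m and w :: "nat \<Rightarrow> 'c"
  have sw: "sw n m (vec_tensor m u v) = vec_tensor n v u" if "u \<in> kspace n" "v \<in> kspace m" for n m u v
  proof
    fix i
    show "sw n m (vec_tensor m u v) i = vec_tensor n v u i"
    proof (cases "i < n * m")
      case True
      then have "n > 0" by (cases n) auto
      moreover have "i div n < m" using True by (simp add: less_mult_imp_div_less mult.commute)
      ultimately show ?thesis using True by (simp add: sw_def vec_tensor_def mult.commute)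
    next
      case False
      then show ?thesis using vec_tensor_kspace[OF that(2,1)] by (simp add: sw_def kspace_def mult.commute)
    qed
  qed
  have lsw: "klin (sw n m)" for n m
    by (intro klinI) (auto simp: sw_def vscale_def fun_eq_iff)
  let ?st = "\<lambda>X Y. {vec_tensor (rdim (gamb Y)) u v |u v. u \<in> gsub X \<and> v \<in> gsub Y}"
  let ?tt = "\<lambda>X Y. {vec_tensor (rdim (gamb Y)) u v |u v. u \<in> gtop X \<and> v \<in> gtop Y}"
  have k: "u \<in> gtop X \<Longrightarrow> u \<in> kspace ?n" "u \<in> gsub X \<Longrightarrow> u \<in> kspace ?n"
    "u \<in> gtop Y \<Longrightarrow> u \<in> kspace ?m" "u \<in> gsub Y \<Longrightarrow> u \<in> kspace ?m" for u
    using X Y unfolding is_glider_iff by blast+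
  show ?thesis
  proof (rule glider_tensor_isoI[where f = "sw ?n ?m" and g = "sw ?m ?n" and S = "?st X Y" and T = "?tt X Y"
        and S' = "?st Y X" and T' = "?tt Y X"])
    show "sw ?n ?m (act (gamb (glider_tensor X Y)) a u) = act (gamb (glider_tensor Y X)) a (sw ?n ?m u)"
      if "a \<in> carrier G" "u \<in> ?st X Y" for a u
      using that k by (auto simp: glider_tensor_def act_tensor sw act_kspace)
    show "sw ?n ?m u \<in> ?tt Y X" if "u \<in> ?tt X Y" for u using that k sw by fastforce
    show "sw ?n ?m u \<in> ?st Y X" if "u \<in> ?st X Y" for u using that k sw by fastforce
    show "sw ?m ?n u \<in> ?tt X Y" if "u \<in> ?tt Y X" for u using that k sw by fastforce
    show "sw ?m ?n u \<in> ?st X Y" if "u \<in> ?st Y X" for u using that k sw by fastforce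
    show "sw ?m ?n (sw ?n ?m u) = u" if "u \<in> ?tt X Y" for u using that k sw by fastforce
    show "sw ?n ?m (sw ?m ?n u) = u" if "u \<in> ?tt Y X" for u using that k sw by fastforce
  qed (use X Y in \<open>simp_all add: is_glider_tensor lsw\<close>, simp_all add: glider_tensor_def)
qed

lemma vec_tensor_assoc: "vec_tensor p (vec_tensor m u v) w = vec_tensor (m * p) u (vec_tensor p v w)"
  by (cases "p = 0")
    (auto simp: vec_tensor_def fun_eq_iff div_mult2_eq mult.assoc mod_mult2_eq mult.commute[of m p])

lemma rep_tensor_assoc: "rep_tensor (rep_tensor U V) W = rep_tensor U (rep_tensor V W)"
  by (cases "rdim W = 0")
    (auto simp: rep_tensor_def fun_eq_iff div_mult2_eq mult.assoc mod_mult2_eq mult.commute[of "rdim V"])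

text \<open>Both bracketings place the tensor of the unit vectors \<open>a\<close>,
  \<open>b\<close>, \<open>c\<close> at the index \<open>(a * m + b) * p + c\<close>, so
  associativity is an equality of gliders and not just an isomorphism.\<close>

lemma glider_tensor_assoc:
  fixes X :: "('a, 'k::field) glider"
  shows "glider_tensor (glider_tensor X Y) Z = glider_tensor X (glider_tensor Y Z)"
proof -
  have "kv.span {vec_tensor p w c |w c. w \<in> kv.span {vec_tensor m a b |a b. a \<in> A \<and> b \<in> B} \<and> c \<in> C} =
    kv.span {vec_tensor (m * p) a w |a w. a \<in> A \<and> w \<in> kv.span {vec_tensor p b c |b c. b \<in> B \<and> c \<in> C}}"
    for A B C :: "(nat \<Rightarrow> 'k) set" and m p
  proof -
    have "{vec_tensor p w c |w c. w \<in> {vec_tensor m a b |a b. a \<in> A \<and> b \<in> B} \<and> c \<in> C} =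
      {vec_tensor (m * p) a w |a w. a \<in> A \<and> w \<in> {vec_tensor p b c |b c. b \<in> B \<and> c \<in> C}}"
      by (auto simp: vec_tensor_assoc) (metis vec_tensor_assoc)+
    then show ?thesis unfolding span_tensor_l span_tensor_r by simp
  qed
  then show ?thesis
    by (simp add: glider_tensor_def rep_tensor_assoc) (simp add: rep_tensor_def)
qed

lemma is_glider_linear:
  assumes "\<chi> \<one> = 1" "\<And>g h. g \<in> carrier G \<Longrightarrow> h \<in> carrier G \<Longrightarrow> \<chi> (g \<otimes> h) = \<chi> g * \<chi> h"
  shows "is_glider G (linear_glider \<chi>)"
proof -
  have "unit_vec0 1 \<in> kspace 1" by (auto simp: unit_vec0_def kspace_def)
  then have "kv.span {unit_vec0 1} \<subseteq> kspace 1" by (intro kv.span_minimal) auto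
  then show ?thesis
    using is_rep_linear[OF assms] act_kspace[of "linear_rep \<chi>"]
    by (simp add: is_glider_iff linear_glider_def line_glider_def) (simp add: linear_rep_def)
qed

lemma is_glider_trivial: "is_glider G trivial_glider"
  unfolding trivial_glider_def by (rule is_glider_linear) auto

lemma trivial_tensor_vec:
  assumes "u \<in> kspace 1" "v \<in> kspace n"
  shows "vec_tensor n u v = vscale (u 0) v"
proof
  fix i
  show "vec_tensor n u v i = vscale (u 0) v i"
  proof (cases "i < n")
    case True
    then show ?thesis by (simp add: vec_tensor_def vscale_def)
  next
    case False
    have "u (i div n) * v (i mod n) = 0"
    proof (cases "n = 0")
      case True
      then show ?thesis using assms by (simp add: kspace_def)
    next
      case nz: False
      then have "1 \<le> i div n" using False by (simp add: div_greater_zero_iff Suc_le_eq)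
      then show ?thesis using assms(1) by (simp add: kspace_def)
    qed
    then show ?thesis using assms(2) False by (simp add: vec_tensor_def vscale_def kspace_def)
  qed
qed

text \<open>The trivial factor has a single coordinate, equal to 1, so tensoring with it changes no
  coordinates and the identity map is an isomorphism.\<close>

lemma glider_tensor_one:
  assumes X: "is_glider G X"
  shows "glider_iso G (glider_tensor trivial_glider X) X"
proof -
  note X' = X[unfolded is_glider_iff]
  let ?n = "rdim (gamb X)"
  let ?u = "unit_vec0 1 :: nat \<Rightarrow> 'c"
  have u: "?u \<in> kspace 1" by (auto simp: unit_vec0_def kspace_def)
  have v: "vec_tensor ?n ?u v = v" if "v \<in> kspace ?n" for v
    using trivial_tensor_vec[OF u that] by (simp add: unit_vec0_def)
  have 1: "kv.span {vec_tensor ?n u v |u v. u \<in> kv.span {?u} \<and> v \<in> S} = S"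
    if "kv.subspace S" "S \<subseteq> kspace ?n" for S
  proof -
    have "{vec_tensor ?n u v |u v. u \<in> {?u} \<and> v \<in> S} = S" using that v by force
    then show ?thesis unfolding span_tensor_l using that(1) by (simp add: kv.span_eq_iff)
  qed
  have k1: "kspace 1 = kv.span {?u}"
    unfolding span_ev[symmetric] by (simp add: ev_def unit_vec0_def lessThan_Suc)
  have "gsub (glider_tensor trivial_glider X) =
      kv.span {vec_tensor ?n u v |u v. u \<in> kv.span {?u} \<and> v \<in> gsub X}"
    by (simp add: glider_tensor_def trivial_glider_def linear_glider_def line_glider_def)
  moreover have "gtop (glider_tensor trivial_glider X) =
      kv.span {vec_tensor ?n u v |u v. u \<in> kspace 1 \<and> v \<in> gtop X}"
    by (simp add: glider_tensor_def trivial_glider_def linear_glider_def line_glider_def linear_rep_def)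
  moreover have "gsub X \<subseteq> kspace ?n" "gtop X \<subseteq> kspace ?n" using X' by auto
  ultimately have g: "gsub (glider_tensor trivial_glider X) = gsub X"
      "gtop (glider_tensor trivial_glider X) = gtop X"
    using X' 1 unfolding k1 by simp_all
  have act1: "act (linear_rep (\<lambda>g. 1)) a ?u = ?u" for a :: 'a
    by (auto simp: act_def linear_rep_def unit_vec0_def)
  show ?thesis
  proof (rule glider_isoI[OF is_glider_tensor[OF is_glider_trivial X] X klin_id klin_id], unfold g)
    fix a m assume "a \<in> carrier G" "m \<in> gsub X"
    then have "m \<in> kspace ?n" using X' by auto
    then show "act (gamb (glider_tensor trivial_glider X)) a m = act (gamb X) a m"
      using act_tensor[of "linear_rep (\<lambda>g. 1)" "gamb X" a ?u m] v act_kspace[of "gamb X" a m]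
      by (simp add: glider_tensor_def trivial_glider_def linear_glider_def line_glider_def act1)
  qed auto
qed

subsection \<open>Direct sums\<close>

lemma subspace_dsum:
  assumes "kv.subspace S" "kv.subspace T"
  shows "kv.subspace {vec_dsum n u v |u v. u \<in> S \<and> v \<in> T}"
  unfolding kv.subspace_def
proof (intro conjI ballI allI)
  show "0 \<in> {vec_dsum n u v |u v. u \<in> S \<and> v \<in> T}"
    using assms kv.subspace_0 vec_dsum_zero[of n] by (smt (verit) mem_Collect_eq)
next
  fix x y assume "x \<in> {vec_dsum n u v |u v. u \<in> S \<and> v \<in> T}" "y \<in> {vec_dsum n u v |u v. u \<in> S \<and> v \<in> T}"
  then obtain u v u' v' where uv: "x = vec_dsum n u v" "y = vec_dsum n u' v'"
    "u \<in> S" "v \<in> T" "u' \<in> S" "v' \<in> T" by blast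
  have "x + y = vec_dsum n (u + u') (v + v')" using uv by (simp only: vec_dsum_add)
  moreover have "u + u' \<in> S" "v + v' \<in> T" using assms uv kv.subspace_add by blast+
  ultimately show "x + y \<in> {vec_dsum n u v |u v. u \<in> S \<and> v \<in> T}" by blast
next
  fix c x assume "x \<in> {vec_dsum n u v |u v. u \<in> S \<and> v \<in> T}"
  then obtain u v where uv: "x = vec_dsum n u v" "u \<in> S" "v \<in> T" by blast
  have "vscale c x = vec_dsum n (vscale c u) (vscale c v)" using uv by (simp only: vec_dsum_scale)
  moreover have "vscale c u \<in> S" "vscale c v \<in> T" using assms uv kv.subspace_scale by blast+
  ultimately show "vscale c x \<in> {vec_dsum n u v |u v. u \<in> S \<and> v \<in> T}" by blast
qed

lemma is_glider_dsum:
  assumes X: "is_glider G X" and Y: "is_glider G Y"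
  shows "is_glider G (glider_dsum X Y)"
  unfolding is_glider_iff
proof (intro conjI ballI)
  note X' = X[unfolded is_glider_iff] and Y' = Y[unfolded is_glider_iff]
  show "is_rep G (gamb (glider_dsum X Y))" using X' Y' by (simp add: glider_dsum_def is_rep_dsum)
  show "kv.subspace (gsub (glider_dsum X Y))" "kv.subspace (gtop (glider_dsum X Y))"
    using X' Y' by (simp_all add: glider_dsum_def subspace_dsum)
  show "gsub (glider_dsum X Y) \<subseteq> gtop (glider_dsum X Y)"
    using X' Y' by (auto simp: glider_dsum_def)
  show "gtop (glider_dsum X Y) \<subseteq> kspace (rdim (gamb (glider_dsum X Y)))"
    using X' Y' by (auto simp: glider_dsum_def rep_dsum_def intro!: vec_dsum_kspace)
  show "act (gamb (glider_dsum X Y)) a v \<in> gtop (glider_dsum X Y)"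
    if a0: "a \<in> carrier G" and v0: "v \<in> gsub (glider_dsum X Y)" for a v
  proof -
    obtain x y where v: "v = vec_dsum (rdim (gamb X)) x y" "x \<in> gsub X" "y \<in> gsub Y"
      using v0 by (auto simp: glider_dsum_def)
    have "act (gamb (glider_dsum X Y)) a v = vec_dsum (rdim (gamb X)) (act (gamb X) a x) (act (gamb Y) a y)"
      unfolding v(1) by (simp add: glider_dsum_def act_dsum)
    then show ?thesis
      using dsum_setI[of "act (gamb X) a x" "gtop X" "act (gamb Y) a y" "gtop Y"] X' Y' a0 v
      by (simp add: glider_dsum_def)
  qed
qed

lemma klin_dsum_l: "klin (\<lambda>u. vec_dsum n u 0)" and klin_dsum_r: "klin (\<lambda>v. vec_dsum n 0 v)"
  by (intro klinI; simp add: fun_eq_iff vec_dsum_def vscale_def)+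

lemma vec_dsum_split: "vec_dsum n u v = vec_dsum n u 0 + vec_dsum n 0 v"
  using vec_dsum_add[of n u 0 0 v] by simp

lemma vec_tensor_dsum:
  "z \<in> kspace p \<Longrightarrow> vec_tensor p (vec_dsum n u v) z = vec_dsum (n * p) (vec_tensor p u z) (vec_tensor p v z)"
proof
  fix i assume z: "z \<in> kspace p"
  show "vec_tensor p (vec_dsum n u v) z i = vec_dsum (n * p) (vec_tensor p u z) (vec_tensor p v z) i"
  proof (cases "p = 0")
    case True
    then show ?thesis using z by (simp add: vec_tensor_def vec_dsum_def kspace_def)
  next
    case False
    then have "i div p < n \<longleftrightarrow> i < n * p" by (simp add: div_less_iff_less_mult)
    moreover have "(i - n * p) div p = i div p - n" "(i - n * p) mod p = i mod p" if "\<not> i < n * p"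
    proof -
      obtain j where j: "i = j + n * p" using \<open>\<not> i < n * p\<close> by (metis add.commute le_Suc_ex not_less)
      show "(i - n * p) div p = i div p - n" "(i - n * p) mod p = i mod p" using False j by simp_all
    qed
    ultimately show ?thesis by (auto simp: vec_tensor_def vec_dsum_def)
  qed
qed

text \<open>With the sum in the left factor both sides use the same coordinates and the identity map
  is an isomorphism. The other distributive law would permute coordinates; commutativity supplies it
  where it is used.\<close>

lemma glider_tensor_dsum:
  assumes X: "is_glider G X" and Y: "is_glider G Y" and Z: "is_glider G Z"
  shows "glider_iso G (glider_tensor (glider_dsum X Y) Z) (glider_dsum (glider_tensor X Z) (glider_tensor Y Z))"
proof -
  let ?n = "rdim (gamb X)" and ?p = "rdim (gamb Z)"
  have 1: "kv.span {vec_tensor ?p w z |w z. w \<in> {vec_dsum ?n u v |u v. u \<in> A \<and> v \<in> B} \<and> z \<in> C} =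
    {vec_dsum (?n * ?p) u v |u v. u \<in> kv.span {vec_tensor ?p a c |a c. a \<in> A \<and> c \<in> C} \<and>
      v \<in> kv.span {vec_tensor ?p b c |b c. b \<in> B \<and> c \<in> C}}" (is "kv.span ?L = ?R")
    if A: "kv.subspace A" and B: "kv.subspace B" and C: "C \<subseteq> kspace ?p" for A B C
  proof
    have "?L \<subseteq> ?R"
    proof
      fix x assume "x \<in> ?L"
      then obtain u v z where x: "x = vec_tensor ?p (vec_dsum ?n u v) z" "u \<in> A" "v \<in> B" "z \<in> C" by blast
      then have "x = vec_dsum (?n * ?p) (vec_tensor ?p u z) (vec_tensor ?p v z)"
        using vec_tensor_dsum[OF subsetD[OF C x(4)]] by simp
      moreover have "vec_tensor ?p u z \<in> kv.span {vec_tensor ?p a c |a c. a \<in> A \<and> c \<in> C}"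
        "vec_tensor ?p v z \<in> kv.span {vec_tensor ?p b c |b c. b \<in> B \<and> c \<in> C}"
        using x by (auto intro!: kv.span_base)
      ultimately show "x \<in> ?R" by blast
    qed
    then show "kv.span ?L \<subseteq> ?R" by (intro kv.span_minimal subspace_dsum) auto
    show "?R \<subseteq> kv.span ?L"
    proof
      fix x assume "x \<in> ?R"
      then obtain u v where x: "x = vec_dsum (?n * ?p) u v"
        "u \<in> kv.span {vec_tensor ?p a c |a c. a \<in> A \<and> c \<in> C}"
        "v \<in> kv.span {vec_tensor ?p b c |b c. b \<in> B \<and> c \<in> C}" by blast
      have "(\<lambda>u. vec_dsum (?n * ?p) u 0) ` kv.span {vec_tensor ?p a c |a c. a \<in> A \<and> c \<in> C} \<subseteq> kv.span ?L"
      proof (rule span_subset_image[OF klin_dsum_l])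
        fix x assume "x \<in> {vec_tensor ?p a c |a c. a \<in> A \<and> c \<in> C}"
        then obtain a c where x: "x = vec_tensor ?p a c" "a \<in> A" "c \<in> C" by blast
        then have "vec_dsum (?n * ?p) x 0 = vec_tensor ?p (vec_dsum ?n a 0) c"
          using vec_tensor_dsum[OF subsetD[OF C x(3)]] by simp
        then show "vec_dsum (?n * ?p) x 0 \<in> ?L" using x kv.subspace_0[OF B] by blast
      qed
      moreover have "(\<lambda>v. vec_dsum (?n * ?p) 0 v) ` kv.span {vec_tensor ?p a c |a c. a \<in> B \<and> c \<in> C} \<subseteq> kv.span ?L"
      proof (rule span_subset_image[OF klin_dsum_r])
        fix x assume "x \<in> {vec_tensor ?p a c |a c. a \<in> B \<and> c \<in> C}"
        then obtain a c where x: "x = vec_tensor ?p a c" "a \<in> B" "c \<in> C" by blast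
        then have "vec_dsum (?n * ?p) 0 x = vec_tensor ?p (vec_dsum ?n 0 a) c"
          using vec_tensor_dsum[OF subsetD[OF C x(3)]] by simp
        then show "vec_dsum (?n * ?p) 0 x \<in> ?L" using x kv.subspace_0[OF A] by blast
      qed
      ultimately show "x \<in> kv.span ?L"
        unfolding x(1) vec_dsum_split[of "?n * ?p" u v] using x by (intro kv.span_add) blast+
    qed
  qed
  have g: "gsub (glider_tensor (glider_dsum X Y) Z) = gsub (glider_dsum (glider_tensor X Z) (glider_tensor Y Z))"
    "gtop (glider_tensor (glider_dsum X Y) Z) = gtop (glider_dsum (glider_tensor X Z) (glider_tensor Y Z))"
    unfolding glider_tensor_def glider_dsum_def glider.simps
    using X Y Z unfolding is_glider_iff by (subst 1; simp add: rep_tensor_def; blast)+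
  show ?thesis
  proof (rule glider_isoI[OF _ _ klin_id klin_id], unfold g)
    show "is_glider G (glider_tensor (glider_dsum X Y) Z)"
      "is_glider G (glider_dsum (glider_tensor X Z) (glider_tensor Y Z))"
      using X Y Z by (simp_all add: is_glider_tensor is_glider_dsum)
    let ?L = "{vec_tensor ?p w z |w z. w \<in> {vec_dsum ?n u v |u v. u \<in> gsub X \<and> v \<in> gsub Y} \<and> z \<in> gsub Z}"
    fix a m assume "a \<in> carrier G" and m: "m \<in> gsub (glider_dsum (glider_tensor X Z) (glider_tensor Y Z))"
    have "m \<in> kv.span ?L" using m unfolding g(1)[symmetric] by (simp add: glider_tensor_def glider_dsum_def)
    then show "act (gamb (glider_tensor (glider_dsum X Y) Z)) a m =
        act (gamb (glider_dsum (glider_tensor X Z) (glider_tensor Y Z))) a m"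
    proof (rule klin_eq_on_span[OF klin_act klin_act, rotated])
      fix b assume "b \<in> ?L"
      then obtain u v z where b: "b = vec_tensor ?p (vec_dsum ?n u v) z" "z \<in> gsub Z" by blast
      then have z: "z \<in> kspace ?p" using Z by (auto simp: is_glider_iff)
      have d: "rdim (rep_tensor (gamb X) (gamb Z)) = ?n * ?p" by (simp add: rep_tensor_def)
      have "act (gamb (glider_dsum (glider_tensor X Z) (glider_tensor Y Z))) a b =
        act (rep_dsum (rep_tensor (gamb X) (gamb Z)) (rep_tensor (gamb Y) (gamb Z))) a
          (vec_dsum (rdim (rep_tensor (gamb X) (gamb Z))) (vec_tensor ?p u z) (vec_tensor ?p v z))"
        unfolding b(1) vec_tensor_dsum[OF z] d by (simp add: glider_dsum_def glider_tensor_def)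
      also have "\<dots> = vec_tensor ?p (vec_dsum ?n (act (gamb X) a u) (act (gamb Y) a v)) (act (gamb Z) a z)"
        unfolding act_dsum act_tensor unfolding d by (rule vec_tensor_dsum[OF act_kspace, symmetric])
      also have "\<dots> = act (gamb (glider_tensor (glider_dsum X Y) Z)) a b"
        unfolding b(1) by (simp add: glider_dsum_def glider_tensor_def act_tensor act_dsum)
      finally show "act (gamb (glider_tensor (glider_dsum X Y) Z)) a b =
        act (gamb (glider_dsum (glider_tensor X Z) (glider_tensor Y Z))) a b" by simp
    qed
  qed auto
qed

lemma length_zero_tensor:
  "length_zero G X \<Longrightarrow> is_glider G Y \<Longrightarrow> length_zero G (glider_tensor X Y)"
proof -
  assume X: "length_zero G X" and Y: "is_glider G Y"
  have "{vec_tensor (rdim (gamb Y)) u v |u v. u \<in> gsub X \<and> v \<in> gsub Y} = {0}"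
    (is "?L = _")
  proof
    have X0: "gsub X = {0}" using X by (simp add: length_zero_def)
    then show "?L \<subseteq> {0}" by auto
    have "0 \<in> gsub Y" using Y kv.subspace_0[of "gsub Y"] by (simp add: is_glider_iff)
    then show "{0} \<subseteq> ?L" using tensor_setI[of 0 "gsub X" 0 "gsub Y" "rdim (gamb Y)"] X0 by simp
  qed
  then have "gsub (glider_tensor X Y) = {0}" unfolding glider_tensor_def glider.simps by simp
  then show ?thesis using X Y is_glider_tensor unfolding length_zero_def by blast
qed

end

context fin_grp
begin

section \<open>Annihilators and multiplicities\<close>

definition ann :: "('a, 'k::field) rep \<Rightarrow> (nat \<Rightarrow> 'k) \<Rightarrow> ('a \<Rightarrow> 'k) set"
  where "ann V v = {x. kG_act G V x v = 0}"

definition cyc :: "('a, 'k::field) rep \<Rightarrow> (nat \<Rightarrow> 'k) \<Rightarrow> ('a, 'k) glider"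
  where "cyc V v = \<lparr>gamb = V, gsub = kv.span {v}, gtop = kG_span G V (kv.span {v})\<rparr>"

text \<open>
  Both the space of vectors killed by \<open>J\<close> and the span of the vectors with a strictly larger
  annihilator are additive in the glider, and on \<open>Kv \<subset> V\<close> their dimensions differ exactly when
  \<open>J\<close> is the annihilator of \<open>v\<close>. The difference is the coefficient functional dual to the
  basis of irreducible gliders.
\<close>

definition killed :: "('a \<Rightarrow> 'k::field) set \<Rightarrow> ('a, 'k) glider \<Rightarrow> (nat \<Rightarrow> 'k) set"
  where "killed J X = {m \<in> gsub X. J \<subseteq> ann (gamb X) m}"

definition overkilled :: "('a \<Rightarrow> 'k::field) set \<Rightarrow> ('a, 'k) glider \<Rightarrow> (nat \<Rightarrow> 'k) set"
  where "overkilled J X = kv.span {m \<in> gsub X. J \<subset> ann (gamb X) m}"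

definition mult_of :: "('a \<Rightarrow> 'k::field) set \<Rightarrow> ('a, 'k) glider \<Rightarrow> int"
  where "mult_of J X = int (kv.dim (killed J X)) - int (kv.dim (overkilled J X))"

lemma ann_zero: "ann V 0 = UNIV"
  using kk.linear_0[OF klin_kG_act] by (auto simp: ann_def)

lemma ann_scale: "c \<noteq> 0 \<Longrightarrow> ann V (vscale c v) = ann V v"
  by (simp add: ann_def kk.linear_scale[OF klin_kG_act] kv.scale_eq_0_iff)

lemma subspace_killed:
  assumes "kv.subspace (gsub X)" shows "kv.subspace (killed J X)"
proof -
  have "killed J X = gsub X \<inter> (\<Inter>x\<in>J. {m. kG_act G (gamb X) x m = 0})"
    by (auto simp: killed_def ann_def)
  then show ?thesis
    using assms kk.linear_subspace_kernel[OF klin_kG_act]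
    by (auto intro!: kv.subspace_inter kv.subspace_Int)
qed

lemma overkilled_subset: "kv.subspace (gsub X) \<Longrightarrow> overkilled J X \<subseteq> gsub X"
  unfolding overkilled_def by (intro kv.span_minimal) auto

lemma kG_act_dsum:
  "kG_act G (rep_dsum V W) x (vec_dsum (rdim V) u v) = vec_dsum (rdim V) (kG_act G V x u) (kG_act G W x v)"
  by (rule ext) (simp add: kG_act_apply act_dsum, simp add: vec_dsum_def kG_act_apply)

lemma ann_dsum: "ann (rep_dsum V W) (vec_dsum (rdim V) u v) = ann V u \<inter> ann W v"
  by (auto simp: ann_def kG_act_dsum vec_dsum_eq_0[OF kG_act_kspace])

text \<open>A pair is killed exactly when both components are, so \<open>killed\<close> splits.
  \<open>overkilled\<close> is only a span, but \<open>(u, 0)\<close> has the annihilator of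
  \<open>u\<close>, the zero vector being killed by everything; hence it splits as well.\<close>

lemma mult_of_dsum:
  fixes X Y :: "('a, 'k::field) glider"
  assumes X: "is_glider G X" and Y: "is_glider G Y"
  shows "mult_of J (glider_dsum X Y) = mult_of J X + mult_of J Y"
proof -
  let ?n = "rdim (gamb X)"
  have X': "kv.subspace (gsub X)" "gsub X \<subseteq> kspace ?n" and Y': "kv.subspace (gsub Y)" "gsub Y \<subseteq> kspace (rdim (gamb Y))"
    using X Y by (auto simp: is_glider_iff)
  have 1: "killed J (glider_dsum X Y) = {vec_dsum ?n u v |u v. u \<in> killed J X \<and> v \<in> killed J Y}"
  proof (intro equalityI subsetI)
    fix m assume "m \<in> killed J (glider_dsum X Y)"
    then obtain u v where m: "m = vec_dsum ?n u v" "u \<in> gsub X" "v \<in> gsub Y"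
        "J \<subseteq> ann (gamb X) u \<inter> ann (gamb Y) v"
      by (auto simp: killed_def glider_dsum_def ann_dsum)
    then show "m \<in> {vec_dsum ?n u v |u v. u \<in> killed J X \<and> v \<in> killed J Y}"
      unfolding m(1) by (intro dsum_setI) (auto simp: killed_def)
  qed (auto simp: killed_def glider_dsum_def ann_dsum)
  have 2: "overkilled J (glider_dsum X Y) = {vec_dsum ?n u v |u v. u \<in> overkilled J X \<and> v \<in> overkilled J Y}"
    (is "?L = ?R")
  proof
    have "{m \<in> gsub (glider_dsum X Y). J \<subset> ann (gamb (glider_dsum X Y)) m} \<subseteq> ?R"
    proof
      fix m assume "m \<in> {m \<in> gsub (glider_dsum X Y). J \<subset> ann (gamb (glider_dsum X Y)) m}"
      then obtain u v where m: "m = vec_dsum ?n u v" "u \<in> gsub X" "v \<in> gsub Y"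
        and "J \<subset> ann (gamb (glider_dsum X Y)) m"
        by (auto simp: glider_dsum_def)
      then have "J \<subset> ann (gamb X) u \<inter> ann (gamb Y) v"
        unfolding m(1) by (simp only: glider_dsum_def glider.simps ann_dsum)
      with m have "u \<in> overkilled J X" "v \<in> overkilled J Y"
        unfolding overkilled_def by (auto intro!: kv.span_base)
      then show "m \<in> ?R" unfolding m(1) by (rule dsum_setI)
    qed
    then show "?L \<subseteq> ?R"
      unfolding overkilled_def by (intro kv.span_minimal subspace_dsum) auto
    show "?R \<subseteq> ?L"
    proof
      fix x assume "x \<in> ?R"
      then obtain u v where x: "x = vec_dsum ?n u v" "u \<in> overkilled J X" "v \<in> overkilled J Y" by blast
      have "(\<lambda>u. vec_dsum ?n u 0) ` overkilled J X \<subseteq> ?L"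
        unfolding overkilled_def
      proof (rule span_subset_image[OF klin_dsum_l])
        fix u assume "u \<in> {m \<in> gsub X. J \<subset> ann (gamb X) m}"
        then show "vec_dsum ?n u 0 \<in> {m \<in> gsub (glider_dsum X Y). J \<subset> ann (gamb (glider_dsum X Y)) m}"
          using dsum_setI[of u "gsub X" 0 "gsub Y" ?n] kv.subspace_0[OF Y'(1)]
          by (simp add: glider_dsum_def ann_dsum ann_zero)
      qed
      moreover have "(\<lambda>u. vec_dsum ?n 0 u) ` overkilled J Y \<subseteq> ?L"
        unfolding overkilled_def
      proof (rule span_subset_image[OF klin_dsum_r])
        fix u assume "u \<in> {m \<in> gsub Y. J \<subset> ann (gamb Y) m}"
        then show "vec_dsum ?n 0 u \<in> {m \<in> gsub (glider_dsum X Y). J \<subset> ann (gamb (glider_dsum X Y)) m}"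
          using dsum_setI[of 0 "gsub X" u "gsub Y" ?n] kv.subspace_0[OF X'(1)]
          by (simp add: glider_dsum_def ann_dsum ann_zero)
      qed
      ultimately have "vec_dsum ?n u 0 \<in> ?L" "vec_dsum ?n 0 v \<in> ?L" using x by blast+
      then show "x \<in> ?L"
        unfolding x(1) vec_dsum_split[of ?n u v] overkilled_def by (rule kv.span_add)
    qed
  qed
  have "kv.dim (killed J (glider_dsum X Y)) = kv.dim (killed J X) + kv.dim (killed J Y)"
    unfolding 1 using X' Y'
    by (intro dim_vec_dsum subspace_killed) (auto simp: killed_def)
  moreover have "kv.dim (overkilled J (glider_dsum X Y)) = kv.dim (overkilled J X) + kv.dim (overkilled J Y)"
    unfolding 2
  proof (rule dim_vec_dsum)
    show "overkilled J X \<subseteq> kspace ?n" "overkilled J Y \<subseteq> kspace (rdim (gamb Y))"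
      using X' Y' overkilled_subset by blast+
  qed (simp_all add: overkilled_def)
  ultimately show ?thesis by (simp add: mult_of_def)
qed

lemma dim_image_inj:
  assumes f: "klin f" and inj: "inj_on f (kv.span S)"
  shows "kv.dim (f ` S) = kv.dim S"
proof -
  obtain B where B: "B \<subseteq> S" "kv.independent B" "S \<subseteq> kv.span B" "card B = kv.dim S"
    using kv.basis_exists by blast
  have inj': "inj_on f (kv.span B)" using inj_on_subset[OF inj kv.span_mono[OF B(1)]] .
  show ?thesis
  proof (rule kv.dim_unique)
    show "f ` B \<subseteq> f ` S" using B(1) by blast
    show "f ` S \<subseteq> kv.span (f ` B)" unfolding klin_span_image[OF f, symmetric] using B(3) by blast
    show "kv.independent (f ` B)" by (rule kk.linear_independent_injective_image[OF f B(2) inj'])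
    show "card (f ` B) = kv.dim S"
      using card_image[OF inj_on_subset[OF inj' kv.span_superset]] B(4) by simp
  qed
qed

text \<open>An isomorphism is injective on the top space, which contains all \<open>x m\<close> with
  \<open>m\<close> in the bottom space. So it preserves the annihilators of bottom vectors, and with
  them both subspaces.\<close>

lemma mult_of_iso:
  fixes X Y :: "('a, 'k::field) glider"
  assumes iso: "glider_iso G X Y" and X: "is_glider G X" and Y: "is_glider G Y"
  shows "mult_of J X = mult_of J Y"
proof -
  let ?f = "\<lambda>F. matapp (rdim (gamb Y)) (rdim (gamb X)) F"
  obtain F F' where "mat_iso X Y F F'" by (rule glider_isoE[OF iso X Y])
  then have F: "?f F ` gtop X \<subseteq> gtop Y" "?f F ` gsub X \<subseteq> gsub Y"
    "matapp (rdim (gamb X)) (rdim (gamb Y)) F' ` gsub Y \<subseteq> gsub X"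
    "\<forall>u\<in>gtop X. matapp (rdim (gamb X)) (rdim (gamb Y)) F' (?f F u) = u"
    "\<forall>u\<in>gtop Y. ?f F (matapp (rdim (gamb X)) (rdim (gamb Y)) F' u) = u"
    "\<forall>x. \<forall>m\<in>gsub X. ?f F (kG_act G (gamb X) x m) = kG_act G (gamb Y) x (?f F m)"
    unfolding mat_iso_def Let_def by blast+
  let ?h = "?f F"
  have sub: "gsub X \<subseteq> gtop X" "gsub Y \<subseteq> gtop Y" "kv.subspace (gsub X)"
    using X Y by (auto simp: is_glider_iff)
  have inj: "inj_on ?h (gtop X)" using F(4) by (metis inj_onI)
  have ann: "ann (gamb Y) (?h m) = ann (gamb X) m" if m: "m \<in> gsub X" for m
  proof -
    have "kG_act G (gamb Y) x (?h m) = 0 \<longleftrightarrow> kG_act G (gamb X) x m = 0" for x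
    proof -
      have 0: "0 \<in> gtop X" using X kv.subspace_0[of "gtop X"] by (simp add: is_glider_iff)
      have "kG_act G (gamb Y) x (?h m) = ?h (kG_act G (gamb X) x m)" using F(6) m by simp
      moreover have "?h (kG_act G (gamb X) x m) = ?h 0 \<longleftrightarrow> kG_act G (gamb X) x m = 0"
        using inj_on_eq_iff[OF inj glider_kG_act[OF X m] 0] .
      ultimately show ?thesis using kk.linear_0[OF klin_matapp] by metis
    qed
    then show ?thesis by (simp add: ann_def)
  qed
  \<comment> \<open>The predicate \<open>P\<close> covers at once inclusion and strict inclusion of
    \<open>J\<close>.\<close>
  have img: "{m \<in> gsub Y. P (ann (gamb Y) m)} = ?h ` {m \<in> gsub X. P (ann (gamb X) m)}" for P
  proof (intro equalityI subsetI)
    fix m assume m: "m \<in> {m \<in> gsub Y. P (ann (gamb Y) m)}"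
    let ?m = "matapp (rdim (gamb X)) (rdim (gamb Y)) F' m"
    have 1: "?m \<in> gsub X" using F(3) m by blast
    have 2: "?h ?m = m" using F(5) m sub by blast
    show "m \<in> ?h ` {m \<in> gsub X. P (ann (gamb X) m)}"
      using ann[OF 1] m 1 unfolding 2 by (intro image_eqI[where x = ?m]) (simp_all add: 2)
  next
    fix m assume "m \<in> ?h ` {m \<in> gsub X. P (ann (gamb X) m)}"
    then show "m \<in> {m \<in> gsub Y. P (ann (gamb Y) m)}" using F(2) ann by auto
  qed
  have "kv.dim (?h ` S) = kv.dim S" if "S \<subseteq> gsub X" for S
  proof -
    have "kv.span S \<subseteq> gtop X" using kv.span_minimal[OF that sub(3)] sub(1) by blast
    then show ?thesis by (intro dim_image_inj[OF klin_matapp] inj_on_subset[OF inj])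
  qed
  then have d: "kv.dim (?h ` {m \<in> gsub X. P (ann (gamb X) m)}) = kv.dim {m \<in> gsub X. P (ann (gamb X) m)}" for P
    by simp
  show ?thesis
    unfolding mult_of_def killed_def overkilled_def kv.dim_span
    using d[of "\<lambda>A. J \<subseteq> A"] d[of "\<lambda>A. J \<subset> A"] img[of "\<lambda>A. J \<subseteq> A"] img[of "\<lambda>A. J \<subset> A"] by simp
qed

lemma mult_of_length_zero: "length_zero G X \<Longrightarrow> mult_of J X = 0"
proof -
  assume "length_zero G X"
  then have g: "gsub X = {0}" "kv.subspace (gsub X)" by (auto simp: length_zero_def is_glider_iff)
  have "killed J X = {0}" using g by (auto simp: killed_def ann_zero)
  moreover have "overkilled J X = {0}"
    using overkilled_subset[OF g(2)] g kv.span_zero unfolding overkilled_def by blast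
  ultimately show ?thesis by (simp add: mult_of_def)
qed

text \<open>All nonzero vectors of a line have the same annihilator \<open>A\<close>, so the two
  dimensions are 1 or 0 according to \<open>J \<subseteq> A\<close> and
  \<open>J \<subset> A\<close>; they differ only for \<open>J = A\<close>.\<close>

lemma mult_of_line:
  fixes v :: "nat \<Rightarrow> 'k::field"
  assumes g: "gsub X = kv.span {v}" and v: "v \<noteq> 0"
  shows "mult_of J X = (if ann (gamb X) v = J then 1 else 0)"
proof -
  have el: "ann (gamb X) m = (if m = 0 then UNIV else ann (gamb X) v)" if m: "m \<in> kv.span {v}" for m
  proof -
    obtain c where c: "m = vscale c v" using m unfolding kv.span_singleton by blast
    show ?thesis using c v ann_scale[of c "gamb X" v] ann_zero[of "gamb X"] by (auto simp: kv.scale_eq_0_iff)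
  qed
  have d1: "kv.dim (kv.span {v}) = 1"
    using kv.dim_eq_card_independent[of "{v}"] v by (simp add: kv.dim_span)
  have d0: "kv.dim {0 :: nat \<Rightarrow> 'k} = 0"
    using kv.dim_span[of "{} :: (nat \<Rightarrow> 'k) set"] kv.dim_eq_card_independent[OF kv.independent_empty]
    by simp
  have k: "killed J X = (if J \<subseteq> ann (gamb X) v then kv.span {v} else {0})"
    using el v kv.span_zero[of "{v}"] unfolding killed_def g by (auto split: if_splits)
  have o: "overkilled J X = (if J \<subset> ann (gamb X) v then kv.span {v} else {0})"
  proof (cases "J \<subset> ann (gamb X) v")
    case True
    then have "{m \<in> kv.span {v}. J \<subset> ann (gamb X) m} \<supseteq> {v}" using kv.span_base[of v "{v}"] by auto
    then have "kv.span {v} \<subseteq> kv.span {m \<in> kv.span {v}. J \<subset> ann (gamb X) m}" by (rule kv.span_mono)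
    then show ?thesis
      using True overkilled_subset[of X J] unfolding g by (auto simp: overkilled_def g)
  next
    case False
    then have "{m \<in> kv.span {v}. J \<subset> ann (gamb X) m} \<subseteq> {0}" using el by auto
    then have "overkilled J X \<subseteq> {0}"
      unfolding overkilled_def g by (rule kv.span_minimal) (simp add: kv.subspace_single_0)
    then show ?thesis using False kv.span_zero unfolding overkilled_def by auto
  qed
  show ?thesis unfolding mult_of_def k o using d1 by (auto simp: d0)
qed

subsection \<open>Gliders modulo length zero\<close>

lemma kG_span_subspace: "kv.subspace (kG_span G V S)"
  by (simp add: kG_span_def)

lemma is_glider_top:
  assumes "is_glider G X"
  shows "is_glider G (X\<lparr>gtop := kG_span G (gamb X) (gsub X)\<rparr>)"
proof -
  have "gsub X \<subseteq> kG_span G (gamb X) (gsub X)"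
  proof
    fix v assume v: "v \<in> gsub X"
    then have "act (gamb X) \<one> v = v" using assms by (intro act_one) (auto simp: is_glider_iff)
    then show "v \<in> kG_span G (gamb X) (gsub X)" using act_in_span[OF one_closed v, of "gamb X"] by simp
  qed
  then show ?thesis
    using assms kG_span_subspace act_in_span
    by (simp add: is_glider_def) (blast)
qed

text \<open>Morphisms must respect the action on the bottom space only. Any linear complement of
  \<open>K[G]M\<close> in the top space can therefore be split off as a glider of length zero,
  whether or not the group preserves it.\<close>

lemma glider_iso_top:
  fixes X :: "('a, 'k::field) glider"
  assumes X: "is_glider G X"
  shows "\<exists>Z. length_zero G Z \<and> glider_iso G X (glider_dsum (X\<lparr>gtop := kG_span G (gamb X) (gsub X)\<rparr>) Z)"
proof -
  let ?n = "rdim (gamb X)" and ?S = "kG_span G (gamb X) (gsub X)"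
  let ?X = "X\<lparr>gtop := ?S\<rparr>"
  have X': "kv.subspace (gsub X)" "kv.subspace (gtop X)" "gsub X \<subseteq> gtop X" "gtop X \<subseteq> kspace ?n" "?S \<subseteq> gtop X"
    "is_rep G (gamb X)"
    using X by (auto simp: is_glider_def)
  have GX: "is_glider G ?X" by (rule is_glider_top[OF X])
  then have SS: "gsub X \<subseteq> ?S" by (simp add: is_glider_def)
  obtain p where p: "klin p" "\<And>u. p u \<in> ?S" "\<And>u. u \<in> ?S \<Longrightarrow> p u = u"
    using projection_exists[OF kG_span_subspace] by metis
  define Z where "Z = \<lparr>gamb = gamb X, gsub = {0}, gtop = {u \<in> gtop X. p u = 0}\<rparr>"
  have ker: "kv.subspace {u \<in> gtop X. p u = 0}"
    using kv.subspace_inter[OF X'(2) kk.linear_subspace_kernel[OF p(1)]] by (simp add: Int_def)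
  have Z: "length_zero G Z"
    unfolding length_zero_def is_glider_iff Z_def
    using X' ker kv.subspace_0[OF X'(2)] kk.linear_0[OF p(1)]
    by (auto simp: kv.subspace_single_0 kk.linear_0[OF klin_act])
  \<comment> \<open>\<open>f\<close> separates \<open>u\<close> into its part in \<open>?S\<close>
    and its part in the kernel of \<open>p\<close>; \<open>g\<close> adds the two blocks
    again.\<close>
  define f where "f u = vec_dsum ?n (p u) (u - p u)" for u
  define g where "g w = (\<lambda>i. if i < ?n then w i + w (i + ?n) else 0)" for w :: "nat \<Rightarrow> 'k"
  have f: "klin f"
    unfolding f_def
    by (intro klinI) (simp_all add: kk.linear_add[OF p(1)] kk.linear_scale[OF p(1)] kv.scale_right_diff_distrib
      flip: vec_dsum_add vec_dsum_scale, simp add: algebra_simps)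
  have g: "klin g" by (intro klinI) (auto simp: g_def vscale_def fun_eq_iff algebra_simps)
  have gd: "g (vec_dsum ?n u v) = u + v" if "u \<in> kspace ?n" "v \<in> kspace ?n" for u v
    using that by (auto simp: g_def vec_dsum_def kspace_def fun_eq_iff)
  have fS: "f u = vec_dsum ?n u 0" if "u \<in> ?S" for u using p(3)[OF that] by (simp add: f_def)
  have "glider_iso G X (glider_dsum ?X Z)"
  proof (rule glider_isoI[OF X _ f g])
    show "is_glider G (glider_dsum ?X Z)"
      using GX Z by (intro is_glider_dsum) (simp_all add: length_zero_def)
    show "f ` gtop X \<subseteq> gtop (glider_dsum ?X Z)"
    proof
      fix y assume "y \<in> f ` gtop X"
      then obtain u where u: "u \<in> gtop X" "y = f u" by blast
      have "p (u - p u) = 0" using kk.linear_diff[OF p(1)] p(2,3) by simp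
      moreover have "u - p u \<in> gtop X" using u X' p(2) kv.subspace_diff by blast
      ultimately show "y \<in> gtop (glider_dsum ?X Z)"
        using p(2) by (auto simp: glider_dsum_def Z_def u f_def)
    qed
    show "f ` gsub X \<subseteq> gsub (glider_dsum ?X Z)"
      using fS SS by (auto simp: glider_dsum_def Z_def)
    show "g ` gtop (glider_dsum ?X Z) \<subseteq> gtop X"
    proof
      fix y assume "y \<in> g ` gtop (glider_dsum ?X Z)"
      then obtain u v where y: "y = g (vec_dsum ?n u v)" "u \<in> ?S" "v \<in> gtop X"
        by (auto simp: glider_dsum_def Z_def)
      then have "y = u + v" using gd X' by blast
      then show "y \<in> gtop X" using y X' kv.subspace_add by blast
    qed
    show "g ` gsub (glider_dsum ?X Z) \<subseteq> gsub X"
    proof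
      fix y assume "y \<in> g ` gsub (glider_dsum ?X Z)"
      then obtain u where y: "y = g (vec_dsum ?n u 0)" "u \<in> gsub X"
        by (auto simp: glider_dsum_def Z_def)
      then have "y = u + 0" using gd X' kspace_zero by blast
      then show "y \<in> gsub X" using y by simp
    qed
    show "g (f u) = u" if u: "u \<in> gtop X" for u
    proof -
      have "p u \<in> kspace ?n" "u - p u \<in> kspace ?n"
        using u X' p(2) kv.subspace_diff[OF subspace_kspace] by blast+
      then show ?thesis using gd by (simp add: f_def)
    qed
    show "f (g w) = w" if w: "w \<in> gtop (glider_dsum ?X Z)" for w
    proof -
      obtain u v where uv: "w = vec_dsum ?n u v" "u \<in> ?S" "v \<in> gtop X" "p v = 0"
        using w by (auto simp: glider_dsum_def Z_def)
      then have gw: "g w = u + v" using gd X' by blast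
      have "p (u + v) = u" using uv p kk.linear_add[OF p(1)] by simp
      then have "f (u + v) = w" unfolding f_def uv(1) by simp
      then show ?thesis unfolding gw .
    qed
    show "f (act (gamb X) a m) = act (gamb (glider_dsum ?X Z)) a (f m)"
      if am: "a \<in> carrier G" "m \<in> gsub X" for a m
    proof -
      have "act (gamb X) a m \<in> ?S" "m \<in> ?S" using act_in_span[OF am] am(2) SS by blast+
      then show ?thesis using act_dsum[of "gamb X" "gamb X" a m 0]
        by (simp add: fS glider_dsum_def Z_def kk.linear_0[OF klin_act])
    qed
  qed
  then show ?thesis using Z by blast
qed

lemma is_glider_cyc: "is_rep G V \<Longrightarrow> v \<in> kspace (rdim V) \<Longrightarrow> is_glider G (cyc V v)"
proof -
  assume V: "is_rep G V" and v: "v \<in> kspace (rdim V)"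
  have "kv.span {v} \<subseteq> kspace (rdim V)" using v by (intro kv.span_minimal) auto
  then have "is_glider G \<lparr>gamb = V, gsub = kv.span {v}, gtop = kspace (rdim V)\<rparr>"
    using V act_kspace by (auto simp: is_glider_iff)
  from is_glider_top[OF this] show ?thesis by (simp add: cyc_def)
qed

lemma irreducible_glider_iff:
  "irreducible_glider G X \<longleftrightarrow> (\<exists>V v. is_rep G V \<and> v \<in> kspace (rdim V) \<and> v \<noteq> 0 \<and> X = cyc V v)"
proof
  assume X: "irreducible_glider G X"
  then have g: "is_glider G X" "kv.dim (gsub X) = 1" "gtop X = kG_span G (gamb X) (gsub X)"
    by (auto simp: irreducible_glider_def)
  have k: "gsub X \<subseteq> kspace (rdim (gamb X))" "kv.subspace (gsub X)" using g by (auto simp: is_glider_iff)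
  obtain B where B: "finite B" "B \<subseteq> gsub X" "kv.independent B" "kv.span B = kv.span (gsub X)" "card B = kv.dim (gsub X)"
    using kspace_finite_basis[OF k(1)] .
  then obtain v where v: "B = {v}" using g(2) card_1_singletonE by metis
  have "v \<noteq> 0" using B(3) v by auto
  moreover have "gsub X = kv.span {v}" using B(4) v k(2) kv.span_eq_iff by metis
  ultimately show "\<exists>V v. is_rep G V \<and> v \<in> kspace (rdim V) \<and> v \<noteq> 0 \<and> X = cyc V v"
    using g k B(2) v by (intro exI[of _ "gamb X"] exI[of _ v]) (auto simp: cyc_def is_glider_iff)
next
  assume "\<exists>V v. is_rep G V \<and> v \<in> kspace (rdim V) \<and> v \<noteq> 0 \<and> X = cyc V v"
  then obtain V v where v: "is_rep G V" "v \<in> kspace (rdim V)" "v \<noteq> 0" "X = cyc V v" by blast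
  have "kv.dim (kv.span {v}) = 1"
    using kv.dim_eq_card_independent[of "{v}"] v(3) by (simp add: kv.dim_span)
  then show "irreducible_glider G X"
    using is_glider_cyc[OF v(1,2)] by (simp add: irreducible_glider_def v(4)) (simp add: cyc_def)
qed

text \<open>\<open>xv \<mapsto> xv'\<close> is well defined if \<open>v\<close> and \<open>v'\<close> have the same annihilator.\<close>

lemma cyc_iso:
  fixes V V' :: "('a, 'k::field) rep"
  assumes V: "is_rep G V" "v \<in> kspace (rdim V)" and V': "is_rep G V'" "v' \<in> kspace (rdim V')"
    and eq: "ann V v = ann V' v'"
  shows "glider_iso G (cyc V v) (cyc V' v')"
proof -
  have lin: "kG_act G W (x + y) w = kG_act G W x w + kG_act G W y w"
    "kG_act G W (\<lambda>g. c * x g) w = vscale c (kG_act G W x w)" for W :: "('a, 'k) rep" and x y w c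
    by (rule ext; simp add: kG_act_apply vscale_apply sum.distrib algebra_simps sum_distrib_left)+
  \<comment> \<open>The vectors \<open>x w\<close> already form a subspace, so every element of the
    top space is of this form and no span remains.\<close>
  have top: "kG_span G W (kv.span {w}) = {kG_act G W x w |x. True}" if "is_rep G W" for W :: "('a, 'k) rep" and w
  proof
    have "kv.subspace {kG_act G W x w |x. True}"
      unfolding kv.subspace_def
    proof (intro conjI ballI allI)
      have "kG_act G W 0 w = 0" by (rule ext) (simp add: kG_act_apply)
      then show "0 \<in> {kG_act G W x w |x. True}" by (metis (mono_tags, lifting) mem_Collect_eq)
    next
      fix a b assume "a \<in> {kG_act G W x w |x. True}" "b \<in> {kG_act G W x w |x. True}"
      then obtain x y where "a = kG_act G W x w" "b = kG_act G W y w" by blast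
      then have "a + b = kG_act G W (x + y) w" by (simp only: lin)
      then show "a + b \<in> {kG_act G W x w |x. True}" by blast
    next
      fix c a assume "a \<in> {kG_act G W x w |x. True}"
      then obtain x where "a = kG_act G W x w" by blast
      then have "vscale c a = kG_act G W (\<lambda>g. c * x g) w" by (simp only: lin)
      then show "vscale c a \<in> {kG_act G W x w |x. True}" by blast
    qed
    moreover have "act W a u \<in> {kG_act G W x w |x. True}"
      if a: "a \<in> carrier G" and u: "u \<in> kv.span {w}" for a u
    proof -
      obtain c where c: "u = vscale c w" using u unfolding kv.span_singleton by blast
      have "act W a u = vscale c (kG_act G W (delta a) w)"
        unfolding kG_act_delta[OF a] c by (simp add: kk.linear_scale[OF klin_act])
      then have "act W a u = kG_act G W (\<lambda>g. c * delta a g) w" by (simp only: lin)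
      then show ?thesis by blast
    qed
    ultimately show "kG_span G W (kv.span {w}) \<subseteq> {kG_act G W x w |x. True}"
      by (intro kG_span_least) auto
    show "{kG_act G W x w |x. True} \<subseteq> kG_span G W (kv.span {w})"
      using kG_act_in_span kv.span_base[of w "{w}"] by auto
  qed
  define f where "f u = kG_act G V' (SOME x. kG_act G V x v = u) v'" for u
  define g where "g u = kG_act G V (SOME x. kG_act G V' x v' = u) v" for u
  have diff: "kG_act G W (x - y) w = kG_act G W x w - kG_act G W y w" for W :: "('a, 'k) rep" and x y w
    by (rule ext) (simp add: kG_act_apply sum_subtractf algebra_simps)
  have wd: "kG_act G V x v = kG_act G V y v \<longleftrightarrow> kG_act G V' x v' = kG_act G V' y v'" for x y
  proof -
    have "x - y \<in> ann V v \<longleftrightarrow> x - y \<in> ann V' v'" using eq by simp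
    then show ?thesis by (simp add: ann_def diff)
  qed
  have fx: "f (kG_act G V x v) = kG_act G V' x v'" for x
    unfolding f_def using wd someI[of "\<lambda>y. kG_act G V y v = kG_act G V x v" x] by blast
  have gx: "g (kG_act G V' x v') = kG_act G V x v" for x
    unfolding g_def using wd someI[of "\<lambda>y. kG_act G V' y v' = kG_act G V' x v'" x] by blast
  have one: "kG_act G W (delta \<one>) w = w" if "is_rep G W" "w \<in> kspace (rdim W)" for W :: "('a, 'k) rep" and w
    using act_one[OF that] kG_act_delta[OF one_closed] by metis
  have sp: "u \<in> kv.span {w} \<longleftrightarrow> (\<exists>c. u = vscale c w)" for u w :: "nat \<Rightarrow> 'k"
    unfolding kv.span_singleton by blast
  have mor: "glider_mor G (cyc W w) (cyc W' w') h"
    if W: "is_rep G W" "w \<in> kspace (rdim W)" and W': "is_rep G W'" "w' \<in> kspace (rdim W')"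
      and h: "\<And>x. h (kG_act G W x w) = kG_act G W' x w'" for W W' :: "('a, 'k) rep" and w w' h
    unfolding glider_mor_def cyc_def glider.simps top[OF W(1)] top[OF W'(1)] klinear_on_def
  proof (intro conjI ballI allI)
    show "h (a + b) = h a + h b"
      if ab: "a \<in> {kG_act G W x w |x. True}" "b \<in> {kG_act G W x w |x. True}" for a b
    proof -
      obtain x y where "a = kG_act G W x w" "b = kG_act G W y w" using ab by blast
      then show ?thesis using h[of "x + y"] by (simp only: lin h)
    qed
    show "h (vscale c a) = vscale c (h a)" if a: "a \<in> {kG_act G W x w |x. True}" for c a
    proof -
      obtain x where "a = kG_act G W x w" using a by blast
      then show ?thesis using h[of "\<lambda>g. c * x g"] by (simp only: lin h)
    qed
    show "h ` {kG_act G W x w |x. True} \<subseteq> {kG_act G W' x w' |x. True}" using h by auto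
    have hw: "h (vscale c w) = vscale c w'" for c
      using h[of "\<lambda>g. c * delta \<one> g"] by (simp add: lin one[OF W] one[OF W'])
    show "h ` kv.span {w} \<subseteq> kv.span {w'}" using hw by (auto simp: sp)
    show "h (kG_act G W x m) = kG_act G W' x (h m)" if m: "m \<in> kv.span {w}" for x m
    proof -
      obtain c where c: "m = vscale c w" using m sp by blast
      show ?thesis
        using h[of "\<lambda>g. c * x g"] unfolding c hw by (simp only: lin kk.linear_scale[OF klin_kG_act])
    qed
  qed
  show ?thesis
    unfolding glider_iso_def
  proof (intro exI conjI ballI)
    show "glider_mor G (cyc V v) (cyc V' v') f" by (rule mor[OF V V' fx])
    show "glider_mor G (cyc V' v') (cyc V v) g" by (rule mor[OF V' V gx])
    show "g (f m) = m" if "m \<in> gtop (cyc V v)" for m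
      using that by (auto simp: cyc_def top[OF V(1)] fx gx)
    show "f (g m) = m" if "m \<in> gtop (cyc V' v')" for m
      using that by (auto simp: cyc_def top[OF V'(1)] fx gx)
  qed
qed

end

section \<open>Additive spans, quotients and rings presented by generators\<close>

context abelian_group
begin

lemma add_span_incl: "S \<subseteq> carrier G \<Longrightarrow> add_span G S \<subseteq> carrier G"
  using add.generate_incl by simp

lemma add_span_subgroup: "S \<subseteq> carrier G \<Longrightarrow> subgroup (add_span G S) (add_monoid G)"
  using add.generate_is_subgroup by simp

lemma add_span_zero: "\<zero> \<in> add_span G S"
  using generate.one[of "add_monoid G" S] by simp

lemma add_span_add: "x \<in> add_span G S \<Longrightarrow> y \<in> add_span G S \<Longrightarrow> x \<oplus> y \<in> add_span G S"
  using generate.eng[of x "add_monoid G" S y] by simp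

lemma add_span_minus: "S \<subseteq> carrier G \<Longrightarrow> x \<in> add_span G S \<Longrightarrow> \<ominus> x \<in> add_span G S"
  using add.generate_m_inv_closed[of S x] by (simp add: a_inv_def)

lemma add_span_induct [consumes 1, case_names zero base minus add]:
  assumes "x \<in> add_span G S" "P \<zero>" "\<And>s. s \<in> S \<Longrightarrow> P s" "\<And>s. s \<in> S \<Longrightarrow> P (\<ominus> s)"
    and "\<And>x y. x \<in> add_span G S \<Longrightarrow> y \<in> add_span G S \<Longrightarrow> P x \<Longrightarrow> P y \<Longrightarrow> P (x \<oplus> y)"
  shows "P x"
  using assms(1)
proof (induction rule: generate.induct)
  case (inv h)
  then show ?case using assms(4)[of h] by (simp add: a_inv_def)
qed (use assms in auto)

lemma add_span_least:
  assumes "S \<subseteq> T" "\<zero> \<in> T" "\<And>x. x \<in> T \<Longrightarrow> \<ominus> x \<in> T" "\<And>x y. x \<in> T \<Longrightarrow> y \<in> T \<Longrightarrow> x \<oplus> y \<in> T"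
  shows "add_span G S \<subseteq> T"
proof
  fix x assume "x \<in> add_span G S"
  then show "x \<in> T" by (induction rule: add_span_induct) (use assms in auto)
qed

lemma additive_zero:
  fixes f :: "'a \<Rightarrow> 'c::ab_group_add"
  assumes "\<And>x y. x \<in> carrier G \<Longrightarrow> y \<in> carrier G \<Longrightarrow> f (x \<oplus> y) = f x + f y"
  shows "f \<zero> = 0"
  using assms[of \<zero> \<zero>] by simp

lemma additive_minus:
  fixes f :: "'a \<Rightarrow> 'c::ab_group_add"
  assumes f: "\<And>x y. x \<in> carrier G \<Longrightarrow> y \<in> carrier G \<Longrightarrow> f (x \<oplus> y) = f x + f y" and x: "x \<in> carrier G"
  shows "f (\<ominus> x) = - f x"
  using f[of "\<ominus> x" x] additive_zero[OF f] x by (simp add: l_neg eq_neg_iff_add_eq_0)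

lemma additive_vanish:
  fixes f :: "'a \<Rightarrow> 'c::ab_group_add"
  assumes f: "\<And>x y. x \<in> carrier G \<Longrightarrow> y \<in> carrier G \<Longrightarrow> f (x \<oplus> y) = f x + f y"
    and S: "S \<subseteq> carrier G" "\<And>s. s \<in> S \<Longrightarrow> f s = 0" and x: "x \<in> add_span G S"
  shows "f x = 0"
  using x
proof (induction rule: add_span_induct)
  case (minus s)
  then have "f (\<ominus> s) = - f s" using additive_minus[OF f] S(1) by blast
  then show ?case using S(2) minus by simp
next
  case (add x y)
  then have "f (x \<oplus> y) = f x + f y" using f add_span_incl[OF S(1)] by blast
  then show ?case using add by simp
qed (use additive_zero[OF f] S in auto)

end

text \<open>By distributivity, closure under multiplication is inherited from products of additive
  generators. The three ideals of the construction are all treated this way.\<close>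

lemma (in cring) add_span_ideal:
  assumes S: "S \<subseteq> carrier R" and B: "B \<subseteq> carrier R" "carrier R \<subseteq> add_span R B"
    and mult: "\<And>b s. b \<in> B \<Longrightarrow> s \<in> S \<Longrightarrow> b \<otimes> s \<in> add_span R S"
  shows "ideal (add_span R S) R"
proof (rule idealI)
  show "ring R" by (rule ring_axioms)
  show sub: "subgroup (add_span R S) (add_monoid R)" by (rule add_span_subgroup[OF S])
  have 1: "x \<otimes> s \<in> add_span R S" if "x \<in> carrier R" and s: "s \<in> S" for x s
    using subsetD[OF B(2) that(1)]
  proof (induction rule: add_span_induct)
    case zero
    then show ?case using s S add_span_zero by auto
  next
    case (minus b)
    then have "(\<ominus> b) \<otimes> s = \<ominus> (b \<otimes> s)" using s S B l_minus by blast
    then show ?case using add_span_minus[OF S] mult[OF minus s] by simp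
  next
    case (add x y)
    then have "(x \<oplus> y) \<otimes> s = x \<otimes> s \<oplus> y \<otimes> s" using s S add_span_incl[OF B(1)] l_distr by blast
    then show ?case using add add_span_add by simp
  qed (use mult s in auto)
  have 2: "x \<otimes> a \<in> add_span R S" if "a \<in> add_span R S" and x: "x \<in> carrier R" for x a
    using that(1)
  proof (induction rule: add_span_induct)
    case zero
    then show ?case using x add_span_zero by auto
  next
    case (base s)
    then show ?case using 1 x by auto
  next
    case (minus s)
    then have "x \<otimes> (\<ominus> s) = \<ominus> (x \<otimes> s)" using x S r_minus by blast
    then show ?case using add_span_minus[OF S] 1[OF x minus] by simp
  next
    case (add a b)
    then have "x \<otimes> (a \<oplus> b) = x \<otimes> a \<oplus> x \<otimes> b" using x add_span_incl[OF S] r_distr by blast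
    then show ?case using add add_span_add by simp
  qed
  fix a x assume a: "a \<in> add_span R S" and x: "x \<in> carrier R"
  show "x \<otimes> a \<in> add_span R S" by (rule 2[OF a x])
  then show "a \<otimes> x \<in> add_span R S" using m_comm[OF x, of a] subsetD[OF add_span_incl[OF S] a] by simp
qed

section \<open>Quotient rings and functionals on them\<close>

definition lift_fun :: "('a \<Rightarrow> 'c) \<Rightarrow> 'a set \<Rightarrow> 'c"
  where "lift_fun f C = f (SOME x. x \<in> C)"

context ideal
begin

lemma quot_carrier: "carrier (R Quot I) = (\<lambda>x. I +> x) ` carrier R"
  by (auto simp: FactRing_simps)

lemma quot_closed: "x \<in> carrier R \<Longrightarrow> I +> x \<in> carrier (R Quot I)"
  by (simp add: quot_carrier)

lemma quot_mult: "x \<in> carrier R \<Longrightarrow> y \<in> carrier R \<Longrightarrow> (I +> x) \<otimes>\<^bsub>R Quot I\<^esub> (I +> y) = I +> (x \<otimes> y)"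
  using ring_hom_mult[OF rcos_ring_hom] by simp

lemma quot_add: "x \<in> carrier R \<Longrightarrow> y \<in> carrier R \<Longrightarrow> (I +> x) \<oplus>\<^bsub>R Quot I\<^esub> (I +> y) = I +> (x \<oplus> y)"
  using ring_hom_add[OF rcos_ring_hom] by simp

lemma quot_one: "\<one>\<^bsub>R Quot I\<^esub> = I +> \<one>"
  using ring_hom_one[OF rcos_ring_hom] by simp

lemma quot_zero: "\<zero>\<^bsub>R Quot I\<^esub> = I"
  by (simp add: FactRing_def)

lemma coset_eq_ideal_iff: "x \<in> carrier R \<Longrightarrow> I +> x = I \<longleftrightarrow> x \<in> I"
  using a_rcos_const rcos_const_imp_mem by blast

lemma quot_minus: "x \<in> carrier R \<Longrightarrow> \<ominus>\<^bsub>R Quot I\<^esub> (I +> x) = I +> (\<ominus> x)"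
proof -
  assume x: "x \<in> carrier R"
  interpret Q: ring "R Quot I" by (rule quotient_is_ring)
  have "(I +> (\<ominus> x)) \<oplus>\<^bsub>R Quot I\<^esub> (I +> x) = \<zero>\<^bsub>R Quot I\<^esub>"
    using x coset_eq_ideal_iff[of \<zero>] by (simp add: quot_add l_neg quot_zero)
  then show ?thesis using x by (intro Q.minus_equality) (simp_all add: quot_closed)
qed

lemma coset_eq_iff: "x \<in> carrier R \<Longrightarrow> y \<in> carrier R \<Longrightarrow> I +> x = I +> y \<longleftrightarrow> x \<ominus> y \<in> I"
  by (meson a_rcos_module quotient_eq_iff_same_a_r_cos is_ideal)

lemma quot_span:
  assumes B: "B \<subseteq> carrier R" "carrier R \<subseteq> add_span R B"
  shows "carrier (R Quot I) \<subseteq> add_span (R Quot I) ((\<lambda>x. I +> x) ` B)"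
proof -
  interpret Q: ring "R Quot I" by (rule quotient_is_ring)
  have sub: "(\<lambda>x. I +> x) ` B \<subseteq> carrier (R Quot I)" using B(1) quot_closed by blast
  have "I +> x \<in> add_span (R Quot I) ((\<lambda>x. I +> x) ` B)" if "x \<in> add_span R B" for x
    using that
  proof (induction rule: add_span_induct)
    case zero
    have "I +> \<zero> = \<zero>\<^bsub>R Quot I\<^esub>" using coset_eq_ideal_iff[of \<zero>] by (simp add: quot_zero)
    then show ?case using Q.add_span_zero by simp
  next
    case (base s)
    then show ?case by (intro generate.incl) auto
  next
    case (minus s)
    then have "I +> s \<in> add_span (R Quot I) ((\<lambda>x. I +> x) ` B)" by (intro generate.incl) auto
    moreover have "\<ominus>\<^bsub>R Quot I\<^esub> (I +> s) = I +> (\<ominus> s)" using quot_minus B(1) minus by blast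
    ultimately show ?case using Q.add_span_minus[OF sub] by metis
  next
    case (add x y)
    then have "x \<in> carrier R" "y \<in> carrier R" using add_span_incl[OF B(1)] by auto
    then show ?case using Q.add_span_add[OF add(3,4)] by (simp add: quot_add)
  qed
  then show ?thesis using B(2) by (auto simp: quot_carrier)
qed

text \<open>Since \<open>f\<close> vanishes on the ideal it is constant on cosets, so the chosen
  representative does not matter. Functionals cross all three quotients in this way.\<close>

lemma lift_fun:
  fixes f :: "'a \<Rightarrow> 'c::ab_group_add"
  assumes f: "\<And>x y. x \<in> carrier R \<Longrightarrow> y \<in> carrier R \<Longrightarrow> f (x \<oplus> y) = f x + f y"
    and I: "\<And>x. x \<in> I \<Longrightarrow> f x = 0" and x: "x \<in> carrier R"
  shows "lift_fun f (I +> x) = f x"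
proof -
  have "x \<in> I +> x" using x by (rule a_rcos_self)
  then have "(SOME y. y \<in> I +> x) \<in> I +> x" by (rule someI)
  then obtain i where i: "i \<in> I" "(SOME y. y \<in> I +> x) = i \<oplus> x" by (auto simp: a_r_coset_def r_coset_def)
  then show ?thesis using f[of i x] I x Icarr by (simp add: lift_fun_def)
qed

lemma lift_fun_add:
  fixes f :: "'a \<Rightarrow> 'c::ab_group_add"
  assumes f: "\<And>x y. x \<in> carrier R \<Longrightarrow> y \<in> carrier R \<Longrightarrow> f (x \<oplus> y) = f x + f y"
    and I: "\<And>x. x \<in> I \<Longrightarrow> f x = 0" and C: "C \<in> carrier (R Quot I)" and D: "D \<in> carrier (R Quot I)"
  shows "lift_fun f (C \<oplus>\<^bsub>R Quot I\<^esub> D) = lift_fun f C + lift_fun f D"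
proof -
  obtain x y where "x \<in> carrier R" "C = I +> x" "y \<in> carrier R" "D = I +> y"
    using C D by (auto simp: quot_carrier)
  then show ?thesis using f by (simp add: quot_add lift_fun[OF f I])
qed

end

section \<open>Integral monoid rings\<close>

definition fsum :: "('b \<Rightarrow> 'r::comm_ring_1) \<Rightarrow> ('b \<Rightarrow>\<^sub>0 int) \<Rightarrow> 'r"
  where "fsum h x = (\<Sum>i\<in>Poly_Mapping.keys x. of_int (Poly_Mapping.lookup x i) * h i)"

lemma fsum_superset:
  assumes "finite K" "Poly_Mapping.keys x \<subseteq> K"
  shows "fsum h x = (\<Sum>i\<in>K. of_int (Poly_Mapping.lookup x i) * h i)"
  unfolding fsum_def using assms by (intro sum.mono_neutral_left) (auto simp: in_keys_iff)

lemma fsum_add: "fsum h (x + y) = fsum h x + fsum h y"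
proof -
  let ?K = "Poly_Mapping.keys x \<union> Poly_Mapping.keys y"
  have "fsum h (x + y) = (\<Sum>i\<in>?K. of_int (Poly_Mapping.lookup (x + y) i) * h i)"
    using Poly_Mapping.keys_add[of x y] by (intro fsum_superset) auto
  also have "\<dots> = (\<Sum>i\<in>?K. of_int (Poly_Mapping.lookup x i) * h i) + (\<Sum>i\<in>?K. of_int (Poly_Mapping.lookup y i) * h i)"
    by (simp add: lookup_add algebra_simps sum.distrib)
  finally show ?thesis by (simp add: fsum_superset[of ?K])
qed

lemma fsum_of: "fsum h (frag_of a) = h a"
  by (simp add: fsum_def)

lemma fsum_diff: "fsum h (x - y) = fsum h x - fsum h y"
  using fsum_add[of h "x - y" y] by simp

definition fmul :: "('b \<Rightarrow> 'b \<Rightarrow> 'b) \<Rightarrow> ('b \<Rightarrow>\<^sub>0 int) \<Rightarrow> ('b \<Rightarrow>\<^sub>0 int) \<Rightarrow> 'b \<Rightarrow>\<^sub>0 int"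
  where "fmul m x y = frag_extend (\<lambda>a. frag_extend (\<lambda>b. frag_of (m a b)) y) x"

lemma frag_extend_fun_diff: "frag_extend (\<lambda>a. f a - g a) x = frag_extend f x - frag_extend g x"
  by (rule frag_induction[of x UNIV]) (auto simp: frag_extend_diff)

lemma fmul_diff_l: "fmul m (x - x') y = fmul m x y - fmul m x' y"
  by (simp add: fmul_def frag_extend_diff)

lemma fmul_diff_r: "fmul m x (y - y') = fmul m x y - fmul m x y'"
  by (simp add: fmul_def frag_extend_diff frag_extend_fun_diff)

lemma fmul_zero [simp]: "fmul m 0 y = 0" "fmul m x 0 = 0"
  using fmul_diff_l[of m 0 0 y] fmul_diff_r[of m x 0 0] by simp_all

lemma fmul_add_l: "fmul m (x + x') y = fmul m x y + fmul m x' y"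
  using fmul_diff_l[of m x "- x'" y] fmul_diff_l[of m 0 x' y] by simp

lemma fmul_of: "fmul m (frag_of a) (frag_of b) = frag_of (m a b)"
  by (simp add: fmul_def)

text \<open>The laws are required on \<open>B\<close> only, because the product of classes is
  controlled just for classes of gliders.\<close>

locale free_ring_data =
  fixes B :: "'b set" and m :: "'b \<Rightarrow> 'b \<Rightarrow> 'b" and e :: 'b
  assumes closed: "a \<in> B \<Longrightarrow> b \<in> B \<Longrightarrow> m a b \<in> B"
    and assoc: "a \<in> B \<Longrightarrow> b \<in> B \<Longrightarrow> c \<in> B \<Longrightarrow> m (m a b) c = m a (m b c)"
    and comm: "a \<in> B \<Longrightarrow> b \<in> B \<Longrightarrow> m a b = m b a"
    and unit: "e \<in> B" "a \<in> B \<Longrightarrow> m e a = a"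
begin

lemma free_simps [simp]:
  "x \<in> carrier (free_ring B m e) \<longleftrightarrow> Poly_Mapping.keys x \<subseteq> B"
  "x \<otimes>\<^bsub>free_ring B m e\<^esub> y = fmul m x y" "\<one>\<^bsub>free_ring B m e\<^esub> = frag_of e"
  "\<zero>\<^bsub>free_ring B m e\<^esub> = 0" "x \<oplus>\<^bsub>free_ring B m e\<^esub> y = x + y"
  by (simp_all add: free_ring_def fmul_def)

lemma fmul_closed: "Poly_Mapping.keys x \<subseteq> B \<Longrightarrow> Poly_Mapping.keys y \<subseteq> B \<Longrightarrow> Poly_Mapping.keys (fmul m x y) \<subseteq> B"
proof -
  assume x: "Poly_Mapping.keys x \<subseteq> B" and y: "Poly_Mapping.keys y \<subseteq> B"
  have "Poly_Mapping.keys (frag_extend (\<lambda>b. frag_of (m a b)) y) \<subseteq> B" if "a \<in> B" for a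
    using keys_frag_extend[of "\<lambda>b. frag_of (m a b)" y] y closed[OF that] by (auto simp: keys_frag_of)
  then show ?thesis
    unfolding fmul_def using keys_frag_extend[of "\<lambda>a. frag_extend (\<lambda>b. frag_of (m a b)) y" x] x by blast
qed

lemma fmul_comm: "Poly_Mapping.keys x \<subseteq> B \<Longrightarrow> Poly_Mapping.keys y \<subseteq> B \<Longrightarrow> fmul m x y = fmul m y x"
proof (induction x rule: frag_induction)
  case (one a)
  from one(2) show ?case
    by (induction y rule: frag_induction) (use one(1) comm in \<open>auto simp: fmul_of fmul_diff_r fmul_diff_l\<close>)
qed (auto simp: fmul_diff_l fmul_diff_r)

lemma fmul_one: "Poly_Mapping.keys x \<subseteq> B \<Longrightarrow> fmul m (frag_of e) x = x"
  by (induction x rule: frag_induction) (auto simp: fmul_of fmul_diff_r unit)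

lemma fmul_assoc:
  "Poly_Mapping.keys x \<subseteq> B \<Longrightarrow> Poly_Mapping.keys y \<subseteq> B \<Longrightarrow> Poly_Mapping.keys z \<subseteq> B \<Longrightarrow>
    fmul m (fmul m x y) z = fmul m x (fmul m y z)"
proof (induction x rule: frag_induction)
  case (one a)
  note a = one
  from a(2) show ?case
  proof (induction y rule: frag_induction)
    case (one b)
    note b = one
    from a(3) show ?case
      by (induction z rule: frag_induction) (use a b assoc in \<open>auto simp: fmul_of fmul_diff_r fmul_diff_l\<close>)
  qed (auto simp: fmul_diff_r fmul_diff_l)
qed (auto simp: fmul_diff_l fmul_diff_r)

lemma free_ring_cring: "cring (free_ring B m e)"
proof (rule cringI)
  show "abelian_group (free_ring B m e)"
  proof (rule abelian_groupI)
    fix x assume "x \<in> carrier (free_ring B m e)"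
    then show "\<exists>y\<in>carrier (free_ring B m e). y \<oplus>\<^bsub>free_ring B m e\<^esub> x = \<zero>\<^bsub>free_ring B m e\<^esub>"
      by (intro bexI[of _ "- x"]) auto
  next
    fix x y assume "x \<in> carrier (free_ring B m e)" "y \<in> carrier (free_ring B m e)"
    then show "x \<oplus>\<^bsub>free_ring B m e\<^esub> y \<in> carrier (free_ring B m e)"
      using Poly_Mapping.keys_add[of x y] by auto
  qed (auto simp: algebra_simps)
  show "Group.comm_monoid (free_ring B m e)"
    by (rule comm_monoidI) (use unit fmul_closed fmul_assoc fmul_comm fmul_one in \<open>auto simp: keys_frag_of\<close>)
qed (auto simp: fmul_add_l)

sublocale FR: cring "free_ring B m e" by (rule free_ring_cring)

lemma free_minus: "Poly_Mapping.keys x \<subseteq> B \<Longrightarrow> \<ominus>\<^bsub>free_ring B m e\<^esub> x = - x"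
  by (rule FR.minus_equality) auto

lemma free_span: "carrier (free_ring B m e) \<subseteq> add_span (free_ring B m e) (frag_of ` B)"
proof
  have S: "frag_of ` B \<subseteq> carrier (free_ring B m e)" by (auto simp: keys_frag_of)
  fix x assume "x \<in> carrier (free_ring B m e)"
  then have "Poly_Mapping.keys x \<subseteq> B" by simp
  then show "x \<in> add_span (free_ring B m e) (frag_of ` B)"
  proof (induction x rule: frag_induction)
    case zero
    then show ?case by (metis FR.add_span_zero free_simps(4))
  next
    case (one x)
    then show ?case by (intro generate.incl) auto
  next
    case (diff a b)
    then have "b \<in> carrier (free_ring B m e)" using FR.add_span_incl[OF S] by blast
    then have "\<ominus>\<^bsub>free_ring B m e\<^esub> b = - b" using free_minus by simp
    then have "a \<ominus>\<^bsub>free_ring B m e\<^esub> b = a - b" by (simp add: a_minus_def)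
    then show ?case
      using FR.add_span_add[OF diff(1) FR.add_span_minus[OF S diff(2)]] unfolding a_minus_def by metis
  qed
qed

lemma free_diff_closed:
  "Poly_Mapping.keys x \<subseteq> B \<Longrightarrow> Poly_Mapping.keys y \<subseteq> B \<Longrightarrow> Poly_Mapping.keys (x - y) \<subseteq> B"
  using Poly_Mapping.keys_diff[of x y] by blast

end

section \<open>Extension of scalars to the rationals\<close>

context cring
begin

lemma tensor_data: "free_ring_data (UNIV \<times> carrier R) (\<lambda>(q, a) (p, b). (q * p, a \<otimes> b)) (1 :: rat, \<one>)"
  by unfold_locales (auto simp: m_assoc intro: m_comm)

abbreviation "TF \<equiv> tensor_free R"
abbreviation "QR \<equiv> rat_tensor R"

lemma tensor_free_simps:
  "x \<in> carrier TF \<longleftrightarrow> Poly_Mapping.keys x \<subseteq> UNIV \<times> carrier R"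
  "x \<oplus>\<^bsub>TF\<^esub> y = x + y" "\<zero>\<^bsub>TF\<^esub> = 0"
  "frag_of (q, a) \<otimes>\<^bsub>TF\<^esub> frag_of (p, b) = frag_of (q * p, a \<otimes> b)" "\<one>\<^bsub>TF\<^esub> = frag_of (1, \<one>)"
  unfolding tensor_free_def by (simp_all add: free_ring_data.free_simps[OF tensor_data] fmul_of)

lemma tensor_free_cring: "cring TF"
  unfolding tensor_free_def by (rule free_ring_data.free_ring_cring[OF tensor_data])

lemma keys_diff3:
  assumes "x \<in> A" "y \<in> A" "z \<in> A"
  shows "Poly_Mapping.keys (frag_of x - frag_of y - frag_of z :: 'z \<Rightarrow>\<^sub>0 int) \<subseteq> A"
proof -
  have "Poly_Mapping.keys (frag_of x - frag_of y :: 'z \<Rightarrow>\<^sub>0 int) \<subseteq> {x, y}"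
    using Poly_Mapping.keys_diff[of "frag_of x" "frag_of y"] by (auto simp: keys_frag_of)
  then show ?thesis
    using Poly_Mapping.keys_diff[of "frag_of x - frag_of y" "frag_of z"] assms by (auto simp: keys_frag_of)
qed

abbreviation tgens :: "(rat \<times> 'a \<Rightarrow>\<^sub>0 int) set"
  where "tgens \<equiv> {frag_of (q + p, a) - frag_of (q, a) - frag_of (p, a) |q p a. a \<in> carrier R} \<union>
     {frag_of (q, a \<oplus> b) - frag_of (q, a) - frag_of (q, b) |q a b. a \<in> carrier R \<and> b \<in> carrier R}"

lemma tgens_carrier: "tgens \<subseteq> carrier TF"
proof
  fix s assume "s \<in> tgens"
  then obtain x y z where "s = frag_of x - frag_of y - frag_of z"
      "x \<in> UNIV \<times> carrier R" "y \<in> UNIV \<times> carrier R" "z \<in> UNIV \<times> carrier R"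
  proof
    assume "s \<in> {frag_of (q + p, a) - frag_of (q, a) - frag_of (p, a) |q p a. a \<in> carrier R}"
    then obtain q p a where "s = frag_of (q + p, a) - frag_of (q, a) - frag_of (p, a)" "a \<in> carrier R" by blast
    then show ?thesis using that[of "(q + p, a)" "(q, a)" "(p, a)"] by simp
  next
    assume "s \<in> {frag_of (q, a \<oplus> b) - frag_of (q, a) - frag_of (q, b) |q a b. a \<in> carrier R \<and> b \<in> carrier R}"
    then obtain q a a' where "s = frag_of (q, a \<oplus> a') - frag_of (q, a) - frag_of (q, a')"
      "a \<in> carrier R" "a' \<in> carrier R" by blast
    then show ?thesis using that[of "(q, a \<oplus> a')" "(q, a)" "(q, a')"] by simp
  qed
  then show "s \<in> carrier TF" using keys_diff3 by (simp add: tensor_free_simps)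
qed

text \<open>A generator times a biadditivity relation is again a biadditivity relation.\<close>

lemma tensor_rel_ideal: "ideal (tensor_rel R) TF"
  unfolding tensor_rel_def
proof (rule cring.add_span_ideal[OF tensor_free_cring tgens_carrier])
  interpret T: cring TF by (rule tensor_free_cring)
  show "frag_of ` (UNIV \<times> carrier R) \<subseteq> carrier TF" by (auto simp: tensor_free_simps keys_frag_of)
  show "carrier TF \<subseteq> add_span TF (frag_of ` (UNIV \<times> carrier R))"
    unfolding tensor_free_def by (rule free_ring_data.free_span[OF tensor_data])
  fix b s assume b: "b \<in> frag_of ` ((UNIV :: rat set) \<times> carrier R)" and s: "s \<in> tgens"
  obtain r :: rat and c where bc: "b = frag_of (r, c)" "c \<in> carrier R" using b by auto
  have mul: "frag_of (r :: rat, c) \<otimes>\<^bsub>TF\<^esub> (frag_of x - frag_of y - frag_of z) =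
    frag_of (r * fst x, c \<otimes> snd x) - frag_of (r * fst y, c \<otimes> snd y) - frag_of (r * fst z, c \<otimes> snd z)" for x y z
    unfolding tensor_free_def
    by (simp add: free_ring_data.free_simps[OF tensor_data] fmul_diff_r fmul_of split: prod.splits)
  from s show "b \<otimes>\<^bsub>TF\<^esub> s \<in> add_span TF tgens"
  proof
    assume "s \<in> {frag_of (q + p, a) - frag_of (q, a) - frag_of (p, a) |q p a. a \<in> carrier R}"
    then obtain q p a where s: "s = frag_of (q + p, a) - frag_of (q, a) - frag_of (p, a)" "a \<in> carrier R" by blast
    have "b \<otimes>\<^bsub>TF\<^esub> s = frag_of (r * q + r * p, c \<otimes> a) - frag_of (r * q, c \<otimes> a) - frag_of (r * p, c \<otimes> a)"
      "c \<otimes> a \<in> carrier R" using bc(2) s(2) unfolding s(1) bc(1) mul by (simp_all add: distrib_left)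
    then have "b \<otimes>\<^bsub>TF\<^esub> s \<in> tgens" by blast
    then show ?thesis by (rule generate.incl)
  next
    assume "s \<in> {frag_of (q, a \<oplus> b) - frag_of (q, a) - frag_of (q, b) |q a b. a \<in> carrier R \<and> b \<in> carrier R}"
    then obtain q a a' where s: "s = frag_of (q, a \<oplus> a') - frag_of (q, a) - frag_of (q, a')"
      "a \<in> carrier R" "a' \<in> carrier R" by blast
    have "b \<otimes>\<^bsub>TF\<^esub> s = frag_of (r * q, c \<otimes> a \<oplus> c \<otimes> a') - frag_of (r * q, c \<otimes> a) - frag_of (r * q, c \<otimes> a')"
      "c \<otimes> a \<in> carrier R" "c \<otimes> a' \<in> carrier R"
      using bc(2) s(2,3) unfolding s(1) bc(1) mul by (simp_all add: r_distr)
    then have "b \<otimes>\<^bsub>TF\<^esub> s \<in> tgens" by blast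
    then show ?thesis by (rule generate.incl)
  qed
qed

lemma rat_tensor_cring: "cring QR"
  unfolding rat_tensor_def by (rule ideal.quotient_is_cring[OF tensor_rel_ideal tensor_free_cring])

lemma frag_of_TF: "a \<in> carrier R \<Longrightarrow> frag_of (q, a) \<in> carrier TF"
  by (simp add: tensor_free_simps keys_frag_of)

lemma pure_closed: "a \<in> carrier R \<Longrightarrow> pure_tensor R q a \<in> carrier QR"
  unfolding pure_tensor_def rat_tensor_def by (rule ideal.quot_closed[OF tensor_rel_ideal frag_of_TF])

lemma pure_mult:
  "a \<in> carrier R \<Longrightarrow> b \<in> carrier R \<Longrightarrow>
    pure_tensor R q a \<otimes>\<^bsub>QR\<^esub> pure_tensor R p b = pure_tensor R (q * p) (a \<otimes> b)"
  unfolding pure_tensor_def rat_tensor_def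
  by (simp add: ideal.quot_mult[OF tensor_rel_ideal frag_of_TF frag_of_TF] tensor_free_simps)

lemma pure_one: "\<one>\<^bsub>QR\<^esub> = pure_tensor R 1 \<one>"
  unfolding pure_tensor_def rat_tensor_def
  by (simp add: ideal.quot_one[OF tensor_rel_ideal] tensor_free_simps)

lemma coset_frag_eq:
  assumes g: "x - y - z \<in> tgens" and x: "x \<in> carrier TF" "y \<in> carrier TF" "z \<in> carrier TF"
  shows "tensor_rel R +>\<^bsub>TF\<^esub> x = (tensor_rel R +>\<^bsub>TF\<^esub> y) \<oplus>\<^bsub>QR\<^esub> (tensor_rel R +>\<^bsub>TF\<^esub> z)"
proof -
  interpret T: cring TF by (rule tensor_free_cring)
  interpret I: ideal "tensor_rel R" TF by (rule tensor_rel_ideal)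
  have m: "\<ominus>\<^bsub>TF\<^esub> (y + z) = - (y + z)"
    unfolding tensor_free_def
    by (rule free_ring_data.free_minus[OF tensor_data])
      (use T.a_closed[OF x(2,3)] in \<open>simp add: tensor_free_simps\<close>)
  have "x \<ominus>\<^bsub>TF\<^esub> (y \<oplus>\<^bsub>TF\<^esub> z) = x - y - z"
    by (simp add: a_minus_def tensor_free_simps m)
  then have "x \<ominus>\<^bsub>TF\<^esub> (y \<oplus>\<^bsub>TF\<^esub> z) \<in> tgens" using g by simp
  then have "x \<ominus>\<^bsub>TF\<^esub> (y \<oplus>\<^bsub>TF\<^esub> z) \<in> tensor_rel R"
    unfolding tensor_rel_def by (rule generate.incl)
  then have "tensor_rel R +>\<^bsub>TF\<^esub> x = tensor_rel R +>\<^bsub>TF\<^esub> (y \<oplus>\<^bsub>TF\<^esub> z)"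
    using I.coset_eq_iff[OF x(1)] x by simp
  then show ?thesis using x by (simp add: rat_tensor_def I.quot_add)
qed

lemma pure_add_l: "a \<in> carrier R \<Longrightarrow>
    pure_tensor R (q + p) a = pure_tensor R q a \<oplus>\<^bsub>QR\<^esub> pure_tensor R p a"
  unfolding pure_tensor_def by (rule coset_frag_eq) (auto simp: frag_of_TF)

lemma pure_add_r: "a \<in> carrier R \<Longrightarrow> b \<in> carrier R \<Longrightarrow>
    pure_tensor R q (a \<oplus> b) = pure_tensor R q a \<oplus>\<^bsub>QR\<^esub> pure_tensor R q b"
  unfolding pure_tensor_def by (rule coset_frag_eq) (auto simp: frag_of_TF)

lemma pure_zero: "pure_tensor R q \<zero> = \<zero>\<^bsub>QR\<^esub>"
proof -
  interpret Q: cring QR by (rule rat_tensor_cring)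
  show ?thesis using pure_add_r[of \<zero> \<zero> q] pure_closed[of \<zero> q] by simp
qed

lemma pure_minus: "a \<in> carrier R \<Longrightarrow> pure_tensor R q (\<ominus> a) = \<ominus>\<^bsub>QR\<^esub> pure_tensor R q a"
proof -
  interpret Q: cring QR by (rule rat_tensor_cring)
  assume a: "a \<in> carrier R"
  then show ?thesis
    using pure_add_r[of "\<ominus> a" a q] pure_closed[of a q] pure_closed[of "\<ominus> a" q]
    by (intro Q.minus_equality[symmetric]) (simp_all add: l_neg pure_zero)
qed

lemma rat_tensor_span:
  assumes B: "B \<subseteq> carrier R" "carrier R \<subseteq> add_span R B"
  shows "carrier QR \<subseteq> add_span QR {pure_tensor R q b |q b. b \<in> B}"
proof -
  interpret Q: cring QR by (rule rat_tensor_cring)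
  let ?S = "{pure_tensor R q b |q b. b \<in> B}"
  have S: "?S \<subseteq> carrier QR" using B pure_closed by blast
  have F: "frag_of ` (UNIV \<times> carrier R) \<subseteq> carrier TF" using frag_of_TF by auto
  have "carrier TF \<subseteq> add_span TF (frag_of ` (UNIV \<times> carrier R))"
    unfolding tensor_free_def by (rule free_ring_data.free_span[OF tensor_data])
  from ideal.quot_span[OF tensor_rel_ideal F this]
  have 1: "carrier QR \<subseteq> add_span QR ((\<lambda>x. tensor_rel R +>\<^bsub>TF\<^esub> x) ` frag_of ` (UNIV \<times> carrier R))"
    by (simp add: rat_tensor_def)
  have "pure_tensor R q a \<in> add_span QR ?S" if "a \<in> add_span R B" for q a
    using that
  proof (induction rule: add_span_induct)
    case zero
    then show ?case using Q.add_span_zero by (simp add: pure_zero)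
  next
    case (base s)
    then show ?case by (intro generate.incl) auto
  next
    case (minus s)
    then have "pure_tensor R q s \<in> add_span QR ?S" by (intro generate.incl) auto
    moreover have "s \<in> carrier R" using minus B by auto
    ultimately show ?case using Q.add_span_minus[OF S] by (simp add: pure_minus)
  next
    case (add x y)
    then have "x \<in> carrier R" "y \<in> carrier R" using add_span_incl[OF B(1)] by auto
    then show ?case using add Q.add_span_add by (simp add: pure_add_r)
  qed
  then have "(\<lambda>x. tensor_rel R +>\<^bsub>TF\<^esub> x) ` frag_of ` (UNIV \<times> carrier R) \<subseteq> add_span QR ?S"
    using B(2) by (auto simp: pure_tensor_def)
  then have "add_span QR ((\<lambda>x. tensor_rel R +>\<^bsub>TF\<^esub> x) ` frag_of ` (UNIV \<times> carrier R)) \<subseteq> add_span QR ?S"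
    by (intro Q.add_span_least Q.add_span_zero Q.add_span_minus[OF S] Q.add_span_add)
  then show ?thesis using 1 by blast
qed

text \<open>The assignment of \<open>q * f a\<close> to \<open>(q, a)\<close> is biadditive, so its
  additive extension kills the relations that define the tensor product.\<close>

lemma rat_tensor_functional:
  fixes f :: "'a \<Rightarrow> int"
  assumes f: "\<And>x y. x \<in> carrier R \<Longrightarrow> y \<in> carrier R \<Longrightarrow> f (x \<oplus> y) = f x + f y"
  shows "\<exists>F :: _ \<Rightarrow> rat. (\<forall>x\<in>carrier QR. \<forall>y\<in>carrier QR. F (x \<oplus>\<^bsub>QR\<^esub> y) = F x + F y) \<and>
    (\<forall>q. \<forall>a\<in>carrier R. F (pure_tensor R q a) = q * of_int (f a))"
proof -
  interpret T: cring TF by (rule tensor_free_cring)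
  interpret I: ideal "tensor_rel R" TF by (rule tensor_rel_ideal)
  define F0 where "F0 = fsum (\<lambda>(q, a). q * of_int (f a) :: rat)"
  have add: "F0 (x \<oplus>\<^bsub>TF\<^esub> y) = F0 x + F0 y" for x y by (simp add: F0_def tensor_free_simps fsum_add)
  have of: "F0 (frag_of (q, a)) = q * of_int (f a)" for q a by (simp add: F0_def fsum_of)
  have "F0 s = 0" if "s \<in> tgens" for s
    using that
  proof
    assume "s \<in> {frag_of (q + p, a) - frag_of (q, a) - frag_of (p, a) |q p a. a \<in> carrier R}"
    then obtain q p a where s: "s = frag_of (q + p, a) - frag_of (q, a) - frag_of (p, a)" by blast
    show ?thesis unfolding s F0_def fsum_diff fsum_of by (simp add: algebra_simps)
  next
    assume "s \<in> {frag_of (q, a \<oplus> b) - frag_of (q, a) - frag_of (q, b) |q a b. a \<in> carrier R \<and> b \<in> carrier R}"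
    then obtain q a a' where s: "s = frag_of (q, a \<oplus> a') - frag_of (q, a) - frag_of (q, a')"
      "a \<in> carrier R" "a' \<in> carrier R" by blast
    show ?thesis unfolding s(1) F0_def fsum_diff fsum_of using f[OF s(2,3)] by (simp add: algebra_simps)
  qed
  then have van: "F0 x = 0" if "x \<in> tensor_rel R" for x
    using that T.additive_vanish[of F0 tgens x] add tgens_carrier unfolding tensor_rel_def by blast
  show ?thesis
  proof (intro exI conjI ballI allI)
    show "lift_fun F0 (x \<oplus>\<^bsub>QR\<^esub> y) = lift_fun F0 x + lift_fun F0 y"
      if "x \<in> carrier QR" "y \<in> carrier QR" for x y
      using I.lift_fun_add[of F0 x y] add van that by (simp add: rat_tensor_def)
    show "lift_fun F0 (pure_tensor R q a) = q * of_int (f a)" if "a \<in> carrier R" for q a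
      using I.lift_fun[of F0 "frag_of (q, a)"] add van frag_of_TF[OF that] of by (simp add: pure_tensor_def)
  qed
qed

end

section \<open>The reduced glider representation ring\<close>

context fin_grp
begin

abbreviation "CR \<equiv> class_ring G"
abbreviation "SG \<equiv> split_groth G"
abbreviation "ZQ \<equiv> split_groth G Quot zero_length_ideal G"
abbreviation "RR \<equiv> reduced_ring G"
abbreviation "QA \<equiv> glider_alg G"

lemma iso_class_eqI:
  assumes "glider_iso G X Y"
  shows "iso_class G X = iso_class G Y"
  using assms glider_iso_trans glider_iso_sym unfolding iso_class_def by blast

lemma iso_class_self: "is_glider G X \<Longrightarrow> X \<in> iso_class G X"
  by (simp add: iso_class_def glider_iso_refl)

text \<open>Independence of representatives, by \<open>glider_tensor_cong\<close>, collapses the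
  union in \<open>class_tensor\<close> to a single class.\<close>

lemma class_tensor_eq:
  assumes X: "is_glider G X" and Y: "is_glider G Y"
  shows "class_tensor G (iso_class G X) (iso_class G Y) = iso_class G (glider_tensor X Y)"
proof -
  have "iso_class G (glider_tensor X' Y') = iso_class G (glider_tensor X Y)"
    if "X' \<in> iso_class G X" "Y' \<in> iso_class G Y" for X' Y'
    using that X Y glider_tensor_cong[of X X' Y Y'] unfolding iso_class_def[of G X] iso_class_def[of G Y]
    by (auto dest: iso_class_eqI)
  then show ?thesis
    unfolding class_tensor_def using iso_class_self[OF X] iso_class_self[OF Y] by blast
qed

lemma class_data:
  "free_ring_data {iso_class G X |X. is_glider G X} (class_tensor G) (iso_class G (trivial_glider :: ('a, 'k::field) glider))"
proof
  fix a b c :: "('a, 'k) glider_class"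
  assume a: "a \<in> {iso_class G X |X. is_glider G X}"
  then obtain X where X: "a = iso_class G X" "is_glider G X" by blast
  show "class_tensor G (iso_class G trivial_glider) a = a"
    using X class_tensor_eq[OF is_glider_trivial X(2)] iso_class_eqI[OF glider_tensor_one] by simp
  assume b: "b \<in> {iso_class G X |X. is_glider G X}"
  then obtain Y where Y: "b = iso_class G Y" "is_glider G Y" by blast
  show "class_tensor G a b \<in> {iso_class G X |X. is_glider G X}"
    using X Y class_tensor_eq is_glider_tensor by blast
  show "class_tensor G a b = class_tensor G b a"
    using X Y iso_class_eqI[OF glider_tensor_comm[OF X(2) Y(2)]] by (simp add: class_tensor_eq)
  assume c: "c \<in> {iso_class G X |X. is_glider G X}"
  then obtain Z where Z: "c = iso_class G Z" "is_glider G Z" by blast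
  show "class_tensor G (class_tensor G a b) c = class_tensor G a (class_tensor G b c)"
    using X Y Z by (simp add: class_tensor_eq is_glider_tensor glider_tensor_assoc)
next
  show "iso_class G trivial_glider \<in> {iso_class G (X :: ('a, 'k) glider) |X. is_glider G X}"
    using is_glider_trivial by blast
qed

lemma class_ring_cring: "cring (class_ring G :: (('a, 'k::field) glider_class \<Rightarrow>\<^sub>0 int) ring)"
  unfolding class_ring_def by (rule free_ring_data.free_ring_cring[OF class_data])

lemma class_ring_simps:
  fixes x y :: "('a, 'k::field) glider_class \<Rightarrow>\<^sub>0 int"
  shows "x \<in> carrier CR \<longleftrightarrow> Poly_Mapping.keys x \<subseteq> {iso_class G X |X. is_glider G X}"
    "x \<otimes>\<^bsub>CR\<^esub> y = fmul (class_tensor G) x y" "\<zero>\<^bsub>CR :: (('a, 'k) glider_class \<Rightarrow>\<^sub>0 int) ring\<^esub> = 0"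
    "x \<oplus>\<^bsub>CR\<^esub> y = x + y"
    "\<one>\<^bsub>CR :: (('a, 'k) glider_class \<Rightarrow>\<^sub>0 int) ring\<^esub> = frag_of (iso_class G trivial_glider)"
  unfolding class_ring_def by (simp_all add: free_ring_data.free_simps[OF class_data])

lemma frag_class_closed: "is_glider G X \<Longrightarrow> frag_of (iso_class G X) \<in> carrier CR"
  by (auto simp: class_ring_simps)

abbreviation split_gens :: "(('a, 'k::field) glider_class \<Rightarrow>\<^sub>0 int) set"
  where "split_gens \<equiv> {frag_of (iso_class G (glider_dsum X Y)) - frag_of (iso_class G X) - frag_of (iso_class G Y)
      |X Y. is_glider G X \<and> is_glider G Y}"

lemma split_gens_carrier: "split_gens \<subseteq> carrier CR"
proof
  fix s :: "('a, 'k::field) glider_class \<Rightarrow>\<^sub>0 int" assume "s \<in> split_gens"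
  then obtain X Y where s: "s = frag_of (iso_class G (glider_dsum X Y)) - frag_of (iso_class G X) - frag_of (iso_class G Y)"
    "is_glider G X" "is_glider G Y" by blast
  have "frag_of (iso_class G (glider_dsum X Y)) \<in> carrier CR" "frag_of (iso_class G X) \<in> carrier CR"
    "frag_of (iso_class G Y) \<in> carrier CR"
    using s is_glider_dsum by (blast intro: frag_class_closed)+
  then show "s \<in> carrier CR"
    unfolding s(1) class_ring_simps
    by (intro free_ring_data.free_diff_closed[OF class_data])
qed

lemma class_ring_span: "carrier CR \<subseteq> add_span CR (frag_of ` {iso_class G (X :: ('a, 'k::field) glider) |X. is_glider G X})"
  unfolding class_ring_def by (rule free_ring_data.free_span[OF class_data])

text \<open>By distributivity, \<open>Z\<close> times the relation for \<open>X\<close> and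
  \<open>Y\<close> is the relation for \<open>X \<otimes> Z\<close> and
  \<open>Y \<otimes> Z\<close>.\<close>

lemma split_rel_ideal: "ideal (split_rel G :: (('a, 'k::field) glider_class \<Rightarrow>\<^sub>0 int) set) CR"
  unfolding split_rel_def
proof (rule cring.add_span_ideal[OF class_ring_cring split_gens_carrier])
  show "frag_of ` {iso_class G (X :: ('a, 'k) glider) |X. is_glider G X} \<subseteq> carrier CR"
    using frag_class_closed by blast
  show "carrier CR \<subseteq> add_span CR (frag_of ` {iso_class G (X :: ('a, 'k) glider) |X. is_glider G X})"
    by (rule class_ring_span)
  fix b s :: "('a, 'k) glider_class \<Rightarrow>\<^sub>0 int"
  assume b: "b \<in> frag_of ` {iso_class G (X :: ('a, 'k) glider) |X. is_glider G X}" and s: "s \<in> split_gens"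
  obtain Z :: "('a, 'k) glider" where Z: "b = frag_of (iso_class G Z)" "is_glider G Z" using b by blast
  obtain X Y :: "('a, 'k) glider" where
    XY: "s = frag_of (iso_class G (glider_dsum X Y)) - frag_of (iso_class G X) - frag_of (iso_class G Y)"
    "is_glider G X" "is_glider G Y" using s by blast
  have sw: "iso_class G (glider_tensor Z W) = iso_class G (glider_tensor W Z)" if "is_glider G W" for W
    by (rule iso_class_eqI[OF glider_tensor_comm[OF Z(2) that]])
  have "b \<otimes>\<^bsub>CR\<^esub> s = frag_of (iso_class G (glider_tensor Z (glider_dsum X Y))) -
      frag_of (iso_class G (glider_tensor Z X)) - frag_of (iso_class G (glider_tensor Z Y))"
    using XY(2,3) Z(2) by (simp add: class_ring_simps Z(1) XY(1) fmul_diff_r fmul_of class_tensor_eq is_glider_dsum)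
  also have "\<dots> = frag_of (iso_class G (glider_dsum (glider_tensor X Z) (glider_tensor Y Z))) -
      frag_of (iso_class G (glider_tensor X Z)) - frag_of (iso_class G (glider_tensor Y Z))"
    using XY(2,3) by (simp add: sw is_glider_dsum iso_class_eqI[OF glider_tensor_dsum[OF XY(2,3) Z(2)]])
  also have "\<dots> \<in> split_gens" using XY(2,3) Z(2) is_glider_tensor by blast
  finally show "b \<otimes>\<^bsub>CR\<^esub> s \<in> add_span CR split_gens" by (rule generate.incl)
qed

lemma split_groth_cring: "cring (SG :: (('a, 'k::field) glider_class \<Rightarrow>\<^sub>0 int) set ring)"
  unfolding split_groth_def by (rule ideal.quotient_is_cring[OF split_rel_ideal class_ring_cring])

lemma groth_closed: "is_glider G X \<Longrightarrow> groth_class G X \<in> carrier SG"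
  unfolding split_groth_def groth_class_def by (rule ideal.quot_closed[OF split_rel_ideal frag_class_closed])

lemma groth_mult:
  "is_glider G X \<Longrightarrow> is_glider G Y \<Longrightarrow>
    groth_class G X \<otimes>\<^bsub>SG\<^esub> groth_class G Y = groth_class G (glider_tensor X Y)"
  unfolding split_groth_def groth_class_def
  by (simp add: ideal.quot_mult[OF split_rel_ideal frag_class_closed frag_class_closed]
      class_ring_simps fmul_of class_tensor_eq)

lemma groth_iso: "glider_iso G X Y \<Longrightarrow> groth_class G X = groth_class G Y"
  unfolding groth_class_def by (simp add: iso_class_eqI)

lemma groth_dsum:
  fixes X Y :: "('a, 'k::field) glider"
  assumes X: "is_glider G X" and Y: "is_glider G Y"
  shows "groth_class G (glider_dsum X Y) = groth_class G X \<oplus>\<^bsub>SG\<^esub> groth_class G Y"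
proof -
  interpret C: cring "CR :: (('a, 'k) glider_class \<Rightarrow>\<^sub>0 int) ring" by (rule class_ring_cring)
  interpret I: ideal "split_rel G :: (('a, 'k) glider_class \<Rightarrow>\<^sub>0 int) set" CR by (rule split_rel_ideal)
  let ?d = "frag_of (iso_class G (glider_dsum X Y))" and ?x = "frag_of (iso_class G X)" and ?y = "frag_of (iso_class G Y)"
  have cl: "?d \<in> carrier CR" "?x \<in> carrier CR" "?y \<in> carrier CR"
    using X Y is_glider_dsum by (blast intro: frag_class_closed)+
  have "?x \<oplus>\<^bsub>CR\<^esub> ?y \<in> carrier CR" using cl by simp
  then have m: "\<ominus>\<^bsub>CR\<^esub> (?x \<oplus>\<^bsub>CR\<^esub> ?y) = - (?x + ?y)"
    unfolding class_ring_simps unfolding class_ring_def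
    by (intro free_ring_data.free_minus[OF class_data])
  have "?d \<ominus>\<^bsub>CR\<^esub> (?x \<oplus>\<^bsub>CR\<^esub> ?y) = ?d - ?x - ?y"
    unfolding a_minus_def m by (simp add: class_ring_simps)
  also have "\<dots> \<in> split_gens" using X Y by blast
  finally have "?d \<ominus>\<^bsub>CR\<^esub> (?x \<oplus>\<^bsub>CR\<^esub> ?y) \<in> split_rel G"
    unfolding split_rel_def by (rule generate.incl)
  then have "split_rel G +>\<^bsub>CR\<^esub> ?d = split_rel G +>\<^bsub>CR\<^esub> (?x \<oplus>\<^bsub>CR\<^esub> ?y)"
    using I.coset_eq_iff[OF cl(1)] cl by simp
  then show ?thesis using cl by (simp add: split_groth_def groth_class_def I.quot_add)
qed

lemma split_groth_span:
  "carrier SG \<subseteq> add_span SG {groth_class G (X :: ('a, 'k::field) glider) |X. is_glider G X}"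
proof -
  have "frag_of ` {iso_class G (X :: ('a, 'k) glider) |X. is_glider G X} \<subseteq> carrier CR"
    using frag_class_closed by blast
  from ideal.quot_span[OF split_rel_ideal this class_ring_span]
  have "carrier SG \<subseteq> add_span SG ((\<lambda>x. split_rel G +>\<^bsub>CR\<^esub> x) `
      frag_of ` {iso_class G (X :: ('a, 'k) glider) |X. is_glider G X})"
    by (simp only: split_groth_def)
  moreover have "(\<lambda>x. split_rel G +>\<^bsub>CR\<^esub> x) ` frag_of ` {iso_class G (X :: ('a, 'k) glider) |X. is_glider G X} =
      {groth_class G X |X. is_glider G X}"
    unfolding groth_class_def by blast
  ultimately show ?thesis by simp
qed

lemma zero_length_carrier: "{groth_class G X |X. length_zero G X} \<subseteq> carrier SG"
  using groth_closed by (auto simp: length_zero_def)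

lemma zero_length_ideal: "ideal (zero_length_ideal G :: (('a, 'k::field) glider_class \<Rightarrow>\<^sub>0 int) set set) SG"
  unfolding zero_length_ideal_def
proof (rule cring.add_span_ideal[OF split_groth_cring zero_length_carrier])
  show "{groth_class G (X :: ('a, 'k) glider) |X. is_glider G X} \<subseteq> carrier SG"
    using groth_closed by blast
  show "carrier SG \<subseteq> add_span SG {groth_class G (X :: ('a, 'k) glider) |X. is_glider G X}"
    by (rule split_groth_span)
  fix b s assume b: "b \<in> {groth_class G (X :: ('a, 'k) glider) |X. is_glider G X}"
    and s: "s \<in> {groth_class G (X :: ('a, 'k) glider) |X. length_zero G X}"
  then obtain Z X :: "('a, 'k) glider" where Z: "b = groth_class G Z" "is_glider G Z"
    "s = groth_class G X" "length_zero G X" by blast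
  then have X: "is_glider G X" by (simp add: length_zero_def)
  have "b \<otimes>\<^bsub>SG\<^esub> s = groth_class G (glider_tensor X Z)"
    using Z X groth_iso[OF glider_tensor_comm[OF X Z(2)]] by (simp add: groth_mult)
  then have "b \<otimes>\<^bsub>SG\<^esub> s \<in> {groth_class G X |X. length_zero G X}"
    using length_zero_tensor Z by blast
  then show "b \<otimes>\<^bsub>SG\<^esub> s \<in> add_span SG {groth_class G X |X. length_zero G X}" by (rule generate.incl)
qed

lemma zq_cring: "cring (ZQ :: ('a, 'k::field) red_elem ring)"
  by (rule ideal.quotient_is_cring[OF zero_length_ideal split_groth_cring])

lemma red_closed: "is_glider G X \<Longrightarrow> red_class G X \<in> carrier ZQ"
  unfolding red_class_def by (rule ideal.quot_closed[OF zero_length_ideal groth_closed])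

lemma red_mult:
  "is_glider G X \<Longrightarrow> is_glider G Y \<Longrightarrow>
    red_class G X \<otimes>\<^bsub>ZQ\<^esub> red_class G Y = red_class G (glider_tensor X Y)"
  unfolding red_class_def
  by (simp add: ideal.quot_mult[OF zero_length_ideal groth_closed groth_closed] groth_mult)

lemma red_iso: "glider_iso G X Y \<Longrightarrow> red_class G X = red_class G Y"
  unfolding red_class_def by (simp add: groth_iso)

lemma red_one: "\<one>\<^bsub>ZQ :: ('a, 'k::field) red_elem ring\<^esub> = red_class G trivial_glider"
proof -
  have "\<one>\<^bsub>SG :: (('a, 'k) glider_class \<Rightarrow>\<^sub>0 int) set ring\<^esub> = groth_class G trivial_glider"
    unfolding split_groth_def groth_class_def ideal.quot_one[OF split_rel_ideal] by (simp add: class_ring_simps)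
  then show ?thesis unfolding ideal.quot_one[OF zero_length_ideal] red_class_def by simp
qed

text \<open>What the top space contains beyond \<open>K[G]M\<close> splits off with length zero, by
  \<open>glider_iso_top\<close>, and so vanishes in this quotient.\<close>

lemma red_top:
  fixes X :: "('a, 'k::field) glider"
  assumes X: "is_glider G X"
  shows "red_class G X = red_class G (X\<lparr>gtop := kG_span G (gamb X) (gsub X)\<rparr>)"
proof -
  interpret S: cring "SG :: (('a, 'k) glider_class \<Rightarrow>\<^sub>0 int) set ring" by (rule split_groth_cring)
  interpret Z: cring "ZQ :: ('a, 'k) red_elem ring" by (rule zq_cring)
  interpret I: ideal "zero_length_ideal G :: (('a, 'k) glider_class \<Rightarrow>\<^sub>0 int) set set" SG by (rule zero_length_ideal)
  let ?X = "X\<lparr>gtop := kG_span G (gamb X) (gsub X)\<rparr>"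
  obtain Z where Z: "length_zero G Z" "glider_iso G X (glider_dsum ?X Z)" using glider_iso_top[OF X] by blast
  have g: "is_glider G ?X" "is_glider G Z" using is_glider_top[OF X] Z by (simp_all add: length_zero_def)
  have "groth_class G Z \<in> zero_length_ideal G"
    unfolding zero_length_ideal_def using Z(1) by (intro generate.incl) blast
  then have 0: "red_class G Z = \<zero>\<^bsub>ZQ\<^esub>"
    unfolding red_class_def I.quot_zero using I.coset_eq_ideal_iff[OF groth_closed[OF g(2)]] by simp
  have "red_class G X = red_class G (glider_dsum ?X Z)" by (rule red_iso[OF Z(2)])
  also have "\<dots> = red_class G ?X \<oplus>\<^bsub>ZQ\<^esub> red_class G Z"
    unfolding red_class_def groth_dsum[OF g] I.quot_add[OF groth_closed[OF g(1)] groth_closed[OF g(2)]] ..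
  finally show ?thesis using 0 red_closed[OF g(1)] by simp
qed

text \<open>The data of an irreducible glider \<open>Kv \<subset> K[G]v\<close>. The module may be
  larger than \<open>K[G]v\<close>, which keeps such pairs closed under tensor products and
  induction.\<close>

definition pointed :: "('a, 'k::field) rep \<Rightarrow> (nat \<Rightarrow> 'k) \<Rightarrow> bool"
  where "pointed V v \<longleftrightarrow> is_rep G V \<and> v \<in> kspace (rdim V) \<and> v \<noteq> 0"

lemma red_line:
  fixes X :: "('a, 'k::field) glider"
  assumes X: "is_glider G X" and "gsub X = kv.span {v}"
  shows "red_class G X = red_class G (cyc (gamb X) v)"
proof -
  have "X\<lparr>gtop := kG_span G (gamb X) (gsub X)\<rparr> = cyc (gamb X) v"
    using assms(2) by (simp add: cyc_def)
  then show ?thesis using red_top[OF X] by simp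
qed

lemma tensor_nonzero:
  assumes "u \<in> kspace n" "u \<noteq> 0" "v \<in> kspace m" "v \<noteq> 0"
  shows "vec_tensor m u v \<noteq> 0"
proof -
  obtain i j where ij: "u i \<noteq> 0" "v j \<noteq> 0" using assms by (auto simp: fun_eq_iff)
  then have "j < m" using assms(3) by (meson kspaceD not_less)
  then have "vec_tensor m u v (i * m + j) \<noteq> 0" using ij by (simp add: vec_tensor_def)
  then show ?thesis by auto
qed

lemma pointed_tensor:
  "pointed V v \<Longrightarrow> pointed W w \<Longrightarrow> pointed (rep_tensor V W) (vec_tensor (rdim W) v w)"
proof -
  assume "pointed V v" "pointed W w"
  moreover have "rdim (rep_tensor V W) = rdim V * rdim W" by (simp add: rep_tensor_def)
  ultimately show ?thesis
    unfolding pointed_def using tensor_nonzero[of v "rdim V" w "rdim W"]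
    by (simp add: is_rep_tensor vec_tensor_kspace)
qed

lemma is_glider_pointed: "pointed V v \<Longrightarrow> is_glider G (cyc V v)"
  by (simp add: pointed_def is_glider_cyc)

text \<open>The tensor product of the two top spaces may exceed \<open>K[G](v \<otimes> w)\<close>;
  the excess disappears by \<open>red_line\<close>.\<close>

lemma red_cyc_mult:
  assumes V: "pointed V v" and W: "pointed W w"
  shows "red_class G (cyc V v) \<otimes>\<^bsub>ZQ\<^esub> red_class G (cyc W w) =
    red_class G (cyc (rep_tensor V W) (vec_tensor (rdim W) v w))"
proof -
  note g = is_glider_pointed[OF V] is_glider_pointed[OF W]
  have "{vec_tensor (rdim W) u z |u z. u \<in> {v} \<and> z \<in> {w}} = {vec_tensor (rdim W) v w}" by auto
  then have "gsub (glider_tensor (cyc V v) (cyc W w)) = kv.span {vec_tensor (rdim W) v w}"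
    by (simp add: glider_tensor_def cyc_def span_tensor_l span_tensor_r del: insert_iff singleton_iff)
  from red_line[OF is_glider_tensor[OF g] this] show ?thesis
    by (simp add: red_mult[OF g]) (simp add: glider_tensor_def cyc_def)
qed

definition triv_rep :: "('a, 'k::field) rep" where "triv_rep = linear_rep (\<lambda>g. 1)"

lemma pointed_linear:
  assumes "\<chi> \<one> = 1" "\<And>g h. g \<in> carrier G \<Longrightarrow> h \<in> carrier G \<Longrightarrow> \<chi> (g \<otimes> h) = \<chi> g * \<chi> h" "c \<noteq> 0"
  shows "pointed (linear_rep \<chi>) (unit_vec0 c)"
  unfolding pointed_def using is_rep_linear[OF assms(1,2)] assms(3)
  by (auto simp: linear_rep_def kspace_def unit_vec0_def fun_eq_iff)

lemma pointed_triv: "pointed triv_rep (unit_vec0 1)"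
  unfolding triv_rep_def by (rule pointed_linear) auto

lemma red_triv: "red_class G trivial_glider = red_class G (cyc triv_rep (unit_vec0 1))"
  using red_line[OF is_glider_trivial, of "unit_vec0 1"]
  by (simp add: trivial_glider_def linear_glider_def line_glider_def triv_rep_def)

abbreviation irr_classes :: "('a, 'k::field) red_elem set"
  where "irr_classes \<equiv> {red_class G (cyc V v) |V v. pointed V v}"

lemma irr_classes_eq: "{red_class G X |X. irreducible_glider G X} = irr_classes"
  by (auto simp: irreducible_glider_iff pointed_def)

lemma irr_classes_carrier: "irr_classes \<subseteq> carrier ZQ"
  using red_closed is_glider_pointed by blast

lemma reduced_ring_eq: "RR = ZQ\<lparr>carrier := generate_ring ZQ irr_classes\<rparr>"
  by (simp add: reduced_ring_def Let_def irr_classes_eq)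

lemma reduced_cring: "cring (RR :: ('a, 'k::field) red_elem ring)"
proof -
  interpret Z: cring "ZQ :: ('a, 'k) red_elem ring" by (rule zq_cring)
  have "ring (RR :: ('a, 'k) red_elem ring)"
    unfolding reduced_ring_eq by (rule Z.generate_ring_is_ring[OF irr_classes_carrier])
  then show ?thesis
    by (intro cring.intro comm_monoid.intro comm_monoid_axioms.intro ring.axioms(2))
      (use Z.m_comm Z.generate_ring_incl[OF irr_classes_carrier] in \<open>auto simp: reduced_ring_eq\<close>)
qed

text \<open>Classes of irreducible gliders are closed under products and contain the unit, so the
  subring they generate is already their additive span.\<close>

lemma reduced_span: "carrier RR \<subseteq> add_span RR (irr_classes :: ('a, 'k::field) red_elem set)"
proof -
  interpret Z: cring "ZQ :: ('a, 'k) red_elem ring" by (rule zq_cring)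
  let ?S = "irr_classes :: ('a, 'k) red_elem set"
  have SS: "s \<otimes>\<^bsub>ZQ\<^esub> t \<in> ?S" if "s \<in> ?S" "t \<in> ?S" for s t
  proof -
    obtain V W :: "('a, 'k) rep" and v w where
      "s = red_class G (cyc V v)" "pointed V v" "t = red_class G (cyc W w)" "pointed W w"
      using \<open>s \<in> ?S\<close> \<open>t \<in> ?S\<close> by blast
    then have "s \<otimes>\<^bsub>ZQ\<^esub> t = red_class G (cyc (rep_tensor V W) (vec_tensor (rdim W) v w))"
      "pointed (rep_tensor V W) (vec_tensor (rdim W) v w)"
      by (simp_all add: red_cyc_mult pointed_tensor)
    then show ?thesis by blast
  qed
  have mul1: "s \<otimes>\<^bsub>ZQ\<^esub> y \<in> add_span ZQ ?S" if s: "s \<in> ?S" and "y \<in> add_span ZQ ?S" for s y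
    using that(2)
  proof (induction rule: Z.add_span_induct)
    case zero
    have "s \<in> carrier ZQ" using s irr_classes_carrier by blast
    then have 0: "s \<otimes>\<^bsub>ZQ\<^esub> \<zero>\<^bsub>ZQ\<^esub> = \<zero>\<^bsub>ZQ\<^esub>" by simp
    show ?case unfolding 0 by (rule Z.add_span_zero)
  next
    case (base t)
    then show ?case using SS[OF s] by (intro generate.incl)
  next
    case (minus t)
    then have "s \<otimes>\<^bsub>ZQ\<^esub> t \<in> add_span ZQ ?S" using SS[OF s] by (intro generate.incl)
    moreover have "s \<in> carrier ZQ" "t \<in> carrier ZQ" using s minus irr_classes_carrier by blast+
    ultimately show ?case using Z.add_span_minus[OF irr_classes_carrier] by (simp add: Z.r_minus)
  next
    case (add x y)
    moreover have "s \<in> carrier ZQ" "x \<in> carrier ZQ" "y \<in> carrier ZQ"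
      using s add irr_classes_carrier Z.add_span_incl[OF irr_classes_carrier] by blast+
    ultimately show ?case using Z.add_span_add by (simp add: Z.r_distr)
  qed
  have mul: "x \<otimes>\<^bsub>ZQ\<^esub> y \<in> add_span ZQ ?S" if "x \<in> add_span ZQ ?S" and y: "y \<in> add_span ZQ ?S" for x y
    using that(1)
  proof (induction rule: Z.add_span_induct)
    case zero
    have "y \<in> carrier ZQ" using y Z.add_span_incl[OF irr_classes_carrier] by blast
    then have 0: "\<zero>\<^bsub>ZQ\<^esub> \<otimes>\<^bsub>ZQ\<^esub> y = \<zero>\<^bsub>ZQ\<^esub>" by simp
    show ?case unfolding 0 by (rule Z.add_span_zero)
  next
    case (base t)
    then show ?case using mul1 y by blast
  next
    case (minus t)
    then have "t \<in> carrier ZQ" "y \<in> carrier ZQ"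
      using y irr_classes_carrier Z.add_span_incl[OF irr_classes_carrier] by blast+
    then show ?case using Z.add_span_minus[OF irr_classes_carrier mul1[OF minus y]] by (simp add: Z.l_minus)
  next
    case (add x x')
    moreover have "y \<in> carrier ZQ" "x \<in> carrier ZQ" "x' \<in> carrier ZQ"
      using y add irr_classes_carrier Z.add_span_incl[OF irr_classes_carrier] by blast+
    ultimately show ?case using Z.add_span_add by (simp add: Z.l_distr)
  qed
  have "generate_ring ZQ ?S \<subseteq> add_span ZQ ?S"
  proof
    fix x assume "x \<in> generate_ring ZQ ?S"
    then show "x \<in> add_span ZQ ?S"
    proof (induction rule: generate_ring.induct)
      case one
      then show ?case using pointed_triv unfolding red_one red_triv by (blast intro: generate.incl)
    next
      case (incl h)
      then show ?case by (rule generate.incl)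
    qed (use mul Z.add_span_add Z.add_span_minus[OF irr_classes_carrier] in auto)
  qed
  also have "add_span ZQ ?S = add_span RR ?S"
  proof -
    have H: "?S \<subseteq> generate_ring ZQ ?S" by (rule subsetI) (rule generate_ring.incl)
    have "subring (generate_ring ZQ ?S) ZQ" by (rule Z.generate_ring_is_subring[OF irr_classes_carrier])
    then have "subgroup (generate_ring ZQ ?S) (add_monoid ZQ)" by (rule subring.axioms(1))
    from Z.add.generate_consistent[OF H this] show ?thesis by (simp add: reduced_ring_eq)
  qed
  finally show ?thesis by (simp add: reduced_ring_eq)
qed

lemma irr_classes_reduced: "irr_classes \<subseteq> carrier RR"
  by (auto simp: reduced_ring_eq intro: generate_ring.incl)

text \<open>\<open>mult_of J\<close> descends through both quotients: it is invariant under
  isomorphism, additive on direct sums and zero in length zero.\<close>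

lemma mult_functional:
  "\<exists>f :: ('a, 'k::field) red_elem \<Rightarrow> int.
    (\<forall>x\<in>carrier ZQ. \<forall>y\<in>carrier ZQ. f (x \<oplus>\<^bsub>ZQ\<^esub> y) = f x + f y) \<and>
    (\<forall>X. is_glider G X \<longrightarrow> f (red_class G X) = mult_of J X)"
proof -
  interpret C: cring "CR :: (('a, 'k) glider_class \<Rightarrow>\<^sub>0 int) ring" by (rule class_ring_cring)
  interpret I: ideal "split_rel G :: (('a, 'k) glider_class \<Rightarrow>\<^sub>0 int) set" CR by (rule split_rel_ideal)
  interpret S: cring "SG :: (('a, 'k) glider_class \<Rightarrow>\<^sub>0 int) set ring" by (rule split_groth_cring)
  interpret K: ideal "zero_length_ideal G :: (('a, 'k) glider_class \<Rightarrow>\<^sub>0 int) set set" SG by (rule zero_length_ideal)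
  \<comment> \<open>A class is evaluated at an arbitrary member; \<open>mult_of_iso\<close> makes
    the choice irrelevant.\<close>
  define f0 :: "(('a, 'k) glider_class \<Rightarrow>\<^sub>0 int) \<Rightarrow> int" where "f0 = fsum (\<lambda>c. mult_of J (SOME X. X \<in> c))"
  have add0: "f0 (x \<oplus>\<^bsub>CR\<^esub> y) = f0 x + f0 y" for x y by (simp add: f0_def class_ring_simps fsum_add)
  have f0: "f0 (frag_of (iso_class G X)) = mult_of J X" if X: "is_glider G X" for X
  proof -
    have "(SOME Y. Y \<in> iso_class G X) \<in> iso_class G X" using iso_class_self[OF X] by (rule someI)
    then have "mult_of J X = mult_of J (SOME Y. Y \<in> iso_class G X)"
      by (intro mult_of_iso[OF _ X]) (simp_all only: iso_class_def mem_Collect_eq)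
    then show ?thesis by (simp only: f0_def fsum_of)
  qed
  have "f0 s = 0" if s: "s \<in> split_gens" for s
  proof -
    obtain X Y where XY: "s = frag_of (iso_class G (glider_dsum X Y)) - frag_of (iso_class G X) - frag_of (iso_class G Y)"
      "is_glider G X" "is_glider G Y" using s by blast
    have "f0 s = f0 (frag_of (iso_class G (glider_dsum X Y))) - f0 (frag_of (iso_class G X)) - f0 (frag_of (iso_class G Y))"
      unfolding XY(1) f0_def fsum_diff ..
    then show ?thesis using XY(2,3) by (simp add: f0 is_glider_dsum mult_of_dsum)
  qed
  then have v0: "f0 x = 0" if "x \<in> split_rel G" for x
    using that C.additive_vanish[OF add0 split_gens_carrier] unfolding split_rel_def by blast
  define f1 where "f1 = lift_fun f0"
  have add1: "f1 (x \<oplus>\<^bsub>SG\<^esub> y) = f1 x + f1 y" if "x \<in> carrier SG" "y \<in> carrier SG" for x y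
    using I.lift_fun_add[of f0 x y] add0 v0 that by (simp add: split_groth_def f1_def)
  have f1: "f1 (groth_class G X) = mult_of J X" if X: "is_glider G X" for X
    using I.lift_fun[of f0 "frag_of (iso_class G X)"] add0 v0 frag_class_closed[OF X] f0[OF X]
    by (simp add: groth_class_def f1_def)
  have "f1 s = 0" if s0: "s \<in> {groth_class G X |X. length_zero G X}" for s
  proof -
    obtain X where "s = groth_class G X" "length_zero G X" using s0 by blast
    then show ?thesis using f1[of X] mult_of_length_zero[of X J] by (simp add: length_zero_def)
  qed
  then have v1: "f1 x = 0" if "x \<in> zero_length_ideal G" for x
    using that S.additive_vanish[OF add1 zero_length_carrier] unfolding zero_length_ideal_def by blast
  show ?thesis
  proof (intro exI conjI ballI allI impI)
    show "lift_fun f1 (x \<oplus>\<^bsub>ZQ\<^esub> y) = lift_fun f1 x + lift_fun f1 y" if "x \<in> carrier ZQ" "y \<in> carrier ZQ" for x y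
      by (rule K.lift_fun_add[OF add1 v1 that])
    show "lift_fun f1 (red_class G X) = mult_of J X" if X: "is_glider G X" for X
      using K.lift_fun[OF add1 v1 groth_closed[OF X]] f1[OF X] by (simp add: red_class_def)
  qed
qed

section \<open>The rational glider algebra\<close>

definition kl :: "('a, 'k::field) rep \<Rightarrow> (nat \<Rightarrow> 'k) \<Rightarrow> ('a, 'k) rat_elem"
  where "kl V v = glider_cls G (cyc V v)"

lemma alg_cring: "cring (QA :: ('a, 'k::field) rat_elem ring)"
  unfolding glider_alg_def by (rule cring.rat_tensor_cring[OF reduced_cring])

lemma red_in_reduced: "pointed V v \<Longrightarrow> red_class G (cyc V v) \<in> carrier RR"
  using irr_classes_reduced by blast

lemma kl_closed: "pointed V v \<Longrightarrow> kl V v \<in> carrier QA"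
  unfolding glider_alg_def kl_def glider_cls_def
  by (rule cring.pure_closed[OF reduced_cring red_in_reduced])

lemma kl_mult:
  assumes V: "pointed V v" and W: "pointed W w"
  shows "kl V v \<otimes>\<^bsub>QA\<^esub> kl W w = kl (rep_tensor V W) (vec_tensor (rdim W) v w)"
  unfolding glider_alg_def kl_def glider_cls_def
    cring.pure_mult[OF reduced_cring red_in_reduced[OF V] red_in_reduced[OF W]]
  using red_cyc_mult[OF V W] by (simp add: reduced_ring_eq)

lemma reduced_one: "\<one>\<^bsub>RR :: ('a, 'k::field) red_elem ring\<^esub> = red_class G (cyc triv_rep (unit_vec0 1))"
  by (simp add: reduced_ring_eq red_one red_triv)

lemma kl_one: "\<one>\<^bsub>QA :: ('a, 'k::field) rat_elem ring\<^esub> = kl triv_rep (unit_vec0 1)"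
  unfolding glider_alg_def cring.pure_one[OF reduced_cring] kl_def glider_cls_def reduced_one ..

lemma scal_closed: "(scal G q :: ('a, 'k::field) rat_elem) \<in> carrier QA"
proof -
  interpret R: cring "RR :: ('a, 'k) red_elem ring" by (rule reduced_cring)
  show ?thesis unfolding glider_alg_def scal_def by (rule R.pure_closed) simp
qed

lemma scal_add: "(scal G (q + p) :: ('a, 'k::field) rat_elem) = scal G q \<oplus>\<^bsub>QA\<^esub> scal G p"
proof -
  interpret R: cring "RR :: ('a, 'k) red_elem ring" by (rule reduced_cring)
  show ?thesis unfolding glider_alg_def scal_def by (rule R.pure_add_l) simp
qed

lemma scal_mult: "(scal G (q * p) :: ('a, 'k::field) rat_elem) = scal G q \<otimes>\<^bsub>QA\<^esub> scal G p"
proof -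
  interpret R: cring "RR :: ('a, 'k) red_elem ring" by (rule reduced_cring)
  show ?thesis unfolding glider_alg_def scal_def by (simp add: R.pure_mult)
qed

lemma scal_one: "(scal G 1 :: ('a, 'k::field) rat_elem) = \<one>\<^bsub>QA\<^esub>"
  unfolding glider_alg_def scal_def cring.pure_one[OF reduced_cring] ..

lemma scal_kl:
  fixes V :: "('a, 'k::field) rep"
  assumes V: "pointed V v"
  shows "scal G q \<otimes>\<^bsub>QA\<^esub> kl V v = pure_tensor RR q (red_class G (cyc V v))"
proof -
  interpret R: cring "RR :: ('a, 'k) red_elem ring" by (rule reduced_cring)
  show ?thesis
    unfolding glider_alg_def scal_def kl_def glider_cls_def
    using red_in_reduced[OF V] by (simp add: R.pure_mult)
qed

lemma alg_span:
  "carrier QA \<subseteq> add_span QA {scal G q \<otimes>\<^bsub>QA\<^esub> kl V v |q V v. pointed V (v :: nat \<Rightarrow> 'k::field)}"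
proof -
  have "{pure_tensor RR q b |q b. b \<in> (irr_classes :: ('a, 'k) red_elem set)} =
      {scal G q \<otimes>\<^bsub>QA\<^esub> kl V v |q V v. pointed V (v :: nat \<Rightarrow> 'k)}"
  proof (intro equalityI subsetI)
    fix x :: "('a, 'k) rat_elem"
    assume "x \<in> {pure_tensor RR q b |q b. b \<in> (irr_classes :: ('a, 'k) red_elem set)}"
    then obtain q and V :: "('a, 'k) rep" and v where
      "x = pure_tensor RR q (red_class G (cyc V v))" "pointed V v" by blast
    then have "x = scal G q \<otimes>\<^bsub>QA\<^esub> kl V v" by (simp only: scal_kl)
    then show "x \<in> {scal G q \<otimes>\<^bsub>QA\<^esub> kl V v |q V v. pointed V (v :: nat \<Rightarrow> 'k)}"
      using \<open>pointed V v\<close> by blast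
  next
    fix x :: "('a, 'k) rat_elem"
    assume "x \<in> {scal G q \<otimes>\<^bsub>QA\<^esub> kl V v |q V v. pointed V (v :: nat \<Rightarrow> 'k)}"
    then obtain q and V :: "('a, 'k) rep" and v where
      "x = scal G q \<otimes>\<^bsub>QA\<^esub> kl V v" "pointed V v" by blast
    then have "x = pure_tensor RR q (red_class G (cyc V v))" by (simp only: scal_kl)
    then show "x \<in> {pure_tensor RR q b |q b. b \<in> (irr_classes :: ('a, 'k) red_elem set)}"
      using \<open>pointed V v\<close> by blast
  qed
  moreover have "carrier QA \<subseteq> add_span QA {pure_tensor RR q b |q b. b \<in> (irr_classes :: ('a, 'k) red_elem set)}"
    unfolding glider_alg_def by (rule cring.rat_tensor_span[OF reduced_cring irr_classes_reduced reduced_span])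
  ultimately show ?thesis by (simp only:)
qed

text \<open>Equal annihilators give isomorphic cyclic gliders by \<open>cyc_iso\<close>. From here
  on equality of classes is proved by comparing sets of functions on the group.\<close>

lemma kl_eqI:
  assumes V: "pointed V v" and W: "pointed W w" and "ann V v = ann W w"
  shows "kl V v = kl W w"
proof -
  have "glider_iso G (cyc V v) (cyc W w)"
    using V W assms(3) by (intro cyc_iso) (simp_all add: pointed_def)
  then show ?thesis unfolding kl_def glider_cls_def by (simp add: red_iso)
qed

lemma glider_cls_line:
  assumes "is_glider G X" "gsub X = kv.span {v}"
  shows "glider_cls G X = kl (gamb X) v"
  unfolding kl_def glider_cls_def red_line[OF assms] ..

text \<open>Extends \<open>mult_of J\<close> to rational coefficients. Together with
  \<open>kl_eqI\<close> it makes the classes \<open>kl V v\<close>, one for each annihilator, a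
  basis.\<close>

lemma coef_functional:
  "\<exists>F :: ('a, 'k::field) rat_elem \<Rightarrow> rat. (\<forall>x\<in>carrier QA. \<forall>y\<in>carrier QA. F (x \<oplus>\<^bsub>QA\<^esub> y) = F x + F y) \<and>
    (\<forall>q V v. pointed V v \<longrightarrow> F (scal G q \<otimes>\<^bsub>QA\<^esub> kl V v) = (if ann V v = J then q else 0))"
proof -
  interpret R: cring "RR :: ('a, 'k) red_elem ring" by (rule reduced_cring)
  obtain f :: "('a, 'k) red_elem \<Rightarrow> int" where f: "\<forall>x\<in>carrier ZQ. \<forall>y\<in>carrier ZQ. f (x \<oplus>\<^bsub>ZQ\<^esub> y) = f x + f y"
    "\<forall>X. is_glider G X \<longrightarrow> f (red_class G X) = mult_of J X" using mult_functional by blast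
  have sub: "carrier RR \<subseteq> carrier (ZQ :: ('a, 'k) red_elem ring)"
    using ring.generate_ring_incl[OF cring.axioms(1)[OF zq_cring] irr_classes_carrier] by (simp add: reduced_ring_eq)
  have "f (x \<oplus>\<^bsub>RR\<^esub> y) = f x + f y" if "x \<in> carrier RR" "y \<in> carrier RR" for x y
    using f(1) that sub by (auto simp: reduced_ring_eq)
  from R.rat_tensor_functional[OF this] obtain F :: "('a, 'k) rat_elem \<Rightarrow> rat" where
    F: "\<forall>x\<in>carrier QA. \<forall>y\<in>carrier QA. F (x \<oplus>\<^bsub>QA\<^esub> y) = F x + F y"
      "\<forall>q. \<forall>a\<in>carrier RR. F (pure_tensor RR q a) = q * of_int (f a)"
    unfolding glider_alg_def by blast
  have "F (scal G q \<otimes>\<^bsub>QA\<^esub> kl V v) = (if ann V v = J then q else 0)" if V: "pointed V v" for q V v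
  proof -
    have "f (red_class G (cyc V v)) = (if ann V v = J then 1 else 0)"
      using f(2) is_glider_pointed[OF V] mult_of_line[of "cyc V v" v J] V by (simp add: cyc_def pointed_def)
    then show ?thesis using F(2) red_in_reduced[OF V] by (simp add: scal_kl[OF V])
  qed
  then show ?thesis using F(1) by blast
qed

end

section \<open>Nilpotent elements\<close>

context cring
begin

text \<open>A substitute for the binomial theorem: splitting one factor \<open>x \<oplus> y\<close>
  at a time keeps the total degree, until only monomials of degree at least \<open>N\<close>
  remain.\<close>

lemma binomial_vanish:
  assumes x: "x \<in> carrier R" and y: "y \<in> carrier R"
    and z: "\<And>i j. i + j \<ge> N \<Longrightarrow> x [^] i \<otimes> y [^] j = \<zero>"
  shows "i + j + k \<ge> N \<Longrightarrow> (x \<oplus> y) [^] (k::nat) \<otimes> (x [^] (i::nat) \<otimes> y [^] (j::nat)) = \<zero>"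
proof (induction k arbitrary: i j)
  case 0
  then show ?case using z[of i j] x y by simp
next
  case (Suc k)
  have "(x \<oplus> y) [^] Suc k \<otimes> (x [^] i \<otimes> y [^] j) =
      (x \<oplus> y) [^] k \<otimes> (x [^] Suc i \<otimes> y [^] j) \<oplus> (x \<oplus> y) [^] k \<otimes> (x [^] i \<otimes> y [^] Suc j)"
    using x y by (simp add: l_distr r_distr m_ac)
  also have "\<dots> = \<zero>" using Suc.IH[of "Suc i" j] Suc.IH[of i "Suc j"] Suc.prems x y by simp
  finally show ?case .
qed

text \<open>In degree \<open>n + m\<close> every monomial contains the \<open>n\<close>-th power of
  \<open>x\<close> or the \<open>m\<close>-th power of \<open>y\<close>.\<close>

lemma nilpotent_add:
  assumes x: "x \<in> carrier R" "x [^] (n::nat) = \<zero>" and y: "y \<in> carrier R" "y [^] (m::nat) = \<zero>"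
  shows "(x \<oplus> y) [^] (n + m) = \<zero>"
proof -
  have pz: "a [^] i = \<zero>" if "a \<in> carrier R" "a [^] (k::nat) = \<zero>" "i \<ge> k" for a i k
  proof -
    have "a [^] i = a [^] k \<otimes> a [^] (i - k)" using that(1,3) by (simp add: nat_pow_mult)
    also have "\<dots> = \<zero>" unfolding that(2) using that(1) by simp
    finally show ?thesis .
  qed
  have "x [^] i \<otimes> y [^] j = \<zero>" if "i + j \<ge> n + m" for i j :: nat
  proof (cases "i \<ge> n")
    case True
    then show ?thesis using pz[OF x] y by simp
  next
    case False
    then have "j \<ge> m" using that by simp
    then show ?thesis using pz[OF y] x by simp
  qed
  then have "(x \<oplus> y) [^] (n + m) \<otimes> (x [^] (0::nat) \<otimes> y [^] (0::nat)) = \<zero>"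
    by (intro binomial_vanish[OF x(1) y(1)]) auto
  then show ?thesis using x y by simp
qed

lemma diff_mult_monomial:
  assumes x: "x \<in> carrier R" and y: "y \<in> carrier R"
  shows "(x \<ominus> y) \<otimes> (x [^] (i::nat) \<otimes> y [^] (j::nat)) = x [^] Suc i \<otimes> y [^] j \<ominus> x [^] i \<otimes> y [^] Suc j"
proof -
  have 1: "x \<otimes> (x [^] i \<otimes> y [^] j) = x [^] Suc i \<otimes> y [^] j" using x y by (simp add: m_ac)
  have 2: "y \<otimes> (x [^] i \<otimes> y [^] j) = x [^] i \<otimes> y [^] Suc j" using x y by (simp add: m_ac)
  have "(x \<ominus> y) \<otimes> (x [^] i \<otimes> y [^] j) = x \<otimes> (x [^] i \<otimes> y [^] j) \<ominus> y \<otimes> (x [^] i \<otimes> y [^] j)"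
    using x y by (simp add: a_minus_def l_distr l_minus)
  then show ?thesis unfolding 1 2 .
qed

text \<open>Multiplying by \<open>x - y\<close> already kills all monomials of degree \<open>N\<close> in \<open>x\<close> and \<open>y\<close>.\<close>

lemma nilpotent_diff:
  assumes x: "x \<in> carrier R" and y: "y \<in> carrier R"
    and eq: "\<And>i j i' j'. i + j \<ge> N \<Longrightarrow> i + j = i' + j' \<Longrightarrow>
      x [^] (i::nat) \<otimes> y [^] (j::nat) = x [^] (i'::nat) \<otimes> y [^] (j'::nat)"
  shows "\<exists>n::nat. (x \<ominus> y) [^] n = \<zero>"
proof -
  have xy: "x \<ominus> y \<in> carrier R" using x y by simp
  have "(x \<ominus> y) [^] Suc k \<otimes> (x [^] i \<otimes> y [^] j) = \<zero>" if "i + j + k \<ge> N" for k i j :: nat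
    using that
  proof (induction k arbitrary: i j)
    case 0
    have "(x \<ominus> y) \<otimes> (x [^] i \<otimes> y [^] j) = x [^] Suc i \<otimes> y [^] j \<ominus> x [^] i \<otimes> y [^] Suc j"
      by (rule diff_mult_monomial[OF x y])
    also have "\<dots> = \<zero>" using eq[of "Suc i" j i "Suc j"] 0 x y by (simp add: a_minus_def r_neg)
    finally show ?case using xy by simp
  next
    case (Suc k)
    have "(x \<ominus> y) [^] Suc (Suc k) \<otimes> (x [^] i \<otimes> y [^] j) =
      (x \<ominus> y) [^] Suc k \<otimes> ((x \<ominus> y) \<otimes> (x [^] i \<otimes> y [^] j))" using x y xy by (simp add: m_assoc)
    also have "(x \<ominus> y) \<otimes> (x [^] i \<otimes> y [^] j) = x [^] Suc i \<otimes> y [^] j \<ominus> x [^] i \<otimes> y [^] Suc j"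
      by (rule diff_mult_monomial[OF x y])
    also have "(x \<ominus> y) [^] Suc k \<otimes> (x [^] Suc i \<otimes> y [^] j \<ominus> x [^] i \<otimes> y [^] Suc j) =
      (x \<ominus> y) [^] Suc k \<otimes> (x [^] Suc i \<otimes> y [^] j) \<ominus> (x \<ominus> y) [^] Suc k \<otimes> (x [^] i \<otimes> y [^] Suc j)"
      using x y xy by (simp only: a_minus_def r_distr r_minus nat_pow_closed m_closed a_inv_closed)
    also have "\<dots> = \<zero>" using Suc.IH[of "Suc i" j] Suc.IH[of i "Suc j"] Suc.prems by (simp add: a_minus_def)
    finally show ?case .
  qed
  \<comment> \<open>\<open>N\<close> factors \<open>x \<ominus> y\<close> raise the degree to
    \<open>N\<close>; one more makes the two resulting monomials cancel.\<close>
  from this[of 0 0 N] show ?thesis using x y xy by (intro exI[of _ "Suc N"]) simp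
qed

lemma nilradical_ideal: "ideal (nilradical R) R"
proof -
  have mult: "a \<otimes> x \<in> nilradical R" if x: "x \<in> nilradical R" and a: "a \<in> carrier R" for a x
  proof -
    obtain n :: nat where n: "x \<in> carrier R" "x [^] n = \<zero>" using x by (auto simp: nilradical_def)
    have "(a \<otimes> x) [^] n = a [^] n \<otimes> x [^] n" using n a by (simp add: nat_pow_distrib)
    then show ?thesis using n a by (auto simp: nilradical_def)
  qed
  show ?thesis
  proof (rule idealI[OF ring_axioms])
    show "subgroup (nilradical R) (add_monoid R)"
    proof (rule add.subgroupI)
      show "nilradical R \<subseteq> carrier R" by (auto simp: nilradical_def)
      have "\<zero> [^] Suc 0 = \<zero>" by simp
      then show "nilradical R \<noteq> {}" unfolding nilradical_def by blast
      show "\<ominus> a \<in> nilradical R" if "a \<in> nilradical R" for a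
      proof -
        have "a \<in> carrier R" using that by (simp add: nilradical_def)
        then have "(\<ominus> \<one>) \<otimes> a = \<ominus> a" by (simp add: l_minus)
        then show ?thesis using mult[OF that, of "\<ominus> \<one>"] by simp
      qed
      show "a \<oplus> b \<in> nilradical R" if "a \<in> nilradical R" "b \<in> nilradical R" for a b
        using that nilpotent_add unfolding nilradical_def by blast
    qed
    fix a x assume a: "a \<in> nilradical R" and x: "x \<in> carrier R"
    show "x \<otimes> a \<in> nilradical R" by (rule mult[OF a x])
    then show "a \<otimes> x \<in> nilradical R" using a x m_comm[of a x] by (simp add: nilradical_def)
  qed
qed

end

section \<open>Rational algebras with a multiplicative basis\<close>

text \<open>Scalars act through ring elements \<open>s q\<close>, which is how rational numbers
  enter both the glider algebra and its reduction.\<close>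

locale rat_algebra = cring R for R (structure) +
  fixes s :: "rat \<Rightarrow> 'a"
  assumes s_closed [simp]: "s q \<in> carrier R"
    and s_add: "s (q + p) = s q \<oplus> s p"
    and s_mult: "s (q * p) = s q \<otimes> s p"
    and s_one: "s 1 = \<one>"
begin

lemma s_zero [simp]: "s 0 = \<zero>"
  using s_add[of 0 0] by simp

lemma s_minus: "s (- q) = \<ominus> s q"
  using s_add[of "- q" q] by (intro minus_equality[symmetric]) auto

end

text \<open>Independence of the basis is encoded by dual functionals \<open>co\<close>, because that
  is the form in which the quotient construction yields it.\<close>

locale based_algebra = rat_algebra R s for R (structure) and s +
  fixes J :: "'j set" and b :: "'j \<Rightarrow> 'a" and co :: "'j \<Rightarrow> 'a \<Rightarrow> rat"
  assumes b_closed [simp]: "j \<in> J \<Longrightarrow> b j \<in> carrier R"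
    and span: "carrier R \<subseteq> add_span R {s q \<otimes> b j |q j. j \<in> J}"
    and co_add: "x \<in> carrier R \<Longrightarrow> y \<in> carrier R \<Longrightarrow> co j (x \<oplus> y) = co j x + co j y"
    and co_basis: "j \<in> J \<Longrightarrow> i \<in> J \<Longrightarrow> co i (s q \<otimes> b j) = (if i = j then q else 0)"
begin

text \<open>Negatives need no case of their own, being absorbed by the scalar.\<close>

lemma basis_induct [consumes 1, case_names zero base add]:
  assumes x: "x \<in> carrier R" and "P \<zero>" and base: "\<And>q j. j \<in> J \<Longrightarrow> P (s q \<otimes> b j)"
    and add: "\<And>x y. x \<in> carrier R \<Longrightarrow> y \<in> carrier R \<Longrightarrow> P x \<Longrightarrow> P y \<Longrightarrow> P (x \<oplus> y)"
  shows "P x"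
  using subsetD[OF span x]
proof (induction rule: add_span_induct)
  case (minus t)
  then obtain q j where t: "t = s q \<otimes> b j" "j \<in> J" by blast
  then have "\<ominus> t = s (- q) \<otimes> b j" by (simp add: s_minus l_minus)
  then show ?case using base t by simp
next
  case (add x y)
  have "{s q \<otimes> b j |q j. j \<in> J} \<subseteq> carrier R" by auto
  then have "x \<in> carrier R" "y \<in> carrier R" using add add_span_incl by blast+
  then show ?case using add assms(4) by blast
qed (use assms in auto)

definition supp :: "'a \<Rightarrow> 'j set"
  where "supp x = {j \<in> J. co j x \<noteq> 0}"

lemma co_zero: "co j \<zero> = 0"
  using co_add[of \<zero> \<zero> j] by simp

lemma supp_add:
  assumes "x \<in> carrier R" "y \<in> carrier R"
  shows "supp (x \<oplus> y) \<subseteq> supp x \<union> supp y"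
proof
  fix j assume "j \<in> supp (x \<oplus> y)"
  then have "j \<in> J" "co j x + co j y \<noteq> 0" by (simp_all add: supp_def co_add[OF assms])
  then show "j \<in> supp x \<union> supp y" by (auto simp: supp_def)
qed

lemma finite_supp: "x \<in> carrier R \<Longrightarrow> finite (supp x)"
proof (induction rule: basis_induct)
  case zero
  then show ?case by (simp add: supp_def co_zero)
next
  case (base q j)
  then have "supp (s q \<otimes> b j) \<subseteq> {j}" by (auto simp: supp_def co_basis split: if_splits)
  then show ?case by (rule finite_subset) simp
next
  case (add x y)
  then show ?case using finite_subset[OF supp_add] by blast
qed

text \<open>The linear extension of \<open>\<phi>\<close> from the basis. The target is a field of
  characteristic zero, so that characters with values in \<open>K\<close> are covered as well as
  rational type sums.\<close>

definition ext :: "('j \<Rightarrow> 'f::field_char_0) \<Rightarrow> 'a \<Rightarrow> 'f"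
  where "ext \<phi> x = (\<Sum>j\<in>supp x. of_rat (co j x) * \<phi> j)"

lemma ext_superset: "finite F \<Longrightarrow> supp x \<subseteq> F \<Longrightarrow> F \<subseteq> J \<Longrightarrow> ext \<phi> x = (\<Sum>j\<in>F. of_rat (co j x) * \<phi> j)"
  unfolding ext_def by (intro sum.mono_neutral_left) (auto simp: supp_def)

lemma ext_add:
  assumes x: "x \<in> carrier R" and y: "y \<in> carrier R"
  shows "ext \<phi> (x \<oplus> y) = ext \<phi> x + ext \<phi> y"
proof -
  let ?F = "supp x \<union> supp y"
  have F: "finite ?F" "?F \<subseteq> J" "supp (x \<oplus> y) \<subseteq> ?F"
    using finite_supp[OF x] finite_supp[OF y] supp_add[OF x y] by (auto simp: supp_def)
  show ?thesis
    using x y by (simp add: ext_superset[OF F(1) F(3) F(2)] ext_superset[OF F(1) _ F(2)] co_add of_rat_add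
        algebra_simps sum.distrib)
qed

lemma ext_zero: "ext \<phi> \<zero> = 0"
  by (simp add: ext_def supp_def co_zero)

lemma ext_basis: "j \<in> J \<Longrightarrow> ext \<phi> (s q \<otimes> b j) = of_rat q * \<phi> j"
proof -
  assume j: "j \<in> J"
  then have "supp (s q \<otimes> b j) \<subseteq> {j}" by (auto simp: supp_def co_basis split: if_splits)
  then show ?thesis using j ext_superset[of "{j}" "s q \<otimes> b j" \<phi>] by (simp add: co_basis)
qed

lemma ext_mult:
  assumes closed: "\<And>i j. i \<in> J \<Longrightarrow> j \<in> J \<Longrightarrow> \<exists>k\<in>J. b i \<otimes> b j = b k \<and> \<phi> k = \<phi> i * \<phi> j"
    and x: "x \<in> carrier R" and y: "y \<in> carrier R"
  shows "ext \<phi> (x \<otimes> y) = ext \<phi> x * ext \<phi> y"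
  using x
proof (induction rule: basis_induct)
  case zero
  then show ?case using y by (simp add: ext_zero)
next
  case (base q i)
  from y show ?case
  proof (induction rule: basis_induct)
    case zero
    then show ?case using base by (simp add: ext_zero)
  next
    case (base p j)
    obtain k where k: "k \<in> J" "b i \<otimes> b j = b k" "\<phi> k = \<phi> i * \<phi> j" using closed \<open>i \<in> J\<close> \<open>j \<in> J\<close> by blast
    have "s q \<otimes> b i \<otimes> (s p \<otimes> b j) = (s q \<otimes> s p) \<otimes> (b i \<otimes> b j)"
      using \<open>i \<in> J\<close> \<open>j \<in> J\<close> by (simp add: m_ac)
    also have "\<dots> = s (q * p) \<otimes> b k" by (simp add: s_mult k)
    finally show ?case using k \<open>i \<in> J\<close> \<open>j \<in> J\<close> by (simp add: ext_basis of_rat_mult)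
  next
    case (add y z)
    then show ?case using \<open>i \<in> J\<close> by (simp add: r_distr ext_add algebra_simps)
  qed
next
  case (add x z)
  then show ?case using y by (simp add: l_distr ext_add algebra_simps)
qed

text \<open>Where \<open>\<phi>\<close> is multiplicative on the basis its extension is a ring
  homomorphism to a field, and a field has no nonzero nilpotent elements.\<close>

lemma ext_nilpotent:
  assumes closed: "\<And>i j. i \<in> J \<Longrightarrow> j \<in> J \<Longrightarrow> \<exists>k\<in>J. b i \<otimes> b j = b k \<and> \<phi> k = \<phi> i * \<phi> j"
    and one: "e \<in> J" "b e = \<one>" "\<phi> e = 1"
    and x: "x \<in> carrier R" "x [^] (n::nat) = \<zero>"
  shows "ext \<phi> x = 0"
proof -
  have e1: "ext \<phi> \<one> = 1" using ext_basis[OF one(1), of \<phi> 1] one by (simp add: s_one)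
  have "ext \<phi> (x [^] k) = ext \<phi> x ^ k" for k :: nat
  proof (induction k)
    case (Suc k)
    have "ext \<phi> (x [^] k \<otimes> x) = ext \<phi> (x [^] k) * ext \<phi> x"
      using x(1) by (intro ext_mult closed) simp_all
    then show ?case using Suc by simp
  qed (simp add: e1)
  from this[of n] have "ext \<phi> x ^ n = 0" using x by (simp add: ext_zero)
  then show ?thesis by simp
qed

end

section \<open>Linear maps between algebras, given on a basis\<close>

locale based_pair = B: based_algebra R s J b co + T: rat_algebra R' s'
  for R (structure) and s J and b :: "'j \<Rightarrow> 'a" and co and R' (structure) and s'
begin

text \<open>The linear extension once more, now with values in an algebra. It yields the projections
  onto sets of types, with equal source and target, and the induction maps.\<close>

definition lin :: "('j \<Rightarrow> 'c) \<Rightarrow> 'a \<Rightarrow> 'c"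
  where "lin \<phi> x = (\<Oplus>\<^bsub>R'\<^esub>j\<in>B.supp x. s' (co j x) \<otimes>\<^bsub>R'\<^esub> \<phi> j)"

context
  fixes \<phi> :: "'j \<Rightarrow> 'c"
  assumes \<phi>: "\<And>j. j \<in> J \<Longrightarrow> \<phi> j \<in> carrier R'"
begin

lemma lin_superset:
  assumes "finite F" "B.supp x \<subseteq> F" "F \<subseteq> J"
  shows "lin \<phi> x = (\<Oplus>\<^bsub>R'\<^esub>j\<in>F. s' (co j x) \<otimes>\<^bsub>R'\<^esub> \<phi> j)"
  unfolding lin_def using assms \<phi>
  by (intro T.add.finprod_mono_neutral_cong_left) (auto simp: B.supp_def)

lemma lin_closed: "lin \<phi> x \<in> carrier R'"
  unfolding lin_def using \<phi> by (intro T.finsum_closed) (auto simp: B.supp_def)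

lemma lin_add:
  assumes x: "x \<in> carrier R" and y: "y \<in> carrier R"
  shows "lin \<phi> (x \<oplus> y) = lin \<phi> x \<oplus>\<^bsub>R'\<^esub> lin \<phi> y"
proof -
  let ?F = "B.supp x \<union> B.supp y"
  have F: "finite ?F" "?F \<subseteq> J" "B.supp (x \<oplus> y) \<subseteq> ?F"
    using B.finite_supp[OF x] B.finite_supp[OF y] B.supp_add[OF x y] by (auto simp: B.supp_def)
  have cl: "(\<lambda>j. s' (co j z) \<otimes>\<^bsub>R'\<^esub> \<phi> j) \<in> ?F \<rightarrow> carrier R'" for z using \<phi> F(2) by auto
  have "lin \<phi> (x \<oplus> y) = (\<Oplus>\<^bsub>R'\<^esub>j\<in>?F. s' (co j (x \<oplus> y)) \<otimes>\<^bsub>R'\<^esub> \<phi> j)" by (rule lin_superset[OF F(1,3,2)])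
  also have "\<dots> = (\<Oplus>\<^bsub>R'\<^esub>j\<in>?F. s' (co j x) \<otimes>\<^bsub>R'\<^esub> \<phi> j \<oplus>\<^bsub>R'\<^esub> s' (co j y) \<otimes>\<^bsub>R'\<^esub> \<phi> j)"
    using \<phi> F(2) x y by (intro T.finsum_cong') (auto simp: B.co_add T.s_add T.l_distr)
  also have "\<dots> = (\<Oplus>\<^bsub>R'\<^esub>j\<in>?F. s' (co j x) \<otimes>\<^bsub>R'\<^esub> \<phi> j) \<oplus>\<^bsub>R'\<^esub> (\<Oplus>\<^bsub>R'\<^esub>j\<in>?F. s' (co j y) \<otimes>\<^bsub>R'\<^esub> \<phi> j)"
    by (rule T.finsum_addf[OF cl cl])
  also have "\<dots> = lin \<phi> x \<oplus>\<^bsub>R'\<^esub> lin \<phi> y" using F by (simp add: lin_superset[OF F(1) _ F(2)])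
  finally show ?thesis .
qed

lemma lin_zero: "lin \<phi> \<zero> = \<zero>\<^bsub>R'\<^esub>"
  by (simp add: lin_def B.supp_def B.co_zero)

lemma lin_basis: "j \<in> J \<Longrightarrow> lin \<phi> (s q \<otimes> b j) = s' q \<otimes>\<^bsub>R'\<^esub> \<phi> j"
proof -
  assume j: "j \<in> J"
  then have "B.supp (s q \<otimes> b j) \<subseteq> {j}" by (auto simp: B.supp_def B.co_basis split: if_splits)
  then show ?thesis using j \<phi> lin_superset[of "{j}" "s q \<otimes> b j"] by (simp add: B.co_basis)
qed

lemma lin_scale: "x \<in> carrier R \<Longrightarrow> lin \<phi> (s q \<otimes> x) = s' q \<otimes>\<^bsub>R'\<^esub> lin \<phi> x"
proof (induction rule: B.basis_induct)
  case zero
  then show ?case by (simp add: lin_zero)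
next
  case (base p j)
  then have "s q \<otimes> (s p \<otimes> b j) = s (q * p) \<otimes> b j" by (simp add: B.s_mult B.m_assoc)
  then show ?case using base \<phi> by (simp add: lin_basis T.s_mult T.m_assoc)
next
  case (add x y)
  then show ?case by (simp add: B.r_distr lin_add T.r_distr lin_closed)
qed

lemma lin_mult:
  assumes closed: "\<And>i j. i \<in> J \<Longrightarrow> j \<in> J \<Longrightarrow> \<exists>k\<in>J. b i \<otimes> b j = b k \<and> \<phi> k = \<phi> i \<otimes>\<^bsub>R'\<^esub> \<phi> j"
    and x: "x \<in> carrier R" and y: "y \<in> carrier R"
  shows "lin \<phi> (x \<otimes> y) = lin \<phi> x \<otimes>\<^bsub>R'\<^esub> lin \<phi> y"
  using x
proof (induction rule: B.basis_induct)
  case zero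
  then show ?case using y by (simp add: lin_zero lin_closed)
next
  case (base q i)
  from y show ?case
  proof (induction rule: B.basis_induct)
    case zero
    then show ?case using base by (simp add: lin_zero lin_closed)
  next
    case (base p j)
    obtain k where k: "k \<in> J" "b i \<otimes> b j = b k" "\<phi> k = \<phi> i \<otimes>\<^bsub>R'\<^esub> \<phi> j" using closed \<open>i \<in> J\<close> \<open>j \<in> J\<close> by blast
    have "s q \<otimes> b i \<otimes> (s p \<otimes> b j) = (s q \<otimes> s p) \<otimes> (b i \<otimes> b j)"
      using \<open>i \<in> J\<close> \<open>j \<in> J\<close> by (simp add: B.m_ac)
    also have "\<dots> = s (q * p) \<otimes> b k" by (simp add: B.s_mult k)
    finally show ?case using k \<phi> \<open>i \<in> J\<close> \<open>j \<in> J\<close> by (simp add: lin_basis T.s_mult T.m_ac)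
  next
    case (add y z)
    then show ?case using \<open>i \<in> J\<close> by (simp add: B.r_distr lin_add T.r_distr lin_closed)
  qed
next
  case (add x z)
  then show ?case using y by (simp add: B.l_distr lin_add T.l_distr lin_closed)
qed

lemma lin_unique:
  assumes f: "\<And>x y. x \<in> carrier R \<Longrightarrow> y \<in> carrier R \<Longrightarrow> f (x \<oplus> y) = f x \<oplus>\<^bsub>R'\<^esub> f y"
    and c: "\<And>x. x \<in> carrier R \<Longrightarrow> f x \<in> carrier R'"
    and base: "\<And>q j. j \<in> J \<Longrightarrow> f (s q \<otimes> b j) = s' q \<otimes>\<^bsub>R'\<^esub> \<phi> j"
    and x: "x \<in> carrier R"
  shows "f x = lin \<phi> x"
  using x
proof (induction rule: B.basis_induct)
  case zero
  have "f \<zero> \<oplus>\<^bsub>R'\<^esub> f \<zero> = f \<zero>" using f[of \<zero> \<zero>] by simp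
  then show ?case using c[of \<zero>] by (simp add: lin_zero)
qed (use base lin_basis f lin_add in auto)

end

end

sublocale based_algebra \<subseteq> self: based_pair R s J b co R s ..

context based_algebra
begin

lemma expand: "x \<in> carrier R \<Longrightarrow> self.lin b x = x"
  using self.lin_unique[of b "\<lambda>x. x" x] by simp

lemma zeroI: "x \<in> carrier R \<Longrightarrow> (\<And>j. j \<in> J \<Longrightarrow> co j x = 0) \<Longrightarrow> x = \<zero>"
proof -
  assume x: "x \<in> carrier R" and 0: "\<And>j. j \<in> J \<Longrightarrow> co j x = 0"
  have "supp x = {}" using 0 by (auto simp: supp_def)
  then show "x = \<zero>" using expand[OF x] by (simp add: self.lin_def)
qed

definition tsum :: "('j \<Rightarrow> 't) \<Rightarrow> 't \<Rightarrow> 'a \<Rightarrow> rat"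
  where "tsum ty t = ext (\<lambda>j. if ty j = t then 1 else 0)"

lemma tsum_add: "x \<in> carrier R \<Longrightarrow> y \<in> carrier R \<Longrightarrow> tsum ty t (x \<oplus> y) = tsum ty t x + tsum ty t y"
  by (simp add: tsum_def ext_add)

lemma tsum_basis: "j \<in> J \<Longrightarrow> tsum ty t (s q \<otimes> b j) = (if ty j = t then q else 0)"
  by (simp add: tsum_def ext_basis of_rat_eq_id)

lemma tsum_zero: "tsum ty t \<zero> = 0"
  by (simp add: tsum_def ext_zero)

lemma tsum_minus: "x \<in> carrier R \<Longrightarrow> tsum ty t (\<ominus> x) = - tsum ty t x"
  by (rule additive_minus[of "tsum ty t"]) (simp_all add: tsum_add)

text \<open>
  Replacing every basis element by a fixed one of the same type changes an element by a
  nilpotent one.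
\<close>

lemma nilpotent_if_tsum_zero:
  assumes nil: "\<And>i j. i \<in> J \<Longrightarrow> j \<in> J \<Longrightarrow> ty i = ty j \<Longrightarrow> \<exists>n::nat. (b i \<ominus> b j) [^] n = \<zero>"
    and x: "x \<in> carrier R" and 0: "\<And>t. tsum ty t x = 0"
  shows "\<exists>n::nat. x [^] n = \<zero>"
proof -
  interpret I: ideal "nilradical R" R by (rule nilradical_ideal)
  define r where "r j = (SOME i. i \<in> J \<and> ty i = ty j)" for j
  have r: "r j \<in> J" "ty (r j) = ty j" if "j \<in> J" for j
    using someI[of "\<lambda>i. i \<in> J \<and> ty i = ty j" j] that unfolding r_def by blast+
  have rr: "r i = r j" if "ty i = ty j" for i j using that by (simp add: r_def)
  let ?E = "self.lin (\<lambda>j. b (r j))"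
  have cl: "b (r j) \<in> carrier R" if "j \<in> J" for j using r that by simp
  note E = self.lin_closed[of "\<lambda>j. b (r j)", OF cl] self.lin_add[of "\<lambda>j. b (r j)", OF cl]
    self.lin_basis[of "\<lambda>j. b (r j)", OF cl] self.lin_zero[of "\<lambda>j. b (r j)", OF cl]
  \<comment> \<open>Under \<open>?E\<close> all coefficients of one type are collected at its
    representative, so vanishing type sums give \<open>?E x = \<zero>\<close>.\<close>
  have coE: "co i (?E y) = (if \<exists>j\<in>J. i = r j then tsum ty (ty i) y else 0)" if i: "i \<in> J" and y: "y \<in> carrier R" for i y
    using y
  proof (induction rule: basis_induct)
    case zero
    then show ?case by (simp add: E co_zero tsum_zero)
  next
    case (base q j)
    have "i = r j \<longleftrightarrow> (\<exists>j\<in>J. i = r j) \<and> ty j = ty i" using r rr base by metis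
    then show ?case using base i r by (simp add: E co_basis tsum_basis)
  next
    case (add x y)
    then show ?case by (simp add: E co_add tsum_add)
  qed
  have "?E x = \<zero>" using coE x 0 E(1) by (intro zeroI) (simp_all)
  moreover have "y \<ominus> ?E y \<in> nilradical R" if y: "y \<in> carrier R" for y
    using y
  proof (induction rule: basis_induct)
    case zero
    then show ?case using E(4) I.zero_closed by (simp add: a_minus_def)
  next
    case (base q j)
    obtain n :: nat where "(b j \<ominus> b (r j)) [^] n = \<zero>" using nil[of j "r j"] r base by metis
    moreover have "b j \<ominus> b (r j) \<in> carrier R" using b_closed[OF base] b_closed[OF r(1)[OF base]] by simp
    ultimately have "b j \<ominus> b (r j) \<in> nilradical R" unfolding nilradical_def by blast
    then have "s q \<otimes> (b j \<ominus> b (r j)) \<in> nilradical R" by (rule I.I_l_closed) simp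
    moreover have "s q \<otimes> (b j \<ominus> b (r j)) = s q \<otimes> b j \<ominus> ?E (s q \<otimes> b j)"
      using base r(1)[OF base] by (simp add: E a_minus_def r_distr r_minus)
    ultimately show ?case by simp
  next
    case (add x y)
    have "x \<oplus> y \<ominus> ?E (x \<oplus> y) = (x \<ominus> ?E x) \<oplus> (y \<ominus> ?E y)"
      using add E(1) by (simp add: E a_minus_def minus_add a_ac)
    then show ?case using add I.a_closed by simp
  qed
  ultimately have "x \<ominus> \<zero> \<in> nilradical R" using x by metis
  then have "x \<in> nilradical R" using x by (simp add: a_minus_def)
  then show ?thesis unfolding nilradical_def by blast
qed

end

section \<open>Characters\<close>

text \<open>Dedekind's argument: the relation at a product of \<open>h\<close> and \<open>g\<close>
  minus \<open>F t0 h\<close> times the relation at \<open>g\<close> loses the term for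
  \<open>t0\<close>. The other coefficients become \<open>a u * (F u h - F t0 h)\<close>, and
  \<open>h\<close> is chosen to make this factor nonzero for a given \<open>u\<close>.\<close>

lemma character_independence:
  fixes F :: "'t \<Rightarrow> 'g \<Rightarrow> 'k::field"
  assumes "finite C"
    and H: "monoid (M\<lparr>carrier := H\<rparr>)"
    and hom: "\<And>t g h. t \<in> C \<Longrightarrow> g \<in> H \<Longrightarrow> h \<in> H \<Longrightarrow> F t (g \<otimes>\<^bsub>M\<^esub> h) = F t g * F t h"
    and one: "\<And>t. t \<in> C \<Longrightarrow> F t \<one>\<^bsub>M\<^esub> = 1"
    and neq: "\<And>t u. t \<in> C \<Longrightarrow> u \<in> C \<Longrightarrow> t \<noteq> u \<Longrightarrow> \<exists>h\<in>H. F t h \<noteq> F u h"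
    and rel: "\<And>h. h \<in> H \<Longrightarrow> (\<Sum>t\<in>C. a t * F t h) = 0"
  shows "\<forall>t\<in>C. a t = 0"
  using assms(1) hom one neq rel
proof (induction C arbitrary: a rule: finite_induct)
  case (insert t0 C)
  interpret H: monoid "M\<lparr>carrier := H\<rparr>" by (rule H)
  have 1: "\<one>\<^bsub>M\<^esub> \<in> H" using H.one_closed by simp
  have "a t = 0" if t: "t \<in> C" for t
  proof -
    obtain h where h: "h \<in> H" "F t h \<noteq> F t0 h" using insert.prems(3)[of t t0] t insert.hyps by blast
    have "(\<Sum>u\<in>C. (a u * (F u h - F t0 h)) * F u g) = 0" if g: "g \<in> H" for g
    proof -
      have hg: "h \<otimes>\<^bsub>M\<^esub> g \<in> H" using H.m_closed[of h g] h g by simp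
      have "(\<Sum>u\<in>insert t0 C. a u * F u (h \<otimes>\<^bsub>M\<^esub> g)) - F t0 h * (\<Sum>u\<in>insert t0 C. a u * F u g) = 0"
        using insert.prems(4) hg g by simp
      moreover have "(\<Sum>u\<in>insert t0 C. a u * F u (h \<otimes>\<^bsub>M\<^esub> g)) = (\<Sum>u\<in>insert t0 C. a u * (F u h * F u g))"
        using insert.prems(1) h g by (intro sum.cong) auto
      ultimately have "(\<Sum>u\<in>insert t0 C. (a u * (F u h - F t0 h)) * F u g) = 0"
        by (simp add: sum_distrib_left sum_subtractf algebra_simps)
      then show ?thesis using insert.hyps by simp
    qed
    then have "\<forall>u\<in>C. a u * (F u h - F t0 h) = 0"
      using insert.prems by (intro insert.IH) auto
    then show ?thesis using h t by auto
  qed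
  moreover have "a t0 = 0"
    using insert.prems(4)[OF 1] insert.prems(2)[of t0] insert.hyps calculation by simp
  ultimately show ?case by blast
qed auto

text \<open>Grouping the sum by type shows that a function of the type alone sees nothing but type
  sums.\<close>

lemma (in based_algebra) ext_by_types:
  assumes x: "x \<in> carrier R"
  shows "ext (\<lambda>j. \<psi> (ty j)) x = (\<Sum>t\<in>ty ` supp x. of_rat (tsum ty t x) * \<psi> t)"
proof -
  have "ext (\<lambda>j. \<psi> (ty j)) x = (\<Sum>t\<in>ty ` supp x. \<Sum>j\<in>{j \<in> supp x. ty j = t}. of_rat (co j x) * \<psi> (ty j))"
    unfolding ext_def by (rule sum.image_gen[OF finite_supp[OF x]])
  also have "\<dots> = (\<Sum>t\<in>ty ` supp x. of_rat (tsum ty t x) * \<psi> t)"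
  proof (rule sum.cong[OF refl])
    fix t
    have "tsum ty t x = (\<Sum>j\<in>{j \<in> supp x. ty j = t}. co j x)"
      unfolding tsum_def ext_def using finite_supp[OF x]
      by (simp add: of_rat_eq_id sum.inter_filter if_distrib cong: if_cong)
    then show "(\<Sum>j\<in>{j \<in> supp x. ty j = t}. of_rat (co j x) * \<psi> (ty j)) = of_rat (tsum ty t x) * \<psi> t"
      by (simp add: of_rat_sum sum_distrib_right)
  qed
  finally show ?thesis .
qed

section \<open>Matrix coefficients and stabilisers of lines\<close>

context fin_grp
begin

definition pair :: "('a \<Rightarrow> 'k::field) \<Rightarrow> ('a \<Rightarrow> 'k) \<Rightarrow> 'k"
  where "pair x w = (\<Sum>g\<in>carrier G. x g * w g)"

text \<open>The matrix coefficients of \<open>v\<close>, one for each linear form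
  \<open>\<xi>\<close> on the module. By \<open>ann_iff\<close> the annihilator of \<open>v\<close>
  is their orthogonal complement under \<open>pair\<close>.\<close>

definition coefs :: "('a, 'k::field) rep \<Rightarrow> (nat \<Rightarrow> 'k) \<Rightarrow> ('a \<Rightarrow> 'k) set"
  where "coefs V v = {\<lambda>g. \<Sum>i<rdim V. \<xi> i * act V g v i |\<xi>. True}"

lemma ann_iff: "x \<in> ann V v \<longleftrightarrow> (\<forall>i<rdim V. pair x (\<lambda>g. act V g v i) = 0)"
proof -
  have "kG_act G V x v = 0 \<longleftrightarrow> (\<forall>i. kG_act G V x v i = 0)" by (auto simp: fun_eq_iff)
  also have "\<dots> \<longleftrightarrow> (\<forall>i<rdim V. kG_act G V x v i = 0)"
    using kG_act_kspace[of V x v] by (meson kspaceD not_less)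
  finally show ?thesis by (simp add: ann_def kG_act_apply pair_def)
qed

lemma pair_comb: "pair x (\<lambda>g. \<Sum>i<n. \<xi> i * f i g) = (\<Sum>i<n. \<xi> i * pair x (f i))"
  unfolding pair_def by (simp add: sum_distrib_left sum.swap[of _ "carrier G"] mult_ac)

lemma coord_coefs: "i < rdim V \<Longrightarrow> (\<lambda>g. act V g v i) \<in> coefs V v"
  unfolding coefs_def mem_Collect_eq
  by (intro exI[of _ "\<lambda>j. if j = i then 1 else 0"]) (simp add: if_distrib[of "\<lambda>x. x * _"] cong: if_cong)

lemma pair_mult: "pair (\<lambda>g. x g * a g) w = pair x (\<lambda>g. a g * w g)"
  by (simp add: pair_def mult.assoc)

text \<open>The matrix coefficients of \<open>v \<otimes> w\<close> are spanned by products of those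
  of \<open>v\<close> and of \<open>w\<close>, and \<open>pair\<close> lets the first factor be
  moved onto \<open>x\<close>.\<close>

lemma ann_tensor:
  "x \<in> ann (rep_tensor V W) (vec_tensor (rdim W) v w) \<longleftrightarrow> (\<forall>a\<in>coefs V v. (\<lambda>g. x g * a g) \<in> ann W w)"
proof -
  let ?c = "\<lambda>i j. pair x (\<lambda>g. act V g v i * act W g w j) = 0"
  have "x \<in> ann (rep_tensor V W) (vec_tensor (rdim W) v w) \<longleftrightarrow>
    (\<forall>p<rdim V * rdim W. ?c (p div rdim W) (p mod rdim W))"
    unfolding ann_iff act_tensor by (simp add: rep_tensor_def vec_tensor_def)
  also have "\<dots> \<longleftrightarrow> (\<forall>i<rdim V. \<forall>j<rdim W. ?c i j)"
  proof (intro iffI allI impI)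
    fix i j assume p: "\<forall>p<rdim V * rdim W. ?c (p div rdim W) (p mod rdim W)" and ij: "i < rdim V" "j < rdim W"
    have "i * rdim W + j < (i + 1) * rdim W" using ij by simp
    also have "\<dots> \<le> rdim V * rdim W" using ij by (intro mult_right_mono) auto
    finally show "?c i j" using p[rule_format, of "i * rdim W + j"] ij by simp
  next
    fix p assume c: "\<forall>i<rdim V. \<forall>j<rdim W. ?c i j" and p: "p < rdim V * rdim W"
    then have "rdim W > 0" by (cases "rdim W") auto
    then show "?c (p div rdim W) (p mod rdim W)"
      using c p less_mult_imp_div_less by auto
  qed
  also have "\<dots> \<longleftrightarrow> (\<forall>a\<in>coefs V v. (\<lambda>g. x g * a g) \<in> ann W w)"
  proof
    assume c: "\<forall>i<rdim V. \<forall>j<rdim W. ?c i j"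
    show "\<forall>a\<in>coefs V v. (\<lambda>g. x g * a g) \<in> ann W w"
    proof
      fix a assume "a \<in> coefs V v"
      then obtain \<xi> where a: "a = (\<lambda>g. \<Sum>i<rdim V. \<xi> i * act V g v i)" by (auto simp: coefs_def)
      have "pair x (\<lambda>g. a g * act W g w j) = 0" if "j < rdim W" for j
      proof -
        have "pair x (\<lambda>g. a g * act W g w j) = pair x (\<lambda>g. \<Sum>i<rdim V. \<xi> i * (act V g v i * act W g w j))"
          unfolding a by (simp add: sum_distrib_right mult.assoc)
        then show ?thesis using c that by (simp add: pair_comb)
      qed
      then show "(\<lambda>g. x g * a g) \<in> ann W w" by (simp add: ann_iff pair_mult)
    qed
  next
    assume r: "\<forall>a\<in>coefs V v. (\<lambda>g. x g * a g) \<in> ann W w"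
    show "\<forall>i<rdim V. \<forall>j<rdim W. ?c i j"
    proof (intro allI impI)
      fix i j assume i: "i < rdim V" and "j < rdim W"
      have "(\<lambda>g. x g * act V g v i) \<in> ann W w" using bspec[OF r coord_coefs[OF i]] .
      then show "?c i j" using \<open>j < rdim W\<close> by (simp add: ann_iff pair_mult)
    qed
  qed
  finally show ?thesis .
qed

section \<open>Line stabilizers and their characters\<close>

lemma act_inv: "is_rep G V \<Longrightarrow> g \<in> carrier G \<Longrightarrow> v \<in> kspace (rdim V) \<Longrightarrow> act V (inv g) (act V g v) = v"
  using act_mult[of V "inv g" g v] act_one[of V v] by simp

lemma act_nonzero: "pointed V v \<Longrightarrow> g \<in> carrier G \<Longrightarrow> act V g v \<noteq> 0"
  using act_inv[of V g v] kk.linear_0[OF klin_act[of V "inv g"]] by (auto simp: pointed_def)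

text \<open>The graph of the character by which the stabiliser of the line \<open>Kv\<close> acts on it.\<close>

definition gr :: "('a, 'k::field) rep \<Rightarrow> (nat \<Rightarrow> 'k) \<Rightarrow> ('a \<times> 'k) set"
  where "gr V v = {(h, c). h \<in> carrier G \<and> act V h v = vscale c v}"

text \<open>\<open>h v = c v\<close> says that \<open>h - c\<close> annihilates \<open>v\<close>. So
  the type is already visible in the annihilator and becomes a function on the index set of the
  basis.\<close>

definition ty :: "('a \<Rightarrow> 'k::field) set \<Rightarrow> ('a \<times> 'k) set"
  where "ty j = {(h, c). h \<in> carrier G \<and> (\<lambda>g. delta h g - c * delta \<one> g) \<in> j}"

lemma ty_ann: "pointed V v \<Longrightarrow> ty (ann V v) = gr V v"
proof -
  assume V: "pointed V v"
  have "kG_act G V (\<lambda>g. delta h g - c * delta \<one> g) v = act V h v - vscale c v" if "h \<in> carrier G" for h c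
  proof -
    have "kG_act G V (\<lambda>g. delta h g - c * delta \<one> g) v =
        kG_act G V (delta h) v - vscale c (kG_act G V (delta \<one>) v)"
      by (rule ext) (simp add: kG_act_apply vscale_apply sum_subtractf algebra_simps sum_distrib_left)
    then show ?thesis
      using V act_one[of V v] by (simp add: kG_act_delta[OF that] kG_act_delta[OF one_closed] pointed_def)
  qed
  then show ?thesis by (auto simp: ty_def gr_def ann_def)
qed

lemma gr_unique: "pointed V v \<Longrightarrow> (h, c) \<in> gr V v \<Longrightarrow> (h, d) \<in> gr V v \<Longrightarrow> c = d"
  by (auto simp: gr_def pointed_def kv.scale_cancel_right)

lemma gr_one: "pointed V v \<Longrightarrow> (\<one>, 1) \<in> gr V v"
  by (simp add: gr_def pointed_def act_one)

lemma gr_mult: "pointed V v \<Longrightarrow> (g, c) \<in> gr V v \<Longrightarrow> (h, d) \<in> gr V v \<Longrightarrow> (g \<otimes> h, c * d) \<in> gr V v"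
  by (auto simp: gr_def pointed_def act_mult kk.linear_scale[OF klin_act] mult.commute)

lemma gr_nonzero: "pointed V v \<Longrightarrow> (h, c) \<in> gr V v \<Longrightarrow> c \<noteq> 0"
  using act_nonzero[of V v h] by (auto simp: gr_def)

lemma gr_pow:
  assumes "pointed V v" "(h, c) \<in> gr V v"
  shows "(h [^] (n::nat), c ^ n) \<in> gr V v"
proof (induction n)
  case (Suc n)
  have "(h [^] n \<otimes> h, c ^ n * c) \<in> gr V v" by (rule gr_mult[OF assms(1) Suc assms(2)])
  then show ?case by (simp add: mult.commute)
qed (simp add: gr_one[OF assms(1)])

lemma gr_carrier: "(h, c) \<in> gr V v \<Longrightarrow> h \<in> carrier G"
  by (simp add: gr_def)

text \<open>The values of the character are roots of unity of order dividing \<open>|G|\<close>,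
  which is the source of the period of high powers.\<close>

lemma gr_order:
  assumes V: "pointed V v" and h: "(h, c) \<in> gr V v"
  shows "c ^ card (carrier G) = 1"
proof -
  have "h [^] card (carrier G) = \<one>"
    using pow_order_eq_1[OF gr_carrier[OF h]] by (simp add: Coset.order_def)
  then have "(\<one>, c ^ card (carrier G)) \<in> gr V v" using gr_pow[OF V h, of "card (carrier G)"] by simp
  then show ?thesis using gr_unique[OF V _ gr_one[OF V]] by blast
qed

lemma gr_inv: "pointed V v \<Longrightarrow> (h, c) \<in> gr V v \<Longrightarrow> (inv h, inverse c) \<in> gr V v"
proof -
  assume V: "pointed V v" and h: "(h, c) \<in> gr V v"
  have "v = act V (inv h) (vscale c v)" using h V act_inv[of V h v] by (simp add: gr_def pointed_def)
  then have "vscale (inverse c) v = vscale (inverse c) (vscale c (act V (inv h) v))"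
    by (simp add: kk.linear_scale[OF klin_act])
  then show ?thesis using gr_nonzero[OF V h] gr_carrier[OF h] by (simp add: gr_def)
qed

lemma gr_subgroup: "pointed V v \<Longrightarrow> subgroup (Domain (gr V v)) G"
proof (rule subgroupI)
  assume V: "pointed V v"
  show "Domain (gr V v) \<subseteq> carrier G" by (auto simp: gr_def)
  show "Domain (gr V v) \<noteq> {}" using gr_one[OF V] by blast
  show "inv a \<in> Domain (gr V v)" if "a \<in> Domain (gr V v)" for a using that gr_inv[OF V] by blast
  show "a \<otimes> b \<in> Domain (gr V v)" if "a \<in> Domain (gr V v)" "b \<in> Domain (gr V v)" for a b
    using that gr_mult[OF V] by blast
qed

lemma gr_sum:
  assumes V: "pointed V v"
  shows "(\<Sum>(h, c)\<in>gr V v. f h c) = (\<Sum>h\<in>Domain (gr V v). f h (THE c. (h, c) \<in> gr V v))"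
proof -
  have the: "(THE c. (h, c) \<in> gr V v) = c" if "(h, c) \<in> gr V v" for h c
    using that gr_unique[OF V] by blast
  show ?thesis
  proof (rule sum.reindex_bij_witness[where i = "\<lambda>h. (h, THE c. (h, c) \<in> gr V v)" and j = fst])
    fix h assume "h \<in> Domain (gr V v)"
    then show "(h, THE c. (h, c) \<in> gr V v) \<in> gr V v" using the by force
  qed (auto simp: the)
qed

lemma finite_gr: "pointed V v \<Longrightarrow> finite (gr V v)"
proof -
  assume V: "pointed V v"
  have "inj_on fst (gr V v)" using gr_unique[OF V] by (auto intro!: inj_onI)
  moreover have "fst ` gr V v \<subseteq> carrier G" by (auto simp: gr_def)
  ultimately show ?thesis using fin finite_imageD finite_subset by metis
qed

text \<open>A nonzero pure tensor determines its factors up to scalars. If it is an eigenvector of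
  \<open>h\<close>, then \<open>h v\<close> and \<open>h w\<close> must be proportional to
  \<open>v\<close> and \<open>w\<close>.\<close>

lemma gr_tensor:
  assumes V: "pointed V v" and W: "pointed W w"
  shows "gr (rep_tensor V W) (vec_tensor (rdim W) v w) = {(h, c * d) |h c d. (h, c) \<in> gr V v \<and> (h, d) \<in> gr W w}"
proof (intro equalityI subsetI)
  fix p assume "p \<in> {(h, c * d) |h c d. (h, c) \<in> gr V v \<and> (h, d) \<in> gr W w}"
  then obtain h c d where p: "p = (h, c * d)" "(h, c) \<in> gr V v" "(h, d) \<in> gr W w" by blast
  have "vec_tensor (rdim W) (vscale c v) (vscale d w) = vscale (c * d) (vec_tensor (rdim W) v w)"
    by (rule ext) (simp add: vec_tensor_def vscale_def)
  then show "p \<in> gr (rep_tensor V W) (vec_tensor (rdim W) v w)"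
    using p by (simp add: gr_def act_tensor)
next
  fix p assume "p \<in> gr (rep_tensor V W) (vec_tensor (rdim W) v w)"
  then obtain h e where p: "p = (h, e)" "h \<in> carrier G"
    "vec_tensor (rdim W) (act V h v) (act W h w) = vscale e (vec_tensor (rdim W) v w)"
    unfolding gr_def act_tensor by blast
  let ?m = "rdim W"
  have k: "w \<in> kspace ?m" "v \<in> kspace (rdim V)" using V W by (auto simp: pointed_def)
  have prod: "act V h v i * act W h w j = e * (v i * w j)" for i j
  proof (cases "j < ?m")
    case True
    then show ?thesis using fun_cong[OF p(3), of "i * ?m + j"] by (simp add: vec_tensor_def vscale_def)
  next
    case False
    then show ?thesis using kspaceD[OF k(1)] kspaceD[OF act_kspace[of W h w]] by simp
  qed
  \<comment> \<open>Nonzero coordinates of \<open>h v\<close> and \<open>h w\<close>; dividing by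
    them yields the two eigenvalues.\<close>
  obtain i where i: "act V h v i \<noteq> 0" using act_nonzero[OF V p(2)] by (metis ext zero_fun_apply)
  obtain j where j: "act W h w j \<noteq> 0" using act_nonzero[OF W p(2)] by (metis ext zero_fun_apply)
  define c where "c = e * w j / act W h w j"
  define d where "d = e * v i / act V h v i"
  have c: "(h, c) \<in> gr V v"
  proof -
    have "act V h v k = c * v k" for k using j prod[of k j] by (simp add: c_def field_simps)
    then show ?thesis using p(2) by (simp add: gr_def vscale_def fun_eq_iff)
  qed
  have d: "(h, d) \<in> gr W w"
  proof -
    have "act W h w k = d * w k" for k using i prod[of i k] by (simp add: d_def field_simps)
    then show ?thesis using p(2) by (simp add: gr_def vscale_def fun_eq_iff)
  qed
  have "e = c * d"
  proof -
    have "act V h v i = c * v i" "act W h w j = d * w j" using c d by (auto simp: gr_def vscale_def fun_eq_iff)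
    then have "c * d * (v i * w j) = e * (v i * w j)" using prod[of i j] by (simp add: mult_ac)
    moreover have "v i * w j \<noteq> 0" using prod[of i j] i j by auto
    ultimately show ?thesis by simp
  qed
  then show "p \<in> {(h, c * d) |h c d. (h, c) \<in> gr V v \<and> (h, d) \<in> gr W w}" using c d p(1) by blast
qed

lemma coefs_semi:
  assumes V: "pointed V v" and w: "w \<in> coefs V v" and h: "(h, c) \<in> gr V v" and g: "g \<in> carrier G"
  shows "w (g \<otimes> h) = c * w g"
proof -
  have "act V (g \<otimes> h) v = vscale c (act V g v)"
    using V h g by (simp add: gr_def act_mult pointed_def kk.linear_scale[OF klin_act])
  then show ?thesis using w by (auto simp: coefs_def vscale_def sum_distrib_left mult_ac)
qed

lemma coefs_nonzero:
  assumes V: "pointed V v" and g: "g \<in> carrier G"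
  shows "\<exists>w\<in>coefs V v. w g \<noteq> 0"
proof -
  obtain i where i: "act V g v i \<noteq> 0" using act_nonzero[OF V g] by (auto simp: fun_eq_iff)
  then have "i < rdim V" using kspaceD[OF act_kspace[of V g v]] not_less by blast
  then show ?thesis using coord_coefs[of i V v] i by (intro bexI[of _ "\<lambda>g. act V g v i"])
qed

text \<open>If \<open>g\<close> and \<open>g'\<close> lie in different cosets of the stabilizer, the
  vectors \<open>g v\<close> and \<open>g' v\<close> are not proportional, so some linear form
  vanishes on the second only.\<close>

lemma coefs_separate:
  assumes V: "pointed V v" and g: "g \<in> carrier G" and g': "g' \<in> carrier G"
    and nd: "inv g' \<otimes> g \<notin> Domain (gr V v)"
  shows "\<exists>w\<in>coefs V v. w g \<noteq> 0 \<and> w g' = 0"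
proof -
  let ?a = "act V g' v" and ?b = "act V g v"
  obtain i where i: "?a i \<noteq> 0" using act_nonzero[OF V g'] by (auto simp: fun_eq_iff)
  have "?b \<noteq> vscale (?b i / ?a i) ?a"
  proof
    assume "?b = vscale (?b i / ?a i) ?a"
    then have "act V (inv g') ?b = vscale (?b i / ?a i) (act V (inv g') ?a)"
      using kk.linear_scale[OF klin_act] by metis
    then have "(inv g' \<otimes> g, ?b i / ?a i) \<in> gr V v"
      using V g g' act_inv[of V g' v] by (simp add: gr_def act_mult pointed_def)
    then show False using nd by blast
  qed
  then obtain j where j: "?b j \<noteq> ?b i / ?a i * ?a j" by (auto simp: fun_eq_iff vscale_def)
  have ij: "i < rdim V" using i kspaceD[OF act_kspace[of V g' v]] not_less by blast
  have jj: "j < rdim V"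
  proof (rule ccontr)
    assume "\<not> j < rdim V"
    then show False using j kspaceD[OF act_kspace[of V g v], of j] kspaceD[OF act_kspace[of V g' v], of j] by simp
  qed
  \<comment> \<open>The form that sends \<open>u\<close> to
    \<open>u j - (?a j / ?a i) * u i\<close>. It vanishes at \<open>?a\<close>, and at
    \<open>?b\<close> it does not, by the choice of \<open>j\<close>.\<close>
  let ?\<xi> = "\<lambda>k. (if k = j then 1 else 0) - (if k = i then ?a j / ?a i else 0)"
  let ?w = "\<lambda>g. \<Sum>k<rdim V. ?\<xi> k * act V g v k"
  have w: "?w x = act V x v j - ?a j / ?a i * act V x v i" for x
    using ij jj by (simp add: left_diff_distrib sum_subtractf if_distrib[of "\<lambda>x. x * _"] cong: if_cong)
  have "?w g \<noteq> 0" using j i unfolding w by (auto simp: field_simps)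
  moreover have "?w g' = 0" using i unfolding w by simp
  moreover have "?w \<in> coefs V v" unfolding coefs_def by (intro CollectI exI[of _ ?\<xi>]) simp
  ultimately show ?thesis by (intro bexI[of _ ?w]) auto
qed

section \<open>Powers\<close>

text \<open>Lists allow different factors, so that mixed monomials in two classes of the same type
  are covered along with powers; the empty product is the unit.\<close>

fun tprod :: "(('a, 'k::field) rep \<times> (nat \<Rightarrow> 'k)) list \<Rightarrow> ('a, 'k) rep \<times> (nat \<Rightarrow> 'k)" where
  "tprod [] = (triv_rep, unit_vec0 1)"
| "tprod (X # L) = (rep_tensor (fst X) (fst (tprod L)), vec_tensor (rdim (fst (tprod L))) (snd X) (snd (tprod L)))"

abbreviation "ptd X \<equiv> pointed (fst X) (snd X)"

lemma pointed_tprod: "\<forall>X\<in>set L. ptd X \<Longrightarrow> ptd (tprod L)"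
  by (induction L) (auto intro: pointed_triv pointed_tensor)

lemma ann_triv: "x \<in> ann triv_rep (unit_vec0 1) \<longleftrightarrow> pair x (\<lambda>g. 1) = 0"
  by (auto simp: ann_iff triv_rep_def linear_rep_def act_def unit_vec0_def)

text \<open>Iterates \<open>ann_tensor\<close>: products of one matrix coefficient from each factor
  span the coefficients of the whole product.\<close>

lemma ann_tprod:
  "x \<in> ann (fst (tprod L)) (snd (tprod L)) \<longleftrightarrow>
    (\<forall>ws. list_all2 (\<lambda>w X. w \<in> coefs (fst X) (snd X)) ws L \<longrightarrow> pair x (\<lambda>g. prod_list (map (\<lambda>w. w g) ws)) = 0)"
proof (induction L arbitrary: x)
  case Nil
  then show ?case by (simp add: ann_triv)
next
  case (Cons X L)
  have "x \<in> ann (fst (tprod (X # L))) (snd (tprod (X # L))) \<longleftrightarrow>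
    (\<forall>a\<in>coefs (fst X) (snd X). \<forall>ws. list_all2 (\<lambda>w X. w \<in> coefs (fst X) (snd X)) ws L \<longrightarrow>
      pair x (\<lambda>g. a g * prod_list (map (\<lambda>w. w g) ws)) = 0)"
    by (simp add: ann_tensor Cons.IH pair_mult)
  also have "\<dots> \<longleftrightarrow> (\<forall>ws. list_all2 (\<lambda>w X. w \<in> coefs (fst X) (snd X)) ws (X # L) \<longrightarrow>
      pair x (\<lambda>g. prod_list (map (\<lambda>w. w g) ws)) = 0)"
  proof (intro iffI allI impI ballI)
    fix ws
    assume a: "\<forall>a\<in>coefs (fst X) (snd X). \<forall>ws. list_all2 (\<lambda>w X. w \<in> coefs (fst X) (snd X)) ws L \<longrightarrow>
      pair x (\<lambda>g. a g * prod_list (map (\<lambda>w. w g) ws)) = 0"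
      and ws: "list_all2 (\<lambda>w X. w \<in> coefs (fst X) (snd X)) ws (X # L)"
    then obtain a ws' where "ws = a # ws'" "a \<in> coefs (fst X) (snd X)"
      "list_all2 (\<lambda>w X. w \<in> coefs (fst X) (snd X)) ws' L" by (auto simp: list_all2_Cons2)
    then show "pair x (\<lambda>g. prod_list (map (\<lambda>w. w g) ws)) = 0" using a by simp
  next
    fix a ws
    assume b: "\<forall>ws. list_all2 (\<lambda>w X. w \<in> coefs (fst X) (snd X)) ws (X # L) \<longrightarrow>
      pair x (\<lambda>g. prod_list (map (\<lambda>w. w g) ws)) = 0"
      and a: "a \<in> coefs (fst X) (snd X)" "list_all2 (\<lambda>w X. w \<in> coefs (fst X) (snd X)) ws L"
    then show "pair x (\<lambda>g. a g * prod_list (map (\<lambda>w. w g) ws)) = 0" using b[rule_format, of "a # ws"] by simp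
  qed
  finally show ?case .
qed

text \<open>For the type \<open>t\<close> of a character \<open>\<chi>\<close> on \<open>H\<close>
  this is the annihilator of \<open>1 \<otimes> 1\<close> in the module induced from the
  \<open>n\<close>-th power of \<open>\<chi>\<close>: the sums are the coordinates of
  \<open>x (1 \<otimes> 1)\<close> along the cosets \<open>gH\<close>.\<close>

definition Jt :: "('a \<times> 'k::field) set \<Rightarrow> nat \<Rightarrow> ('a \<Rightarrow> 'k) set"
  where "Jt t n = {x. \<forall>g\<in>carrier G. (\<Sum>(h, c)\<in>t. x (g \<otimes> h) * c ^ n) = 0}"

text \<open>
  A long product of gliders of the same type is the full induced module: coefficient functions
  separating \<open>g\<^sub>0\<close> from the other cosets, one for each factor, multiply to a function supported
  on the coset of \<open>g\<^sub>0\<close>.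
\<close>

lemma ann_long_product:
  fixes L :: "(('a, 'k::field_char_0) rep \<times> (nat \<Rightarrow> 'k)) list"
  assumes L: "\<forall>X\<in>set L. ptd X \<and> gr (fst X) (snd X) = t" and len: "length L \<ge> card (carrier G)"
  shows "ann (fst (tprod L)) (snd (tprod L)) = Jt t (length L)"
proof -
  have "card (carrier G) > 0" using fin one_closed card_gt_0_iff by blast
  then have "L \<noteq> []" using len by auto
  then obtain X where "X \<in> set L" by (cases L) auto
  then have X: "pointed (fst X) (snd X)" and t: "t = gr (fst X) (snd X)" using L by auto
  let ?n = "length L"
  let ?H = "Domain t"
  have semi: "prod_list (map (\<lambda>w. w (g \<otimes> h)) ws) = c ^ length ws * prod_list (map (\<lambda>w. w g) ws)"
    if "list_all2 (\<lambda>w X. w \<in> coefs (fst X) (snd X)) ws L'" "set L' \<subseteq> set L" "(h, c) \<in> t" "g \<in> carrier G"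
    for g h c ws L'
    using that
  proof (induction ws L' rule: list_all2_induct)
    case (Cons w ws X L')
    then have "w (g \<otimes> h) = c * w g" using L by (intro coefs_semi) auto
    then show ?case using Cons by simp
  qed simp
  have tf: "finite t" "(\<one>, 1) \<in> t" unfolding t using finite_gr[OF X] gr_one[OF X] by auto
  have tc: "(h, c) \<in> t \<Longrightarrow> h \<in> carrier G" for h c unfolding t by (rule gr_carrier)
  have lens: "length ws = ?n" if "list_all2 (\<lambda>w X. w \<in> coefs (fst X) (snd X)) ws L" for ws
    using that by (rule list_all2_lengthD)
  show ?thesis
  proof (intro equalityI subsetI)
    fix x assume x: "x \<in> Jt t ?n"
    show "x \<in> ann (fst (tprod L)) (snd (tprod L))"
      unfolding ann_tprod
    proof (intro allI impI)
      fix ws assume ws: "list_all2 (\<lambda>w X. w \<in> coefs (fst X) (snd X)) ws L"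
      let ?W = "\<lambda>g. prod_list (map (\<lambda>w. w g) ws)"
      have sh: "(\<Sum>g\<in>carrier G. x g * ?W g) = (\<Sum>g\<in>carrier G. x (g \<otimes> h) * (c ^ ?n * ?W g))" if h: "(h, c) \<in> t" for h c
      proof -
        have hc: "h \<in> carrier G" using tc h .
        have "(\<Sum>g\<in>carrier G. x g * ?W g) = (\<Sum>g\<in>carrier G. x (g \<otimes> h) * ?W (g \<otimes> h))"
          by (rule sum.reindex_bij_witness[where i = "\<lambda>g. g \<otimes> h" and j = "\<lambda>g. g \<otimes> inv h"])
            (use hc in \<open>auto simp: m_assoc\<close>)
        also have "\<dots> = (\<Sum>g\<in>carrier G. x (g \<otimes> h) * (c ^ ?n * ?W g))"
          using semi[OF ws subset_refl h] lens[OF ws] by (intro sum.cong) auto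
        finally show ?thesis .
      qed
      \<comment> \<open>Averaging over the stabilizer makes the sums from \<open>Jt\<close> appear,
        since \<open>?W (g \<otimes> h) = c ^ ?n * ?W g\<close>. In characteristic zero the factor
        \<open>card t\<close> can be cancelled.\<close>
      have "of_nat (card t) * pair x ?W = (\<Sum>p\<in>t. \<Sum>g\<in>carrier G. x g * ?W g)" by (simp add: pair_def)
      also have "\<dots> = (\<Sum>(h, c)\<in>t. \<Sum>g\<in>carrier G. x (g \<otimes> h) * (c ^ ?n * ?W g))"
        using sh by (intro sum.cong) auto
      also have "\<dots> = (\<Sum>p\<in>t. \<Sum>g\<in>carrier G. x (g \<otimes> fst p) * (snd p ^ ?n * ?W g))" by (simp add: case_prod_unfold)
      also have "\<dots> = (\<Sum>g\<in>carrier G. \<Sum>p\<in>t. x (g \<otimes> fst p) * (snd p ^ ?n * ?W g))" by (rule sum.swap)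
      also have "\<dots> = (\<Sum>g\<in>carrier G. ?W g * (\<Sum>(h, c)\<in>t. x (g \<otimes> h) * c ^ ?n))"
        by (simp add: case_prod_unfold sum_distrib_left mult_ac)
      also have "\<dots> = 0" using x by (simp add: Jt_def)
      finally have "of_nat (card t) * pair x ?W = 0" .
      moreover have "card t \<noteq> 0" using tf by auto
      ultimately show "pair x ?W = 0" by simp
    qed
  next
    fix x assume x: "x \<in> ann (fst (tprod L)) (snd (tprod L))"
    show "x \<in> Jt t ?n"
      unfolding Jt_def mem_Collect_eq
    proof
      fix g0 assume g0: "g0 \<in> carrier G"
      \<comment> \<open>The elements outside the coset of \<open>g0\<close>. There are at most
        \<open>|G|\<close> of them, so one factor can be spent on each; the remaining factors only
        have to be nonzero at \<open>g0\<close>.\<close>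
      let ?B = "{g \<in> carrier G. inv g \<otimes> g0 \<notin> ?H}"
      obtain bs where bs: "set bs = ?B" "distinct bs" using finite_distinct_list[of ?B] fin by auto
      have "length bs \<le> card (carrier G)"
        using distinct_card[OF bs(2)] bs(1) card_mono[OF fin, of ?B] by auto
      then have lb: "length bs \<le> ?n" using len by simp
      have "\<exists>w. w \<in> coefs (fst (L ! k)) (snd (L ! k)) \<and> w g0 \<noteq> 0 \<and> (k < length bs \<longrightarrow> w (bs ! k) = 0)"
        if k: "k < ?n" for k
      proof -
        have P: "ptd (L ! k)" "gr (fst (L ! k)) (snd (L ! k)) = t" using L k by auto
        show ?thesis
        proof (cases "k < length bs")
          case True
          then have "bs ! k \<in> ?B" using bs(1) nth_mem by blast
          then show ?thesis using coefs_separate[OF P(1) g0, of "bs ! k"] P(2) by auto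
        next
          case False
          then show ?thesis using coefs_nonzero[OF P(1) g0] by auto
        qed
      qed
      then obtain w where w: "\<And>k. k < ?n \<Longrightarrow> w k \<in> coefs (fst (L ! k)) (snd (L ! k)) \<and> w k g0 \<noteq> 0 \<and>
          (k < length bs \<longrightarrow> w k (bs ! k) = 0)" by metis
      define ws where "ws = map w [0..<?n]"
      let ?W = "\<lambda>g. prod_list (map (\<lambda>w. w g) ws)"
      have ws: "list_all2 (\<lambda>w X. w \<in> coefs (fst X) (snd X)) ws L"
        unfolding list_all2_conv_all_nth using w by (simp add: ws_def)
      have W0: "?W g0 \<noteq> 0" using w by (auto simp: ws_def prod_list_zero_iff)
      have WB: "?W g = 0" if g: "g \<in> ?B" for g
      proof -
        have "g \<in> set bs" using g unfolding bs(1) .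
        then obtain k where k: "k < length bs" "bs ! k = g" unfolding in_set_conv_nth by blast
        then have "w k g = 0" "k < ?n" using w[of k] lb by auto
        then have "0 \<in> set (map (\<lambda>w. w g) ws)" by (force simp: ws_def)
        then show ?thesis by (simp only: prod_list_zero_iff)
      qed
      \<comment> \<open>\<open>?W\<close> is supported on the coset of \<open>g0\<close>, so the
        pairing reduces to the single sum demanded by \<open>Jt\<close>.\<close>
      have "0 = pair x ?W" using x ws unfolding ann_tprod by simp
      also have "\<dots> = (\<Sum>g\<in>carrier G - ?B. x g * ?W g)"
        unfolding pair_def using WB fin by (intro sum.mono_neutral_right) auto
      also have "\<dots> = (\<Sum>(h, c)\<in>t. x (g0 \<otimes> h) * ?W (g0 \<otimes> h))"
        unfolding t gr_sum[OF X] unfolding t[symmetric]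
      proof (rule sum.reindex_bij_witness[where i = "\<lambda>h. g0 \<otimes> h" and j = "\<lambda>g. inv g0 \<otimes> g"])
        have sg: "subgroup ?H G" unfolding t by (rule gr_subgroup[OF X])
        fix g assume g: "g \<in> carrier G - ?B"
        then have gc: "g \<in> carrier G" "inv g \<otimes> g0 \<in> ?H" by auto
        then have "inv (inv g \<otimes> g0) \<in> ?H" using subgroup.m_inv_closed[OF sg] by blast
        then show "inv g0 \<otimes> g \<in> ?H" using gc g0 by (simp add: inv_mult_group)
        show "g0 \<otimes> (inv g0 \<otimes> g) = g" using gc g0 by (simp flip: m_assoc)
        then show "x (g0 \<otimes> (inv g0 \<otimes> g)) * ?W (g0 \<otimes> (inv g0 \<otimes> g)) = x g * ?W g" by simp
      next
        have sg: "subgroup ?H G" unfolding t by (rule gr_subgroup[OF X])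
        fix h assume h: "h \<in> ?H"
        then have hc: "h \<in> carrier G" "inv h \<in> ?H" using tc subgroup.m_inv_closed[OF sg] by auto
        have "inv (g0 \<otimes> h) \<otimes> g0 = inv h" using hc g0 by (simp add: inv_mult_group m_assoc)
        then show "g0 \<otimes> h \<in> carrier G - ?B" using hc g0 by simp
        show "inv g0 \<otimes> (g0 \<otimes> h) = h" using hc g0 by (simp flip: m_assoc)
      qed
      also have "\<dots> = (\<Sum>(h, c)\<in>t. ?W g0 * (x (g0 \<otimes> h) * c ^ ?n))"
        using semi[OF ws subset_refl _ g0] lens[OF ws] by (intro sum.cong) auto
      also have "\<dots> = ?W g0 * (\<Sum>(h, c)\<in>t. x (g0 \<otimes> h) * c ^ ?n)"
        by (simp add: case_prod_unfold sum_distrib_left)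
      finally show "(\<Sum>(h, c)\<in>t. x (g0 \<otimes> h) * c ^ ?n) = 0" using W0 by simp
    qed
  qed
qed

end

section \<open>The glider algebra modulo its nilradical\<close>

text \<open>\<open>K\<close> is a type token that fixes the field, so that the basis and the algebra
  have a definite type.\<close>

locale glider_ctx = fin_grp G for G :: "('a, 'm) monoid_scheme" (structure) +
  fixes K :: "'k::field_char_0 itself"
begin

abbreviation GA :: "('a, 'k) rat_elem ring"
  where "GA \<equiv> glider_alg G"

definition anns :: "('a \<Rightarrow> 'k) set set"
  where "anns = {ann V v |V v. pointed V v}"

definition bas :: "('a \<Rightarrow> 'k) set \<Rightarrow> ('a, 'k) rat_elem"
  where "bas j = (let P = (SOME P. ptd P \<and> ann (fst P) (snd P) = j) in kl (fst P) (snd P))"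

definition coef :: "('a \<Rightarrow> 'k) set \<Rightarrow> ('a, 'k) rat_elem \<Rightarrow> rat"
  where "coef j = (SOME F. (\<forall>x\<in>carrier GA. \<forall>y\<in>carrier GA. F (x \<oplus>\<^bsub>GA\<^esub> y) = F x + F y) \<and>
    (\<forall>q V v. pointed V v \<longrightarrow> F (scal G q \<otimes>\<^bsub>GA\<^esub> kl V v) = (if ann V v = j then q else 0)))"

lemma coef:
  "x \<in> carrier GA \<Longrightarrow> y \<in> carrier GA \<Longrightarrow> coef j (x \<oplus>\<^bsub>GA\<^esub> y) = coef j x + coef j y"
  "pointed V v \<Longrightarrow> coef j (scal G q \<otimes>\<^bsub>GA\<^esub> kl V v) = (if ann V v = j then q else 0)"
  using someI_ex[OF coef_functional[of j]] unfolding coef_def by blast+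

lemma ann_anns: "pointed V v \<Longrightarrow> ann V v \<in> anns"
  unfolding anns_def by blast

lemma annsE:
  assumes "j \<in> anns"
  obtains V v where "pointed V v" "j = ann V v"
  using assms unfolding anns_def by blast

lemma bas_ann: "pointed V v \<Longrightarrow> bas (ann V v) = kl V v"
proof -
  assume V: "pointed V v"
  let ?P = "SOME P. ptd P \<and> ann (fst P) (snd P) = ann V v"
  have "ptd ?P \<and> ann (fst ?P) (snd ?P) = ann V v"
    by (rule someI[of "\<lambda>P. ptd P \<and> ann (fst P) (snd P) = ann V v" "(V, v)"]) (simp add: V)
  then show ?thesis unfolding bas_def Let_def by (intro kl_eqI[OF _ V]) auto
qed

sublocale A: based_algebra GA "scal G" anns bas coef
proof (intro based_algebra.intro rat_algebra.intro rat_algebra_axioms.intro based_algebra_axioms.intro alg_cring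
    scal_closed scal_add scal_mult scal_one coef(1))
  show "bas j \<in> carrier GA" if "j \<in> anns" for j
    using that by (elim annsE) (simp add: bas_ann kl_closed)
  show "carrier GA \<subseteq> add_span GA {scal G q \<otimes>\<^bsub>GA\<^esub> bas j |q j. j \<in> anns}"
  proof -
    have "{scal G q \<otimes>\<^bsub>GA\<^esub> bas j |q j. j \<in> anns} = {scal G q \<otimes>\<^bsub>GA\<^esub> kl V v |q V v. pointed V v}"
    proof (intro equalityI subsetI)
      fix x assume "x \<in> {scal G q \<otimes>\<^bsub>GA\<^esub> bas j |q j. j \<in> anns}"
      then obtain q j where x: "x = scal G q \<otimes>\<^bsub>GA\<^esub> bas j" "j \<in> anns" by blast
      from x(2) obtain V v where "pointed V v" "j = ann V v" by (rule annsE)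
      then have "x = scal G q \<otimes>\<^bsub>GA\<^esub> kl V v" using x(1) by (simp add: bas_ann)
      then show "x \<in> {scal G q \<otimes>\<^bsub>GA\<^esub> kl V v |q V v. pointed V v}" using \<open>pointed V v\<close> by blast
    next
      fix x assume "x \<in> {scal G q \<otimes>\<^bsub>GA\<^esub> kl V v |q (V :: ('a, 'k) rep) v. pointed V v}"
      then obtain q and V :: "('a, 'k) rep" and v where x: "x = scal G q \<otimes>\<^bsub>GA\<^esub> kl V v" "pointed V v" by blast
      then have "x = scal G q \<otimes>\<^bsub>GA\<^esub> bas (ann V v)" by (simp add: bas_ann)
      then show "x \<in> {scal G q \<otimes>\<^bsub>GA\<^esub> bas j |q j. j \<in> anns}" using ann_anns[OF x(2)] by blast
    qed
    then show ?thesis using alg_span by (simp only:)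
  qed
  show "coef i (scal G q \<otimes>\<^bsub>GA\<^esub> bas j) = (if i = j then q else 0)" if "j \<in> anns" "i \<in> anns" for i j q
    using that(1) by (elim annsE) (auto simp: bas_ann coef(2))
qed auto

lemma kl_induct [consumes 1, case_names zero base add]:
  assumes "x \<in> carrier GA" "P \<zero>\<^bsub>GA\<^esub>" "\<And>q V v. pointed V v \<Longrightarrow> P (scal G q \<otimes>\<^bsub>GA\<^esub> kl V v)"
    and "\<And>x y. x \<in> carrier GA \<Longrightarrow> y \<in> carrier GA \<Longrightarrow> P x \<Longrightarrow> P y \<Longrightarrow> P (x \<oplus>\<^bsub>GA\<^esub> y)"
  shows "P x"
  using assms(1)
proof (induction rule: A.basis_induct)
  case (base q j)
  then obtain V v where "pointed V v" "j = ann V v" by (elim annsE)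
  then show ?case using assms(3) by (simp add: bas_ann)
qed (use assms in auto)

lemma kl_inj:
  fixes V W :: "('a, 'k) rep"
  assumes V: "pointed V v" and W: "pointed W w" and eq: "kl V v = kl W w"
  shows "ann V v = ann W w"
proof -
  have "coef (ann V v) (scal G 1 \<otimes>\<^bsub>GA\<^esub> kl V v) = 1" using coef(2)[OF V] by simp
  then have "coef (ann V v) (scal G 1 \<otimes>\<^bsub>GA\<^esub> kl W w) = 1" using eq by simp
  then show ?thesis using coef(2)[OF W, of "ann V v" 1] by (auto split: if_splits)
qed

lemma kl_nonzero:
  fixes V :: "('a, 'k) rep"
  assumes V: "pointed V v"
  shows "kl V v \<noteq> \<zero>\<^bsub>GA\<^esub>"
proof
  assume "kl V v = \<zero>\<^bsub>GA\<^esub>"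
  then have "coef (ann V v) (scal G 1 \<otimes>\<^bsub>GA\<^esub> kl V v) = 0" using A.co_zero by simp
  then show False using coef(2)[OF V, of "ann V v" 1] by simp
qed

subsection \<open>Powers of basis elements\<close>

abbreviation klp :: "('a, 'k) rep \<times> (nat \<Rightarrow> 'k) \<Rightarrow> ('a, 'k) rat_elem"
  where "klp X \<equiv> kl (fst X) (snd X)"

lemma kl_tprod:
  fixes X :: "('a, 'k) rep \<times> (nat \<Rightarrow> 'k)"
  assumes X: "ptd X" and L: "\<forall>Y\<in>set L. ptd Y"
  shows "klp (tprod (replicate i X @ L)) = klp X [^]\<^bsub>GA\<^esub> i \<otimes>\<^bsub>GA\<^esub> klp (tprod L)"
proof (induction i)
  case 0
  then show ?case using kl_closed[OF pointed_tprod[OF L]] by simp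
next
  case (Suc i)
  have P: "ptd (tprod (replicate i X @ L))" using X L by (intro pointed_tprod) auto
  have "klp (tprod (replicate (Suc i) X @ L)) = klp X \<otimes>\<^bsub>GA\<^esub> klp (tprod (replicate i X @ L))"
    by (simp add: kl_mult[OF X P])
  then show ?case using Suc kl_closed[OF X] kl_closed[OF pointed_tprod[OF L]] by (simp add: A.m_ac)
qed

lemma kl_pow:
  fixes V :: "('a, 'k) rep"
  assumes V: "pointed V v"
  shows "kl V v [^]\<^bsub>GA\<^esub> n = klp (tprod (replicate n (V, v)))"
  using kl_tprod[of "(V, v)" "[]" n] V kl_closed[OF V] by (simp add: kl_one[symmetric])

abbreviation N where "N \<equiv> card (carrier G)"

lemma N_pos: "N > 0"
  using fin one_closed card_gt_0_iff by blast

text \<open>By \<open>ann_long_product\<close> only the number of factors matters once it is at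
  least \<open>N\<close>. This is the hypothesis of \<open>nilpotent_diff\<close>.\<close>

lemma kl_mixed_power:
  fixes V W :: "('a, 'k) rep"
  assumes V: "pointed V v" and W: "pointed W w" and eq: "gr V v = gr W w"
    and ij: "i + j \<ge> N" "i + j = i' + j'"
  shows "kl V v [^]\<^bsub>GA\<^esub> i \<otimes>\<^bsub>GA\<^esub> kl W w [^]\<^bsub>GA\<^esub> j = kl V v [^]\<^bsub>GA\<^esub> i' \<otimes>\<^bsub>GA\<^esub> kl W w [^]\<^bsub>GA\<^esub> j'"
proof -
  have p: "kl V v [^]\<^bsub>GA\<^esub> i \<otimes>\<^bsub>GA\<^esub> kl W w [^]\<^bsub>GA\<^esub> j = klp (tprod (replicate i (V, v) @ replicate j (W, w)))" for i j
    using kl_tprod[of "(V, v)" "replicate j (W, w)" i] V W by (simp add: kl_pow)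
  have pt: "ptd (tprod (replicate i (V, v) @ replicate j (W, w)))" for i j
    using V W by (intro pointed_tprod) auto
  have "ann (fst (tprod (replicate a (V, v) @ replicate b (W, w)))) (snd (tprod (replicate a (V, v) @ replicate b (W, w)))) =
      Jt (gr V v) (i + j)" if "a + b = i + j" for a b
  proof -
    have "\<forall>X\<in>set (replicate a (V, v) @ replicate b (W, w)). ptd X \<and> gr (fst X) (snd X) = gr V v"
    proof
      fix X assume "X \<in> set (replicate a (V, v) @ replicate b (W, w))"
      then have "X = (V, v) \<or> X = (W, w)" by auto
      then show "ptd X \<and> gr (fst X) (snd X) = gr V v" using V W eq by (elim disjE) simp_all
    qed
    from ann_long_product[OF this] show ?thesis using ij that by simp
  qed
  from this[of i j] this[of i' j'] show ?thesis unfolding p using ij by (intro kl_eqI pt) simp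
qed

lemma kl_diff_nilpotent:
  fixes V W :: "('a, 'k) rep"
  assumes V: "pointed V v" and W: "pointed W w" and eq: "gr V v = gr W w"
  shows "\<exists>n::nat. (kl V v \<ominus>\<^bsub>GA\<^esub> kl W w) [^]\<^bsub>GA\<^esub> n = \<zero>\<^bsub>GA\<^esub>"
  using kl_mixed_power[OF V W eq] by (intro A.nilpotent_diff kl_closed V W) blast

lemma ann_power:
  fixes V :: "('a, 'k) rep"
  assumes V: "pointed V v" and n: "n \<ge> N"
  shows "ann (fst (tprod (replicate n (V, v)))) (snd (tprod (replicate n (V, v)))) = Jt (gr V v) n"
  using ann_long_product[of "replicate n (V, v)" "gr V v"] V n by auto

lemma Jt_period:
  fixes V :: "('a, 'k) rep"
  assumes V: "pointed V v"
  shows "Jt (gr V v) (n + N) = Jt (gr V v) n"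
proof -
  have "(\<Sum>(h, c)\<in>gr V v. x (g \<otimes> h) * c ^ (n + N)) = (\<Sum>(h, c)\<in>gr V v. x (g \<otimes> h) * c ^ n)" for x :: "'a \<Rightarrow> 'k" and g
    using gr_order[OF V] by (intro sum.cong) (auto simp: power_add)
  then show ?thesis by (simp add: Jt_def)
qed

text \<open>High powers depend on \<open>n\<close> only through the \<open>n\<close>-th power of the
  character, and its \<open>N\<close>-th power is trivial.\<close>

lemma kl_period:
  fixes V :: "('a, 'k) rep"
  assumes V: "pointed V v" and n: "n \<ge> N"
  shows "kl V v [^]\<^bsub>GA\<^esub> (n + N) = kl V v [^]\<^bsub>GA\<^esub> n"
proof -
  have "ptd (tprod (replicate k (V, v)))" for k using V by (intro pointed_tprod) auto
  then show ?thesis unfolding kl_pow[OF V] using n V by (intro kl_eqI) (simp_all add: ann_power Jt_period)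
qed

text \<open>From exponent \<open>N\<close> on the powers have period \<open>N\<close>, so all of
  them occur below \<open>2 * N\<close>.\<close>

lemma finite_powers:
  fixes V :: "('a, 'k) rep"
  assumes V: "pointed V v"
  shows "finite (cyclic_semigroup GA (kl V v))"
proof -
  have "\<exists>m<2 * N. kl V v [^]\<^bsub>GA\<^esub> n = kl V v [^]\<^bsub>GA\<^esub> m" for n :: nat
  proof (induction n rule: less_induct)
    case (less n)
    show ?case
    proof (cases "n < 2 * N")
      case False
      then have "kl V v [^]\<^bsub>GA\<^esub> n = kl V v [^]\<^bsub>GA\<^esub> (n - N)" using kl_period[OF V, of "n - N"] by simp
      then show ?thesis using less.IH[of "n - N"] N_pos False by simp
    qed blast
  qed
  then have "cyclic_semigroup GA (kl V v) \<subseteq> (\<lambda>m. kl V v [^]\<^bsub>GA\<^esub> m) ` {..<2 * N}"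
  proof (intro subsetI)
    fix e assume "e \<in> cyclic_semigroup GA (kl V v)"
    then obtain n :: nat where n: "e = kl V v [^]\<^bsub>GA\<^esub> n" unfolding cyclic_semigroup_def by blast
    obtain m where "m < 2 * N" "kl V v [^]\<^bsub>GA\<^esub> n = kl V v [^]\<^bsub>GA\<^esub> m"
      using \<open>\<And>n. \<exists>m<2 * N. kl V v [^]\<^bsub>GA\<^esub> n = kl V v [^]\<^bsub>GA\<^esub> m\<close> by blast
    then show "e \<in> (\<lambda>m. kl V v [^]\<^bsub>GA\<^esub> m) ` {..<2 * N}" unfolding n by simp
  qed
  then show ?thesis by (rule finite_subset) simp
qed

text \<open>The idempotent among the powers is the permutation glider \<open>K(1 \<otimes> 1) \<subset> K[G/H]\<close>, \<open>H\<close> the line stabiliser.\<close>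

lemma the_idempotent_kl:
  fixes V :: "('a, 'k) rep"
  assumes V: "pointed V v"
  shows "\<exists>W w. pointed W w \<and> ann W w = Jt (gr V v) 0 \<and> the_idempotent GA (kl V v) = kl W w \<and>
    kl W w \<otimes>\<^bsub>GA\<^esub> kl W w = kl W w"
proof -
  let ?x = "kl V v" and ?P = "tprod (replicate N (V, v))"
  have x: "?x \<in> carrier GA" by (rule kl_closed[OF V])
  have id: "?x [^]\<^bsub>GA\<^esub> N \<otimes>\<^bsub>GA\<^esub> ?x [^]\<^bsub>GA\<^esub> N = ?x [^]\<^bsub>GA\<^esub> N"
    using kl_period[OF V, of N] x by (simp add: A.nat_pow_mult)
  have pow: "y [^]\<^bsub>GA\<^esub> k = y" if "y \<in> carrier GA" "y \<otimes>\<^bsub>GA\<^esub> y = y" "k \<ge> 1" for y and k :: nat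
    using that(3)
  proof (induction k rule: dec_induct)
    case base
    then show ?case using that by simp
  next
    case (step k)
    then show ?case using that by simp
  qed
  have "the_idempotent GA ?x = ?x [^]\<^bsub>GA\<^esub> N"
    unfolding the_idempotent_def
  proof (rule the_equality)
    have "1 \<le> N" using N_pos by simp
    then have "?x [^]\<^bsub>GA\<^esub> N \<in> cyclic_semigroup GA ?x" unfolding cyclic_semigroup_def by blast
    then show "?x [^]\<^bsub>GA\<^esub> N \<in> cyclic_semigroup GA ?x \<and>
        ?x [^]\<^bsub>GA\<^esub> N \<otimes>\<^bsub>GA\<^esub> ?x [^]\<^bsub>GA\<^esub> N = ?x [^]\<^bsub>GA\<^esub> N" using id by simp
    \<comment> \<open>An idempotent \<open>e\<close> that is the \<open>n\<close>-th power of
      \<open>?x\<close> equals its own \<open>N\<close>-th power, which is the \<open>n\<close>-th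
      power of the idempotent \<open>?x [^] N\<close> and hence \<open>?x [^] N\<close>
      itself.\<close>
    fix e assume e: "e \<in> cyclic_semigroup GA ?x \<and> e \<otimes>\<^bsub>GA\<^esub> e = e"
    then obtain n :: nat where n: "n \<ge> 1" "e = ?x [^]\<^bsub>GA\<^esub> n" unfolding cyclic_semigroup_def by blast
    have "e = e [^]\<^bsub>GA\<^esub> N" using pow[of e N] e n x N_pos by simp
    also have "\<dots> = (?x [^]\<^bsub>GA\<^esub> N) [^]\<^bsub>GA\<^esub> n" unfolding n(2) using x by (simp add: A.nat_pow_pow mult.commute)
    also have "\<dots> = ?x [^]\<^bsub>GA\<^esub> N" using pow[of "?x [^]\<^bsub>GA\<^esub> N" n] id n(1) x by simp
    finally show "e = ?x [^]\<^bsub>GA\<^esub> N" .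
  qed
  moreover have "ptd ?P" using V by (intro pointed_tprod) auto
  moreover have "ann (fst ?P) (snd ?P) = Jt (gr V v) 0"
    using ann_power[OF V, of N] Jt_period[OF V, of 0] by simp
  ultimately show ?thesis using id unfolding kl_pow[OF V] by blast
qed

subsection \<open>The nilradical\<close>

abbreviation tsum :: "('a \<times> 'k) set \<Rightarrow> ('a, 'k) rat_elem \<Rightarrow> rat"
  where "tsum \<equiv> A.tsum ty"

lemma tsum_kl: "pointed V v \<Longrightarrow> tsum t (scal G q \<otimes>\<^bsub>GA\<^esub> kl V v) = (if gr V v = t then q else 0)"
  using A.tsum_basis[OF ann_anns, of V v ty t q] by (simp add: bas_ann ty_ann)

definition cval :: "('a \<times> 'k) set \<Rightarrow> 'a \<Rightarrow> 'k"
  where "cval t h = (THE c. (h, c) \<in> t)"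

lemma cval: "pointed V v \<Longrightarrow> (h, c) \<in> gr V v \<Longrightarrow> cval (gr V v) h = c"
  unfolding cval_def using gr_unique by blast

text \<open>Types multiply by intersecting stabilizers and multiplying characters. So evaluation at
  \<open>l\<close>, cut off to types whose stabilizer contains \<open>L\<close>, is multiplicative
  and sends the unit to 1; it extends to a homomorphism into \<open>K\<close>.\<close>

lemma character_hom:
  assumes l: "l \<in> L" "L \<subseteq> carrier G"
    and \<psi>: "\<psi> = (\<lambda>t. if L \<subseteq> Domain t then cval t l else 0)"
    and x: "x \<in> carrier GA" "x [^]\<^bsub>GA\<^esub> (n::nat) = \<zero>\<^bsub>GA\<^esub>"
  shows "A.ext (\<lambda>j. \<psi> (ty j)) x = 0"
proof (rule A.ext_nilpotent[OF _ _ _ _ x])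
  show "\<exists>k\<in>anns. bas i \<otimes>\<^bsub>GA\<^esub> bas j = bas k \<and> \<psi> (ty k) = \<psi> (ty i) * \<psi> (ty j)"
    if "i \<in> anns" "j \<in> anns" for i j
  proof -
    obtain V v where V: "pointed V v" "i = ann V v" using \<open>i \<in> anns\<close> by (rule annsE)
    obtain W w where W: "pointed W w" "j = ann W w" using \<open>j \<in> anns\<close> by (rule annsE)
    let ?T = "rep_tensor V W" and ?t = "vec_tensor (rdim W) v w"
    have T: "pointed ?T ?t" by (rule pointed_tensor[OF V(1) W(1)])
    have dom: "Domain (gr ?T ?t) = Domain (gr V v) \<inter> Domain (gr W w)"
      unfolding gr_tensor[OF V(1) W(1)] by blast
    have "\<psi> (gr ?T ?t) = \<psi> (gr V v) * \<psi> (gr W w)"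
    proof (cases "L \<subseteq> Domain (gr V v) \<and> L \<subseteq> Domain (gr W w)")
      case True
      then obtain c d where c: "(l, c) \<in> gr V v" "(l, d) \<in> gr W w" using l by blast
      then have "(l, c * d) \<in> gr ?T ?t" unfolding gr_tensor[OF V(1) W(1)] by blast
      then show ?thesis using True c by (simp add: \<psi> dom cval[OF V(1)] cval[OF W(1)] cval[OF T])
    qed (auto simp: \<psi> dom)
    then show ?thesis
      using V W T by (intro bexI[of _ "ann ?T ?t"]) (simp_all add: bas_ann kl_mult ty_ann ann_anns)
  qed
  let ?e = "ann triv_rep (unit_vec0 (1 :: 'k))"
  show "?e \<in> anns" by (rule ann_anns[OF pointed_triv])
  show "bas ?e = \<one>\<^bsub>GA\<^esub>" by (simp add: bas_ann[OF pointed_triv] kl_one)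
  have "(h, 1) \<in> gr triv_rep (unit_vec0 (1 :: 'k))" if "h \<in> carrier G" for h
    using that by (auto simp: gr_def triv_rep_def linear_rep_def act_def unit_vec0_def vscale_def)
  then show "\<psi> (ty ?e) = 1"
    using l cval[OF pointed_triv] by (auto simp: \<psi> ty_ann[OF pointed_triv] subset_iff Domain.simps)
qed

text \<open>Among the types with nonzero sum take one whose stabilizer \<open>?H\<close> is as large
  as possible. The homomorphisms attached to \<open>?H\<close> then see only types with stabilizer
  exactly \<open>?H\<close>, and their vanishing is a linear relation between distinct characters of
  \<open>?H\<close>.\<close>

lemma nilpotent_tsum:
  assumes x: "x \<in> carrier GA" "x [^]\<^bsub>GA\<^esub> (n::nat) = \<zero>\<^bsub>GA\<^esub>"
  shows "tsum t x = 0"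
proof (rule ccontr)
  let ?T = "{t \<in> ty ` A.supp x. tsum t x \<noteq> 0}"
  assume nz: "tsum t x \<noteq> 0"
  have fT: "finite ?T" using A.finite_supp[OF x(1)] by simp
  have T: "\<exists>V v. pointed V v \<and> u = gr V v" if "u \<in> ?T" for u
  proof -
    have "u \<in> ty ` A.supp x" using that by blast
    then obtain j where j: "j \<in> anns" "u = ty j" unfolding A.supp_def by blast
    from j(1) obtain V v where "pointed V v" "j = ann V v" by (rule annsE)
    then show ?thesis using j ty_ann by blast
  qed
  have "t \<in> ?T"
  proof -
    have "t \<in> ty ` A.supp x"
    proof (rule ccontr)
      assume "t \<notin> ty ` A.supp x"
      then have "tsum t x = 0" unfolding A.tsum_def A.ext_def by (intro sum.neutral) auto
      then show False using nz by simp
    qed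
    then show ?thesis using nz by simp
  qed
  then have ne: "?T \<noteq> {}" by blast
  obtain t0 where t0: "t0 \<in> ?T" "\<And>u. u \<in> ?T \<Longrightarrow> card (Domain u) \<le> card (Domain t0)"
  proof -
    let ?S = "(\<lambda>u. card (Domain u)) ` ?T"
    have fS: "finite ?S" using fT by (rule finite_imageI)
    have "Max ?S \<in> ?S" using ne by (intro Max_in[OF fS]) blast
    then obtain u where u: "u \<in> ?T" "Max ?S = card (Domain u)" by blast
    show thesis
    proof (rule that[OF u(1)])
      fix u' assume "u' \<in> ?T"
      then show "card (Domain u') \<le> card (Domain u)" unfolding u(2)[symmetric] by (intro Max_ge[OF fS]) blast
    qed
  qed
  obtain V0 v0 where V0: "pointed V0 v0" "t0 = gr V0 v0" using T[OF t0(1)] by blast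
  let ?H = "Domain t0"
  have sg: "subgroup ?H G" unfolding V0 by (rule gr_subgroup[OF V0(1)])
  have Hc: "?H \<subseteq> carrier G" using sg by (rule subgroup.subset)
  let ?C = "{u \<in> ?T. ?H \<subseteq> Domain u}"
  have dom: "Domain u = ?H" if "u \<in> ?C" for u
  proof -
    obtain V v where V: "pointed V v" "u = gr V v" using T[of u] \<open>u \<in> ?C\<close> by blast
    have "finite (Domain u)" using finite_gr[OF V(1)] V(2) by (simp add: finite_Domain)
    then show ?thesis using \<open>u \<in> ?C\<close> t0(2)[of u] by (intro card_seteq[symmetric]) auto
  qed
  have "\<forall>u\<in>?C. (of_rat (tsum u x) :: 'k) = 0"
  proof (rule character_independence[where F = cval and H = ?H and M = G])
    show "finite ?C" by (rule finite_subset[OF _ fT]) blast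
    show "monoid (G\<lparr>carrier := ?H\<rparr>)" using subgroup.subgroup_is_group[OF sg is_group] by (rule group.is_monoid)
    show "cval u (g \<otimes> h) = cval u g * cval u h" if u: "u \<in> ?C" and gh: "g \<in> ?H" "h \<in> ?H" for u g h
    proof -
      obtain V v where V: "pointed V v" "u = gr V v" using T[of u] u by blast
      obtain c d where "(g, c) \<in> gr V v" "(h, d) \<in> gr V v" using gh dom[OF u] V(2) by blast
      then show ?thesis using gr_mult[OF V(1)] by (simp add: V(2) cval[OF V(1)])
    qed
    show "cval u \<one> = 1" if u: "u \<in> ?C" for u
    proof -
      obtain V v where V: "pointed V v" "u = gr V v" using T[of u] u by blast
      then show ?thesis using gr_one[OF V(1)] cval[OF V(1)] by simp
    qed
    show "\<exists>h\<in>?H. cval u h \<noteq> cval u' h" if u: "u \<in> ?C" "u' \<in> ?C" and ne: "u \<noteq> u'" for u u'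
    proof (rule ccontr)
      assume eq: "\<not> ?thesis"
      obtain V v where V: "pointed V v" "u = gr V v" using T[of u] u by blast
      obtain W w where W: "pointed W w" "u' = gr W w" using T[of u'] u by blast
      have gv: "u = {(h, cval u h) |h. h \<in> Domain u}" using cval[OF V(1)] unfolding V(2) by force
      have gw: "u' = {(h, cval u' h) |h. h \<in> Domain u'}" using cval[OF W(1)] unfolding W(2) by force
      have "{(h, cval u h) |h. h \<in> Domain u} = {(h, cval u' h) |h. h \<in> Domain u'}"
        unfolding dom[OF u(1)] dom[OF u(2)]
      proof (intro equalityI subsetI)
        fix p assume "p \<in> {(h, cval u h) |h. h \<in> ?H}"
        then obtain h where "p = (h, cval u h)" "h \<in> ?H" by blast
        moreover have "cval u h = cval u' h" using eq \<open>h \<in> ?H\<close> by blast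
        ultimately show "p \<in> {(h, cval u' h) |h. h \<in> ?H}" by auto
      next
        fix p assume "p \<in> {(h, cval u' h) |h. h \<in> ?H}"
        then obtain h where "p = (h, cval u' h)" "h \<in> ?H" by blast
        moreover have "cval u h = cval u' h" using eq \<open>h \<in> ?H\<close> by blast
        ultimately show "p \<in> {(h, cval u h) |h. h \<in> ?H}" by auto
      qed
      then have "u = u'" using gv gw by argo
      then show False using ne by simp
    qed
    show "(\<Sum>u\<in>?C. of_rat (tsum u x) * cval u h) = 0" if h: "h \<in> ?H" for h
    proof -
      let ?\<psi> = "\<lambda>u. if ?H \<subseteq> Domain u then cval u h else 0"
      have "0 = (\<Sum>u\<in>ty ` A.supp x. of_rat (tsum u x) * ?\<psi> u)"
        using character_hom[OF h Hc refl x] A.ext_by_types[OF x(1), of ?\<psi> ty] by simp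
      \<comment> \<open>A type that is dropped has sum zero or a stabilizer not containing
        \<open>?H\<close>, where \<open>?\<psi>\<close> is zero.\<close>
      also have "\<dots> = (\<Sum>u\<in>?C. of_rat (tsum u x) * ?\<psi> u)"
        using A.finite_supp[OF x(1)] by (intro sum.mono_neutral_right) auto
      also have "\<dots> = (\<Sum>u\<in>?C. of_rat (tsum u x) * cval u h)" by (intro sum.cong) auto
      finally show ?thesis by simp
    qed
  qed
  then show False using t0(1) by auto
qed

lemma nil_ideal: "ideal (nil G) GA"
  unfolding nil_def by (rule A.nilradical_ideal)

lemma nil_iff:
  assumes x: "x \<in> carrier GA"
  shows "x \<in> nil G \<longleftrightarrow> (\<forall>t. tsum t x = 0)"
proof
  assume "x \<in> nil G"
  then obtain n :: nat where "x [^]\<^bsub>GA\<^esub> n = \<zero>\<^bsub>GA\<^esub>" unfolding nil_def nilradical_def by blast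
  then show "\<forall>t. tsum t x = 0" using nilpotent_tsum[OF x] by blast
next
  assume 0: "\<forall>t. tsum t x = 0"
  have "\<exists>n::nat. x [^]\<^bsub>GA\<^esub> n = \<zero>\<^bsub>GA\<^esub>"
  proof (rule A.nilpotent_if_tsum_zero[OF _ x])
    fix i j assume ij: "i \<in> anns" "j \<in> anns" "ty i = ty j"
    obtain V v where V: "pointed V v" "i = ann V v" using ij(1) by (rule annsE)
    obtain W w where W: "pointed W w" "j = ann W w" using ij(2) by (rule annsE)
    show "\<exists>n::nat. (bas i \<ominus>\<^bsub>GA\<^esub> bas j) [^]\<^bsub>GA\<^esub> n = \<zero>\<^bsub>GA\<^esub>"
      using kl_diff_nilpotent[OF V(1) W(1)] ij(3) by (simp add: V W bas_ann ty_ann)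
  qed (use 0 in blast)
  then show "x \<in> nil G" using x unfolding nil_def nilradical_def by blast
qed

abbreviation RA :: "('a, 'k) rat_elem set ring"
  where "RA \<equiv> red_alg G"

sublocale NI: ideal "nil G" GA by (rule nil_ideal)

sublocale RA: cring RA
  unfolding red_alg_def by (rule NI.quotient_is_cring[OF A.is_cring])

lemma mod_nil_simps:
  assumes "x \<in> carrier GA"
  shows "mod_nil G x \<in> carrier RA"
    and "y \<in> carrier GA \<Longrightarrow> mod_nil G x \<oplus>\<^bsub>RA\<^esub> mod_nil G y = mod_nil G (x \<oplus>\<^bsub>GA\<^esub> y)"
    and "y \<in> carrier GA \<Longrightarrow> mod_nil G x \<otimes>\<^bsub>RA\<^esub> mod_nil G y = mod_nil G (x \<otimes>\<^bsub>GA\<^esub> y)"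
    and "\<ominus>\<^bsub>RA\<^esub> mod_nil G x = mod_nil G (\<ominus>\<^bsub>GA\<^esub> x)"
  using assms by (simp_all add: mod_nil_def red_alg_def NI.quot_closed NI.quot_add NI.quot_mult NI.quot_minus)

lemma mod_nil_one: "\<one>\<^bsub>RA\<^esub> = mod_nil G \<one>\<^bsub>GA\<^esub>"
  by (simp add: mod_nil_def red_alg_def NI.quot_one)

lemma mod_nil_zero: "\<zero>\<^bsub>RA\<^esub> = mod_nil G \<zero>\<^bsub>GA\<^esub>"
  using NI.coset_eq_ideal_iff[of "\<zero>\<^bsub>GA\<^esub>"] by (simp add: mod_nil_def red_alg_def NI.quot_zero)

lemma carrier_RA: "carrier RA = mod_nil G ` carrier GA"
  by (simp add: mod_nil_def red_alg_def NI.quot_carrier)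

text \<open>The type sums serve as coordinates on the reduced algebra; equations between cosets are
  checked through them.\<close>

lemma mod_nil_eq:
  assumes x: "x \<in> carrier GA" and y: "y \<in> carrier GA"
  shows "mod_nil G x = mod_nil G y \<longleftrightarrow> (\<forall>t. tsum t x = tsum t y)"
proof -
  have "mod_nil G x = mod_nil G y \<longleftrightarrow> x \<ominus>\<^bsub>GA\<^esub> y \<in> nil G"
    using x y by (simp add: mod_nil_def NI.coset_eq_iff)
  also have "\<dots> \<longleftrightarrow> (\<forall>t. tsum t (x \<ominus>\<^bsub>GA\<^esub> y) = 0)" using x y by (intro nil_iff) simp
  also have "\<dots> \<longleftrightarrow> (\<forall>t. tsum t x = tsum t y)"
    using x y by (simp add: a_minus_def A.tsum_add A.tsum_minus)
  finally show ?thesis .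
qed

text \<open>Maps on cosets are written as unions over all members, so every member has to be known
  to represent the same coset.\<close>

lemma mod_nil_members:
  assumes x: "x \<in> carrier GA" and y: "y \<in> mod_nil G x"
  shows "y \<in> carrier GA \<and> mod_nil G y = mod_nil G x"
proof -
  obtain i where i: "i \<in> nil G" "y = i \<oplus>\<^bsub>GA\<^esub> x"
    using y unfolding mod_nil_def a_r_coset_def r_coset_def by auto
  have ic: "i \<in> carrier GA" using NI.Icarr[OF i(1)] .
  have "tsum t y = tsum t x" for t
    using i nil_iff[OF ic] x ic by (simp add: A.tsum_add)
  then show ?thesis using i x ic mod_nil_eq[of y x] by simp
qed

lemma mod_nil_self: "x \<in> carrier GA \<Longrightarrow> x \<in> mod_nil G x"
  unfolding mod_nil_def by (rule NI.a_rcos_self)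

subsection \<open>The projection onto a set of types\<close>

definition proj :: "(('a \<times> 'k) set \<Rightarrow> bool) \<Rightarrow> ('a, 'k) rat_elem \<Rightarrow> ('a, 'k) rat_elem"
  where "proj P = A.self.lin (\<lambda>j. if P (ty j) then bas j else \<zero>\<^bsub>GA\<^esub>)"

definition kspan :: "(('a \<times> 'k) set \<Rightarrow> bool) \<Rightarrow> ('a, 'k) rat_elem set"
  where "kspan P = qspan G {kl V v |V v. pointed V v \<and> P (gr V v)}"

lemma proj_simps:
  shows proj_closed: "proj P x \<in> carrier GA"
    and proj_add: "x \<in> carrier GA \<Longrightarrow> y \<in> carrier GA \<Longrightarrow> proj P (x \<oplus>\<^bsub>GA\<^esub> y) = proj P x \<oplus>\<^bsub>GA\<^esub> proj P y"
    and proj_zero: "proj P \<zero>\<^bsub>GA\<^esub> = \<zero>\<^bsub>GA\<^esub>"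
    and proj_scale: "x \<in> carrier GA \<Longrightarrow> proj P (scal G q \<otimes>\<^bsub>GA\<^esub> x) = scal G q \<otimes>\<^bsub>GA\<^esub> proj P x"
proof -
  have cl: "(if P (ty j) then bas j else \<zero>\<^bsub>GA\<^esub>) \<in> carrier GA" if "j \<in> anns" for j using that by simp
  show "proj P x \<in> carrier GA"
    "x \<in> carrier GA \<Longrightarrow> y \<in> carrier GA \<Longrightarrow> proj P (x \<oplus>\<^bsub>GA\<^esub> y) = proj P x \<oplus>\<^bsub>GA\<^esub> proj P y"
    "proj P \<zero>\<^bsub>GA\<^esub> = \<zero>\<^bsub>GA\<^esub>"
    "x \<in> carrier GA \<Longrightarrow> proj P (scal G q \<otimes>\<^bsub>GA\<^esub> x) = scal G q \<otimes>\<^bsub>GA\<^esub> proj P x"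
    unfolding proj_def
    by (rule A.self.lin_closed A.self.lin_add A.self.lin_zero A.self.lin_scale; simp add: cl)+
qed

lemma proj_kl:
  assumes V: "pointed V v"
  shows "proj P (scal G q \<otimes>\<^bsub>GA\<^esub> kl V v) = (if P (gr V v) then scal G q \<otimes>\<^bsub>GA\<^esub> kl V v else \<zero>\<^bsub>GA\<^esub>)"
proof -
  have cl: "(if P (ty j) then bas j else \<zero>\<^bsub>GA\<^esub>) \<in> carrier GA" if "j \<in> anns" for j using that by simp
  have "proj P (scal G q \<otimes>\<^bsub>GA\<^esub> bas (ann V v)) =
      scal G q \<otimes>\<^bsub>GA\<^esub> (if P (ty (ann V v)) then bas (ann V v) else \<zero>\<^bsub>GA\<^esub>)"
    unfolding proj_def by (rule A.self.lin_basis[OF cl ann_anns[OF V]])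
  then show ?thesis using V by (simp add: bas_ann ty_ann)
qed

lemma tsum_proj:
  assumes x: "x \<in> carrier GA"
  shows "tsum t (proj P x) = (if P t then tsum t x else 0)"
  using x
proof (induction rule: kl_induct)
  case zero
  then show ?case by (simp add: proj_zero A.tsum_zero)
next
  case (base q V v)
  then show ?case by (auto simp: proj_kl tsum_kl A.tsum_zero)
next
  case (add x y)
  then show ?case by (simp add: proj_add proj_closed A.tsum_add)
qed

lemma kgens_closed: "{scal G q \<otimes>\<^bsub>GA\<^esub> s |q s. s \<in> {kl V v |V v. pointed V v \<and> P (gr V v)}} \<subseteq> carrier GA"
  using kl_closed scal_closed by auto

lemma kspan_closed: "kspan P \<subseteq> carrier GA"
  unfolding kspan_def qspan_def by (rule A.add_span_incl[OF kgens_closed])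

lemma kspan_simps:
  shows kspan_zero: "\<zero>\<^bsub>GA\<^esub> \<in> kspan P"
    and kspan_add: "x \<in> kspan P \<Longrightarrow> y \<in> kspan P \<Longrightarrow> x \<oplus>\<^bsub>GA\<^esub> y \<in> kspan P"
    and kspan_minus: "x \<in> kspan P \<Longrightarrow> \<ominus>\<^bsub>GA\<^esub> x \<in> kspan P"
  unfolding kspan_def qspan_def
  by (rule A.add_span_zero A.add_span_add A.add_span_minus[OF kgens_closed]; assumption)+

lemma kspan_kl: "pointed V v \<Longrightarrow> P (gr V v) \<Longrightarrow> scal G q \<otimes>\<^bsub>GA\<^esub> kl V v \<in> kspan P"
  unfolding kspan_def qspan_def by (intro generate.incl) blast

lemma proj_kspan: "x \<in> carrier GA \<Longrightarrow> proj P x \<in> kspan P"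
  by (induction rule: kl_induct) (auto simp: proj_zero proj_kl proj_add kspan_zero kspan_add kspan_kl)

lemma kspan_induct [consumes 1, case_names zero base add]:
  assumes "x \<in> kspan P" "Q \<zero>\<^bsub>GA\<^esub>" "\<And>q V v. pointed V v \<Longrightarrow> P (gr V v) \<Longrightarrow> Q (scal G q \<otimes>\<^bsub>GA\<^esub> kl V v)"
    and "\<And>x y. x \<in> kspan P \<Longrightarrow> y \<in> kspan P \<Longrightarrow> Q x \<Longrightarrow> Q y \<Longrightarrow> Q (x \<oplus>\<^bsub>GA\<^esub> y)"
  shows "Q x"
  using assms(1) unfolding kspan_def qspan_def
proof (induction rule: A.add_span_induct)
  case (minus s)
  then obtain q V v where s: "s = scal G q \<otimes>\<^bsub>GA\<^esub> kl V v" "pointed V v" "P (gr V v)" by blast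
  then have "\<ominus>\<^bsub>GA\<^esub> s = scal G (- q) \<otimes>\<^bsub>GA\<^esub> kl V v" by (simp add: A.s_minus A.l_minus kl_closed)
  then show ?case using assms(3) s by simp
next
  case (add x y)
  then show ?case using assms(4) unfolding kspan_def qspan_def by blast
qed (use assms in auto)

lemma proj_id: "x \<in> kspan P \<Longrightarrow> proj P x = x"
proof (induction rule: kspan_induct)
  case (add x y)
  then have "x \<in> carrier GA" "y \<in> carrier GA" using kspan_closed by blast+
  then show ?case using add by (simp add: proj_add)
qed (simp_all add: proj_zero proj_kl)

lemma tsum_kspan: "x \<in> kspan P \<Longrightarrow> \<not> P t \<Longrightarrow> tsum t x = 0"
  using tsum_proj[of x t P] proj_id[of x P] kspan_closed by auto

text \<open>Multiplication by \<open>kl Z z\<close> sends each basis element to a basis element, and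
  \<open>P\<close> is assumed not to change along the way.\<close>

lemma proj_mult_kl:
  assumes Z: "pointed Z z"
    and P: "\<And>V v. pointed V v \<Longrightarrow> P (gr (rep_tensor Z V) (vec_tensor (rdim V) z v)) \<longleftrightarrow> P (gr V v)"
    and x: "x \<in> carrier GA"
  shows "proj P (kl Z z \<otimes>\<^bsub>GA\<^esub> x) = kl Z z \<otimes>\<^bsub>GA\<^esub> proj P x"
  using x
proof (induction rule: kl_induct)
  case zero
  then show ?case using kl_closed[OF Z] by (simp add: proj_zero)
next
  case (base q V v)
  have "kl Z z \<otimes>\<^bsub>GA\<^esub> (scal G q \<otimes>\<^bsub>GA\<^esub> kl V v) = scal G q \<otimes>\<^bsub>GA\<^esub> kl (rep_tensor Z V) (vec_tensor (rdim V) z v)"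
    unfolding kl_mult[OF Z base, symmetric] using kl_closed[OF Z] kl_closed[OF base] by (simp add: A.m_ac)
  then show ?case
    using base P[OF base] kl_closed[OF Z] proj_kl[OF base] proj_kl[OF pointed_tensor[OF Z base]] by simp
next
  case (add x y)
  then show ?case using kl_closed[OF Z] by (simp add: proj_add proj_closed A.r_distr)
qed

end

section \<open>Complete reducibility\<close>

lemma dim_kspace: "kv.dim (kspace n :: (nat \<Rightarrow> 'k::field) set) = n"
proof -
  let ?B = "ev ` {..<n} :: (nat \<Rightarrow> 'k) set"
  have inj: "inj_on (ev :: nat \<Rightarrow> nat \<Rightarrow> 'k) {..<n}"
    by (rule inj_onI) (metis ev_def zero_neq_one)
  have "kv.independent ?B"
    unfolding kv.dependent_finite[OF finite_imageI[OF finite_lessThan]]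
  proof clarify
    fix u j assume s: "(\<Sum>v\<in>?B. vscale (u v) v) = 0" and j: "j < n" "u (ev j) \<noteq> 0"
    have "(\<Sum>v\<in>?B. vscale (u v) v) j = (\<Sum>i<n. u (ev i) * ev i j)"
      by (simp add: sum.reindex[OF inj] sum_fun_apply vscale_def)
    also have "\<dots> = (\<Sum>i<n. if i = j then u (ev i) else 0)" by (intro sum.cong) (auto simp: ev_def)
    also have "\<dots> = u (ev j)" using j by simp
    finally show False using s j by simp
  qed
  then have "kv.dim (kv.span ?B) = card ?B" unfolding kv.dim_span by (rule kv.dim_eq_card_independent)
  then show ?thesis by (simp add: span_ev card_image[OF inj])
qed

lemma card_independent_kspace:
  "kv.independent B \<Longrightarrow> B \<subseteq> (kspace n :: (nat \<Rightarrow> 'k::field) set) \<Longrightarrow> finite B \<and> card B \<le> n"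
proof -
  assume B: "kv.independent B" "B \<subseteq> (kspace n :: (nat \<Rightarrow> 'k) set)"
  have "finite B \<and> card B \<le> card (ev ` {..<n} :: (nat \<Rightarrow> 'k) set)"
    using B by (intro kv.independent_span_bound) (simp_all add: span_ev)
  moreover have "card (ev ` {..<n} :: (nat \<Rightarrow> 'k) set) \<le> n" using card_image_le[of "{..<n}" ev] by simp
  ultimately show ?thesis by linarith
qed

lemma dim_proper_subspace:
  assumes S: "kv.subspace S" "S \<subseteq> kspace n" "S \<noteq> (kspace n :: (nat \<Rightarrow> 'k::field) set)"
  shows "kv.dim S < n"
proof -
  obtain B where B: "finite B" "B \<subseteq> S" "kv.independent B" "kv.span B = kv.span S" "card B = kv.dim S"
    using kspace_finite_basis[OF S(2)] .
  obtain y where y: "y \<in> kspace n" "y \<notin> S" using S by blast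
  have "kv.span B = S" using B(4) S(1) kv.span_eq_iff by metis
  then have "y \<notin> kv.span B" using y by simp
  then have "kv.independent (insert y B)" "y \<notin> B"
    using B(3) kv.independent_insertI kv.span_base by blast+
  then have "card B + 1 \<le> n"
    using card_independent_kspace[of "insert y B" n] B y S by auto
  then show ?thesis using B(5) by simp
qed

lemma dim_subspace_le:
  assumes "S \<subseteq> (kspace n :: (nat \<Rightarrow> 'k::field) set)"
  shows "kv.dim S \<le> n"
  using kspace_finite_basis[OF assms] card_independent_kspace[of _ n] assms by (metis order_trans)

context fin_grp
begin

definition stable :: "('a, 'k::field) rep \<Rightarrow> (nat \<Rightarrow> 'k) set \<Rightarrow> bool"
  where "stable V S \<longleftrightarrow> kv.subspace S \<and> S \<subseteq> kspace (rdim V) \<and> (\<forall>a\<in>carrier G. \<forall>u\<in>S. act V a u \<in> S)"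

lemma irreducible_rep_iff:
  "irreducible_rep G V \<longleftrightarrow> is_rep G V \<and> rdim V > 0 \<and> (\<forall>S. stable V S \<longrightarrow> S = {0} \<or> S = kspace (rdim V))"
proof -
  have "kv.subspace S \<and> S \<subseteq> kspace (rdim V) \<and> kG_span G V S \<subseteq> S \<longleftrightarrow> stable V S" for S
  proof -
    have "(\<forall>a\<in>carrier G. \<forall>u\<in>S. act V a u \<in> S)" if "kG_span G V S \<subseteq> S"
      using that act_in_span[of _ _ S V] by blast
    moreover have "kG_span G V S \<subseteq> S" if "kv.subspace S" "\<forall>a\<in>carrier G. \<forall>u\<in>S. act V a u \<in> S"
      using that by (intro kG_span_least) auto
    ultimately show ?thesis unfolding stable_def by blast
  qed
  then show ?thesis unfolding irreducible_rep_def by blast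
qed

definition ghom :: "('a, 'k::field) rep \<Rightarrow> ('a, 'k) rep \<Rightarrow> ((nat \<Rightarrow> 'k) \<Rightarrow> nat \<Rightarrow> 'k) \<Rightarrow> bool"
  where "ghom V W f \<longleftrightarrow> klin f \<and> (\<forall>u\<in>kspace (rdim V). f u \<in> kspace (rdim W)) \<and>
    (\<forall>a\<in>carrier G. \<forall>u\<in>kspace (rdim V). f (act V a u) = act W a (f u))"

lemma ghom_kG_act:
  assumes f: "ghom V W f" and u: "u \<in> kspace (rdim V)"
  shows "f (kG_act G V x u) = kG_act G W x (f u)"
  using f u by (intro kG_act_commute) (auto simp: ghom_def)

lemma ghom_compose: "ghom V W f \<Longrightarrow> ghom W U g \<Longrightarrow> ghom V U (\<lambda>u. g (f u))"
  unfolding ghom_def by (auto intro: klin_compose)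

lemma ghom_add: "ghom V W f \<Longrightarrow> ghom V W g \<Longrightarrow> ghom V W (\<lambda>u. f u + g u)"
  unfolding ghom_def
  by (auto simp: kk.linear_add[OF klin_act] intro: kk.linear_compose_add kv.subspace_add[OF subspace_kspace])

lemma ghom_scale: "ghom V W f \<Longrightarrow> ghom V W (\<lambda>u. vscale c (f u))"
  unfolding ghom_def
  by (auto simp: kk.linear_scale[OF klin_act] intro: kk.linear_compose_scale_right kv.subspace_scale[OF subspace_kspace])

lemma ghom_zero: "ghom V W (\<lambda>u. 0)"
  unfolding ghom_def by (auto simp: kk.linear_0[OF klin_act] intro: klinI)

lemma ghom_id: "ghom V V (\<lambda>u. u)"
  unfolding ghom_def by (simp add: klin_id)

lemma stable_kernel:
  assumes f: "ghom V W f"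
  shows "stable V {u \<in> kspace (rdim V). f u = 0}"
proof -
  have lf: "klin f" using f by (simp add: ghom_def)
  have "kv.subspace {u \<in> kspace (rdim V). f u = 0}"
    using kv.subspace_inter[OF subspace_kspace kk.linear_subspace_kernel[OF lf]] by (simp add: Int_def)
  then show ?thesis
    using f by (auto simp: stable_def ghom_def act_kspace kk.linear_0[OF klin_act])
qed

text \<open>Translating the summation variable by \<open>a\<close> moves the action of
  \<open>a\<close> through the sum. Maschke's theorem feeds in a projection, Schur orthogonality an
  elementary matrix.\<close>

lemma average_hom:
  fixes V W :: "('a, 'k::field) rep"
  assumes V: "is_rep G V" and W: "is_rep G W" and f: "klin f" "\<And>u. u \<in> kspace (rdim V) \<Longrightarrow> f u \<in> kspace (rdim W)"
  shows "ghom V W (\<lambda>u. \<Sum>g\<in>carrier G. act W g (f (act V (inv g) u)))"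
  unfolding ghom_def
proof (intro conjI ballI)
  show "klin (\<lambda>u. \<Sum>g\<in>carrier G. act W g (f (act V (inv g) u)))"
    by (intro kk.linear_compose_sum ballI klin_compose[OF _ klin_act] klin_compose[OF klin_act f(1)])
  fix u :: "nat \<Rightarrow> 'k" assume u: "u \<in> kspace (rdim V)"
  show "(\<Sum>g\<in>carrier G. act W g (f (act V (inv g) u))) \<in> kspace (rdim W)"
    by (intro kv.subspace_sum act_kspace) simp
  fix a assume a: "a \<in> carrier G"
  have "act W a (\<Sum>g\<in>carrier G. act W g (f (act V (inv g) u))) =
      (\<Sum>g\<in>carrier G. act W (a \<otimes> g) (f (act V (inv g) u)))"
    using a by (simp add: kk.linear_sum[OF klin_act] act_mult[OF W])
  also have "\<dots> = (\<Sum>g\<in>carrier G. act W g (f (act V (inv g) (act V a u))))"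
  proof (rule sum.reindex_bij_witness[where i = "\<lambda>g. inv a \<otimes> g" and j = "\<lambda>g. a \<otimes> g"])
    fix g assume g: "g \<in> carrier G"
    have "inv (a \<otimes> g) \<otimes> a = inv g" using a g by (simp add: inv_mult_group m_assoc)
    then have "act V (inv (a \<otimes> g)) (act V a u) = act V (inv g) u"
      using act_mult[OF V, of "inv (a \<otimes> g)" a u] a g by simp
    then show "act W (a \<otimes> g) (f (act V (inv (a \<otimes> g)) (act V a u))) = act W (a \<otimes> g) (f (act V (inv g) u))"
      by simp
  qed (use a in \<open>auto simp flip: m_assoc\<close>)
  finally show "(\<Sum>g\<in>carrier G. act W g (f (act V (inv g) (act V a u)))) =
      act W a (\<Sum>g\<in>carrier G. act W g (f (act V (inv g) u)))" by simp
qed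

text \<open>Averaging a linear projection onto \<open>S\<close> over the group and dividing by the
  group order makes it equivariant, and it still fixes \<open>S\<close> because \<open>S\<close> is
  stable.\<close>

lemma maschke:
  fixes V :: "('a, 'k::field_char_0) rep"
  assumes V: "is_rep G V" and S: "stable V S"
  obtains p where "ghom V V p" "\<And>u. u \<in> kspace (rdim V) \<Longrightarrow> p u \<in> S" "\<And>u. u \<in> S \<Longrightarrow> p u = u"
proof -
  have S': "kv.subspace S" "S \<subseteq> kspace (rdim V)" "\<And>a u. a \<in> carrier G \<Longrightarrow> u \<in> S \<Longrightarrow> act V a u \<in> S"
    using S by (auto simp: stable_def)
  obtain q where q: "klin q" "\<And>u. q u \<in> S" "\<And>u. u \<in> S \<Longrightarrow> q u = u"
    using projection_exists[OF S'(1)] by metis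
  let ?s = "\<lambda>u. \<Sum>g\<in>carrier G. act V g (q (act V (inv g) u))"
  let ?n = "of_nat (card (carrier G)) :: 'k"
  have "?n \<noteq> 0" using fin one_closed card_gt_0_iff[of "carrier G"] by auto
  have "ghom V V ?s" using q(2) S'(2) by (intro average_hom[OF V V q(1)]) blast
  then have "ghom V V (\<lambda>u. vscale (inverse ?n) (?s u))" by (rule ghom_scale)
  moreover have "vscale (inverse ?n) (?s u) \<in> S" for u
    using q(2) S' by (intro kv.subspace_scale kv.subspace_sum) auto
  moreover have "vscale (inverse ?n) (?s u) = u" if u: "u \<in> S" for u
  proof -
    have "act V g (q (act V (inv g) u)) = u" if g: "g \<in> carrier G" for g
    proof -
      have "q (act V (inv g) u) = act V (inv g) u" using q(3) S'(3)[of "inv g" u] u g by simp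
      then show ?thesis
        using act_mult[OF V g, of "inv g" u] act_one[OF V, of u] u S'(2) g by auto
    qed
    then have "?s u = (\<Sum>g\<in>carrier G. u)" by simp
    also have "\<dots> = vscale ?n u" by (rule ext) (simp add: sum_fun_apply vscale_def)
    finally show ?thesis using \<open>?n \<noteq> 0\<close> by simp
  qed
  ultimately show ?thesis using that by blast
qed

text \<open>A module is by definition a full coordinate space, so a stable subspace has to be
  transported through a basis before it counts as a module. \<open>f\<close> takes coordinates with
  respect to that basis.\<close>

lemma stable_coordinates:
  fixes V :: "('a, 'k::field) rep"
  assumes V: "is_rep G V" and S: "stable V S"
  obtains W f where "is_rep G W" "rdim W = kv.dim S" "klin f" "inj_on f S"
    "\<And>u. u \<in> S \<Longrightarrow> f u \<in> kspace (rdim W)" "\<And>a u. a \<in> carrier G \<Longrightarrow> u \<in> S \<Longrightarrow> f (act V a u) = act W a (f u)"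
proof -
  have S': "kv.subspace S" "S \<subseteq> kspace (rdim V)" "\<And>a u. a \<in> carrier G \<Longrightarrow> u \<in> S \<Longrightarrow> act V a u \<in> S"
    using S by (auto simp: stable_def)
  obtain B where B: "finite B" "B \<subseteq> S" "kv.independent B" "kv.span B = kv.span S" "card B = kv.dim S"
    using kspace_finite_basis[OF S'(2)] .
  have spB: "kv.span B = S" using B(4) S'(1) kv.span_eq_iff by metis
  obtain bs where bs: "set bs = B" "distinct bs" using finite_distinct_list[OF B(1)] by blast
  let ?d = "kv.dim S"
  have len: "length bs = ?d" using distinct_card[OF bs(2)] bs(1) B(5) by simp
  define h where "h w = (\<Sum>j<?d. vscale (w j) (bs ! j))" for w :: "nat \<Rightarrow> 'k"
  have lh: "klin h"
    unfolding h_def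
    by (intro klinI) (simp_all add: kv.scale_left_distrib sum.distrib kv.scale_sum_right vscale_apply)
  have hB: "(\<Sum>b\<in>B. vscale (c b) b) = (\<Sum>j<?d. vscale (c (bs ! j)) (bs ! j))" for c
    using sum.reindex_bij_betw[OF bij_betw_nth[OF bs(2) refl bs(1)[symmetric]], of "\<lambda>b. vscale (c b) b"] len
    by (simp add: bs(1))
  have hS: "h w \<in> S" for w
    unfolding h_def using B(2) bs(1) len S'(1) by (intro kv.subspace_sum kv.subspace_scale) auto
  have inj: "inj_on h (kspace ?d)"
    unfolding kk.linear_inj_on_iff_eq_0[OF lh subspace_kspace]
  proof (intro ballI impI)
    fix w :: "nat \<Rightarrow> 'k" assume w: "w \<in> kspace ?d" and 0: "h w = 0"
    have "w j = 0" if j: "j < ?d" for j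
    proof -
      let ?c = "\<lambda>b. w (THE j. j < ?d \<and> bs ! j = b)"
      have the: "(THE j. j < ?d \<and> bs ! j = bs ! i) = i" if "i < ?d" for i
        using that bs(2) len by (intro the_equality) (auto simp: nth_eq_iff_index_eq)
      have "(\<Sum>b\<in>B. vscale (?c b) b) = h w" unfolding hB h_def using the by (intro sum.cong) auto
      then have "?c (bs ! j) = 0"
        using kv.independentD[OF B(3) B(1) subset_refl, of ?c "bs ! j"] 0 j len bs(1) by auto
      then show ?thesis using the[OF j] by simp
    qed
    then show "w = 0" using w by (intro ext) (metis kspaceD not_less zero_fun_apply)
  qed
  obtain f where f: "range f \<subseteq> kspace ?d" "klin f" "\<And>w. w \<in> kspace ?d \<Longrightarrow> f (h w) = w"
    using kk.linear_exists_left_inverse_on[OF lh subspace_kspace inj] by auto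
  have hf: "h (f u) = u" if u: "u \<in> S" for u
  proof -
    have "u \<in> range (\<lambda>c. \<Sum>b\<in>B. vscale (c b) b)" using u spB kv.span_finite[OF B(1)] by auto
    then obtain c where "u = (\<Sum>b\<in>B. vscale (c b) b)" by blast
    then have u2: "u = h (\<lambda>j. if j < ?d then c (bs ! j) else 0)" unfolding hB h_def by simp
    have "(\<lambda>j. if j < ?d then c (bs ! j) else 0) \<in> kspace ?d" by (simp add: kspace_def)
    then show ?thesis using f(3) u2 by metis
  qed
  \<comment> \<open>The matrix of \<open>a\<close> in the chosen basis: column \<open>j\<close>
    holds the coordinates of \<open>a\<close> applied to the basis vector
    \<open>bs ! j\<close>.\<close>
  define W where "W = \<lparr>rdim = ?d, rmat = (\<lambda>a i j. f (act V a (h (ev j))) i)\<rparr>"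
  have actW: "act W a w = f (act V a (h w))" if w: "w \<in> kspace ?d" for a w
  proof
    fix i
    have "f (act V a (h w)) = f (act V a (h (\<Sum>j<?d. vscale (w j) (ev j))))" using kspace_expand[OF w] by simp
    also have "\<dots> = (\<Sum>j<?d. vscale (w j) (f (act V a (h (ev j)))))"
      by (simp add: kk.linear_sum[OF lh] kk.linear_scale[OF lh] kk.linear_sum[OF klin_act] kk.linear_scale[OF klin_act]
          kk.linear_sum[OF f(2)] kk.linear_scale[OF f(2)])
    finally have e: "f (act V a (h w)) i = (\<Sum>j<?d. w j * f (act V a (h (ev j))) i)"
      by (simp add: sum_fun_apply vscale_def)
    show "act W a w i = f (act V a (h w)) i"
    proof (cases "i < ?d")
      case True
      then show ?thesis unfolding e by (simp add: act_def W_def mult.commute)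
    next
      case False
      then have "f (act V a (h w)) i = 0" using f(1) kspaceD[of _ ?d i] by auto
      then show ?thesis using False by (simp add: act_def W_def)
    qed
  qed
  have dW: "rdim W = ?d" by (simp add: W_def)
  have fk: "f u \<in> kspace ?d" for u using f(1) by blast
  have "is_rep G W"
  proof (rule is_repI)
    fix j assume j: "j < rdim W"
    then have e: "(ev j :: nat \<Rightarrow> 'k) \<in> kspace ?d" using ev_kspace dW by metis
    have "act V \<one> (h (ev j)) = h (ev j)" using act_one[OF V] hS S'(2) by blast
    then show "act W \<one> (ev j) = ev j" using actW[OF e] f(3)[OF e] by simp
    fix g k assume gk: "g \<in> carrier G" "k \<in> carrier G"
    have "act W g (act W k (ev j)) = f (act V g (h (f (act V k (h (ev j))))))"
      using actW[OF e] actW[OF fk] by simp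
    also have "h (f (act V k (h (ev j)))) = act V k (h (ev j))" using hf S'(3) gk hS by blast
    finally show "act W (g \<otimes> k) (ev j) = act W g (act W k (ev j))"
      using actW[OF e] act_mult[OF V gk] by simp
  qed
  moreover have "inj_on f S" using hf by (metis inj_onI)
  moreover have "f (act V a u) = act W a (f u)" if "a \<in> carrier G" "u \<in> S" for a u
    using actW[OF fk] hf[OF that(2)] by simp
  ultimately show ?thesis using that[of W f] f(2) fk dW by metis
qed

text \<open>Pass to a proper direct summand as long as the module is reducible.\<close>

lemma irreducible_quotients_separate:
  fixes V :: "('a, 'k::field_char_0) rep"
  assumes "is_rep G V" "y \<in> kspace (rdim V)" "y \<noteq> 0"
  shows "\<exists>U f. irreducible_rep G U \<and> ghom V U f \<and> f y \<noteq> 0"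
  using assms
proof (induction "rdim V" arbitrary: V y rule: less_induct)
  case less
  note V = less.prems(1)
  have pos: "rdim V > 0"
  proof (rule ccontr)
    assume "\<not> rdim V > 0"
    then have "y i = 0" for i using less.prems(2) by (simp add: kspace_def)
    then show False using less.prems(3) by (auto simp: fun_eq_iff)
  qed
  show ?case
  proof (cases "irreducible_rep G V")
    case True
    then show ?thesis using ghom_id less.prems(3) by blast
  next
    case False
    then obtain S where S: "stable V S" "S \<noteq> {0}" "S \<noteq> kspace (rdim V)"
      using V pos by (auto simp: irreducible_rep_iff)
    obtain p where p: "ghom V V p" "\<And>u. u \<in> kspace (rdim V) \<Longrightarrow> p u \<in> S" "\<And>u. u \<in> S \<Longrightarrow> p u = u"
      using maschke[OF V S(1)] by metis
    \<comment> \<open>The induction hypothesis for any proper stable subspace into which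
      \<open>V\<close> maps equivariantly without killing \<open>y\<close>.\<close>
    have step: ?thesis
      if S: "stable V S" "S \<noteq> kspace (rdim V)" and p: "ghom V V p" "\<And>u. u \<in> kspace (rdim V) \<Longrightarrow> p u \<in> S"
        and py: "p y \<noteq> 0" for S p
    proof -
      have S': "kv.subspace S" "S \<subseteq> kspace (rdim V)" using S by (auto simp: stable_def)
      obtain W f where W: "is_rep G W" "rdim W = kv.dim S" "klin f" "inj_on f S"
        "\<And>u. u \<in> S \<Longrightarrow> f u \<in> kspace (rdim W)" "\<And>a u. a \<in> carrier G \<Longrightarrow> u \<in> S \<Longrightarrow> f (act V a u) = act W a (f u)"
        using stable_coordinates[OF V S(1)] by metis
      have lt: "rdim W < rdim V" using dim_proper_subspace[OF S' S(2)] W(2) by simp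
      have "f (p y) \<noteq> f 0"
        using inj_onD[OF W(4), of "p y" 0] py p(2)[OF less.prems(2)] kv.subspace_0[OF S'(1)] by auto
      then have fy: "f (p y) \<noteq> 0" using kk.linear_0[OF W(3)] by simp
      have "\<exists>U g. irreducible_rep G U \<and> ghom W U g \<and> g (f (p y)) \<noteq> 0"
        by (rule less.hyps[OF lt W(1) W(5)[OF p(2)[OF less.prems(2)]] fy])
      then obtain U where "\<exists>g. irreducible_rep G U \<and> ghom W U g \<and> g (f (p y)) \<noteq> 0" by (rule exE)
      then obtain g where "irreducible_rep G U \<and> ghom W U g \<and> g (f (p y)) \<noteq> 0" by (rule exE)
      then have U: "irreducible_rep G U" "ghom W U g" "g (f (p y)) \<noteq> 0" by simp_all
      have "ghom V W (\<lambda>u. f (p u))"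
        unfolding ghom_def
      proof (intro conjI ballI)
        have "klin p" using p(1) by (simp add: ghom_def)
        from klin_compose[OF this W(3)] show "klin (\<lambda>u. f (p u))" .
        show "f (p u) \<in> kspace (rdim W)" if "u \<in> kspace (rdim V)" for u using W(5) p(2) that by blast
        show "f (p (act V a u)) = act W a (f (p u))" if "a \<in> carrier G" "u \<in> kspace (rdim V)" for a u
          using W(6) p that by (simp add: ghom_def)
      qed
      from ghom_compose[OF this U(2)] have "ghom V U (\<lambda>u. g (f (p u)))" .
      with U(1,3) show ?thesis by (intro exI conjI)
    qed
    show ?thesis
    proof (cases "p y = 0")
      case False
      then show ?thesis using step[OF S(1,3) p(1,2)] by blast
    next
      case True
      \<comment> \<open>If \<open>p\<close> kills \<open>y\<close>, the complementary map
        \<open>u - p u\<close> fixes \<open>y\<close> and lands in the kernel of \<open>p\<close>,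
        which is proper because \<open>p\<close> fixes a nonzero vector of \<open>S\<close>.\<close>
      let ?S = "{u \<in> kspace (rdim V). p u = 0}"
      obtain s where s: "s \<in> S" "s \<noteq> 0" using S kv.subspace_0[of S] by (auto simp: stable_def)
      then have "s \<notin> ?S" "s \<in> kspace (rdim V)" using p(3) S(1) by (auto simp: stable_def)
      then have neq: "?S \<noteq> kspace (rdim V)" by blast
      have q: "ghom V V (\<lambda>u. u + vscale (- 1) (p u))" by (intro ghom_add ghom_id ghom_scale p(1))
      have "u + vscale (- 1) (p u) \<in> ?S" if u: "u \<in> kspace (rdim V)" for u
      proof -
        have lp: "klin p" using p(1) by (simp add: ghom_def)
        have "p (u + vscale (- 1) (p u)) = p u + vscale (- 1) (p (p u))"
          unfolding kk.linear_add[OF lp] kk.linear_scale[OF lp] by (rule refl)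
        also have "\<dots> = 0" using p(3)[OF p(2)[OF u]] by (simp add: vscale_def fun_eq_iff)
        finally show ?thesis using q u by (simp add: ghom_def)
      qed
      from step[OF stable_kernel[OF p(1)] neq q this] show ?thesis using True less.prems(3) by simp
    qed
  qed
qed

subsection \<open>Schur orthogonality\<close>

text \<open>Kernel and image are stable, and irreducibility leaves only a zero kernel and a full
  image.\<close>

lemma schur:
  fixes U W :: "('a, 'k::field) rep"
  assumes U: "irreducible_rep G U" and W: "irreducible_rep G W" and f: "ghom U W f"
    and u: "u \<in> kspace (rdim U)" "f u \<noteq> 0"
  shows "rep_iso G U W"
proof -
  have lf: "klin f" using f by (simp add: ghom_def)
  let ?K = "{u \<in> kspace (rdim U). f u = 0}"
  have "?K = {0}" using stable_kernel[OF f] U u by (auto simp: irreducible_rep_iff)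
  then have inj: "inj_on f (kspace (rdim U))"
    unfolding kk.linear_inj_on_iff_eq_0[OF lf subspace_kspace] by blast
  have "stable W (f ` kspace (rdim U))"
    unfolding stable_def
  proof (intro conjI ballI)
    show "kv.subspace (f ` kspace (rdim U))" by (rule kk.linear_subspace_image[OF lf subspace_kspace])
    show "f ` kspace (rdim U) \<subseteq> kspace (rdim W)" using f by (auto simp: ghom_def)
    fix a y assume "a \<in> carrier G" "y \<in> f ` kspace (rdim U)"
    then obtain x where x: "y = f x" "x \<in> kspace (rdim U)" "a \<in> carrier G" by blast
    then have "act W a y = f (act U a x)" using f by (simp add: ghom_def)
    then show "act W a y \<in> f ` kspace (rdim U)" by (simp add: act_kspace)
  qed
  moreover have "f ` kspace (rdim U) \<noteq> {0}" using imageI[OF u(1), of f] u(2) by auto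
  ultimately have "f ` kspace (rdim U) = kspace (rdim W)"
    using W[unfolded irreducible_rep_iff, THEN conjunct2, THEN conjunct2, rule_format, of "f ` kspace (rdim U)"]
    by simp
  then have "bij_betw f (kspace (rdim U)) (kspace (rdim W))" using inj by (simp add: bij_betw_def)
  then show ?thesis unfolding rep_iso_def using klin_on[OF lf] ghom_kG_act[OF f] by blast
qed

definition mform :: "('a, 'k::field) rep \<Rightarrow> ('a, 'k) rep \<Rightarrow> nat \<Rightarrow> nat \<Rightarrow> nat \<Rightarrow> nat \<Rightarrow> 'k"
  where "mform W U i j k l = (\<Sum>g\<in>carrier G. rmat W g i j * rmat U (inv g) k l)"

text \<open>Averaging the elementary map that sends \<open>u\<close> to \<open>u k\<close> times
  \<open>ev j\<close> gives a homomorphism whose entry in row \<open>i\<close> and column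
  \<open>l\<close> is \<open>mform W U i j k l\<close>; by Schur's lemma it is zero.\<close>

lemma schur_orthogonality:
  fixes U W :: "('a, 'k::field) rep"
  assumes U: "irreducible_rep G U" and W: "irreducible_rep G W" and "\<not> rep_iso G U W"
    and ij: "i < rdim W" "j < rdim W" and kl: "k < rdim U" "l < rdim U"
  shows "mform W U i j k l = 0"
proof -
  define f where "f u = vscale (u k) (ev j)" for u :: "nat \<Rightarrow> 'k"
  have f: "klin f" unfolding f_def by (intro klinI) (simp_all add: kv.scale_left_distrib vscale_apply)
  have fk: "f u \<in> kspace (rdim W)" for u
    unfolding f_def by (intro kv.subspace_scale[OF subspace_kspace] ev_kspace ij)
  let ?E = "\<lambda>u. \<Sum>g\<in>carrier G. act W g (f (act U (inv g) u))"
  have E: "ghom U W ?E"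
    using U W by (intro average_hom f fk) (simp_all add: irreducible_rep_iff)
  have "?E (ev l) = 0" using schur[OF U W E, of "ev l"] assms(3) ev_kspace[OF kl(2)] by blast
  then have "0 = ?E (ev l) i" by simp
  also have "\<dots> = (\<Sum>g\<in>carrier G. act U (inv g) (ev l) k * act W g (ev j) i)"
    unfolding sum_fun_apply f_def kk.linear_scale[OF klin_act] vscale_apply by (rule refl)
  also have "\<dots> = mform W U i j k l"
    unfolding mform_def using rmat_act[OF ij] rmat_act[OF kl] by (intro sum.cong) (simp_all add: mult.commute)
  finally show ?thesis by simp
qed

text \<open>The sum of \<open>mform U U i k k i\<close> over \<open>i\<close> and \<open>k\<close>
  adds up the traces of the matrix of \<open>g\<close> times that of \<open>inv g\<close>. It equals
  \<open>rdim U\<close> times the group order, which is nonzero in characteristic zero.\<close>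

lemma mform_nonzero:
  fixes U :: "('a, 'k::field_char_0) rep"
  assumes U: "irreducible_rep G U"
  shows "\<exists>i<rdim U. \<exists>k<rdim U. mform U U i k k i \<noteq> 0"
proof (rule ccontr)
  assume "\<not> ?thesis"
  then have z: "mform U U i k k i = 0" if "i < rdim U" "k < rdim U" for i k using that by blast
  have o: "(\<Sum>k<rdim U. rmat U g i k * rmat U (inv g) k i) = 1" if g: "g \<in> carrier G" "i < rdim U" for g i
  proof -
    have V: "is_rep G U" using U by (simp add: irreducible_rep_iff)
    have "rmat U (g \<otimes> inv g) i i = (\<Sum>k<rdim U. rmat U g i k * rmat U (inv g) k i)"
      using V g inv_closed[OF g(1)] unfolding is_rep_def by blast
    moreover have "rmat U \<one> i i = 1" using V g unfolding is_rep_def by simp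
    ultimately show ?thesis using g by simp
  qed
  have "0 = (\<Sum>i<rdim U. \<Sum>k<rdim U. mform U U i k k i)" using z by simp
  also have "\<dots> = (\<Sum>i<rdim U. \<Sum>g\<in>carrier G. \<Sum>k<rdim U. rmat U g i k * rmat U (inv g) k i)"
    unfolding mform_def by (intro sum.cong refl sum.swap)
  also have "\<dots> = (\<Sum>i<rdim U. \<Sum>g\<in>carrier G. 1)" using o by (intro sum.cong) auto
  also have "\<dots> = of_nat (rdim U * card (carrier G))" by simp
  finally have "rdim U * card (carrier G) = 0" by (metis of_nat_eq_0_iff)
  then show False using U fin one_closed by (auto simp: irreducible_rep_iff card_eq_0_iff)
qed

lemma rep_iso_refl: "rep_iso G V V"
  unfolding rep_iso_def by (intro exI[of _ "\<lambda>x. x"]) (simp add: klinear_on_def bij_betw_def)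

text \<open>One matrix entry per member, chosen to pair nontrivially with a reversed entry, gives
  functions on the group that Schur orthogonality makes independent, so there are at most
  \<open>|G|\<close> members. Finiteness allows a point set to be listed as \<open>presents\<close>
  demands.\<close>

lemma irr_system_finite:
  fixes I :: "('a, 'k::field_char_0) rep set"
  assumes I: "irr_system G I"
  shows "finite I"
proof (rule ccontr)
  assume "infinite I"
  let ?N = "card (carrier G)"
  obtain F where F: "finite F" "card F = ?N + 1" "F \<subseteq> I"
    using infinite_arbitrarily_large[OF \<open>infinite I\<close>, of "?N + 1"] by blast
  have irr: "irreducible_rep G U" if "U \<in> I" for U using I that by (simp add: irr_system_def)
  have noniso: "\<not> rep_iso G U W" if "U \<in> I" "W \<in> I" "U \<noteq> W" for U W
  proof
    assume "rep_iso G U W"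
    moreover have "\<exists>!X. X \<in> I \<and> rep_iso G U X" using I irr that(1) unfolding irr_system_def by blast
    ultimately show False using that rep_iso_refl by blast
  qed
  have "\<forall>U\<in>I. \<exists>p. fst p < rdim U \<and> snd p < rdim U \<and> mform U U (fst p) (snd p) (snd p) (fst p) \<noteq> 0"
    using mform_nonzero irr by (metis fst_conv snd_conv)
  then obtain p where p: "\<And>U. U \<in> I \<Longrightarrow> fst (p U) < rdim U \<and> snd (p U) < rdim U \<and>
      mform U U (fst (p U)) (snd (p U)) (snd (p U)) (fst (p U)) \<noteq> 0" by metis
  obtain gs where gs: "set gs = carrier G" "distinct gs" using finite_distinct_list[OF fin] by blast
  have len: "length gs = ?N" using distinct_card[OF gs(2)] gs(1) by simp
  \<comment> \<open>The chosen matrix entry as a function on the group, written as a vector through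
    the list \<open>gs\<close>; \<open>pr U\<close> pairs with the transposed entry at
    inverses.\<close>
  define vec where "vec U = (\<lambda>m. if m < ?N then rmat U (gs ! m) (fst (p U)) (snd (p U)) else 0)" for U :: "('a, 'k) rep"
  define pr where "pr U w = (\<Sum>m<?N. w m * rmat U (inv (gs ! m)) (snd (p U)) (fst (p U)))"
    for U :: "('a, 'k) rep" and w :: "nat \<Rightarrow> 'k"
  have pv: "pr U (vec W) = mform W U (fst (p W)) (snd (p W)) (snd (p U)) (fst (p U))" for U W
  proof -
    have "pr U (vec W) = (\<Sum>m<length gs. rmat W (gs ! m) (fst (p W)) (snd (p W)) * rmat U (inv (gs ! m)) (snd (p U)) (fst (p U)))"
      unfolding pr_def vec_def len by (intro sum.cong) auto
    also have "\<dots> = mform W U (fst (p W)) (snd (p W)) (snd (p U)) (fst (p U))"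
      unfolding mform_def
      using sum.reindex_bij_betw[OF bij_betw_nth[OF gs(2) refl gs(1)[symmetric]],
        of "\<lambda>g. rmat W g (fst (p W)) (snd (p W)) * rmat U (inv g) (snd (p U)) (fst (p U))"] .
    finally show ?thesis .
  qed
  have orth: "pr U (vec W) = 0" if "U \<in> I" "W \<in> I" "U \<noteq> W" for U W
    unfolding pv using that p noniso irr by (intro schur_orthogonality) auto
  have nz: "pr U (vec U) \<noteq> 0" if "U \<in> I" for U unfolding pv using p that by blast
  have inj: "inj_on vec F" using orth nz F(3) by (intro inj_onI) (metis subsetD)
  have "kv.independent (vec ` F)"
    unfolding kv.dependent_finite[OF finite_imageI[OF F(1)]]
  proof clarify
    fix c U assume s: "(\<Sum>v\<in>vec ` F. vscale (c v) v) = 0" and U: "U \<in> F" "c (vec U) \<noteq> 0"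
    have "0 = pr U (\<Sum>W\<in>F. vscale (c (vec W)) (vec W))"
      using s by (simp add: sum.reindex[OF inj] pr_def)
    also have "\<dots> = (\<Sum>W\<in>F. c (vec W) * pr U (vec W))"
      unfolding pr_def sum_fun_apply vscale_def sum_distrib_right
      by (subst sum.swap) (simp add: sum_distrib_left mult.assoc)
    also have "\<dots> = (\<Sum>W\<in>F. if W = U then c (vec U) * pr U (vec U) else 0)"
      using orth U F(3) by (intro sum.cong) auto
    also have "\<dots> = c (vec U) * pr U (vec U)" using U(1) F(1) by simp
    finally show False using U nz F(3) by auto
  qed
  moreover have "vec ` F \<subseteq> kspace ?N" by (auto simp: vec_def kspace_def)
  ultimately have "card (vec ` F) \<le> ?N" using card_independent_kspace by blast
  then show False using F(2) card_image[OF inj] by simp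
qed

end

section \<open>The parametrization\<close>

text \<open>Translation by \<open>a\<close> multiplies the sum by \<open>\<chi> a\<close>, which is
  not 1.\<close>

lemma (in group) sum_nontrivial_character:
  fixes \<chi> :: "'a \<Rightarrow> 'k::field"
  assumes fin: "finite (carrier G)" and mult: "\<And>g h. g \<in> carrier G \<Longrightarrow> h \<in> carrier G \<Longrightarrow> \<chi> (g \<otimes> h) = \<chi> g * \<chi> h"
    and a: "a \<in> carrier G" "\<chi> a \<noteq> 1"
  shows "(\<Sum>g\<in>carrier G. \<chi> g) = 0"
proof -
  have "(\<Sum>g\<in>carrier G. \<chi> g) = (\<Sum>g\<in>carrier G. \<chi> (a \<otimes> g))"
    by (rule sum.reindex_bij_witness[of _ "\<lambda>g. a \<otimes> g" "\<lambda>g. inv a \<otimes> g"]) (use a in \<open>simp_all flip: m_assoc\<close>)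
  also have "\<dots> = \<chi> a * (\<Sum>g\<in>carrier G. \<chi> g)" using a(1) mult by (simp add: sum_distrib_left)
  finally have "(\<chi> a - 1) * (\<Sum>g\<in>carrier G. \<chi> g) = 0" by (simp add: algebra_simps)
  then show ?thesis using a(2) by simp
qed

context fin_grp
begin

lemma act_linear: "act (linear_rep \<chi>) g v = unit_vec0 (\<chi> g * v 0)"
  by (simp add: act_def linear_rep_def unit_vec0_def fun_eq_iff)

lemma rdim_linear [simp]: "rdim (linear_rep \<chi>) = 1"
  by (simp add: linear_rep_def)

lemma kG_act_linear: "kG_act G (linear_rep \<chi>) x v = unit_vec0 (pair x \<chi> * v 0)"
  by (rule ext) (simp add: kG_act_apply act_linear unit_vec0_def pair_def sum_distrib_right mult.assoc)

lemma kspace_1: "v \<in> kspace 1 \<Longrightarrow> v = unit_vec0 (v 0)"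
  by (auto simp: kspace_def unit_vec0_def fun_eq_iff)

lemma unit_vec0_eq_0: "unit_vec0 c = 0 \<longleftrightarrow> c = 0"
  by (auto simp: unit_vec0_def fun_eq_iff)

lemma ann_linear: "v \<in> kspace 1 \<Longrightarrow> v \<noteq> 0 \<Longrightarrow> x \<in> ann (linear_rep \<chi>) v \<longleftrightarrow> pair x \<chi> = 0"
  using kspace_1[of v] by (auto simp: ann_def kG_act_linear unit_vec0_eq_0)

lemma list_Cons [simp]:
  "rep_of_list ((V, v) # L) = rep_dsum V (rep_of_list L)" "rep_of_list [] = zero_rep"
  "vec_of_list ((V, v) # L) = vec_dsum (rdim V) v (vec_of_list L)" "vec_of_list [] = 0"
  unfolding rep_of_list_def vec_of_list_def by simp_all

lemma rdim_dsum: "rdim (rep_dsum V W) = rdim V + rdim W"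
  by (simp add: rep_dsum_def)

lemma rep_of_list:
  fixes L :: "(('a, 'k::field) rep \<times> (nat \<Rightarrow> 'k)) list"
  assumes "\<forall>(V, v)\<in>set L. is_rep G V \<and> v \<in> kspace (rdim V)"
  shows "is_rep G (rep_of_list L) \<and> vec_of_list L \<in> kspace (rdim (rep_of_list L)) \<and>
    ann (rep_of_list L) (vec_of_list L) = {x. \<forall>(V, v)\<in>set L. kG_act G V x v = 0}"
  using assms
proof (induction L)
  case Nil
  have "is_rep G zero_rep" by (simp add: is_rep_def zero_rep_def)
  then show ?case unfolding list_Cons ann_zero by (simp add: kspace_def)
next
  case (Cons X L)
  obtain V v where X: "X = (V, v)" by force
  have V: "is_rep G V" and L: "\<forall>(V, v)\<in>set L. is_rep G V \<and> v \<in> kspace (rdim V)" using Cons.prems X by auto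
  note IH = Cons.IH[OF L]
  have "ann (rep_dsum V (rep_of_list L)) (vec_dsum (rdim V) v (vec_of_list L)) =
      {x. \<forall>(V, v)\<in>set (X # L). kG_act G V x v = 0}"
    unfolding ann_dsum using IH by (simp add: X ann_def Collect_conj_eq zero_fun_def)
  then show ?case
    unfolding X list_Cons rdim_dsum using IH V by (simp add: is_rep_dsum vec_dsum_kspace zero_fun_def)
qed

end

locale glider_param = glider_ctx G K for G :: "('a, 'm) monoid_scheme" (structure) and K :: "'k::field_char_0 itself" +
  fixes T :: "'a set \<Rightarrow> 'a \<Rightarrow> 'k" and I :: "('a, 'k) rep set"
  assumes T: "T \<in> iso (abelianization G) (linear_characters G)" and I: "irr_system G I"
begin

abbreviation "\<Gamma> \<equiv> abelianization G"

sublocale ab: comm_group \<Gamma>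
  unfolding abelianization_def by (rule derived_quot_is_comm_group)

lemma carrier_\<Gamma>: "carrier \<Gamma> = rcosets (derived G (carrier G))"
  by (simp add: abelianization_def FactGroup_def)

lemma finite_\<Gamma>: "finite (carrier \<Gamma>)"
  by (simp add: carrier_\<Gamma> RCOSETS_def fin)

lemma T_char: "z \<in> carrier \<Gamma> \<Longrightarrow> T z \<in> carrier (linear_characters G)"
  using T unfolding iso_def hom_def by blast

lemma T_mult: "z \<in> carrier \<Gamma> \<Longrightarrow> g \<in> carrier G \<Longrightarrow> h \<in> carrier G \<Longrightarrow> T z (g \<otimes> h) = T z g * T z h"
  and T_nonzero: "z \<in> carrier \<Gamma> \<Longrightarrow> g \<in> carrier G \<Longrightarrow> T z g \<noteq> 0"
  using T_char[of z] by (auto simp: linear_characters_def)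

lemma T_one:
  assumes z: "z \<in> carrier \<Gamma>" shows "T z \<one> = 1"
  using T_mult[OF z one_closed one_closed] T_nonzero[OF z one_closed] by simp

lemma T_prod:
  assumes "z \<in> carrier \<Gamma>" "w \<in> carrier \<Gamma>" "g \<in> carrier G"
  shows "T (z \<otimes>\<^bsub>\<Gamma>\<^esub> w) g = T z g * T w g"
proof -
  have "T (z \<otimes>\<^bsub>\<Gamma>\<^esub> w) = T z \<otimes>\<^bsub>linear_characters G\<^esub> T w" using T assms(1,2) unfolding iso_def hom_def by blast
  then show ?thesis using assms(3) by (simp add: linear_characters_def)
qed

lemma T_unit: "g \<in> carrier G \<Longrightarrow> T \<one>\<^bsub>\<Gamma>\<^esub> g = 1"
  using T_prod[OF ab.one_closed ab.one_closed, of g] T_nonzero[OF ab.one_closed, of g] by simp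

lemma T_m_inv:
  assumes "z \<in> carrier \<Gamma>" "g \<in> carrier G"
  shows "T (inv\<^bsub>\<Gamma>\<^esub> z) g = inverse (T z g)"
  using T_prod[OF assms(1) ab.inv_closed[OF assms(1)] assms(2)] T_unit[OF assms(2)] assms(1)
  by (intro inverse_unique[symmetric]) simp

lemma T_inj:
  assumes "z \<in> carrier \<Gamma>" "w \<in> carrier \<Gamma>" "\<And>g. g \<in> carrier G \<Longrightarrow> T z g = T w g"
  shows "z = w"
proof -
  have "T z \<in> extensional (carrier G)" "T w \<in> extensional (carrier G)"
    using T_char assms(1,2) by (auto simp: linear_characters_def)
  then have "T z = T w" using assms(3) by (rule extensionalityI)
  moreover have "inj_on T (carrier \<Gamma>)" using T unfolding iso_def bij_betw_def by blast
  ultimately show ?thesis using assms(1,2) by (simp add: inj_on_eq_iff)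
qed

lemma T_surj:
  assumes "\<And>g. g \<in> carrier G \<Longrightarrow> \<chi> g \<noteq> 0"
    and "\<And>g h. g \<in> carrier G \<Longrightarrow> h \<in> carrier G \<Longrightarrow> \<chi> (g \<otimes> h) = \<chi> g * \<chi> h"
  obtains z where "z \<in> carrier \<Gamma>" "\<And>g. g \<in> carrier G \<Longrightarrow> T z g = \<chi> g"
proof -
  have "restrict \<chi> (carrier G) \<in> carrier (linear_characters G)" using assms by (simp add: linear_characters_def)
  then have "restrict \<chi> (carrier G) \<in> T ` carrier \<Gamma>" using T unfolding iso_def bij_betw_def by blast
  then obtain z where "z \<in> carrier \<Gamma>" "restrict \<chi> (carrier G) = T z" by blast
  then show ?thesis using that[of z] by (metis restrict_apply')
qed

lemma T_pointed: "z \<in> carrier \<Gamma> \<Longrightarrow> c \<noteq> 0 \<Longrightarrow> pointed (linear_rep (T z)) (unit_vec0 c)"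
  by (intro pointed_linear T_one T_mult)

text \<open>The annihilator that the generator of the glider for \<open>(A, B)\<close> turns out to
  have; the scalars and bases chosen for the generator do not enter.\<close>

definition JAB :: "'a set set \<Rightarrow> (('a, 'k) rep \<times> (nat \<Rightarrow> 'k)  set) set \<Rightarrow> ('a \<Rightarrow> 'k) set"
  where "JAB A B = {x. (\<forall>z\<in>A. pair x (T z) = 0) \<and> (\<forall>(U, W)\<in>B. \<forall>w\<in>W. kG_act G U x w = 0)}"

lemma delta_one_act: "is_rep G V \<Longrightarrow> v \<in> kspace (rdim V) \<Longrightarrow> kG_act G V (delta \<one>) v = v"
  by (simp add: kG_act_delta act_one)

lemma irr_rep: "U \<in> I \<Longrightarrow> irreducible_rep G U"
  using I by (simp add: irr_system_def)

lemma pointsD: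
  assumes "B \<in> pointsets I" "(U, W) \<in> B"
  shows "U \<in> I" "rdim U > 1" "kv.subspace W" "W \<subseteq> kspace (rdim U)" "W \<noteq> {0}" "is_rep G U"
proof -
  have *: "U \<in> I \<and> rdim U > 1 \<and> (\<exists>j\<in>{1..rdim U}. W \<in> Gr j U)" using assms unfolding pointsets_def by blast
  then show "U \<in> I" "rdim U > 1" "kv.subspace W" "W \<subseteq> kspace (rdim U)" by (auto simp: Gr_def)
  show "W \<noteq> {0}"
  proof
    assume "W = {0}"
    moreover have "kv.dim W \<noteq> 0" using * by (auto simp: Gr_def)
    moreover have "kv.dim {0 :: nat \<Rightarrow> 'k} = kv.dim ({} :: (nat \<Rightarrow> 'k) set)" using kv.dim_span[of "{}"] by (simp only: kv.span_empty)
    moreover have "kv.dim ({} :: (nat \<Rightarrow> 'k) set) = 0" using kv.dim_eq_card_independent[OF kv.independent_empty] by simp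
    ultimately show False by simp
  qed
  show "is_rep G U" using irr_rep * unfolding irreducible_rep_def by blast
qed

lemma finite_pointset:
  assumes B: "B \<in> pointsets I"
  shows "finite B"
proof (rule finite_imageD[of fst])
  have "fst ` B \<subseteq> I" using pointsD(1)[OF B] by auto
  then show "finite (fst ` B)" using irr_system_finite[OF I] by (rule finite_subset)
  have fn: "W = W'" if "(U, W) \<in> B" "(U, W') \<in> B" for U W W' using B that unfolding pointsets_def by blast
  show "inj_on fst B"
  proof (rule inj_onI)
    fix p q assume "p \<in> B" "q \<in> B" "fst p = fst q"
    then show "p = q" using fn[of "fst p" "snd p" "snd q"] by (cases p, cases q) simp
  qed
qed

lemma kG_act_span:
  "(\<forall>w\<in>kv.span S. kG_act G U x w = 0) \<longleftrightarrow> (\<forall>w\<in>S. kG_act G U x w = 0)"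
proof -
  have "kv.subspace {w. kG_act G U x w = 0}" by (rule kk.linear_subspace_kernel[OF klin_kG_act])
  then have "S \<subseteq> {w. kG_act G U x w = 0} \<Longrightarrow> kv.span S \<subseteq> {w. kG_act G U x w = 0}" by (rule kv.span_minimal[rotated])
  then show ?thesis using kv.span_superset[of S] by blast
qed

text \<open>An element that kills a vector kills its multiples, and one that kills a basis of
  \<open>W\<close> kills all of \<open>W\<close>. Hence the annihilator does not depend on the
  presentation, and the choice in \<open>M_cls\<close> is harmless.\<close>

lemma presents_ann:
  assumes AB: "is_index G I A B" and P: "presents T A B L"
  shows "pointed (rep_of_list L) (vec_of_list L)" "ann (rep_of_list L) (vec_of_list L) = JAB A B"
proof -
  have A: "A \<subseteq> carrier \<Gamma>" and B: "B \<in> pointsets I" and ne: "A \<noteq> {} \<or> B \<noteq> {}"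
    using AB unfolding is_index_def by blast+
  obtain zs c bs \<beta> where zs: "set zs = A" "\<forall>z\<in>A. c z \<noteq> 0" and bs: "set bs = B"
    and \<beta>: "\<forall>(U, W)\<in>B. distinct (\<beta> (U, W)) \<and> kv.independent (set (\<beta> (U, W))) \<and> kv.span (set (\<beta> (U, W))) = W"
    and L: "L = map (\<lambda>z. (linear_rep (T z), unit_vec0 (c z))) zs @
        concat (map (\<lambda>(U, W). map (\<lambda>w. (U, w)) (\<beta> (U, W))) bs)"
    using P unfolding presents_def by blast
  have sL: "set L = (\<lambda>z. (linear_rep (T z), unit_vec0 (c z))) ` A \<union>
      (\<Union>p\<in>B. (\<lambda>w. (fst p, w)) ` set (\<beta> p))"
    unfolding L by (auto simp: zs(1) bs split: prod.splits)
  have sp: "kv.span (set (\<beta> (U, W))) = W" if "(U, W) \<in> B" for U W using \<beta> that by blast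
  have reps: "\<forall>(V, v)\<in>set L. is_rep G V \<and> v \<in> kspace (rdim V)"
  proof (intro ballI, clarify)
    fix V v assume "(V, v) \<in> set L"
    then consider z where "z \<in> A" "V = linear_rep (T z)" "v = unit_vec0 (c z)"
      | U W where "(U, W) \<in> B" "V = U" "v \<in> set (\<beta> (U, W))" unfolding sL by force
    then show "is_rep G V \<and> v \<in> kspace (rdim V)"
    proof cases
      case 1
      then show ?thesis using T_pointed[of z "c z"] A zs(2) by (auto simp: pointed_def)
    next
      case 2
      have "v \<in> W" using kv.span_base[OF 2(3)] sp[OF 2(1)] by simp
      then show ?thesis using pointsD(4,6)[OF B 2(1)] 2(2) by blast
    qed
  qed
  have lin: "kG_act G (linear_rep (T z)) x (unit_vec0 (c z)) = 0 \<longleftrightarrow> pair x (T z) = 0" if "z \<in> A" for z x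
    using zs(2) that by (simp add: kG_act_linear unit_vec0_eq_0) (simp add: unit_vec0_def)
  have pt: "(\<forall>w\<in>set (\<beta> (U, W)). kG_act G U x w = 0) \<longleftrightarrow> (\<forall>w\<in>W. kG_act G U x w = 0)" if "(U, W) \<in> B" for U W x
    using kG_act_span[of "set (\<beta> (U, W))"] sp[OF that] by simp
  have "(\<forall>(V, v)\<in>set L. kG_act G V x v = 0) \<longleftrightarrow>
      (\<forall>z\<in>A. kG_act G (linear_rep (T z)) x (unit_vec0 (c z)) = 0) \<and>
      (\<forall>(U, W)\<in>B. \<forall>w\<in>set (\<beta> (U, W)). kG_act G U x w = 0)" for x
    unfolding sL by (auto simp: ball_Un)
  moreover have "(\<forall>z\<in>A. kG_act G (linear_rep (T z)) x (unit_vec0 (c z)) = 0) \<longleftrightarrow> (\<forall>z\<in>A. pair x (T z) = 0)" for x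
    using lin by blast
  moreover have "(\<forall>(U, W)\<in>B. \<forall>w\<in>set (\<beta> (U, W)). kG_act G U x w = 0) \<longleftrightarrow> (\<forall>(U, W)\<in>B. \<forall>w\<in>W. kG_act G U x w = 0)" for x
    using pt by (intro ball_cong refl) (clarsimp)
  ultimately have "{x. \<forall>(V, v)\<in>set L. kG_act G V x v = 0} = JAB A B" unfolding JAB_def by (simp only:)
  with rep_of_list[OF reps] show ann: "ann (rep_of_list L) (vec_of_list L) = JAB A B" by simp
  \<comment> \<open>The identity of the group acts as 1 on some nonzero component, so the generator
    is not zero.\<close>
  have "JAB A B \<noteq> UNIV"
  proof (cases "A = {}")
    case False
    then obtain z where z: "z \<in> A" by blast
    have "pair (delta \<one>) (T z) = 1" using T_one[of z] z A fin
      by (auto simp: pair_def delta_def if_distrib[of "\<lambda>a. a * _"] cong: if_cong)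
    then have "delta \<one> \<notin> JAB A B" using z unfolding JAB_def by auto
    then show ?thesis by blast
  next
    case True
    then obtain U W where UW: "(U, W) \<in> B" using ne by force
    then obtain w where w: "w \<in> W" "w \<noteq> 0" using pointsD(3,5)[OF B UW] kv.subspace_0 by blast
    then have "kG_act G U (delta \<one>) w = w" using pointsD(4,6)[OF B UW] by (intro delta_one_act) auto
    then have "\<not> (\<forall>w\<in>W. kG_act G U (delta \<one>) w = 0)" using w by force
    then have "delta \<one> \<notin> JAB A B" using UW unfolding JAB_def by blast
    then show ?thesis by blast
  qed
  then have "vec_of_list L \<noteq> 0" using ann by (metis ann_zero)
  then show "pointed (rep_of_list L) (vec_of_list L)" using rep_of_list[OF reps] by (simp add: pointed_def)
qed

lemma presents_exists:
  assumes AB: "is_index G I A B"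
  shows "\<exists>L. presents T A B L"
proof -
  have A: "A \<subseteq> carrier \<Gamma>" and B: "B \<in> pointsets I" using AB unfolding is_index_def by blast+
  obtain zs where zs: "set zs = A" "distinct zs"
    using finite_distinct_list[OF finite_subset[OF A finite_\<Gamma>]] by blast
  obtain bs where bs: "set bs = B" "distinct bs" using finite_distinct_list[OF finite_pointset[OF B]] by blast
  have "\<forall>p\<in>B. \<exists>l. distinct l \<and> kv.independent (set l) \<and> kv.span (set l) = snd p"
  proof
    fix p assume p: "p \<in> B"
    then have "snd p \<subseteq> kspace (rdim (fst p))" using pointsD(4)[OF B, of "fst p" "snd p"] by simp
    then obtain C where C: "finite C" "kv.independent C" "kv.span C = kv.span (snd p)"
      by (rule kspace_finite_basis)
    moreover obtain l where "set l = C" "distinct l" using finite_distinct_list[OF C(1)] by blast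
    moreover have "kv.span (snd p) = snd p" using pointsD(3)[OF B, of "fst p" "snd p"] p by simp
    ultimately show "\<exists>l. distinct l \<and> kv.independent (set l) \<and> kv.span (set l) = snd p" by metis
  qed
  then obtain \<beta> where \<beta>: "\<forall>p\<in>B. distinct (\<beta> p) \<and> kv.independent (set (\<beta> p)) \<and> kv.span (set (\<beta> p)) = snd p"
    by metis
  have "presents T A B (map (\<lambda>z. (linear_rep (T z), unit_vec0 1)) zs @
        concat (map (\<lambda>(U, W). map (\<lambda>w. (U, w)) (\<beta> (U, W))) bs))"
    unfolding presents_def
    by (rule exI[of _ zs], rule exI[of _ "\<lambda>z. 1"], rule exI[of _ bs], rule exI[of _ \<beta>]) (use zs bs \<beta> in fastforce)
  then show ?thesis by blast
qed

lemma M_cls: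
  assumes AB: "is_index G I A B"
  shows "\<exists>V v. pointed V v \<and> ann V v = JAB A B \<and> M_cls G T A B = kl V v"
proof -
  have "\<exists>L. presents T A B L \<and> M_cls G T A B = glider_cls G (line_glider (rep_of_list L) (vec_of_list L))"
    unfolding M_cls_def by (rule someI_ex) (use presents_exists[OF AB] in blast)
  then obtain L where L: "presents T A B L" "M_cls G T A B = glider_cls G (line_glider (rep_of_list L) (vec_of_list L))"
    by blast
  note p = presents_ann[OF AB L(1)]
  have "is_glider G (line_glider (rep_of_list L) (vec_of_list L))"
    unfolding is_glider_iff line_glider_def
    using p(1) kv.span_minimal[of "{vec_of_list L}" "kspace (rdim (rep_of_list L))"]
    by (simp add: act_kspace pointed_def)
  from glider_cls_line[OF this] have "M_cls G T A B = kl (rep_of_list L) (vec_of_list L)"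
    using L(2) by (simp add: line_glider_def)
  then show ?thesis using p by blast
qed

lemma M_cls_eq: "is_index G I A B \<Longrightarrow> pointed V v \<Longrightarrow> ann V v = JAB A B \<Longrightarrow> M_cls G T A B = kl V v"
  using M_cls[of A B] kl_eqI by metis

end

context glider_param
begin

section \<open>From pointed modules back to indices\<close>

lemma rep_iso_ghom:
  fixes U W :: "('a, 'k) rep"
  assumes iso: "rep_iso G U W" and U: "is_rep G U"
  obtains f where "ghom U W f" "\<And>u. u \<in> kspace (rdim U) \<Longrightarrow> f u = 0 \<Longrightarrow> u = 0"
proof -
  obtain \<phi> where \<phi>: "klinear_on (kspace (rdim U)) \<phi>" "bij_betw \<phi> (kspace (rdim U)) (kspace (rdim W))"
    "\<forall>x. \<forall>v\<in>kspace (rdim U). \<phi> (kG_act G U x v) = kG_act G W x (\<phi> v)"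
    using iso unfolding rep_iso_def by blast
  obtain f where f: "klin f" "\<forall>u\<in>kspace (rdim U). f u = \<phi> u"
    using klinear_on_extend[OF subspace_kspace \<phi>(1)] by blast
  have fk: "f u \<in> kspace (rdim W)" if "u \<in> kspace (rdim U)" for u
    using bij_betw_apply[OF \<phi>(2) that] f(2) that by simp
  have "f (act U a u) = act W a (f u)" if "a \<in> carrier G" "u \<in> kspace (rdim U)" for a u
    using \<phi>(3)[rule_format, of u "delta a"] that f(2) act_kspace[of U a u] by (simp add: kG_act_delta)
  then have "ghom U W f" unfolding ghom_def using f(1) fk by simp
  moreover have "u = 0" if "u \<in> kspace (rdim U)" "f u = 0" for u
  proof -
    have "\<phi> u = \<phi> 0" using that f(2) kk.linear_0[OF f(1)] kspace_zero[of "rdim U"] by metis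
    then show ?thesis using \<phi>(2) that(1) kspace_zero[of "rdim U"] unfolding bij_betw_def by (metis inj_onD)
  qed
  ultimately show ?thesis using that by metis
qed

lemma irr_dim_one:
  assumes U: "is_rep G U" "rdim U = 1"
  obtains z where "z \<in> carrier \<Gamma>" "\<And>g u. g \<in> carrier G \<Longrightarrow> act U g u = act (linear_rep (T z)) g u"
proof -
  let ?\<chi> = "\<lambda>g. rmat U g 0 0"
  have mult: "?\<chi> (g \<otimes> h) = ?\<chi> g * ?\<chi> h" if "g \<in> carrier G" "h \<in> carrier G" for g h
    using U that unfolding is_rep_def by simp
  have one: "?\<chi> \<one> = 1" using U unfolding is_rep_def by simp
  have "?\<chi> g \<noteq> 0" if "g \<in> carrier G" for g
    using mult[OF that inv_closed[OF that]] one that by auto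
  then obtain z where z: "z \<in> carrier \<Gamma>" "\<And>g. g \<in> carrier G \<Longrightarrow> T z g = ?\<chi> g"
    using T_surj[of ?\<chi>] mult by blast
  have "act U g u = act (linear_rep (T z)) g u" if "g \<in> carrier G" for g u
    unfolding act_linear z(2)[OF that] by (rule ext) (simp add: act_def U(2) unit_vec0_def)
  with z(1) show ?thesis using that by blast
qed

text \<open>Plays the part of the point of \<open>Gr(U)\<close>: evaluating all homomorphisms at
  \<open>v\<close> collects its components in the copies of \<open>U\<close> without choosing a
  decomposition of \<open>V\<close>.\<close>

definition homs_to :: "('a, 'k) rep \<Rightarrow> (nat \<Rightarrow> 'k) \<Rightarrow> ('a, 'k) rep \<Rightarrow> (nat \<Rightarrow> 'k) set"
  where "homs_to V v U = {f v |f. ghom V U f}"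

lemma homs_to_subspace:
  assumes "v \<in> kspace (rdim V)"
  shows "kv.subspace (homs_to V v U)" "homs_to V v U \<subseteq> kspace (rdim U)"
proof -
  have *: "f v \<in> homs_to V v U" if "ghom V U f" for f using that unfolding homs_to_def by blast
  show "kv.subspace (homs_to V v U)"
  proof (rule kv.subspaceI)
    show "0 \<in> homs_to V v U" using *[OF ghom_zero] .
    fix x y assume "x \<in> homs_to V v U" "y \<in> homs_to V v U"
    then obtain f g where "ghom V U f" "ghom V U g" "x = f v" "y = g v" unfolding homs_to_def by blast
    then show "x + y \<in> homs_to V v U" using *[OF ghom_add] by simp
  next
    fix c x assume "x \<in> homs_to V v U"
    then obtain f where "ghom V U f" "x = f v" unfolding homs_to_def by blast
    then show "vscale c x \<in> homs_to V v U" using *[OF ghom_scale] by simp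
  qed
  show "homs_to V v U \<subseteq> kspace (rdim U)" using assms unfolding homs_to_def ghom_def by blast
qed

text \<open>Homomorphisms commute with \<open>K[G]\<close>, so whatever kills \<open>v\<close> kills
  its images. Conversely, if \<open>x v\<close> is nonzero it survives in an irreducible quotient,
  which is isomorphic to a member of \<open>I\<close> and recorded in \<open>?B\<close>, or in
  \<open>?A\<close> when its dimension is one.\<close>

lemma parametrization:
  assumes V: "pointed V v"
  shows "\<exists>A B. is_index G I A B \<and> JAB A B = ann V v"
proof -
  let ?A = "{z \<in> carrier \<Gamma>. \<exists>f. ghom V (linear_rep (T z)) f \<and> f v \<noteq> 0}"
  let ?B = "{(U, W). U \<in> I \<and> rdim U > 1 \<and> W = homs_to V v U \<and> W \<noteq> {0}}"
  have V': "is_rep G V" "v \<in> kspace (rdim V)" "v \<noteq> 0" using V by (auto simp: pointed_def)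
  have lin0: "kG_act G (linear_rep (T z)) x (f v) = 0 \<longleftrightarrow> pair x (T z) = 0"
    if "ghom V (linear_rep (T z)) f" "f v \<noteq> 0" for z x f
  proof -
    have "f v \<in> kspace 1" using that(1) V'(2) by (simp add: ghom_def)
    from ann_linear[OF this that(2)] show ?thesis by (simp add: ann_def)
  qed
  have "x \<in> JAB ?A ?B" if x: "x \<in> ann V v" for x
  proof -
    have 0: "kG_act G U x (f v) = 0" if "ghom V U f" for U f
      using ghom_kG_act[OF that V'(2), of x] x kk.linear_0[of f] that by (simp add: ann_def ghom_def)
    have "pair x (T z) = 0" if z: "z \<in> ?A" for z
    proof -
      obtain f where f: "ghom V (linear_rep (T z)) f" "f v \<noteq> 0" using z by blast
      show ?thesis using 0[OF f(1)] lin0[OF f, of x] by simp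
    qed
    moreover have "kG_act G U x w = 0" if "(U, W) \<in> ?B" "w \<in> W" for U W w
      using that 0 unfolding homs_to_def by blast
    ultimately show ?thesis unfolding JAB_def by blast
  qed
  moreover have "x \<in> ann V v" if x: "x \<in> JAB ?A ?B" for x
  proof (rule ccontr)
    assume "x \<notin> ann V v"
    then have "kG_act G V x v \<noteq> 0" by (simp add: ann_def)
    from irreducible_quotients_separate[OF V'(1) kG_act_kspace this]
    obtain U' where "\<exists>f. irreducible_rep G U' \<and> ghom V U' f \<and> f (kG_act G V x v) \<noteq> 0" by (rule exE)
    then obtain f where "irreducible_rep G U' \<and> ghom V U' f \<and> f (kG_act G V x v) \<noteq> 0" by (rule exE)
    then have U': "irreducible_rep G U'" and f: "ghom V U' f" and nz: "f (kG_act G V x v) \<noteq> 0" by simp_all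
    have "\<exists>!U. U \<in> I \<and> rep_iso G U' U" using I U' unfolding irr_system_def by simp
    then obtain U where U: "U \<in> I" "rep_iso G U' U" by (elim ex1E conjE)
    have "is_rep G U'" using U' by (simp add: irreducible_rep_def)
    from rep_iso_ghom[OF U(2) this] obtain h where h: "ghom U' U h"
      "\<And>u. u \<in> kspace (rdim U') \<Longrightarrow> h u = 0 \<Longrightarrow> u = 0" by metis
    have g: "ghom V U (\<lambda>u. h (f u))" by (rule ghom_compose[OF f h(1)])
    have "f (kG_act G V x v) \<in> kspace (rdim U')" using f kG_act_kspace[of V x v] by (simp add: ghom_def)
    then have "h (f (kG_act G V x v)) \<noteq> 0" using h(2) nz by metis
    then have ne: "kG_act G U x (h (f v)) \<noteq> 0" using ghom_kG_act[OF g V'(2)] by simp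
    then have gv: "h (f v) \<noteq> 0" using kk.linear_0[OF klin_kG_act] by metis
    have irrU: "is_rep G U" "rdim U > 0" using irr_rep[OF U(1)] unfolding irreducible_rep_def by simp_all
    show False
    proof (cases "rdim U > 1")
      case True
      have "(\<lambda>u. h (f u)) v \<in> homs_to V v U" unfolding homs_to_def by (rule CollectI, rule exI, rule conjI[OF refl g])
      then have mem: "h (f v) \<in> homs_to V v U" .
      then have "homs_to V v U \<noteq> {0}" using gv by (metis singletonD)
      then have "(U, homs_to V v U) \<in> ?B" using True U(1) by simp
      then show False using x mem ne unfolding JAB_def by blast
    next
      case False
      then have d: "rdim U = 1" using irrU(2) by simp
      obtain z where z: "z \<in> carrier \<Gamma>" "\<And>g u. g \<in> carrier G \<Longrightarrow> act U g u = act (linear_rep (T z)) g u"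
        using irr_dim_one[OF irrU(1) d] by metis
      have gz: "ghom V (linear_rep (T z)) (\<lambda>u. h (f u))" using g z(2) d unfolding ghom_def by simp
      then have "\<exists>f. ghom V (linear_rep (T z)) f \<and> f v \<noteq> 0" using gv by (intro exI conjI)
      then have "z \<in> ?A" using z(1) by simp
      then have "pair x (T z) = 0" using x unfolding JAB_def by blast
      then have "kG_act G (linear_rep (T z)) x (h (f v)) = 0" using lin0[OF gz gv] by simp
      moreover have "kG_act G (linear_rep (T z)) x (h (f v)) = kG_act G U x (h (f v))"
        unfolding kG_act_def using z(2) by simp
      ultimately show False using ne by simp
    qed
  qed
  ultimately have eq: "JAB ?A ?B = ann V v" by blast
  have "delta \<one> \<notin> ann V v" using delta_one_act[OF V'(1,2)] V'(3) by (simp add: ann_def)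
  moreover have "JAB {} {} = UNIV" by (simp add: JAB_def)
  ultimately have "\<not> (?A = {} \<and> ?B = {})" using eq UNIV_I by (metis (lifting))
  moreover have "?B \<in> pointsets I"
    unfolding pointsets_def
  proof (intro CollectI conjI)
    show "?B \<subseteq> (SIGMA U : {U \<in> I. rdim U > 1}. \<Union>j\<in>{1..rdim U}. Gr j U)"
    proof
      fix p assume "p \<in> ?B"
      then obtain U where p: "p = (U, homs_to V v U)" and U: "U \<in> I" "1 < rdim U" "homs_to V v U \<noteq> {0}" by blast
      note s = homs_to_subspace[OF V'(2), of U]
      obtain C where C: "finite C" "kv.span C = kv.span (homs_to V v U)" "card C = kv.dim (homs_to V v U)"
        by (rule kspace_finite_basis[OF s(2)])
      have "kv.span (homs_to V v U) = homs_to V v U" using s(1) by (rule kv.span_eq_iff[THEN iffD2])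
      with C(2) have "kv.span C = homs_to V v U" by (rule trans)
      then have "C \<noteq> {}" using U(3) kv.span_empty by metis
      then have "card C \<noteq> 0" using C(1) by simp
      then have "kv.dim (homs_to V v U) \<ge> 1" using C(3) by simp
      moreover have "kv.dim (homs_to V v U) \<le> rdim U" by (rule dim_subspace_le[OF s(2)])
      moreover have "homs_to V v U \<in> Gr (kv.dim (homs_to V v U)) U" using s by (simp add: Gr_def)
      ultimately have "homs_to V v U \<in> (\<Union>j\<in>{1..rdim U}. Gr j U)" by auto
      then show "p \<in> (SIGMA U : {U \<in> I. rdim U > 1}. \<Union>j\<in>{1..rdim U}. Gr j U)"
        unfolding p using U by simp
    qed
  qed auto
  ultimately have "is_index G I ?A ?B" unfolding is_index_def by blast
  then show ?thesis using eq by blast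
qed

subsection \<open>Idempotents\<close>

text \<open>Up to the factor \<open>|G|\<close> the central idempotent of \<open>K[G]\<close> that
  projects onto the \<open>T z\<close>-part of a module. Its membership in an annihilator tests
  whether \<open>T z\<close> occurs in the cyclic module.\<close>

definition ez :: "'a set \<Rightarrow> 'a \<Rightarrow> 'k"
  where "ez z = (\<lambda>g. inverse (T z g))"

lemma pair_ez:
  assumes z: "z \<in> carrier \<Gamma>" and w: "w \<in> carrier \<Gamma>"
  shows "pair (ez z) (T w) = 0 \<longleftrightarrow> z \<noteq> w"
proof (cases "z = w")
  case True
  have "pair (ez z) (T w) = of_nat N" using T_nonzero[OF z] by (simp add: pair_def ez_def True)
  then show ?thesis using True N_pos by simp
next
  case False
  let ?u = "inv\<^bsub>\<Gamma>\<^esub> z \<otimes>\<^bsub>\<Gamma>\<^esub> w"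
  have u: "?u \<in> carrier \<Gamma>" "T ?u g = ez z g * T w g" if "g \<in> carrier G" for g
    using z w that by (simp_all add: T_prod T_m_inv ez_def)
  obtain a where a: "a \<in> carrier G" "T z a \<noteq> T w a" using T_inj[OF z w] False by blast
  have "T z a * T ?u a = T w a" using u(2)[OF a(1)] T_nonzero[OF z a(1)] by (simp add: ez_def)
  then have "T ?u a \<noteq> 1" using a(2) by auto
  then have "(\<Sum>g\<in>carrier G. T ?u g) = 0"
    using sum_nontrivial_character[OF fin T_mult[OF u(1)[OF a(1)]] a(1)] by blast
  then show ?thesis using False u(2) by (simp add: pair_def)
qed

text \<open>Otherwise the image is a nonzero vector on which the group acts through
  \<open>T z\<close>; its line is stable, hence all of \<open>U\<close>, against
  \<open>rdim U > 1\<close>.\<close>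

lemma ez_irreducible:
  assumes z: "z \<in> carrier \<Gamma>" and U: "irreducible_rep G U" "rdim U > 1" and w: "w \<in> kspace (rdim U)"
  shows "kG_act G U (ez z) w = 0"
proof (rule ccontr)
  let ?u = "kG_act G U (ez z) w"
  assume nz: "?u \<noteq> 0"
  have rU: "is_rep G U" using U(1) by (simp add: irreducible_rep_def)
  have "act U a ?u = vscale (T z a) ?u" if a: "a \<in> carrier G" for a
  proof -
    have "act U a ?u = (\<Sum>g\<in>carrier G. vscale (ez z g) (act U (a \<otimes> g) w))"
      unfolding kG_act_def kk.linear_sum[OF klin_act] kk.linear_scale[OF klin_act]
      by (intro sum.cong refl) (simp add: act_mult[OF rU a])
    also have "\<dots> = (\<Sum>g\<in>carrier G. vscale (ez z (inv a \<otimes> g)) (act U g w))"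
      by (rule sum.reindex_bij_witness[of _ "\<lambda>g. inv a \<otimes> g" "\<lambda>g. a \<otimes> g"]) (use a in \<open>simp_all flip: m_assoc\<close>)
    also have "\<dots> = (\<Sum>g\<in>carrier G. vscale (T z a) (vscale (ez z g) (act U g w)))"
    proof (intro sum.cong refl)
      fix g assume g: "g \<in> carrier G"
      have "T z a * T z (inv a) = 1" using T_mult[OF z a inv_closed[OF a]] T_one[OF z] a by simp
      then have "inverse (T z (inv a)) = T z a" by (intro inverse_unique) (simp add: mult.commute)
      then have "ez z (inv a \<otimes> g) = T z a * ez z g"
        using a g by (simp add: ez_def T_mult[OF z])
      then show "vscale (ez z (inv a \<otimes> g)) (act U g w) = vscale (T z a) (vscale (ez z g) (act U g w))" by simp
    qed
    finally show ?thesis by (simp add: kG_act_def kv.scale_sum_right)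
  qed
  then have "stable U (kv.span {?u})"
    unfolding stable_def using kG_act_kspace[of U "ez z" w] kv.span_minimal[of "{?u}" "kspace (rdim U)"]
      kv.subspace_span[of "{?u}"]
    by (auto simp: kv.span_singleton kk.linear_scale[OF klin_act])
  moreover have "?u \<in> kv.span {?u}" by (rule kv.span_base) simp
  then have "kv.span {?u} \<noteq> {0}" using nz by blast
  ultimately have "kv.span {?u} = kspace (rdim U)"
    using U(1)[unfolded irreducible_rep_iff, THEN conjunct2, THEN conjunct2, rule_format, of "kv.span {?u}"] by simp
  then have "rdim U \<le> card {?u}"
    using dim_kspace[of "rdim U", where 'k = 'k] kv.dim_le_card[of "kspace (rdim U)" "{?u}"] by simp
  then show False using U(2) by simp
qed

text \<open>Recovers the set \<open>A\<close> from the annihilator alone.\<close>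

lemma ez_JAB:
  assumes AB: "A \<subseteq> carrier \<Gamma>" "B \<in> pointsets I" and z: "z \<in> carrier \<Gamma>"
  shows "ez z \<in> JAB A B \<longleftrightarrow> z \<notin> A"
proof -
  have "kG_act G U (ez z) w = 0" if "(U, W) \<in> B" "w \<in> W" for U W w
    using pointsD[OF AB(2) that(1)] that(2) by (intro ez_irreducible z irr_rep) auto
  moreover have "pair (ez z) (T w) = 0 \<longleftrightarrow> z \<noteq> w" if "w \<in> A" for w using pair_ez[OF z] AB(1) that by blast
  ultimately show ?thesis unfolding JAB_def by blast
qed

text \<open>Frobenius reciprocity in coordinates: \<open>T z\<close> occurs in the permutation
  module on the cosets of the stabilizer exactly if it is trivial there, since the sum of a
  nontrivial character over the stabilizer vanishes.\<close>

lemma ez_Jt: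
  assumes V: "pointed V v" and z: "z \<in> carrier \<Gamma>"
  shows "ez z \<in> Jt (gr V v) 0 \<longleftrightarrow> (\<exists>h\<in>Domain (gr V v). T z h \<noteq> 1)"
proof -
  let ?D = "Domain (gr V v)"
  interpret D: subgroup ?D G by (rule gr_subgroup[OF V])
  interpret GD: group "G\<lparr>carrier := ?D\<rparr>" by (rule subgroup_imp_group[OF gr_subgroup[OF V]])
  have Dc: "h \<in> ?D \<Longrightarrow> h \<in> carrier G" for h using D.subset by blast
  have "(\<Sum>(h, c)\<in>gr V v. ez z (g \<otimes> h) * c ^ 0) = inverse (T z g) * (\<Sum>h\<in>?D. inverse (T z h))"
    if g: "g \<in> carrier G" for g
    unfolding gr_sum[OF V] sum_distrib_left using g Dc by (intro sum.cong refl) (simp add: ez_def T_mult[OF z])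
  then have "ez z \<in> Jt (gr V v) 0 \<longleftrightarrow> (\<forall>g\<in>carrier G. inverse (T z g) * (\<Sum>h\<in>?D. inverse (T z h)) = 0)"
    unfolding Jt_def by simp
  also have "\<dots> \<longleftrightarrow> (\<Sum>h\<in>?D. inverse (T z h)) = 0" using T_nonzero[OF z] one_closed by auto
  also have "\<dots> \<longleftrightarrow> (\<exists>h\<in>?D. T z h \<noteq> 1)"
  proof (cases "\<exists>h\<in>?D. T z h \<noteq> 1")
    case True
    then obtain h where h: "h \<in> ?D" "T z h \<noteq> 1" by (elim bexE)
    have "(\<Sum>h\<in>carrier (G\<lparr>carrier := ?D\<rparr>). inverse (T z h)) = 0"
      by (rule GD.sum_nontrivial_character[of _ h])
        (use h Dc finite_subset[OF D.subset fin] in \<open>simp_all add: T_mult[OF z]\<close>)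
    then show ?thesis using True by simp
  next
    case False
    then have "(\<Sum>h\<in>?D. inverse (T z h)) = of_nat (card ?D)" by simp
    moreover have "card ?D \<noteq> 0"
      using finite_subset[OF D.subset fin] D.one_closed card_0_eq[of ?D] by (metis empty_iff)
    ultimately show ?thesis using False by simp
  qed
  finally show ?thesis .
qed

text \<open>By \<open>R_type\<close> these are the types belonging to \<open>R(G)\<close>; by
  \<open>not_Rt\<close> they are those whose stabilizer lies in no proper subgroup containing the
  commutator subgroup.\<close>

definition Rt :: "('a \<times> 'k) set \<Rightarrow> bool"
  where "Rt t \<longleftrightarrow> (\<forall>z\<in>carrier \<Gamma>. (\<forall>h\<in>Domain t. T z h = 1) \<longrightarrow> z = \<one>\<^bsub>\<Gamma>\<^esub>)"

text \<open>The idempotent has two descriptions of its annihilator, as \<open>JAB A D\<close> and as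
  \<open>Jt\<close> with exponent 0; they are compared on the elements \<open>ez z\<close>.\<close>

lemma idempotent_index:
  assumes V: "pointed V v" and D: "A \<subseteq> carrier \<Gamma>" "D \<in> pointsets I" "A \<noteq> {} \<or> D \<noteq> {}"
    and eq: "the_idempotent GA (kl V v) = M_cls G T A D"
  shows "A = {z \<in> carrier \<Gamma>. \<forall>h\<in>Domain (gr V v). T z h = 1}"
proof -
  have ind: "is_index G I A D" using D unfolding is_index_def by blast
  obtain W w where W: "pointed W w" "ann W w = Jt (gr V v) 0" "the_idempotent GA (kl V v) = kl W w"
    using the_idempotent_kl[OF V] by blast
  obtain X x where X: "pointed X x" "ann X x = JAB A D" "M_cls G T A D = kl X x" using M_cls[OF ind] by blast
  have J: "JAB A D = Jt (gr V v) 0" using kl_inj[OF W(1) X(1)] W X eq by simp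
  have *: "z \<in> A \<longleftrightarrow> (\<forall>h\<in>Domain (gr V v). T z h = 1)" if z: "z \<in> carrier \<Gamma>" for z
    using ez_JAB[OF D(1,2) z] unfolding J ez_Jt[OF V z] by blast
  show ?thesis
  proof (rule Set.set_eqI)
    fix z
    show "z \<in> A \<longleftrightarrow> z \<in> {z \<in> carrier \<Gamma>. \<forall>h\<in>Domain (gr V v). T z h = 1}"
      using *[of z] subsetD[OF D(1), of z] by (cases "z \<in> carrier \<Gamma>") blast+
  qed
qed

text \<open>Every idempotent has some index \<open>(A, D)\<close> by \<open>parametrization\<close>,
  so the condition concerns only \<open>A\<close>, which \<open>idempotent_index\<close>
  computes.\<close>

lemma R_type:
  assumes V: "pointed V v"
  shows "(\<exists>D\<in>pointsets I. the_idempotent GA (kl V v) = M_cls G T {\<one>\<^bsub>\<Gamma>\<^esub>} D) \<longleftrightarrow> Rt (gr V v)"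
proof
  assume "\<exists>D\<in>pointsets I. the_idempotent GA (kl V v) = M_cls G T {\<one>\<^bsub>\<Gamma>\<^esub>} D"
  then obtain D where D: "D \<in> pointsets I" "the_idempotent GA (kl V v) = M_cls G T {\<one>\<^bsub>\<Gamma>\<^esub>} D" by blast
  have "{\<one>\<^bsub>\<Gamma>\<^esub>} = {z \<in> carrier \<Gamma>. \<forall>h\<in>Domain (gr V v). T z h = 1}"
    by (rule idempotent_index[OF V _ D(1) _ D(2)]) simp_all
  then show "Rt (gr V v)" unfolding Rt_def by blast
next
  assume R: "Rt (gr V v)"
  obtain W w where W: "pointed W w" "the_idempotent GA (kl V v) = kl W w"
    using the_idempotent_kl[OF V] by blast
  obtain A D where AD: "is_index G I A D" "JAB A D = ann W w" using parametrization[OF W(1)] by blast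
  then have eq: "the_idempotent GA (kl V v) = M_cls G T A D" using M_cls_eq[OF AD(1) W(1)] W(2) by simp
  have "T \<one>\<^bsub>\<Gamma>\<^esub> h = 1" if "h \<in> Domain (gr V v)" for h
    using that gr_carrier T_unit by blast
  then have "{\<one>\<^bsub>\<Gamma>\<^esub>} = {z \<in> carrier \<Gamma>. \<forall>h\<in>Domain (gr V v). T z h = 1}" using R unfolding Rt_def by auto
  also have "\<dots> = A"
    using AD(1) idempotent_index[OF V _ _ _ eq] unfolding is_index_def by blast
  finally show "\<exists>D\<in>pointsets I. the_idempotent GA (kl V v) = M_cls G T {\<one>\<^bsub>\<Gamma>\<^esub>} D"
    using AD(1) eq unfolding is_index_def by blast
qed

lemma qspan_empty: "qspan G {} = {\<zero>\<^bsub>GA\<^esub>}"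
  unfolding qspan_def using group.generate_empty[OF A.a_group] by simp

lemma P_mod_zero: "P_mod G T I = {\<zero>\<^bsub>GA\<^esub>}"
proof -
  have "finite (cyclic_semigroup GA (M_cls G T A B))" if "is_index G I A B" for A B
    using M_cls[OF that] finite_powers by metis
  then have e: "{M_cls G T A B |A B. is_index G I A B \<and> infinite (cyclic_semigroup GA (M_cls G T A B))} = {}" by blast
  show ?thesis unfolding P_mod_def e by (rule qspan_empty)
qed

text \<open>The trivial character is trivial on every stabilizer, so by
  \<open>idempotent_index\<close> the set \<open>A\<close> of an idempotent always contains the
  identity and is never empty.\<close>

lemma E_mod_zero: "E_mod G T I = {\<zero>\<^bsub>GA\<^esub>}"
proof -
  have "the_idempotent GA (M_cls G T A B) \<noteq> M_cls G T {} D"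
    if AB: "is_index G I A B" and D: "D \<in> pointsets I" "D \<noteq> {}" for A B D
  proof
    assume eq: "the_idempotent GA (M_cls G T A B) = M_cls G T {} D"
    obtain V v where V: "pointed V v" "M_cls G T A B = kl V v" using M_cls[OF AB] by blast
    have "{} = {z \<in> carrier \<Gamma>. \<forall>h\<in>Domain (gr V v). T z h = 1}"
      by (rule idempotent_index[OF V(1) _ D(1)]) (use D eq V in simp_all)
    moreover have "T \<one>\<^bsub>\<Gamma>\<^esub> h = 1" if "h \<in> Domain (gr V v)" for h
      using that gr_carrier T_unit by blast
    then have "\<one>\<^bsub>\<Gamma>\<^esub> \<in> {z \<in> carrier \<Gamma>. \<forall>h\<in>Domain (gr V v). T z h = 1}" using ab.one_closed by simp
    ultimately show False by blast
  qed
  then have e: "{M_cls G T A B |A B. is_index G I A B \<and> M_cls G T A B \<notin> P_mod G T I \<and>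
    (\<exists>D\<in>pointsets I. D \<noteq> {} \<and> the_idempotent GA (M_cls G T A B) = M_cls G T {} D)} = {}" by blast
  show ?thesis unfolding E_mod_def e by (rule qspan_empty)
qed

text \<open>\<open>parametrization\<close> trades indices \<open>(A, B)\<close> for pointed modules.
  Their classes are nonzero and therefore lie outside \<open>P_mod\<close>, which is zero.\<close>

lemma R_mod_eq: "R_mod G T I = kspan Rt"
proof -
  have "{M_cls G T A B |A B. is_index G I A B \<and> M_cls G T A B \<notin> P_mod G T I \<and>
      (\<exists>D\<in>pointsets I. the_idempotent GA (M_cls G T A B) = M_cls G T {\<one>\<^bsub>\<Gamma>\<^esub>} D)} =
    {kl V v |V v. pointed V v \<and> Rt (gr V v)}" (is "?L = ?R")
  proof
    show "?L \<subseteq> ?R"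
    proof
      fix m assume "m \<in> ?L"
      then obtain A B where AB: "is_index G I A B" "m = M_cls G T A B"
        "\<exists>D\<in>pointsets I. the_idempotent GA (M_cls G T A B) = M_cls G T {\<one>\<^bsub>\<Gamma>\<^esub>} D" by blast
      obtain V v where V: "pointed V v" "M_cls G T A B = kl V v" using M_cls[OF AB(1)] by blast
      then show "m \<in> ?R" using R_type[OF V(1)] AB(2,3) by auto
    qed
    show "?R \<subseteq> ?L"
    proof
      fix m assume "m \<in> ?R"
      then obtain V v where V: "pointed V v" "m = kl V v" "Rt (gr V v)" by blast
      obtain A B where AB: "is_index G I A B" "JAB A B = ann V v" using parametrization[OF V(1)] by blast
      have m: "M_cls G T A B = kl V v" using M_cls_eq[OF AB(1) V(1)] AB(2) by simp
      have "M_cls G T A B \<notin> P_mod G T I" unfolding P_mod_zero m using kl_nonzero[OF V(1)] by simp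
      moreover have "\<exists>D\<in>pointsets I. the_idempotent GA (M_cls G T A B) = M_cls G T {\<one>\<^bsub>\<Gamma>\<^esub>} D"
        unfolding m using R_type[OF V(1)] V(3) by blast
      ultimately show "m \<in> ?L" using AB(1) V(2) m by force
    qed
  qed
  then show ?thesis unfolding R_mod_def kspan_def by simp
qed

subsection \<open>Stabilizers contained in an intermediate subgroup\<close>

lemma T_derived:
  assumes z: "z \<in> carrier \<Gamma>" and d: "d \<in> derived G (carrier G)"
  shows "T z d = 1"
proof -
  let ?K = "{g \<in> carrier G. T z g = 1}"
  have inv: "T z (inv g) = inverse (T z g)" if "g \<in> carrier G" for g
    using T_mult[OF z that inv_closed[OF that]] T_one[OF z] that by (intro inverse_unique[symmetric]) simp
  have "subgroup ?K G" using T_mult[OF z] T_one[OF z] inv by unfold_locales auto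
  moreover have "derived_set G (carrier G) \<subseteq> ?K"
    using T_mult[OF z] T_nonzero[OF z] by (auto simp: inv field_simps)
  ultimately show ?thesis using d generate_subgroup_incl unfolding derived_def by blast
qed

lemma kernel_intermediate:
  assumes z: "z \<in> carrier \<Gamma>" "z \<noteq> \<one>\<^bsub>\<Gamma>\<^esub>"
  shows "{g \<in> carrier G. T z g = 1} \<in> intermediate G"
  unfolding intermediate_def
proof (intro CollectI conjI)
  have inv: "T z (inv g) = inverse (T z g)" if "g \<in> carrier G" for g
    using T_mult[OF z(1) that inv_closed[OF that]] T_one[OF z(1)] that by (intro inverse_unique[symmetric]) simp
  show "subgroup {g \<in> carrier G. T z g = 1} G" using T_mult[OF z(1)] T_one[OF z(1)] inv by unfold_locales auto
  show "derived G (carrier G) \<subseteq> {g \<in> carrier G. T z g = 1}"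
    using T_derived[OF z(1)] derived_in_carrier[of "carrier G"] by blast
  show "{g \<in> carrier G. T z g = 1} \<noteq> carrier G"
    using T_inj[OF z(1) ab.one_closed] T_unit z(2) by fastforce
qed

text \<open>Counting the sum of all \<open>T z h\<close> in two ways, over \<open>z\<close> and over \<open>h\<close> in \<open>H\<close>.\<close>

lemma character_trivial_on:
  assumes H: "H \<in> intermediate G"
  shows "\<exists>z\<in>carrier \<Gamma>. z \<noteq> \<one>\<^bsub>\<Gamma>\<^esub> \<and> (\<forall>h\<in>H. T z h = 1)"
proof (rule ccontr)
  assume no: "\<not> ?thesis"
  have sub: "subgroup H G" and dH: "derived G (carrier G) \<subseteq> H" and ne: "H \<noteq> carrier G"
    using H by (auto simp: intermediate_def)
  interpret H: subgroup H G by (rule sub)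
  interpret GH: group "G\<lparr>carrier := H\<rparr>" by (rule subgroup_imp_group[OF sub])
  have fH: "finite H" using finite_subset[OF H.subset fin] .
  \<comment> \<open>The elements of \<open>H\<close> on which all characters are trivial.
    Orthogonality turns the two counts into \<open>|H| = |\<Gamma>| |?M|\<close>.\<close>
  let ?M = "{h \<in> H. \<forall>z\<in>carrier \<Gamma>. T z h = 1}"
  have "(\<Sum>h\<in>H. T z h) = (if z = \<one>\<^bsub>\<Gamma>\<^esub> then of_nat (card H) else 0)" if z: "z \<in> carrier \<Gamma>" for z
  proof (cases "z = \<one>\<^bsub>\<Gamma>\<^esub>")
    case True
    then show ?thesis using T_unit H.subset by (simp add: subset_iff)
  next
    case False
    then obtain h where h: "h \<in> H" "T z h \<noteq> 1" using no z by blast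
    have "(\<Sum>h\<in>carrier (G\<lparr>carrier := H\<rparr>). T z h) = 0"
      by (rule GH.sum_nontrivial_character[of _ h]) (use h fH H.subset in \<open>auto simp: T_mult[OF z]\<close>)
    then show ?thesis using False by simp
  qed
  then have "(\<Sum>z\<in>carrier \<Gamma>. \<Sum>h\<in>H. T z h) = of_nat (card H)" using finite_\<Gamma> by simp
  moreover have "(\<Sum>z\<in>carrier \<Gamma>. T z h) = (if h \<in> ?M then of_nat (card (carrier \<Gamma>)) else 0)" if h: "h \<in> H" for h
  proof (cases "h \<in> ?M")
    case True
    then show ?thesis by simp
  next
    case False
    then obtain z where z: "z \<in> carrier \<Gamma>" "T z h \<noteq> 1" using h by blast
    have "(\<Sum>z\<in>carrier \<Gamma>. T z h) = 0"
      by (rule ab.sum_nontrivial_character[of _ z]) (use z finite_\<Gamma> T_prod h H.subset in auto)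
    then show ?thesis unfolding if_not_P[OF False] .
  qed
  then have "(\<Sum>h\<in>H. \<Sum>z\<in>carrier \<Gamma>. T z h) = of_nat (card (carrier \<Gamma>) * card ?M)"
    using fH by (simp add: sum.If_cases Int_def mult.commute)
  ultimately have "(of_nat (card H) :: 'k) = of_nat (card (carrier \<Gamma>) * card ?M)"
    using sum.swap[of T H "carrier \<Gamma>"] by simp
  then have card: "card H = card (carrier \<Gamma>) * card ?M" by (rule of_nat_eq_iff[THEN iffD1])
  \<comment> \<open>As \<open>?M\<close> contains the commutator subgroup, \<open>|H|\<close> is at
    least \<open>|\<Gamma>|\<close> times its order, that is \<open>|G|\<close>, against the
    properness of \<open>H\<close>.\<close>
  have "derived G (carrier G) \<subseteq> ?M" using dH T_derived by blast
  then have "card (derived G (carrier G)) \<le> card ?M" using fH by (intro card_mono) auto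
  then have "card (carrier \<Gamma>) * card (derived G (carrier G)) \<le> card H" unfolding card by simp
  moreover have "card (carrier \<Gamma>) * card (derived G (carrier G)) = card (carrier G)"
    unfolding carrier_\<Gamma> using lagrange[OF derived_is_subgroup[of "carrier G"]] by (simp add: Coset.order_def)
  ultimately show False using ne H.subset fin card_seteq by metis
qed

text \<open>In one direction the subgroup is the kernel of the offending character; in the other
  \<open>character_trivial_on\<close> supplies the character.\<close>

lemma not_Rt: "\<not> Rt t \<longleftrightarrow> (\<exists>H\<in>intermediate G. Domain t \<subseteq> H)" if "Domain t \<subseteq> carrier G"
proof
  assume "\<not> Rt t"
  then obtain z where z: "z \<in> carrier \<Gamma>" "\<forall>h\<in>Domain t. T z h = 1" "z \<noteq> \<one>\<^bsub>\<Gamma>\<^esub>" unfolding Rt_def by blast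
  then show "\<exists>H\<in>intermediate G. Domain t \<subseteq> H"
    using kernel_intermediate[OF z(1,3)] that by (intro bexI[of _ "{g \<in> carrier G. T z g = 1}"]) auto
next
  assume "\<exists>H\<in>intermediate G. Domain t \<subseteq> H"
  then show "\<not> Rt t" using character_trivial_on unfolding Rt_def by (metis subsetD)
qed

end

section \<open>Induction\<close>

lemma block_index: "i < m \<Longrightarrow> k < n \<Longrightarrow> i * n + k < m * (n :: nat)"
proof -
  assume i: "i < m" and k: "k < n"
  have "i * n + k < Suc i * n" using k by simp
  also have "\<dots> \<le> m * n" using i by (intro mult_le_mono1) simp
  finally show ?thesis .
qed

lemma blocks: "(\<forall>p<m * n. P p) \<longleftrightarrow> (\<forall>i<m. \<forall>k<(n :: nat). P (i * n + k))"
proof (intro iffI allI impI)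
  fix p assume a: "\<forall>i<m. \<forall>k<n. P (i * n + k)" and p: "p < m * n"
  then have "n > 0" by (metis less_nat_zero_code mult_0_right neq0_conv)
  then show "P p" using a[rule_format, of "p div n" "p mod n"] p by (simp add: less_mult_imp_div_less)
qed (use block_index in blast)

text \<open>The form of \<open>ann_tensor\<close> that is symmetric in the two factors, suited to
  the block coordinates of induced modules.\<close>

lemma (in fin_grp) ann_tensor_coord:
  "x \<in> ann (rep_tensor V W) (vec_tensor (rdim W) v w) \<longleftrightarrow>
    (\<forall>i<rdim V. \<forall>j<rdim W. pair x (\<lambda>g. act V g v i * act W g w j) = 0)"
proof -
  have "x \<in> ann (rep_tensor V W) (vec_tensor (rdim W) v w) \<longleftrightarrow>
      (\<forall>p<rdim V * rdim W. pair x (\<lambda>g. act V g v (p div rdim W) * act W g w (p mod rdim W)) = 0)"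
    unfolding ann_iff act_tensor by (simp add: vec_tensor_def rep_tensor_def)
  then show ?thesis unfolding blocks by simp
qed

text \<open>The subgroup becomes a second instance \<open>Hg\<close> of the whole theory. Its
  elements have the same type as those of \<open>G\<close>, so a representation of \<open>G\<close>
  restricts to \<open>H\<close> without any change of data.\<close>

locale glider_sub = glider_ctx G K + subgroup H G
  for G :: "('a, 'm) monoid_scheme" (structure) and K :: "'k::field_char_0 itself" and H :: "'a set"
begin

sublocale Hg: glider_ctx "G\<lparr>carrier := H\<rparr>" K
  by (intro glider_ctx.intro fin_grp.intro fin_grp_axioms.intro subgroup_imp_group subgroup_axioms)
    (simp add: finite_subset[OF subset fin])

lemma Hg_rep: "is_rep G V \<Longrightarrow> is_rep (G\<lparr>carrier := H\<rparr>) V"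
  using subset unfolding is_rep_def by (simp add: subset_iff)

lemma cancel [simp]:
  "a \<in> carrier G \<Longrightarrow> x \<in> carrier G \<Longrightarrow> a \<otimes> (inv a \<otimes> x) = x"
  "a \<in> carrier G \<Longrightarrow> x \<in> carrier G \<Longrightarrow> inv a \<otimes> (a \<otimes> x) = x"
  by (simp_all flip: m_assoc)

abbreviation "rs \<equiv> coset_reps G H"

text \<open>Shows that the list demanded by the choice in \<open>coset_reps\<close> exists.
  Representing \<open>H\<close> itself by the identity allows it to head the list.\<close>

lemma coset_reps:
  "rs \<noteq> [] \<and> hd rs = \<one> \<and> distinct rs \<and> set rs \<subseteq> carrier G \<and>
    (\<forall>g\<in>carrier G. \<exists>!r. r \<in> set rs \<and> inv r \<otimes> g \<in> H)"
proof -
  define rep where "rep g = (if g \<in> H then \<one> else SOME r. r \<in> carrier G \<and> inv r \<otimes> g \<in> H)" for g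
  have rep: "rep g \<in> carrier G \<and> inv (rep g) \<otimes> g \<in> H" if g: "g \<in> carrier G" for g
  proof (cases "g \<in> H")
    case True
    then show ?thesis using g by (simp add: rep_def)
  next
    case False
    have "g \<in> carrier G \<and> inv g \<otimes> g \<in> H" using g by simp
    from someI[of "\<lambda>r. r \<in> carrier G \<and> inv r \<otimes> g \<in> H", OF this] show ?thesis using False by (simp add: rep_def)
  qed
  \<comment> \<open>\<open>rep\<close> depends on the coset only: the predicate inside
    \<open>SOME\<close> is the same for \<open>g\<close> and \<open>g'\<close>, and either both lie
    in \<open>H\<close> or neither does.\<close>
  have rel: "rep g = rep g'" if g: "g \<in> carrier G" "g' \<in> carrier G" and i: "inv g' \<otimes> g \<in> H" for g g'
  proof -
    have "inv r \<otimes> g \<in> H \<longleftrightarrow> inv r \<otimes> g' \<in> H" if r: "r \<in> carrier G" for r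
    proof -
      have 1: "(inv r \<otimes> g') \<otimes> (inv g' \<otimes> g) = inv r \<otimes> g" using g r by (simp add: m_assoc)
      have 2: "(inv r \<otimes> g) \<otimes> inv (inv g' \<otimes> g) = inv r \<otimes> g'" using g r by (simp add: m_assoc inv_mult_group)
      show ?thesis using 1 2 i m_closed m_inv_closed by metis
    qed
    moreover have "g \<in> H \<longleftrightarrow> g' \<in> H"
    proof -
      have 1: "g' \<otimes> (inv g' \<otimes> g) = g" using g by simp
      have 2: "g \<otimes> inv (inv g' \<otimes> g) = g'" using g by (simp add: inv_mult_group)
      show ?thesis using 1 2 i m_closed m_inv_closed by metis
    qed
    ultimately have "(\<lambda>r. r \<in> carrier G \<and> inv r \<otimes> g \<in> H) = (\<lambda>r. r \<in> carrier G \<and> inv r \<otimes> g' \<in> H)"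
      by blast
    then show ?thesis using \<open>g \<in> H \<longleftrightarrow> g' \<in> H\<close> by (simp add: rep_def)
  qed
  have "finite (rep ` carrier G - {\<one>})" using fin by simp
  then obtain l where l: "set l = rep ` carrier G - {\<one>}" "distinct l" using finite_distinct_list by blast
  have "rep \<one> = \<one>" by (simp add: rep_def)
  then have set: "set (\<one> # l) = rep ` carrier G" using l(1) one_closed by (force simp: image_iff)
  have "\<exists>!r. r \<in> rep ` carrier G \<and> inv r \<otimes> g \<in> H" if g: "g \<in> carrier G" for g
  proof (rule ex1I[of _ "rep g"])
    show "rep g \<in> rep ` carrier G \<and> inv (rep g) \<otimes> g \<in> H" using rep g by blast
    fix r assume "r \<in> rep ` carrier G \<and> inv r \<otimes> g \<in> H"
    then obtain g' where g': "g' \<in> carrier G" "r = rep g'" "inv (rep g') \<otimes> g \<in> H" by blast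
    have "inv g' \<otimes> g = inv (inv (rep g') \<otimes> g') \<otimes> (inv (rep g') \<otimes> g)"
      using rep[OF g'(1)] g g'(1) by (simp add: inv_mult_group m_assoc)
    then have "inv g' \<otimes> g \<in> H" using rep[OF g'(1)] g'(3) by simp
    then show "r = rep g" using rel[OF g g'(1)] g'(2) by simp
  qed
  then have "\<one> # l \<noteq> [] \<and> hd (\<one> # l) = \<one> \<and> distinct (\<one> # l) \<and> set (\<one> # l) \<subseteq> carrier G \<and>
    (\<forall>g\<in>carrier G. \<exists>!r. r \<in> set (\<one> # l) \<and> inv r \<otimes> g \<in> H)"
    unfolding set using rep l by auto
  then show ?thesis unfolding coset_reps_def by (rule someI)
qed

lemma distinct_rs: "distinct rs"
  and rs_ex1: "g \<in> carrier G \<Longrightarrow> \<exists>!r. r \<in> set rs \<and> inv r \<otimes> g \<in> H"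
  using coset_reps by simp_all

lemma rs_pos: "0 < length rs" and rs_0: "rs ! 0 = \<one>"
  and rs_closed: "i < length rs \<Longrightarrow> rs ! i \<in> carrier G"
  using coset_reps by (auto simp: hd_conv_nth subset_iff)

lemma coset_index: "g \<in> carrier G \<Longrightarrow> \<exists>!i. i < length rs \<and> inv (rs ! i) \<otimes> g \<in> H"
proof -
  assume g: "g \<in> carrier G"
  obtain r where r: "r \<in> set rs" "inv r \<otimes> g \<in> H" "\<And>s. s \<in> set rs \<Longrightarrow> inv s \<otimes> g \<in> H \<Longrightarrow> s = r"
    using rs_ex1[OF g] by blast
  obtain i where i: "i < length rs" "r = rs ! i" using r(1) by (metis in_set_conv_nth)
  show ?thesis
  proof (rule ex1I[of _ i])
    show "i < length rs \<and> inv (rs ! i) \<otimes> g \<in> H" using i r(2) by simp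
    fix j assume j: "j < length rs \<and> inv (rs ! j) \<otimes> g \<in> H"
    have "rs ! j = r" by (rule r(3)) (use j in simp_all)
    then have "rs ! j = rs ! i" using i(2) by (rule trans)
    then show "j = i" using nth_eq_iff_index_eq[OF distinct_rs] i(1) j by simp
  qed
qed

lemma coset_index_eq:
  assumes "i < length rs" "j < length rs" "g \<in> carrier G" "inv (rs ! i) \<otimes> g \<in> H" "inv (rs ! j) \<otimes> g \<in> H"
  shows "i = j"
  using coset_index[OF assms(3)] assms by blast

section \<open>Induced representations in block coordinates\<close>

abbreviation "Ind V \<equiv> rep_ind G H V"

lemma rdim_ind: "rdim (Ind V) = length rs * rdim V"
  by (simp add: rep_ind_def Let_def)

lemma rmat_ind:
  "rmat (Ind V) g p q = (if inv (rs ! (p div rdim V)) \<otimes> g \<otimes> rs ! (q div rdim V) \<in> H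
    then rmat V (inv (rs ! (p div rdim V)) \<otimes> g \<otimes> rs ! (q div rdim V)) (p mod rdim V) (q mod rdim V) else 0)"
  by (simp add: rep_ind_def Let_def)

text \<open>Group elements permute the blocks: in a given block row exactly one block is nonzero, so
  a product of two matrices reduces to a product of two blocks.\<close>

lemma is_rep_ind:
  fixes V :: "('a, 'k) rep"
  assumes V: "is_rep (G\<lparr>carrier := H\<rparr>) V"
  shows "is_rep G (Ind V)"
  unfolding is_rep_def
proof (intro conjI allI impI ballI)
  let ?n = "rdim V"
  fix p q assume "p < rdim (Ind V)" "q < rdim (Ind V)"
  then have pq: "p < length rs * ?n" "q < length rs * ?n" by (simp_all add: rdim_ind)
  then have n: "?n > 0" by (metis less_nat_zero_code mult_0_right neq0_conv)
  have ij: "p div ?n < length rs" "q div ?n < length rs" "p mod ?n < ?n" "q mod ?n < ?n"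
    using pq n by (simp_all add: less_mult_imp_div_less)
  let ?h = "\<lambda>g i j. inv (rs ! i) \<otimes> g \<otimes> rs ! j"
  show "rmat (Ind V) \<one> p q = (if p = q then 1 else 0)"
  proof (cases "p div ?n = q div ?n")
    case True
    then have "?h \<one> (p div ?n) (q div ?n) = \<one>" using rs_closed[OF ij(1)] rs_closed[OF ij(2)] by simp
    moreover have "p = q \<longleftrightarrow> p mod ?n = q mod ?n" using True by (metis div_mult_mod_eq)
    ultimately show ?thesis using V ij unfolding rmat_ind is_rep_def by simp
  next
    case False
    have "?h \<one> (p div ?n) (q div ?n) \<notin> H"
      using coset_index_eq[OF ij(1,2) rs_closed[OF ij(2)]] False rs_closed[OF ij(1)] rs_closed[OF ij(2)] by auto
    then show ?thesis using False by (auto simp: rmat_ind)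
  qed
  fix g g' assume g: "g \<in> carrier G" "g' \<in> carrier G"
  have hc: "?h a i j \<in> carrier G" if "a \<in> carrier G" "i < length rs" "j < length rs" for a i j
    using that rs_closed by simp
  have hm: "?h g i a \<otimes> ?h g' a j = ?h (g \<otimes> g') i j" if "i < length rs" "a < length rs" "j < length rs" for i a j
    using that rs_closed g by (simp add: m_assoc)
  let ?i = "p div ?n" and ?j = "q div ?n"
  \<comment> \<open>Inverting moves the unknown representative to the left, the form to which
    \<open>coset_index\<close> applies.\<close>
  have hi: "?h g ?i a \<in> H \<longleftrightarrow> inv (rs ! a) \<otimes> (inv g \<otimes> rs ! ?i) \<in> H" if a: "a < length rs" for a
  proof -
    have i: "inv (?h g ?i a) = inv (rs ! a) \<otimes> (inv g \<otimes> rs ! ?i)"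
      using rs_closed[OF a] rs_closed[OF ij(1)] g(1) by (simp add: inv_mult_group m_assoc)
    show ?thesis unfolding i[symmetric] using m_inv_closed inv_inv[OF hc[OF g(1) ij(1) a]] by metis
  qed
  obtain a where a: "a < length rs" "?h g ?i a \<in> H" and un: "\<And>b. b < length rs \<Longrightarrow> ?h g ?i b \<in> H \<Longrightarrow> b = a"
  proof -
    have "inv g \<otimes> rs ! ?i \<in> carrier G" using g(1) rs_closed[OF ij(1)] by simp
    from coset_index[OF this] obtain a where a: "a < length rs" "inv (rs ! a) \<otimes> (inv g \<otimes> rs ! ?i) \<in> H"
      and un: "\<And>b. b < length rs \<Longrightarrow> inv (rs ! b) \<otimes> (inv g \<otimes> rs ! ?i) \<in> H \<Longrightarrow> b = a" by blast
    show ?thesis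
    proof (rule that[of a])
      show "a < length rs" by (rule a(1))
      show "?h g ?i a \<in> H" using hi[OF a(1)] a(2) by simp
      show "b = a" if b: "b < length rs" "?h g ?i b \<in> H" for b
        by (rule un[OF b(1) hi[OF b(1), THEN iffD1, OF b(2)]])
    qed
  qed
  define F where "F b l = (if ?h g ?i b \<in> H then rmat V (?h g ?i b) (p mod ?n) l else 0) *
    (if ?h g' b ?j \<in> H then rmat V (?h g' b ?j) l (q mod ?n) else 0)" for b l
  have "(\<Sum>s<rdim (Ind V). rmat (Ind V) g p s * rmat (Ind V) g' s q) = (\<Sum>s<length rs * ?n. F (s div ?n) (s mod ?n))"
    unfolding rdim_ind rmat_ind F_def by simp
  also have "\<dots> = (\<Sum>b<length rs. \<Sum>l<?n. F b l)" by (rule sum_divmod)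
  also have "\<dots> = (\<Sum>b<length rs. if b = a then \<Sum>l<?n. F a l else 0)"
  proof (intro sum.cong refl)
    fix b assume "b \<in> {..<length rs}"
    then have "b \<noteq> a \<Longrightarrow> ?h g ?i b \<notin> H" using un by blast
    then show "(\<Sum>l<?n. F b l) = (if b = a then \<Sum>l<?n. F a l else 0)" by (cases "b = a") (simp_all add: F_def cong: if_cong)
  qed
  also have "\<dots> = (\<Sum>l<?n. F a l)" using a(1) by simp
  also have "\<dots> = rmat (Ind V) (g \<otimes> g') p q"
  proof (cases "?h g' a ?j \<in> H")
    case True
    then have "?h (g \<otimes> g') ?i ?j \<in> H" using hm[OF ij(1) a(1) ij(2)] a(2) m_closed by metis
    moreover have "rmat V (?h g ?i a \<otimes> ?h g' a ?j) (p mod ?n) (q mod ?n) =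
        (\<Sum>l<?n. rmat V (?h g ?i a) (p mod ?n) l * rmat V (?h g' a ?j) l (q mod ?n))"
      using V a(2) True ij unfolding is_rep_def by simp
    ultimately show ?thesis using True a(2) hm[OF ij(1) a(1) ij(2)] by (simp add: F_def rmat_ind)
  next
    case False
    have "?h g' a ?j = inv (?h g ?i a) \<otimes> ?h (g \<otimes> g') ?i ?j"
      using hm[OF ij(1) a(1) ij(2)] hc[OF g(1) ij(1) a(1)] hc[OF g(2) a(1) ij(2)] by (metis cancel(2))
    then have "?h (g \<otimes> g') ?i ?j \<notin> H" using False a(2) m_closed m_inv_closed by metis
    then show ?thesis using False by (simp add: F_def rmat_ind)
  qed
  finally show "rmat (Ind V) (g \<otimes> g') p q = (\<Sum>s<rdim (Ind V). rmat (Ind V) g p s * rmat (Ind V) g' s q)" by simp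
qed

text \<open>\<open>v\<close> lies in the initial block, so only the block column of the
  representative \<open>\<one>\<close> contributes.\<close>

lemma act_ind:
  fixes V :: "('a, 'k) rep"
  assumes v: "v \<in> kspace (rdim V)" and g: "g \<in> carrier G" and ik: "i < length rs" "k < rdim V"
  shows "act (Ind V) g v (i * rdim V + k) = (if inv (rs ! i) \<otimes> g \<in> H then act V (inv (rs ! i) \<otimes> g) v k else 0)"
proof -
  let ?n = "rdim V"
  let ?F = "\<lambda>j l. (if inv (rs ! i) \<otimes> g \<otimes> rs ! j \<in> H then rmat V (inv (rs ! i) \<otimes> g \<otimes> rs ! j) k l else 0) * v (j * ?n + l)"
  have d: "(i * ?n + k) div ?n = i" "(i * ?n + k) mod ?n = k" using ik by simp_all
  have "act (Ind V) g v (i * ?n + k) = (\<Sum>s<length rs * ?n. ?F (s div ?n) (s mod ?n))"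
    unfolding act_def rdim_ind rmat_ind d using block_index[OF ik] by simp
  also have "\<dots> = (\<Sum>j<length rs. \<Sum>l<?n. ?F j l)" by (rule sum_divmod)
  also have "\<dots> = (\<Sum>j<length rs. if j = 0 then \<Sum>l<?n. ?F 0 l else 0)"
  proof (intro sum.cong refl)
    fix j
    have "v (j * ?n + l) = 0" if "j \<noteq> 0" for l
      using that by (intro kspaceD[OF v]) (metis le_add1 le_trans mult_le_mono1 nat_mult_1 less_one not_le)
    then show "(\<Sum>l<?n. ?F j l) = (if j = 0 then \<Sum>l<?n. ?F 0 l else 0)" by (cases "j = 0") (simp_all cong: if_cong)
  qed
  also have "\<dots> = (\<Sum>l<?n. ?F 0 l)" using rs_pos by simp
  finally show ?thesis using g rs_closed[OF ik(1)] ik(2) by (simp add: rs_0 act_def)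
qed

lemma act_ind_H:
  fixes V :: "('a, 'k) rep"
  assumes v: "v \<in> kspace (rdim V)" and h: "h \<in> H"
  shows "act (Ind V) h v = act V h v"
proof
  fix p
  let ?n = "rdim V"
  have hc: "h \<in> carrier G" using h subset by blast
  show "act (Ind V) h v p = act V h v p"
  proof (cases "p < length rs * ?n")
    case False
    moreover have "?n \<le> length rs * ?n" using mult_le_mono1[OF Suc_leI[OF rs_pos], of ?n] by simp
    ultimately have "\<not> p < ?n" by linarith
    then show ?thesis using False by (simp add: act_def rdim_ind)
  next
    case True
    then have n: "?n > 0" by (metis less_nat_zero_code mult_0_right neq0_conv)
    have i: "p div ?n < length rs" "p mod ?n < ?n" using True n by (simp_all add: less_mult_imp_div_less)
    have "act (Ind V) h v p = (if inv (rs ! (p div ?n)) \<otimes> h \<in> H then act V (inv (rs ! (p div ?n)) \<otimes> h) v (p mod ?n) else 0)"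
      using act_ind[OF v hc i] by simp
    moreover have "inv (rs ! (p div ?n)) \<otimes> h \<in> H \<longleftrightarrow> p div ?n = 0"
      using coset_index_eq[OF i(1) rs_pos hc] h hc by (auto simp: rs_0)
    moreover have "p div ?n = 0 \<longleftrightarrow> p < ?n" using n by (simp add: div_eq_0_iff)
    ultimately show ?thesis using hc by (cases "p < ?n") (simp_all add: rs_0, simp add: act_def)
  qed
qed

lemma ind_kspace: "v \<in> kspace (rdim V) \<Longrightarrow> v \<in> kspace (rdim (Ind V))"
proof -
  assume v: "v \<in> kspace (rdim V)"
  have "rdim V \<le> rdim (Ind V)" using mult_le_mono1[OF Suc_leI[OF rs_pos], of "rdim V"] by (simp add: rdim_ind)
  then show ?thesis using kspaceD[OF v] by (simp add: kspace_def)
qed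

lemma pointed_ind:
  fixes V :: "('a, 'k) rep"
  shows "Hg.pointed V v \<Longrightarrow> pointed (Ind V) v"
  unfolding pointed_def Hg.pointed_def using is_rep_ind ind_kspace by blast

text \<open>An element outside \<open>H\<close> moves the initial block to another one and cannot
  stabilize a line there; elements of \<open>H\<close> act as before.\<close>

lemma gr_ind:
  fixes V :: "('a, 'k) rep"
  assumes V: "Hg.pointed V v"
  shows "gr (Ind V) v = Hg.gr V v"
proof -
  have v: "v \<in> kspace (rdim V)" "v \<noteq> 0" using V by (auto simp: Hg.pointed_def)
  have inH: "g \<in> H" if gc: "(g, c) \<in> gr (Ind V) v" for g c
  proof (rule ccontr)
    assume gH: "g \<notin> H"
    have g: "g \<in> carrier G" "act (Ind V) g v = vscale c v" using gc by (auto simp: gr_def)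
    have "c * v k = 0" if k: "k < rdim V" for k
    proof -
      have "act (Ind V) g v k = 0" using act_ind[OF v(1) g(1) rs_pos k] gH g(1) by (simp add: rs_0)
      then show ?thesis unfolding g(2) vscale_apply .
    qed
    moreover have "c * v k = 0" if "\<not> k < rdim V" for k using kspaceD[OF v(1)] that by simp
    ultimately have "c * v k = 0" for k by blast
    moreover have "c \<noteq> 0" by (rule gr_nonzero[OF pointed_ind[OF V] gc])
    ultimately have "v = 0" by (simp add: fun_eq_iff)
    then show False using v(2) by simp
  qed
  show ?thesis
  proof (intro subset_antisym subrelI)
    fix g c assume gc: "(g, c) \<in> gr (Ind V) v"
    then show "(g, c) \<in> Hg.gr V v" using inH[OF gc] act_ind_H[OF v(1) inH[OF gc]] by (simp add: gr_def Hg.gr_def)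
  next
    fix g c assume "(g, c) \<in> Hg.gr V v"
    then have g: "g \<in> H" "act V g v = vscale c v" by (simp_all add: Hg.gr_def)
    then show "(g, c) \<in> gr (Ind V) v" using act_ind_H[OF v(1) g(1)] subsetD[OF subset g(1)] by (simp add: gr_def)
  qed
qed

lemma pair_ind:
  fixes f :: "'a \<Rightarrow> 'k"
  assumes i: "i < length rs"
  shows "pair x (\<lambda>g. if inv (rs ! i) \<otimes> g \<in> H then f (inv (rs ! i) \<otimes> g) else 0) = Hg.pair (\<lambda>h. x (rs ! i \<otimes> h)) f"
proof -
  have r: "rs ! i \<in> carrier G" by (rule rs_closed[OF i])
  have "pair x (\<lambda>g. if inv (rs ! i) \<otimes> g \<in> H then f (inv (rs ! i) \<otimes> g) else 0) =
      (\<Sum>g\<in>{g \<in> carrier G. inv (rs ! i) \<otimes> g \<in> H}. x g * f (inv (rs ! i) \<otimes> g))"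
    unfolding pair_def by (rule sum.mono_neutral_cong_right) (use fin in auto)
  also have "\<dots> = (\<Sum>h\<in>H. x (rs ! i \<otimes> h) * f h)"
    by (rule sum.reindex_bij_witness[of _ "\<lambda>h. rs ! i \<otimes> h" "\<lambda>g. inv (rs ! i) \<otimes> g"])
      (use r subset in \<open>auto simp: subset_iff\<close>)
  finally show ?thesis by (simp add: Hg.pair_def)
qed

text \<open>An element of \<open>K[G]\<close> is a sum of terms \<open>r x\<close> with
  \<open>r\<close> a coset representative and \<open>x\<close> in \<open>K[H]\<close>; it kills
  \<open>1 \<otimes> v\<close> exactly if every such \<open>x\<close> kills
  \<open>v\<close>.\<close>

definition indann :: "('a \<Rightarrow> 'k) set \<Rightarrow> ('a \<Rightarrow> 'k) set"
  where "indann j = {x. \<forall>i<length rs. (\<lambda>h. x (rs ! i \<otimes> h)) \<in> j}"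

lemma pair_cong: "(\<And>g. g \<in> carrier G \<Longrightarrow> f g = f' g) \<Longrightarrow> pair x f = pair x f'"
  unfolding pair_def by simp

lemma ann_ind:
  fixes V :: "('a, 'k) rep"
  assumes v: "v \<in> kspace (rdim V)"
  shows "ann (Ind V) v = indann (Hg.ann V v)"
proof (rule Set.set_eqI)
  fix x
  have "x \<in> ann (Ind V) v \<longleftrightarrow>
      (\<forall>i<length rs. \<forall>k<rdim V. pair x (\<lambda>g. act (Ind V) g v (i * rdim V + k)) = 0)"
    unfolding ann_iff rdim_ind by (rule blocks)
  also have "\<dots> \<longleftrightarrow> (\<forall>i<length rs. \<forall>k<rdim V. Hg.pair (\<lambda>h. x (rs ! i \<otimes> h)) (\<lambda>h. act V h v k) = 0)"
  proof (intro all_cong imp_cong refl)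
    fix i k assume ik: "i < length rs" "k < rdim V"
    have "pair x (\<lambda>g. act (Ind V) g v (i * rdim V + k)) =
        pair x (\<lambda>g. if inv (rs ! i) \<otimes> g \<in> H then act V (inv (rs ! i) \<otimes> g) v k else 0)"
      by (rule pair_cong) (rule act_ind[OF v _ ik])
    then show "(pair x (\<lambda>g. act (Ind V) g v (i * rdim V + k)) = 0) =
        (Hg.pair (\<lambda>h. x (rs ! i \<otimes> h)) (\<lambda>h. act V h v k) = 0)"
      using pair_ind[OF ik(1), of x "\<lambda>h. act V h v k"] by simp
  qed
  also have "\<dots> \<longleftrightarrow> x \<in> indann (Hg.ann V v)" by (simp add: indann_def Hg.ann_iff)
  finally show "x \<in> ann (Ind V) v \<longleftrightarrow> x \<in> indann (Hg.ann V v)" .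
qed

text \<open>Coefficients of \<open>1 \<otimes> v\<close> and \<open>1 \<otimes> w\<close> in
  different blocks are supported on different cosets, so their products vanish; within one block the
  products are those for \<open>v \<otimes> w\<close>. This is why induction is
  multiplicative.\<close>

lemma ann_ind_tensor:
  fixes V W :: "('a, 'k) rep"
  assumes v: "v \<in> kspace (rdim V)" and w: "w \<in> kspace (rdim W)"
  shows "ann (rep_tensor (Ind V) (Ind W)) (vec_tensor (rdim (Ind W)) v w) =
    indann (Hg.ann (rep_tensor V W) (vec_tensor (rdim W) v w))"
proof (rule Set.set_eqI)
  fix x
  let ?P = "\<lambda>i k j l. pair x (\<lambda>g. act (Ind V) g v (i * rdim V + k) * act (Ind W) g w (j * rdim W + l)) = 0"
  let ?Q = "\<lambda>i k l. Hg.pair (\<lambda>h. x (rs ! i \<otimes> h)) (\<lambda>h. act V h v k * act W h w l) = 0"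
  have P: "?P i k j l \<longleftrightarrow> (i = j \<longrightarrow> ?Q i k l)" if ik: "i < length rs" "k < rdim V" and jl: "j < length rs" "l < rdim W" for i k j l
  proof (cases "i = j")
    case True
    have "pair x (\<lambda>g. act (Ind V) g v (i * rdim V + k) * act (Ind W) g w (j * rdim W + l)) =
        pair x (\<lambda>g. if inv (rs ! i) \<otimes> g \<in> H then act V (inv (rs ! i) \<otimes> g) v k * act W (inv (rs ! i) \<otimes> g) w l else 0)"
      by (rule pair_cong) (use act_ind[OF v _ ik] act_ind[OF w _ jl] True in simp)
    then show ?thesis using pair_ind[OF ik(1), of x "\<lambda>h. act V h v k * act W h w l"] True by simp
  next
    case False
    have "pair x (\<lambda>g. act (Ind V) g v (i * rdim V + k) * act (Ind W) g w (j * rdim W + l)) = pair x (\<lambda>g. 0)"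
    proof (rule pair_cong)
      fix g assume g: "g \<in> carrier G"
      have "\<not> (inv (rs ! i) \<otimes> g \<in> H \<and> inv (rs ! j) \<otimes> g \<in> H)" using coset_index_eq[OF ik(1) jl(1) g] False by blast
      then show "act (Ind V) g v (i * rdim V + k) * act (Ind W) g w (j * rdim W + l) = 0"
        using act_ind[OF v g ik] act_ind[OF w g jl] by auto
    qed
    then show ?thesis using False by (simp add: pair_def)
  qed
  have "x \<in> ann (rep_tensor (Ind V) (Ind W)) (vec_tensor (rdim (Ind W)) v w) \<longleftrightarrow>
      (\<forall>p<rdim (Ind V). \<forall>q<rdim (Ind W). pair x (\<lambda>g. act (Ind V) g v p * act (Ind W) g w q) = 0)"
    by (rule ann_tensor_coord)
  also have "\<dots> \<longleftrightarrow> (\<forall>i<length rs. \<forall>k<rdim V. \<forall>j<length rs. \<forall>l<rdim W. ?P i k j l)"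
    unfolding rdim_ind blocks by (rule refl)
  also have "\<dots> \<longleftrightarrow> (\<forall>i<length rs. \<forall>k<rdim V. \<forall>l<rdim W. ?Q i k l)"
    using P by blast
  also have "\<dots> \<longleftrightarrow> x \<in> indann (Hg.ann (rep_tensor V W) (vec_tensor (rdim W) v w))"
    by (simp add: indann_def Hg.ann_tensor_coord)
  finally show "x \<in> ann (rep_tensor (Ind V) (Ind W)) (vec_tensor (rdim (Ind W)) v w) \<longleftrightarrow>
      x \<in> indann (Hg.ann (rep_tensor V W) (vec_tensor (rdim W) v w))" .
qed

end

context glider_sub
begin

section \<open>Induction as a map of algebras, and its effect on types\<close>

abbreviation blk :: "nat \<Rightarrow> (nat \<Rightarrow> 'k) \<Rightarrow> nat \<Rightarrow> nat \<Rightarrow> 'k"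
  where "blk n w i \<equiv> (\<lambda>k. if k < n then w (i * n + k) else 0)"

lemma klin_blk: "klin (\<lambda>w. blk n w i)"
  by (rule klinI) (simp_all add: fun_eq_iff vscale_def)

lemma is_glider_ind:
  fixes V :: "('a, 'k) rep"
  assumes V: "Hg.pointed V v"
  shows "is_glider G (glider_ind G H (Hg.cyc V v))"
proof -
  let ?n = "rdim V" and ?L = "kv.span {v}"
  let ?S = "kG_span (G\<lparr>carrier := H\<rparr>) V ?L"
  let ?T = "{w \<in> kspace (length rs * ?n). \<forall>i<length rs. blk ?n w i \<in> ?S}"
  have V': "is_rep (G\<lparr>carrier := H\<rparr>) V" "v \<in> kspace ?n" using V by (auto simp: Hg.pointed_def)
  have X: "is_glider (G\<lparr>carrier := H\<rparr>) (Hg.cyc V v)" by (rule Hg.is_glider_cyc[OF V'])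
  have S: "kv.subspace ?S" "?L \<subseteq> ?S" using X by (simp_all add: is_glider_def Hg.cyc_def)
  have L: "?L \<subseteq> kspace ?n" using V'(2) by (intro kv.span_minimal) simp_all
  have T1: "kv.subspace ?T"
  proof (rule kv.subspaceI)
    show "0 \<in> ?T" using kv.subspace_0[OF S(1)] kk.linear_0[OF klin_blk] by simp
    fix x y assume "x \<in> ?T" "y \<in> ?T"
    then show "x + y \<in> ?T"
      using kv.subspace_add[OF S(1)] by (simp add: kk.linear_add[OF klin_blk] kv.subspace_add[OF subspace_kspace])
  next
    fix c x assume "x \<in> ?T"
    then show "vscale c x \<in> ?T"
      using kv.subspace_scale[OF S(1)] by (simp add: kk.linear_scale[OF klin_blk] kv.subspace_scale[OF subspace_kspace])
  qed
  have T2: "?L \<subseteq> ?T"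
  proof
    fix u assume u: "u \<in> ?L"
    then have uk: "u \<in> kspace ?n" using L by blast
    have "blk ?n u i \<in> ?S" for i
    proof (cases "i = 0")
      case True
      have "blk ?n u 0 = u" using kspaceD[OF uk] by (auto simp: fun_eq_iff)
      then show ?thesis using True u S(2) by auto
    next
      case False
      have "blk ?n u i = 0"
      proof
        fix k
        have "1 * ?n \<le> i * ?n" using False by (intro mult_le_mono1) simp
        then have "?n \<le> i * ?n + k" by linarith
        then show "blk ?n u i k = 0 k" using kspaceD[OF uk, of "i * ?n + k"] by simp
      qed
      then show ?thesis using kv.subspace_0[OF S(1)] by simp
    qed
    then show "u \<in> ?T" using ind_kspace[OF uk] by (simp add: rdim_ind)
  qed
  have T3: "act (Ind V) a u \<in> ?T" if a: "a \<in> carrier G" and u: "u \<in> ?L" for a u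
  proof -
    have uk: "u \<in> kspace ?n" using u L by blast
    have "blk ?n (act (Ind V) a u) i \<in> ?S" if i: "i < length rs" for i
    proof -
      have "blk ?n (act (Ind V) a u) i = (if inv (rs ! i) \<otimes> a \<in> H then act V (inv (rs ! i) \<otimes> a) u else 0)"
      proof
        fix k
        show "blk ?n (act (Ind V) a u) i k = (if inv (rs ! i) \<otimes> a \<in> H then act V (inv (rs ! i) \<otimes> a) u else 0) k"
          using act_ind[OF uk a i] by (cases "k < ?n") (simp_all, simp add: act_def)
      qed
      moreover have "act V (inv (rs ! i) \<otimes> a) u \<in> ?S" if "inv (rs ! i) \<otimes> a \<in> H"
        using that u by (intro Hg.act_in_span) simp_all
      ultimately show ?thesis using kv.subspace_0[OF S(1)] by (auto split: if_splits)
    qed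
    then show ?thesis using act_kspace[of "Ind V" a u] by (simp add: rdim_ind)
  qed
  have g: "glider_ind G H (Hg.cyc V v) = \<lparr>gamb = Ind V, gsub = ?L, gtop = ?T\<rparr>"
    by (simp add: glider_ind_def Hg.cyc_def Let_def)
  show ?thesis
    unfolding is_glider_iff g glider.select_convs
  proof (intro conjI ballI)
    show "is_rep G (Ind V)" by (rule is_rep_ind[OF V'(1)])
    show "kv.subspace ?L" by (rule kv.subspace_span)
    show "?T \<subseteq> kspace (rdim (Ind V))" unfolding rdim_ind by blast
  qed (fact T1 T2 T3)+
qed

lemma glider_cls_ind:
  fixes V :: "('a, 'k) rep"
  assumes V: "Hg.pointed V v"
  shows "glider_cls G (glider_ind G H (Hg.cyc V v)) = kl (Ind V) v"
  using glider_cls_line[OF is_glider_ind[OF V], of v] by (simp add: glider_ind_def Hg.cyc_def Let_def)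

sublocale IM: based_pair Hg.GA "scal (G\<lparr>carrier := H\<rparr>)" Hg.anns Hg.bas Hg.coef GA "scal G"
  by (rule based_pair.intro[OF Hg.A.based_algebra_axioms A.rat_algebra_axioms])

lemma bas_indann:
  fixes V :: "('a, 'k) rep"
  assumes V: "Hg.pointed V v"
  shows "bas (indann (Hg.ann V v)) = kl (Ind V) v"
proof -
  have v: "v \<in> kspace (rdim V)" using V by (simp add: Hg.pointed_def)
  show ?thesis unfolding ann_ind[OF v, symmetric] by (rule bas_ann[OF pointed_ind[OF V]])
qed

text \<open>Built directly on the basis; \<open>ind_map_eq\<close> identifies it with the map that
  the definite description in \<open>ind_map\<close> asks for.\<close>

definition ind :: "('a, 'k) rat_elem \<Rightarrow> ('a, 'k) rat_elem"
  where "ind = IM.lin (\<lambda>j. bas (indann j))"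

lemma ind_bas_closed: "j \<in> Hg.anns \<Longrightarrow> bas (indann j) \<in> carrier GA"
  by (elim Hg.annsE) (simp add: bas_indann kl_closed pointed_ind)

lemma ind_closed: "ind x \<in> carrier GA"
  and ind_add: "x \<in> carrier Hg.GA \<Longrightarrow> y \<in> carrier Hg.GA \<Longrightarrow> ind (x \<oplus>\<^bsub>Hg.GA\<^esub> y) = ind x \<oplus>\<^bsub>GA\<^esub> ind y"
  and ind_zero: "ind \<zero>\<^bsub>Hg.GA\<^esub> = \<zero>\<^bsub>GA\<^esub>"
  and ind_scale: "x \<in> carrier Hg.GA \<Longrightarrow> ind (scal (G\<lparr>carrier := H\<rparr>) q \<otimes>\<^bsub>Hg.GA\<^esub> x) = scal G q \<otimes>\<^bsub>GA\<^esub> ind x"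
  unfolding ind_def
  by (rule IM.lin_closed IM.lin_add IM.lin_zero IM.lin_scale, erule ind_bas_closed, assumption?, assumption?)+

lemma ind_scal_kl:
  fixes V :: "('a, 'k) rep"
  assumes V: "Hg.pointed V v"
  shows "ind (scal (G\<lparr>carrier := H\<rparr>) q \<otimes>\<^bsub>Hg.GA\<^esub> Hg.kl V v) = scal G q \<otimes>\<^bsub>GA\<^esub> kl (Ind V) v"
  using IM.lin_basis[where \<phi> = "\<lambda>j. bas (indann j)", OF ind_bas_closed Hg.ann_anns[OF V], where q = q]
  unfolding ind_def Hg.bas_ann[OF V] bas_indann[OF V] .

lemma ind_kl:
  fixes V :: "('a, 'k) rep"
  assumes V: "Hg.pointed V v"
  shows "ind (Hg.kl V v) = kl (Ind V) v"
proof -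
  have "Hg.kl V v = scal (G\<lparr>carrier := H\<rparr>) 1 \<otimes>\<^bsub>Hg.GA\<^esub> Hg.kl V v"
    unfolding Hg.scal_one by (rule Hg.A.l_one[symmetric, OF Hg.kl_closed[OF V]])
  then have "ind (Hg.kl V v) = scal G 1 \<otimes>\<^bsub>GA\<^esub> kl (Ind V) v" using ind_scal_kl[OF V, of 1] by simp
  then show ?thesis unfolding scal_one using kl_closed[OF pointed_ind[OF V]] by simp
qed

lemma ind_mult:
  assumes x: "x \<in> carrier Hg.GA" and y: "y \<in> carrier Hg.GA"
  shows "ind (x \<otimes>\<^bsub>Hg.GA\<^esub> y) = ind x \<otimes>\<^bsub>GA\<^esub> ind y"
  unfolding ind_def
proof (rule IM.lin_mult[OF ind_bas_closed _ x y])
  fix i j assume "i \<in> Hg.anns" "j \<in> Hg.anns"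
  then obtain V v W w where V: "Hg.pointed V v" "i = Hg.ann V v" and W: "Hg.pointed W w" "j = Hg.ann W w"
    by (elim Hg.annsE) blast
  let ?T = "rep_tensor V W" and ?t = "vec_tensor (rdim W) v w"
  have T: "Hg.pointed ?T ?t" by (rule Hg.pointed_tensor[OF V(1) W(1)])
  have vw: "v \<in> kspace (rdim V)" "w \<in> kspace (rdim W)" "?t \<in> kspace (rdim ?T)"
    using V W T by (simp_all add: Hg.pointed_def)
  have "kl (Ind ?T) ?t = kl (rep_tensor (Ind V) (Ind W)) (vec_tensor (rdim (Ind W)) v w)"
    by (rule kl_eqI[OF pointed_ind[OF T] pointed_tensor[OF pointed_ind[OF V(1)] pointed_ind[OF W(1)]]])
      (simp add: ann_ind[OF vw(3)] ann_ind_tensor[OF vw(1,2)])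
  then have "bas (indann (Hg.ann ?T ?t)) = bas (indann i) \<otimes>\<^bsub>GA\<^esub> bas (indann j)"
    unfolding V(2) W(2) bas_indann[OF V(1)] bas_indann[OF W(1)] bas_indann[OF T]
    by (simp add: kl_mult[OF pointed_ind[OF V(1)] pointed_ind[OF W(1)]])
  moreover have "Hg.bas i \<otimes>\<^bsub>Hg.GA\<^esub> Hg.bas j = Hg.bas (Hg.ann ?T ?t)"
    unfolding V(2) W(2) Hg.bas_ann[OF V(1)] Hg.bas_ann[OF W(1)] Hg.bas_ann[OF T] by (rule Hg.kl_mult[OF V(1) W(1)])
  ultimately show "\<exists>k\<in>Hg.anns. Hg.bas i \<otimes>\<^bsub>Hg.GA\<^esub> Hg.bas j = Hg.bas k \<and> bas (indann k) = bas (indann i) \<otimes>\<^bsub>GA\<^esub> bas (indann j)"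
    using Hg.ann_anns[OF T] by blast
qed

text \<open>Existence is provided by \<open>ind\<close>; uniqueness holds because the classes of
  irreducible gliders span the algebra over the rationals.\<close>

lemma ind_map_eq: "ind_map G H = restrict ind (carrier Hg.GA)"
  unfolding ind_map_def Let_def
proof (rule the_equality)
  let ?f = "restrict ind (carrier Hg.GA)"
  have irr: "?f (glider_cls (G\<lparr>carrier := H\<rparr>) X) = glider_cls G (glider_ind G H X)"
    if X: "irreducible_glider (G\<lparr>carrier := H\<rparr>) X" for X :: "('a, 'k) glider"
  proof -
    obtain V v where "Hg.pointed V v" "X = Hg.cyc V v"
      using X unfolding Hg.irreducible_glider_iff Hg.pointed_def by blast
    then show ?thesis
      using ind_kl[of V v] glider_cls_ind[of V v] Hg.kl_closed[of V v] by (simp add: Hg.kl_def)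
  qed
  show "?f \<in> carrier Hg.GA \<rightarrow>\<^sub>E carrier GA \<and>
      (\<forall>x\<in>carrier Hg.GA. \<forall>y\<in>carrier Hg.GA.
         ?f (x \<oplus>\<^bsub>Hg.GA\<^esub> y) = ?f x \<oplus>\<^bsub>GA\<^esub> ?f y \<and> ?f (x \<otimes>\<^bsub>Hg.GA\<^esub> y) = ?f x \<otimes>\<^bsub>GA\<^esub> ?f y) \<and>
      (\<forall>q. \<forall>x\<in>carrier Hg.GA. ?f (scal (G\<lparr>carrier := H\<rparr>) q \<otimes>\<^bsub>Hg.GA\<^esub> x) = scal G q \<otimes>\<^bsub>GA\<^esub> ?f x) \<and>
      (\<forall>X. irreducible_glider (G\<lparr>carrier := H\<rparr>) X \<longrightarrow>
         ?f (glider_cls (G\<lparr>carrier := H\<rparr>) X) = glider_cls G (glider_ind G H X))"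
  proof (intro conjI ballI allI impI irr)
    show "?f \<in> carrier Hg.GA \<rightarrow>\<^sub>E carrier GA" using ind_closed by (intro restrict_PiE_iff[THEN iffD2]) simp
  qed (simp_all add: ind_add ind_mult flip: ind_scale)
  fix \<phi> :: "('a, 'k) rat_elem \<Rightarrow> ('a, 'k) rat_elem"
  assume \<phi>: "\<phi> \<in> carrier Hg.GA \<rightarrow>\<^sub>E carrier GA \<and>
      (\<forall>x\<in>carrier Hg.GA. \<forall>y\<in>carrier Hg.GA.
         \<phi> (x \<oplus>\<^bsub>Hg.GA\<^esub> y) = \<phi> x \<oplus>\<^bsub>GA\<^esub> \<phi> y \<and> \<phi> (x \<otimes>\<^bsub>Hg.GA\<^esub> y) = \<phi> x \<otimes>\<^bsub>GA\<^esub> \<phi> y) \<and>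
      (\<forall>q. \<forall>x\<in>carrier Hg.GA. \<phi> (scal (G\<lparr>carrier := H\<rparr>) q \<otimes>\<^bsub>Hg.GA\<^esub> x) = scal G q \<otimes>\<^bsub>GA\<^esub> \<phi> x) \<and>
      (\<forall>X. irreducible_glider (G\<lparr>carrier := H\<rparr>) X \<longrightarrow>
         \<phi> (glider_cls (G\<lparr>carrier := H\<rparr>) X) = glider_cls G (glider_ind G H X))"
  have \<phi>P: "\<phi> \<in> carrier Hg.GA \<rightarrow>\<^sub>E carrier GA" by (rule conjunct1[OF \<phi>])
  have \<phi>a: "x \<in> carrier Hg.GA \<Longrightarrow> y \<in> carrier Hg.GA \<Longrightarrow> \<phi> (x \<oplus>\<^bsub>Hg.GA\<^esub> y) = \<phi> x \<oplus>\<^bsub>GA\<^esub> \<phi> y" for x y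
    using conjunct1[OF conjunct2[OF \<phi>]] by blast
  have \<phi>s: "x \<in> carrier Hg.GA \<Longrightarrow> \<phi> (scal (G\<lparr>carrier := H\<rparr>) q \<otimes>\<^bsub>Hg.GA\<^esub> x) = scal G q \<otimes>\<^bsub>GA\<^esub> \<phi> x" for q x
    using conjunct1[OF conjunct2[OF conjunct2[OF \<phi>]]] by blast
  have \<phi>i: "irreducible_glider (G\<lparr>carrier := H\<rparr>) X \<Longrightarrow>
         \<phi> (glider_cls (G\<lparr>carrier := H\<rparr>) X) = glider_cls G (glider_ind G H X)" for X
    by (rule conjunct2[OF conjunct2[OF conjunct2[OF \<phi>]], rule_format])
  have \<phi>c: "\<phi> x \<in> carrier GA" if "x \<in> carrier Hg.GA" for x using \<phi>P that by (rule PiE_mem)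
  have base: "\<phi> (scal (G\<lparr>carrier := H\<rparr>) q \<otimes>\<^bsub>Hg.GA\<^esub> Hg.bas j) = scal G q \<otimes>\<^bsub>GA\<^esub> bas (indann j)"
    if "j \<in> Hg.anns" for q j
  proof -
    obtain V v where V: "Hg.pointed V v" "j = Hg.ann V v" using \<open>j \<in> Hg.anns\<close> by (rule Hg.annsE)
    have "irreducible_glider (G\<lparr>carrier := H\<rparr>) (Hg.cyc V v)"
      unfolding Hg.irreducible_glider_iff using V(1) unfolding Hg.pointed_def by blast
    from \<phi>i[OF this] have "\<phi> (Hg.kl V v) = kl (Ind V) v" unfolding glider_cls_ind[OF V(1)] Hg.kl_def .
    then show ?thesis
      unfolding V(2) Hg.bas_ann[OF V(1)] bas_indann[OF V(1)] \<phi>s[OF Hg.kl_closed[OF V(1)]] by simp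
  qed
  have "\<phi> x = ind x" if x: "x \<in> carrier Hg.GA" for x
    unfolding ind_def
    by (rule IM.lin_unique[where \<phi> = "\<lambda>j. bas (indann j)", OF ind_bas_closed \<phi>a \<phi>c base x])
  then show "\<phi> = ?f"
    using PiE_restrict[OF \<phi>P] by (metis (no_types, lifting) restrict_ext)
qed

lemma tsum_ind: "x \<in> carrier Hg.GA \<Longrightarrow> tsum t (ind x) = Hg.tsum t x"
proof (induction rule: Hg.kl_induct)
  case zero
  then show ?case by (simp add: ind_zero A.tsum_zero Hg.A.tsum_zero)
next
  case (base q V v)
  then show ?case
    by (simp add: ind_scal_kl Hg.tsum_kl tsum_kl[OF pointed_ind] gr_ind)
next
  case (add x y)
  then show ?case by (simp add: ind_add A.tsum_add Hg.A.tsum_add ind_closed)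
qed

lemma tsum_Hg_zero: "x \<in> carrier Hg.GA \<Longrightarrow> \<not> Domain t \<subseteq> H \<Longrightarrow> Hg.tsum t x = 0"
proof (induction rule: Hg.kl_induct)
  case zero
  then show ?case by (simp add: Hg.A.tsum_zero)
next
  case (base q V v)
  have "Domain (Hg.gr V v) \<subseteq> H" by (auto simp: Hg.gr_def)
  then show ?case using base(2) Hg.tsum_kl[OF base(1), of t q] by auto
next
  case (add x y)
  then show ?case by (simp add: Hg.A.tsum_add)
qed

text \<open>Induction preserves type sums, hence carries the nilradical of the algebra of
  \<open>H\<close> into that of \<open>G\<close>, and all members of a coset give the same
  value.\<close>

lemma ind_map_red_mod_nil:
  assumes x: "x \<in> carrier Hg.GA"
  shows "ind_map_red G H (mod_nil (G\<lparr>carrier := H\<rparr>) x) = mod_nil G (ind x)"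
proof -
  have "mod_nil G (ind_map G H y) = mod_nil G (ind x)" if y: "y \<in> mod_nil (G\<lparr>carrier := H\<rparr>) x" for y
  proof -
    have y': "y \<in> carrier Hg.GA" "mod_nil (G\<lparr>carrier := H\<rparr>) y = mod_nil (G\<lparr>carrier := H\<rparr>) x"
      using Hg.mod_nil_members[OF x y] by simp_all
    have "\<forall>t. Hg.tsum t y = Hg.tsum t x" using Hg.mod_nil_eq[OF y'(1) x] y'(2) by simp
    then show ?thesis
      unfolding ind_map_eq restrict_apply'[OF y'(1)] mod_nil_eq[OF ind_closed ind_closed]
      using tsum_ind[OF y'(1)] tsum_ind[OF x] by simp
  qed
  then show ?thesis unfolding ind_map_red_def using Hg.mod_nil_self[OF x] by blast
qed

lemma gr_restrict:
  fixes V :: "('a, 'k) rep"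
  assumes V: "pointed V v" and d: "Domain (gr V v) \<subseteq> H"
  shows "Hg.pointed V v" "Hg.gr V v = gr V v"
proof -
  show "Hg.pointed V v" using V by (simp add: pointed_def Hg.pointed_def Hg_rep)
  show "Hg.gr V v = gr V v"
  proof (intro subset_antisym subrelI)
    fix g c assume "(g, c) \<in> Hg.gr V v"
    then show "(g, c) \<in> gr V v" using subsetD[OF subset] by (simp add: gr_def Hg.gr_def)
  next
    fix g c assume gc: "(g, c) \<in> gr V v"
    then have "g \<in> H" using d by blast
    then show "(g, c) \<in> Hg.gr V v" using gc by (simp add: gr_def Hg.gr_def)
  qed
qed

lemma mod_nil_restrict:
  fixes V :: "('a, 'k) rep"
  assumes V: "pointed V v" and d: "Domain (gr V v) \<subseteq> H"
  shows "mod_nil G (scal G q \<otimes>\<^bsub>GA\<^esub> kl V v) = mod_nil G (ind (scal (G\<lparr>carrier := H\<rparr>) q \<otimes>\<^bsub>Hg.GA\<^esub> Hg.kl V v))"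
proof -
  note r = gr_restrict[OF V d]
  have c: "scal (G\<lparr>carrier := H\<rparr>) q \<otimes>\<^bsub>Hg.GA\<^esub> Hg.kl V v \<in> carrier Hg.GA" using Hg.kl_closed[OF r(1)] by simp
  have c': "scal G q \<otimes>\<^bsub>GA\<^esub> kl V v \<in> carrier GA" using kl_closed[OF V] by simp
  show ?thesis
    unfolding mod_nil_eq[OF c' ind_closed] tsum_ind[OF c] Hg.tsum_kl[OF r(1)] tsum_kl[OF V] r(2) by simp
qed

text \<open>The two sides agree only modulo the nilradical: they have the same type.\<close>

lemma mod_nil_ind_linear:
  assumes \<chi>: "pointed (linear_rep \<chi>) (unit_vec0 1)" and x: "x \<in> carrier Hg.GA"
  shows "mod_nil G (ind (Hg.kl (linear_rep \<chi>) (unit_vec0 1) \<otimes>\<^bsub>Hg.GA\<^esub> x)) =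
    mod_nil G (kl (linear_rep \<chi>) (unit_vec0 1) \<otimes>\<^bsub>GA\<^esub> ind x)"
proof -
  let ?Z = "linear_rep \<chi>" and ?z = "unit_vec0 1 :: nat \<Rightarrow> 'k"
  have \<chi>H: "Hg.pointed ?Z ?z" using \<chi> by (simp add: pointed_def Hg.pointed_def Hg_rep)
  have cH: "Hg.kl ?Z ?z \<in> carrier Hg.GA" and c: "kl ?Z ?z \<in> carrier GA"
    using Hg.kl_closed[OF \<chi>H] kl_closed[OF \<chi>] .
  have "Hg.tsum t (Hg.kl ?Z ?z \<otimes>\<^bsub>Hg.GA\<^esub> x) = tsum t (kl ?Z ?z \<otimes>\<^bsub>GA\<^esub> ind x)" for t
    using x
  proof (induction rule: Hg.kl_induct)
    case zero
    then show ?case using cH c by (simp add: ind_zero A.tsum_zero Hg.A.tsum_zero)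
  next
    case (base q V v)
    note I = pointed_ind[OF base]
    have "Hg.kl ?Z ?z \<otimes>\<^bsub>Hg.GA\<^esub> (scal (G\<lparr>carrier := H\<rparr>) q \<otimes>\<^bsub>Hg.GA\<^esub> Hg.kl V v) =
        scal (G\<lparr>carrier := H\<rparr>) q \<otimes>\<^bsub>Hg.GA\<^esub> Hg.kl (rep_tensor ?Z V) (vec_tensor (rdim V) ?z v)"
      using cH Hg.kl_closed[OF base] by (simp add: Hg.A.m_lcomm Hg.kl_mult[OF \<chi>H base])
    moreover have "kl ?Z ?z \<otimes>\<^bsub>GA\<^esub> (scal G q \<otimes>\<^bsub>GA\<^esub> kl (Ind V) v) =
        scal G q \<otimes>\<^bsub>GA\<^esub> kl (rep_tensor ?Z (Ind V)) (vec_tensor (rdim (Ind V)) ?z v)"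
      using c kl_closed[OF I] by (simp add: A.m_lcomm kl_mult[OF \<chi> I])
    \<comment> \<open>The line of a linear character is stabilized by all of \<open>G\<close>,
      respectively \<open>H\<close>, and the eigenvalues agree on \<open>H\<close>, which contains
      the stabilizer of the induced glider.\<close>
    moreover have "Hg.gr (rep_tensor ?Z V) (vec_tensor (rdim V) ?z v) = gr (rep_tensor ?Z (Ind V)) (vec_tensor (rdim (Ind V)) ?z v)"
    proof -
      have "(h, c) \<in> Hg.gr ?Z ?z \<longleftrightarrow> (h, c) \<in> gr ?Z ?z" if "(h, d) \<in> Hg.gr V v" for h c d
        using that subsetD[OF subset] by (auto simp: gr_def Hg.gr_def)
      then show ?thesis unfolding gr_tensor[OF \<chi> I] Hg.gr_tensor[OF \<chi>H base] gr_ind[OF base] by blast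
    qed
    ultimately show ?case
      unfolding ind_scal_kl[OF base]
      by (simp add: tsum_kl[OF pointed_tensor[OF \<chi> I]] Hg.tsum_kl[OF Hg.pointed_tensor[OF \<chi>H base]])
  next
    case (add x y)
    then show ?case
      using cH c by (simp add: ind_add A.tsum_add Hg.A.tsum_add ind_closed A.r_distr Hg.A.r_distr)
  qed
  then show ?thesis
    using tsum_ind[OF Hg.A.m_closed[OF cH x]] mod_nil_eq[OF ind_closed A.m_closed[OF c ind_closed]] by simp
qed

end

section \<open>Modules over the group algebra\<close>

lemma (in abelian_monoid) finsum_swap:
  assumes "finite A" and B: "finite B" and f: "\<And>a b. a \<in> A \<Longrightarrow> b \<in> B \<Longrightarrow> f a b \<in> carrier G"
  shows "(\<Oplus>a\<in>A. \<Oplus>b\<in>B. f a b) = (\<Oplus>b\<in>B. \<Oplus>a\<in>A. f a b)"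
  using assms(1) f
proof (induction A rule: finite_induct)
  case empty
  then show ?case by (simp add: finsum_zero)
next
  case (insert x A)
  have "(\<Oplus>a\<in>insert x A. \<Oplus>b\<in>B. f a b) = (\<Oplus>b\<in>B. f x b) \<oplus> (\<Oplus>b\<in>B. \<Oplus>a\<in>A. f a b)"
    using insert by (subst finsum_insert) (auto intro!: finsum_closed)
  also have "\<dots> = (\<Oplus>b\<in>B. f x b \<oplus> (\<Oplus>a\<in>A. f a b))"
    using insert by (intro finsum_addf[symmetric]) (auto intro!: finsum_closed)
  also have "\<dots> = (\<Oplus>b\<in>B. \<Oplus>a\<in>insert x A. f a b)"
    using insert by (intro finsum_cong' refl) (auto intro!: finsum_closed)
  finally show ?case .
qed

text \<open>Commutativity of convolution is the substitution of \<open>inv b \<otimes> c\<close> for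
  \<open>a\<close>, associativity that of \<open>b \<otimes> d\<close> for \<open>a\<close>.\<close>

lemma (in comm_group) group_alg_cring:
  assumes fin: "finite (carrier G)"
  shows "cring (group_alg G)"
proof (intro cringI abelian_groupI comm_monoidI)
  let ?R = "group_alg G"
  have mc: "(x \<otimes>\<^bsub>?R\<^esub> y) c = (if c \<in> carrier G then \<Sum>a\<in>carrier G. x a * y (inv a \<otimes> c) else 0)" for x y c
    by (simp add: group_alg_def)
  have shift: "(\<Sum>a\<in>carrier G. f a) = (\<Sum>d\<in>carrier G. f (b \<otimes> d))" if b: "b \<in> carrier G" for f :: "'a \<Rightarrow> rat" and b
    by (rule sum.reindex_bij_witness[of _ "\<lambda>d. b \<otimes> d" "\<lambda>a. inv b \<otimes> a"]) (use b in \<open>simp_all flip: m_assoc\<close>)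
  show "x \<oplus>\<^bsub>?R\<^esub> y \<in> carrier ?R" if "x \<in> carrier ?R" "y \<in> carrier ?R" for x y
    using that by (simp add: group_alg_def)
  show "\<zero>\<^bsub>?R\<^esub> \<in> carrier ?R" by (simp add: group_alg_def)
  show "x \<oplus>\<^bsub>?R\<^esub> y \<oplus>\<^bsub>?R\<^esub> z = x \<oplus>\<^bsub>?R\<^esub> (y \<oplus>\<^bsub>?R\<^esub> z)" for x y z by (simp add: group_alg_def add.assoc)
  show "x \<oplus>\<^bsub>?R\<^esub> y = y \<oplus>\<^bsub>?R\<^esub> x" for x y by (simp add: group_alg_def add.commute)
  show "\<zero>\<^bsub>?R\<^esub> \<oplus>\<^bsub>?R\<^esub> x = x" for x by (simp add: group_alg_def)
  show "\<exists>y\<in>carrier ?R. y \<oplus>\<^bsub>?R\<^esub> x = \<zero>\<^bsub>?R\<^esub>" if "x \<in> carrier ?R" for x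
    using that by (intro bexI[of _ "\<lambda>a. - x a"]) (simp_all add: group_alg_def)
  show "x \<otimes>\<^bsub>?R\<^esub> y \<in> carrier ?R" for x y by (simp add: group_alg_def)
  show "\<one>\<^bsub>?R\<^esub> \<in> carrier ?R" by (auto simp: group_alg_def)
  show "x \<otimes>\<^bsub>?R\<^esub> y = y \<otimes>\<^bsub>?R\<^esub> x" for x y
  proof
    fix c
    have "(\<Sum>a\<in>carrier G. x a * y (inv a \<otimes> c)) = (\<Sum>b\<in>carrier G. y b * x (inv b \<otimes> c))" if c: "c \<in> carrier G"
      by (rule sum.reindex_bij_witness[of _ "\<lambda>b. inv b \<otimes> c" "\<lambda>a. inv a \<otimes> c"])
        (use c in \<open>simp_all add: inv_mult_group m_ac flip: m_assoc\<close>)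
    then show "(x \<otimes>\<^bsub>?R\<^esub> y) c = (y \<otimes>\<^bsub>?R\<^esub> x) c" by (simp add: mc)
  qed
  show "\<one>\<^bsub>?R\<^esub> \<otimes>\<^bsub>?R\<^esub> x = x" if x: "x \<in> carrier ?R" for x
  proof
    fix c
    have "(\<Sum>a\<in>carrier G. \<one>\<^bsub>?R\<^esub> a * x (inv a \<otimes> c)) = (\<Sum>a\<in>carrier G. if a = \<one> then x c else 0)" if "c \<in> carrier G"
      using that by (intro sum.cong refl) (simp add: group_alg_def)
    then show "(\<one>\<^bsub>?R\<^esub> \<otimes>\<^bsub>?R\<^esub> x) c = x c" using x fin by (simp add: mc) (simp add: group_alg_def)
  qed
  show "(x \<otimes>\<^bsub>?R\<^esub> y) \<otimes>\<^bsub>?R\<^esub> z = x \<otimes>\<^bsub>?R\<^esub> (y \<otimes>\<^bsub>?R\<^esub> z)" for x y z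
  proof
    fix c
    have "(\<Sum>a\<in>carrier G. (x \<otimes>\<^bsub>?R\<^esub> y) a * z (inv a \<otimes> c)) =
        (\<Sum>b\<in>carrier G. x b * (y \<otimes>\<^bsub>?R\<^esub> z) (inv b \<otimes> c))" if c: "c \<in> carrier G"
    proof -
      have "(\<Sum>a\<in>carrier G. (x \<otimes>\<^bsub>?R\<^esub> y) a * z (inv a \<otimes> c)) =
          (\<Sum>a\<in>carrier G. \<Sum>b\<in>carrier G. x b * (y (inv b \<otimes> a) * z (inv a \<otimes> c)))"
        by (intro sum.cong refl) (simp add: mc sum_distrib_right mult.assoc)
      also have "\<dots> = (\<Sum>b\<in>carrier G. x b * (\<Sum>a\<in>carrier G. y (inv b \<otimes> a) * z (inv a \<otimes> c)))"
        by (subst sum.swap) (simp add: sum_distrib_left)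
      also have "\<dots> = (\<Sum>b\<in>carrier G. x b * (y \<otimes>\<^bsub>?R\<^esub> z) (inv b \<otimes> c))"
      proof (intro sum.cong refl arg_cong2[where f = "(*)"])
        fix b assume b: "b \<in> carrier G"
        have "(\<Sum>a\<in>carrier G. y (inv b \<otimes> a) * z (inv a \<otimes> c)) =
            (\<Sum>d\<in>carrier G. y (inv b \<otimes> (b \<otimes> d)) * z (inv (b \<otimes> d) \<otimes> c))" by (rule shift[OF b])
        also have "\<dots> = (\<Sum>d\<in>carrier G. y d * z (inv d \<otimes> (inv b \<otimes> c)))"
        proof (intro sum.cong refl)
          fix d assume d: "d \<in> carrier G"
          have "inv b \<otimes> (b \<otimes> d) = d" using b d by (simp flip: m_assoc)
          moreover have "inv (b \<otimes> d) \<otimes> c = inv d \<otimes> (inv b \<otimes> c)" using b c d by (simp add: inv_mult_group m_assoc)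
          ultimately show "y (inv b \<otimes> (b \<otimes> d)) * z (inv (b \<otimes> d) \<otimes> c) = y d * z (inv d \<otimes> (inv b \<otimes> c))" by simp
        qed
        finally show "(\<Sum>a\<in>carrier G. y (inv b \<otimes> a) * z (inv a \<otimes> c)) = (y \<otimes>\<^bsub>?R\<^esub> z) (inv b \<otimes> c)"
          using b c by (simp add: mc)
      qed
      finally show ?thesis .
    qed
    then show "((x \<otimes>\<^bsub>?R\<^esub> y) \<otimes>\<^bsub>?R\<^esub> z) c = (x \<otimes>\<^bsub>?R\<^esub> (y \<otimes>\<^bsub>?R\<^esub> z)) c"
      by (cases "c \<in> carrier G") (simp_all add: mc[of "x \<otimes>\<^bsub>?R\<^esub> y"] mc[of x "y \<otimes>\<^bsub>?R\<^esub> z"])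
  qed
  show "(x \<oplus>\<^bsub>?R\<^esub> y) \<otimes>\<^bsub>?R\<^esub> z = x \<otimes>\<^bsub>?R\<^esub> z \<oplus>\<^bsub>?R\<^esub> y \<otimes>\<^bsub>?R\<^esub> z" for x y z
    by (rule ext) (simp add: group_alg_def distrib_right sum.distrib)
qed

locale group_action = Gam: comm_group \<Gamma> + rat_algebra Y s
  for \<Gamma> :: "('g, 'm) monoid_scheme" and Y :: "('y, 'n) ring_scheme" (structure) and s :: "rat \<Rightarrow> 'y" +
  fixes c :: "'g \<Rightarrow> 'y"
  assumes finG: "finite (carrier \<Gamma>)" and c_closed [simp]: "z \<in> carrier \<Gamma> \<Longrightarrow> c z \<in> carrier Y"
    and c_mult: "z \<in> carrier \<Gamma> \<Longrightarrow> w \<in> carrier \<Gamma> \<Longrightarrow> c (z \<otimes>\<^bsub>\<Gamma>\<^esub> w) = c z \<otimes> c w"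
    and c_one: "c \<one>\<^bsub>\<Gamma>\<^esub> = \<one>"
begin

text \<open>The algebra map from the group algebra to \<open>Y\<close> that extends
  \<open>c\<close>. Scalar multiplication is multiplication by \<open>\<rho> f\<close>, so the
  module axioms follow from \<open>\<rho>\<close> being a homomorphism.\<close>

definition \<rho> :: "('g \<Rightarrow> rat) \<Rightarrow> 'y"
  where "\<rho> f = (\<Oplus>z\<in>carrier \<Gamma>. s (f z) \<otimes> c z)"

abbreviation "MM \<equiv> mult_module \<Gamma> Y s c"

lemma \<rho>_closed [simp]: "\<rho> f \<in> carrier Y"
  unfolding \<rho>_def by (intro finsum_closed) auto

lemma smult_eq: "x \<in> carrier Y \<Longrightarrow> f \<odot>\<^bsub>MM\<^esub> x = \<rho> f \<otimes> x"
proof -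
  assume x: "x \<in> carrier Y"
  have "\<rho> f \<otimes> x = (\<Oplus>z\<in>carrier \<Gamma>. s (f z) \<otimes> c z \<otimes> x)"
    unfolding \<rho>_def by (rule finsum_ldistr[OF finG x]) auto
  also have "\<dots> = (\<Oplus>z\<in>carrier \<Gamma>. s (f z) \<otimes> (c z \<otimes> x))"
    by (intro finsum_cong' refl) (auto simp: x m_assoc)
  finally show ?thesis by (simp add: mult_module_def)
qed

lemma MM_simps [simp]:
  "carrier MM = carrier Y" "x \<oplus>\<^bsub>MM\<^esub> y = x \<oplus> y" "\<zero>\<^bsub>MM\<^esub> = \<zero>"
  by (simp_all add: mult_module_def)

lemma s_sum: "finite A \<Longrightarrow> s (\<Sum>a\<in>A. f a) = (\<Oplus>a\<in>A. s (f a))"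
  by (induction A rule: finite_induct) (simp_all add: s_add)

lemma \<rho>_add: "\<rho> (\<lambda>z. f z + g z) = \<rho> f \<oplus> \<rho> g"
proof -
  have "\<rho> (\<lambda>z. f z + g z) = (\<Oplus>z\<in>carrier \<Gamma>. s (f z) \<otimes> c z \<oplus> s (g z) \<otimes> c z)"
    unfolding \<rho>_def by (intro finsum_cong' refl) (auto simp: s_add l_distr)
  also have "\<dots> = \<rho> f \<oplus> \<rho> g" unfolding \<rho>_def by (intro finsum_addf) auto
  finally show ?thesis .
qed

lemma \<rho>_one: "\<rho> \<one>\<^bsub>group_alg \<Gamma>\<^esub> = \<one>"
proof -
  have "\<rho> \<one>\<^bsub>group_alg \<Gamma>\<^esub> = (\<Oplus>z\<in>carrier \<Gamma>. if z = \<one>\<^bsub>\<Gamma>\<^esub> then \<one> else \<zero>)"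
    unfolding \<rho>_def by (intro finsum_cong') (auto simp: group_alg_def s_one c_one)
  also have "\<dots> = \<one>" using finsum_singleton[OF Gam.one_closed finG, of "\<lambda>z. \<one>"] by (simp add: eq_commute)
  finally show ?thesis .
qed

lemma \<rho>_mult: "\<rho> (f \<otimes>\<^bsub>group_alg \<Gamma>\<^esub> g) = \<rho> f \<otimes> \<rho> g"
proof -
  have "\<rho> (f \<otimes>\<^bsub>group_alg \<Gamma>\<^esub> g) =
      (\<Oplus>z\<in>carrier \<Gamma>. \<Oplus>a\<in>carrier \<Gamma>. s (f a * g (inv\<^bsub>\<Gamma>\<^esub> a \<otimes>\<^bsub>\<Gamma>\<^esub> z)) \<otimes> c z)"
    unfolding \<rho>_def
  proof (intro finsum_cong' refl)
    fix z assume z: "z \<in> carrier \<Gamma>"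
    have "s ((f \<otimes>\<^bsub>group_alg \<Gamma>\<^esub> g) z) \<otimes> c z = (\<Oplus>a\<in>carrier \<Gamma>. s (f a * g (inv\<^bsub>\<Gamma>\<^esub> a \<otimes>\<^bsub>\<Gamma>\<^esub> z))) \<otimes> c z"
      using z by (simp add: group_alg_def s_sum[OF finG])
    also have "\<dots> = (\<Oplus>a\<in>carrier \<Gamma>. s (f a * g (inv\<^bsub>\<Gamma>\<^esub> a \<otimes>\<^bsub>\<Gamma>\<^esub> z)) \<otimes> c z)"
      by (rule finsum_ldistr[OF finG c_closed[OF z]]) auto
    finally show "s ((f \<otimes>\<^bsub>group_alg \<Gamma>\<^esub> g) z) \<otimes> c z = \<dots>" .
  qed (auto intro!: finsum_closed)
  also have "\<dots> = (\<Oplus>a\<in>carrier \<Gamma>. \<Oplus>z\<in>carrier \<Gamma>. s (f a * g (inv\<^bsub>\<Gamma>\<^esub> a \<otimes>\<^bsub>\<Gamma>\<^esub> z)) \<otimes> c z)"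
    by (rule finsum_swap[OF finG finG]) auto
  also have "\<dots> = (\<Oplus>a\<in>carrier \<Gamma>. s (f a) \<otimes> c a \<otimes> \<rho> g)"
  proof (intro finsum_cong' refl)
    fix a assume a: "a \<in> carrier \<Gamma>"
    \<comment> \<open>Substituting the product of \<open>a\<close> and \<open>d\<close> for
      \<open>z\<close> turns the convolution into a product of two sums.\<close>
    have im: "(\<lambda>d. a \<otimes>\<^bsub>\<Gamma>\<^esub> d) ` carrier \<Gamma> = carrier \<Gamma>" by (rule Gam.surj_const_mult[OF a])
    have "(\<Oplus>z\<in>(\<lambda>d. a \<otimes>\<^bsub>\<Gamma>\<^esub> d) ` carrier \<Gamma>. s (f a * g (inv\<^bsub>\<Gamma>\<^esub> a \<otimes>\<^bsub>\<Gamma>\<^esub> z)) \<otimes> c z) =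
        (\<Oplus>d\<in>carrier \<Gamma>. s (f a * g (inv\<^bsub>\<Gamma>\<^esub> a \<otimes>\<^bsub>\<Gamma>\<^esub> (a \<otimes>\<^bsub>\<Gamma>\<^esub> d))) \<otimes> c (a \<otimes>\<^bsub>\<Gamma>\<^esub> d))"
      by (rule finsum_reindex) (use a in \<open>auto intro!: inj_onI\<close>)
    also have "\<dots> = (\<Oplus>d\<in>carrier \<Gamma>. (s (f a) \<otimes> c a) \<otimes> (s (g d) \<otimes> c d))"
    proof (intro finsum_cong' refl)
      fix d assume d: "d \<in> carrier \<Gamma>"
      have "inv\<^bsub>\<Gamma>\<^esub> a \<otimes>\<^bsub>\<Gamma>\<^esub> (a \<otimes>\<^bsub>\<Gamma>\<^esub> d) = d" using a d by (simp flip: Gam.m_assoc)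
      then show "s (f a * g (inv\<^bsub>\<Gamma>\<^esub> a \<otimes>\<^bsub>\<Gamma>\<^esub> (a \<otimes>\<^bsub>\<Gamma>\<^esub> d))) \<otimes> c (a \<otimes>\<^bsub>\<Gamma>\<^esub> d) = (s (f a) \<otimes> c a) \<otimes> (s (g d) \<otimes> c d)"
        using a d by (simp add: s_mult c_mult m_ac)
    qed (use a in auto)
    also have "\<dots> = s (f a) \<otimes> c a \<otimes> \<rho> g"
      unfolding \<rho>_def by (rule finsum_rdistr[OF finG, symmetric]) (use a in auto)
    finally show "(\<Oplus>z\<in>carrier \<Gamma>. s (f a * g (inv\<^bsub>\<Gamma>\<^esub> a \<otimes>\<^bsub>\<Gamma>\<^esub> z)) \<otimes> c z) = s (f a) \<otimes> c a \<otimes> \<rho> g" unfolding im .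
  qed auto
  also have "\<dots> = \<rho> f \<otimes> \<rho> g"
    unfolding \<rho>_def[of f] by (rule finsum_ldistr[OF finG \<rho>_closed, symmetric]) auto
  finally show ?thesis .
qed

lemma module_MM: "module (group_alg \<Gamma>) MM"
proof (rule moduleI[OF Gam.group_alg_cring[OF finG]])
  show "abelian_group MM"
    by (rule abelian_groupI) (auto simp: a_ac l_neg intro!: bexI[of _ "\<ominus> _"])
  show "(f \<oplus>\<^bsub>group_alg \<Gamma>\<^esub> g) \<odot>\<^bsub>MM\<^esub> x = f \<odot>\<^bsub>MM\<^esub> x \<oplus>\<^bsub>MM\<^esub> g \<odot>\<^bsub>MM\<^esub> x" if x: "x \<in> carrier MM" for f g x
  proof -
    have "\<rho> (f \<oplus>\<^bsub>group_alg \<Gamma>\<^esub> g) = \<rho> f \<oplus> \<rho> g" using \<rho>_add by (simp add: group_alg_def)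
    then show ?thesis using x by (simp add: smult_eq l_distr)
  qed
qed (simp_all add: smult_eq r_distr \<rho>_mult \<rho>_one m_assoc)

lemma submodule_MM:
  assumes X: "X \<subseteq> carrier Y" "\<zero> \<in> X" "\<And>x. x \<in> X \<Longrightarrow> \<ominus> x \<in> X" "\<And>x y. x \<in> X \<Longrightarrow> y \<in> X \<Longrightarrow> x \<oplus> y \<in> X"
    and sX: "\<And>q x. x \<in> X \<Longrightarrow> s q \<otimes> x \<in> X" and cX: "\<And>z x. z \<in> carrier \<Gamma> \<Longrightarrow> x \<in> X \<Longrightarrow> c z \<otimes> x \<in> X"
  shows "submodule X (group_alg \<Gamma>) MM"
proof (rule module.submoduleI[OF module_MM])
  have fs: "(\<Oplus>a\<in>A. f a) \<in> X" if "finite A" "\<And>a. a \<in> A \<Longrightarrow> f a \<in> X" for f :: "'g \<Rightarrow> 'y" and A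
    using that
  proof (induction A rule: finite_induct)
    case empty
    then show ?case using X(2) by simp
  next
    case (insert a A)
    then show ?case using X(1,4) by (subst finsum_insert) auto
  qed
  show "f \<odot>\<^bsub>MM\<^esub> x \<in> X" if "x \<in> X" for f x
    unfolding mult_module_def using fs[OF finG] sX cX that by simp
  interpret M: abelian_group MM using module_MM by (rule module.axioms(2))
  show "\<ominus>\<^bsub>MM\<^esub> x \<in> X" if "x \<in> X" for x
  proof -
    have "x \<in> carrier Y" using that X(1) by blast
    then have "\<ominus>\<^bsub>MM\<^esub> x = \<ominus> x" using M.minus_equality[of "\<ominus> x" x] by (simp add: l_neg)
    then show ?thesis using X(3) that by simp
  qed
qed (use X in simp_all)

end

text \<open>The action is a finite sum built from rational scalars and group elements, so
  compatibility with these two is enough.\<close>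

lemma mult_module_hom:
  assumes Y: "cring Y" and Y': "cring Y'" and fin: "finite (carrier \<Gamma>)"
    and s: "\<And>q. s q \<in> carrier Y" "\<And>q. s' q \<in> carrier Y'"
    and c: "\<And>z. z \<in> carrier \<Gamma> \<Longrightarrow> c z \<in> carrier Y" "\<And>z. z \<in> carrier \<Gamma> \<Longrightarrow> c' z \<in> carrier Y'"
    and \<phi>: "\<And>x. x \<in> carrier Y \<Longrightarrow> \<phi> x \<in> carrier Y'"
      "\<And>x y. x \<in> carrier Y \<Longrightarrow> y \<in> carrier Y \<Longrightarrow> \<phi> (x \<oplus>\<^bsub>Y\<^esub> y) = \<phi> x \<oplus>\<^bsub>Y'\<^esub> \<phi> y"
      "\<And>q x. x \<in> carrier Y \<Longrightarrow> \<phi> (s q \<otimes>\<^bsub>Y\<^esub> x) = s' q \<otimes>\<^bsub>Y'\<^esub> \<phi> x"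
      "\<And>z x. z \<in> carrier \<Gamma> \<Longrightarrow> x \<in> carrier Y \<Longrightarrow> \<phi> (c z \<otimes>\<^bsub>Y\<^esub> x) = c' z \<otimes>\<^bsub>Y'\<^esub> \<phi> x"
  shows "\<phi> \<in> mod_hom (group_alg \<Gamma>) (mult_module \<Gamma> Y s c) (mult_module \<Gamma> Y' s' c')"
proof -
  interpret Y: cring Y by (rule Y)
  interpret Y': cring Y' by (rule Y')
  have "\<phi> \<zero>\<^bsub>Y\<^esub> \<oplus>\<^bsub>Y'\<^esub> \<phi> \<zero>\<^bsub>Y\<^esub> = \<phi> \<zero>\<^bsub>Y\<^esub>" using \<phi>(2)[of "\<zero>\<^bsub>Y\<^esub>" "\<zero>\<^bsub>Y\<^esub>"] by simp
  then have z: "\<phi> \<zero>\<^bsub>Y\<^esub> = \<zero>\<^bsub>Y'\<^esub>"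
    using \<phi>(1)[OF Y.zero_closed] Y'.add.l_cancel_one' by metis
  have fs: "\<phi> (\<Oplus>\<^bsub>Y\<^esub>a\<in>A. f a) = (\<Oplus>\<^bsub>Y'\<^esub>a\<in>A. \<phi> (f a))" if "finite A" "\<And>a. a \<in> A \<Longrightarrow> f a \<in> carrier Y" for A f
    using that
  proof (induction A rule: finite_induct)
    case empty
    then show ?case using z by simp
  next
    case (insert a A)
    have "\<phi> (\<Oplus>\<^bsub>Y\<^esub>a\<in>insert a A. f a) = \<phi> (f a \<oplus>\<^bsub>Y\<^esub> (\<Oplus>\<^bsub>Y\<^esub>a\<in>A. f a))"
      using insert by (subst Y.finsum_insert) auto
    also have "\<dots> = \<phi> (f a) \<oplus>\<^bsub>Y'\<^esub> (\<Oplus>\<^bsub>Y'\<^esub>a\<in>A. \<phi> (f a))"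
      using insert by (subst \<phi>(2)) (auto intro!: Y.finsum_closed)
    also have "\<dots> = (\<Oplus>\<^bsub>Y'\<^esub>a\<in>insert a A. \<phi> (f a))"
      using insert \<phi>(1) by (subst Y'.finsum_insert) auto
    finally show ?case .
  qed
  have "\<phi> (\<Oplus>\<^bsub>Y\<^esub>z\<in>carrier \<Gamma>. s (f z) \<otimes>\<^bsub>Y\<^esub> (c z \<otimes>\<^bsub>Y\<^esub> x)) =
      (\<Oplus>\<^bsub>Y'\<^esub>z\<in>carrier \<Gamma>. s' (f z) \<otimes>\<^bsub>Y'\<^esub> (c' z \<otimes>\<^bsub>Y'\<^esub> \<phi> x))" if x: "x \<in> carrier Y" for f x
  proof -
    have "\<phi> (\<Oplus>\<^bsub>Y\<^esub>z\<in>carrier \<Gamma>. s (f z) \<otimes>\<^bsub>Y\<^esub> (c z \<otimes>\<^bsub>Y\<^esub> x)) =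
        (\<Oplus>\<^bsub>Y'\<^esub>z\<in>carrier \<Gamma>. \<phi> (s (f z) \<otimes>\<^bsub>Y\<^esub> (c z \<otimes>\<^bsub>Y\<^esub> x)))"
      using s c x by (intro fs[OF fin]) simp
    also have "\<dots> = (\<Oplus>\<^bsub>Y'\<^esub>z\<in>carrier \<Gamma>. s' (f z) \<otimes>\<^bsub>Y'\<^esub> (c' z \<otimes>\<^bsub>Y'\<^esub> \<phi> x))"
      by (intro Y'.finsum_cong' refl) (auto simp: s c x \<phi>(1,3,4))
    finally show ?thesis .
  qed
  then show ?thesis unfolding mod_hom_def mult_module_def using \<phi>(1,2) by simp
qed

section \<open>The exact sequence\<close>

context glider_param
begin

section \<open>The action of the linear characters\<close>

definition Lz :: "'a set \<Rightarrow> ('a, 'k) rat_elem"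
  where "Lz z = kl (linear_rep (T z)) (unit_vec0 1)"

lemma Lz_closed: "z \<in> carrier \<Gamma> \<Longrightarrow> Lz z \<in> carrier GA"
  unfolding Lz_def by (rule kl_closed[OF T_pointed]) simp_all

lemma linear_vec: "unit_vec0 (1 :: 'k) \<in> kspace 1" "unit_vec0 (1 :: 'k) \<noteq> 0"
  by (simp_all add: unit_vec0_def kspace_def fun_eq_iff)

lemma M_cls_linear:
  assumes z: "z \<in> carrier \<Gamma>"
  shows "M_cls G T {z} {} = Lz z"
  unfolding Lz_def
proof (rule M_cls_eq)
  show "is_index G I {z} {}" using z by (simp add: is_index_def pointsets_def)
  show "pointed (linear_rep (T z)) (unit_vec0 1)" using T_pointed[OF z, of 1] by simp
  show "ann (linear_rep (T z)) (unit_vec0 1) = JAB {z} {}"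
    using ann_linear[OF linear_vec, of _ "T z"] by (auto simp: JAB_def)
qed

text \<open>Both sides are classes of cyclic gliders, and both annihilators consist of the elements
  orthogonal to the product character.\<close>

lemma Lz_mult:
  assumes z: "z \<in> carrier \<Gamma>" and w: "w \<in> carrier \<Gamma>"
  shows "Lz (z \<otimes>\<^bsub>\<Gamma>\<^esub> w) = Lz z \<otimes>\<^bsub>GA\<^esub> Lz w"
proof -
  let ?u = "unit_vec0 1 :: nat \<Rightarrow> 'k"
  note p = T_pointed[OF z one_neq_zero] T_pointed[OF w one_neq_zero]
  have "Lz z \<otimes>\<^bsub>GA\<^esub> Lz w = kl (rep_tensor (linear_rep (T z)) (linear_rep (T w))) (vec_tensor (rdim (linear_rep (T w))) ?u ?u)"
    unfolding Lz_def by (rule kl_mult[OF p])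
  also have "\<dots> = Lz (z \<otimes>\<^bsub>\<Gamma>\<^esub> w)"
    unfolding Lz_def
  proof (rule kl_eqI[OF pointed_tensor[OF p] T_pointed[OF ab.m_closed[OF z w] one_neq_zero]], rule Set.set_eqI)
    fix x
    have "pair x (\<lambda>g. act (linear_rep (T z)) g ?u 0 * act (linear_rep (T w)) g ?u 0) = pair x (T (z \<otimes>\<^bsub>\<Gamma>\<^esub> w))"
      unfolding pair_def act_linear by (intro sum.cong refl) (simp add: unit_vec0_def T_prod[OF z w])
    then show "x \<in> ann (rep_tensor (linear_rep (T z)) (linear_rep (T w))) (vec_tensor (rdim (linear_rep (T w))) ?u ?u) \<longleftrightarrow>
        x \<in> ann (linear_rep (T (z \<otimes>\<^bsub>\<Gamma>\<^esub> w))) ?u"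
      unfolding ann_tensor_coord ann_linear[OF linear_vec] by simp
  qed
  finally show ?thesis by (rule sym)
qed

lemma Lz_one: "Lz \<one>\<^bsub>\<Gamma>\<^esub> = \<one>\<^bsub>GA\<^esub>"
  unfolding Lz_def kl_one
proof (rule kl_eqI[OF T_pointed[OF ab.one_closed one_neq_zero] pointed_triv], rule Set.set_eqI)
  fix x
  have "pair x (T \<one>\<^bsub>\<Gamma>\<^esub>) = pair x (\<lambda>g. 1)" unfolding pair_def by (intro sum.cong refl) (simp add: T_unit)
  then show "x \<in> ann (linear_rep (T \<one>\<^bsub>\<Gamma>\<^esub>)) (unit_vec0 1) \<longleftrightarrow> x \<in> ann triv_rep (unit_vec0 1)"
    unfolding ann_triv ann_linear[OF linear_vec] by simp
qed

sublocale act: group_action \<Gamma> RA "\<lambda>q. mod_nil G (scal G q)" "\<lambda>z. mod_nil G (M_cls G T {z} {})"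
proof (intro group_action.intro rat_algebra.intro rat_algebra_axioms.intro group_action_axioms.intro)
  show "comm_group \<Gamma>" by (rule ab.comm_group_axioms)
  show "cring RA" by (rule RA.is_cring)
  show "finite (carrier \<Gamma>)" by (rule finite_\<Gamma>)
  show "mod_nil G (scal G q) \<in> carrier RA" for q by (rule mod_nil_simps(1)[OF scal_closed])
  show "mod_nil G (scal G (q + p)) = mod_nil G (scal G q) \<oplus>\<^bsub>RA\<^esub> mod_nil G (scal G p)" for q p
    unfolding mod_nil_simps(2)[OF scal_closed scal_closed] scal_add by (rule refl)
  show "mod_nil G (scal G (q * p)) = mod_nil G (scal G q) \<otimes>\<^bsub>RA\<^esub> mod_nil G (scal G p)" for q p
    unfolding mod_nil_simps(3)[OF scal_closed scal_closed] scal_mult by (rule refl)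
  show "mod_nil G (scal G 1) = \<one>\<^bsub>RA\<^esub>" unfolding mod_nil_one scal_one by (rule refl)
  show "mod_nil G (M_cls G T {z} {}) \<in> carrier RA" if "z \<in> carrier \<Gamma>" for z
    unfolding M_cls_linear[OF that] by (rule mod_nil_simps(1)[OF Lz_closed[OF that]])
  show "mod_nil G (M_cls G T {z \<otimes>\<^bsub>\<Gamma>\<^esub> w} {}) = mod_nil G (M_cls G T {z} {}) \<otimes>\<^bsub>RA\<^esub> mod_nil G (M_cls G T {w} {})"
    if "z \<in> carrier \<Gamma>" "w \<in> carrier \<Gamma>" for z w
    unfolding M_cls_linear[OF that(1)] M_cls_linear[OF that(2)] M_cls_linear[OF ab.m_closed[OF that]] Lz_mult[OF that]
      mod_nil_simps(3)[OF Lz_closed[OF that(1)] Lz_closed[OF that(2)]] by (rule refl)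
  show "mod_nil G (M_cls G T {\<one>\<^bsub>\<Gamma>\<^esub>} {}) = \<one>\<^bsub>RA\<^esub>"
    unfolding M_cls_linear[OF ab.one_closed] Lz_one mod_nil_one by (rule refl)
qed

lemma red_module_eq: "red_module G T = act.MM"
  by (simp add: red_module_def)

text \<open>The whole group stabilizes the line of a linear character, so twisting changes the
  character of a type but not its stabilizer. Conditions on stabilizers therefore cut out subspaces
  stable under \<open>\<Gamma>\<close>.\<close>

lemma Domain_linear_tensor:
  assumes z: "z \<in> carrier \<Gamma>" and V: "pointed V v"
  shows "Domain (gr (rep_tensor (linear_rep (T z)) V) (vec_tensor (rdim V) (unit_vec0 1) v)) = Domain (gr V v)"
proof -
  have "(h, T z h) \<in> gr (linear_rep (T z)) (unit_vec0 1)" if "h \<in> carrier G" for h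
    using that by (simp add: gr_def act_linear) (simp add: unit_vec0_def vscale_def fun_eq_iff)
  then show ?thesis
    unfolding gr_tensor[OF T_pointed[OF z one_neq_zero] V] using gr_carrier[of _ _ V v] by blast
qed

text \<open>If the type sums outside \<open>P\<close> vanish, deleting the basis elements of those
  types with \<open>proj P\<close> does not change the coset.\<close>

lemma mod_nil_kspan:
  assumes x: "x \<in> carrier GA"
  shows "mod_nil G x \<in> mod_nil G ` kspan P \<longleftrightarrow> (\<forall>t. \<not> P t \<longrightarrow> tsum t x = 0)"
proof
  assume "mod_nil G x \<in> mod_nil G ` kspan P"
  then obtain y where y: "y \<in> kspan P" "mod_nil G x = mod_nil G y" by blast
  then have "\<forall>t. tsum t x = tsum t y" using mod_nil_eq[OF x] kspan_closed by blast
  then show "\<forall>t. \<not> P t \<longrightarrow> tsum t x = 0" using tsum_kspan[OF y(1)] by simp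
next
  assume "\<forall>t. \<not> P t \<longrightarrow> tsum t x = 0"
  then have "mod_nil G x = mod_nil G (proj P x)" unfolding mod_nil_eq[OF x proj_closed] tsum_proj[OF x] by simp
  then show "mod_nil G x \<in> mod_nil G ` kspan P" using proj_kspan[OF x] by blast
qed

lemma submodule_kspan:
  assumes P: "\<And>t u. Domain t = Domain u \<Longrightarrow> P t \<longleftrightarrow> P u"
  shows "submodule (mod_nil G ` kspan P) (group_alg \<Gamma>) (red_module G T)"
  unfolding red_module_eq
proof (rule act.submodule_MM)
  note c = subsetD[OF kspan_closed]
  show "mod_nil G ` kspan P \<subseteq> carrier RA" using mod_nil_simps(1)[OF c] by blast
  show "\<zero>\<^bsub>RA\<^esub> \<in> mod_nil G ` kspan P" unfolding mod_nil_zero using kspan_zero by blast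
  show "\<ominus>\<^bsub>RA\<^esub> C \<in> mod_nil G ` kspan P" if C: "C \<in> mod_nil G ` kspan P" for C
    using C by (elim imageE) (simp add: mod_nil_simps(4)[OF c] kspan_minus)
  show "C \<oplus>\<^bsub>RA\<^esub> D \<in> mod_nil G ` kspan P" if C: "C \<in> mod_nil G ` kspan P" and D: "D \<in> mod_nil G ` kspan P" for C D
    using C D by (elim imageE) (simp add: mod_nil_simps(2)[OF c c] kspan_add)
  show "mod_nil G (scal G q) \<otimes>\<^bsub>RA\<^esub> C \<in> mod_nil G ` kspan P" if C: "C \<in> mod_nil G ` kspan P" for q C
  proof -
    obtain x where x: "x \<in> kspan P" "C = mod_nil G x" using C by blast
    have "scal G q \<otimes>\<^bsub>GA\<^esub> x = proj P (scal G q \<otimes>\<^bsub>GA\<^esub> x)" using proj_scale[OF c[OF x(1)], of P q] proj_id[OF x(1)] by simp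
    then have "scal G q \<otimes>\<^bsub>GA\<^esub> x \<in> kspan P" using proj_kspan[OF A.m_closed[OF scal_closed c[OF x(1)]]] by metis
    then show ?thesis unfolding x(2) mod_nil_simps(3)[OF scal_closed c[OF x(1)]] by blast
  qed
  show "mod_nil G (M_cls G T {z} {}) \<otimes>\<^bsub>RA\<^esub> C \<in> mod_nil G ` kspan P"
    if z: "z \<in> carrier \<Gamma>" and C: "C \<in> mod_nil G ` kspan P" for z C
  proof -
    obtain x where x: "x \<in> kspan P" "C = mod_nil G x" using C by blast
    have "proj P (Lz z \<otimes>\<^bsub>GA\<^esub> x) = Lz z \<otimes>\<^bsub>GA\<^esub> proj P x"
      unfolding Lz_def by (rule proj_mult_kl[OF T_pointed[OF z one_neq_zero] P[OF Domain_linear_tensor[OF z]] c[OF x(1)]])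
    then have "Lz z \<otimes>\<^bsub>GA\<^esub> x = proj P (Lz z \<otimes>\<^bsub>GA\<^esub> x)" using proj_id[OF x(1)] by simp
    then have "Lz z \<otimes>\<^bsub>GA\<^esub> x \<in> kspan P" using proj_kspan[OF A.m_closed[OF Lz_closed[OF z] c[OF x(1)]]] by metis
    then show ?thesis unfolding x(2) M_cls_linear[OF z] mod_nil_simps(3)[OF Lz_closed[OF z] c[OF x(1)]] by blast
  qed
qed

lemma Rt_Domain: "Domain t = Domain u \<Longrightarrow> Rt t \<longleftrightarrow> Rt u"
  by (simp add: Rt_def)

lemma kspan_False: "kspan (\<lambda>t. False) = {\<zero>\<^bsub>GA\<^esub>}"
  unfolding kspan_def by (simp add: qspan_empty)

lemma glider_sub_intermediate: "H \<in> intermediate G \<Longrightarrow> glider_sub G H"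
  by (intro glider_sub.intro glider_ctx_axioms) (simp add: intermediate_def)

lemma ind_map_red_hom:
  assumes H: "H \<in> intermediate G"
  shows "ind_map_red G H \<in> mod_hom (group_alg \<Gamma>) (red_module_sub G T H) (red_module G T)"
proof -
  interpret S: glider_sub G K H by (rule glider_sub_intermediate[OF H])
  let ?H = "G\<lparr>carrier := H\<rparr>"
  let ?u = "unit_vec0 1 :: nat \<Rightarrow> 'k"
  have lin: "glider_cls ?H (linear_glider (T z)) = S.Hg.kl (linear_rep (T z)) ?u"
    and linp: "S.Hg.pointed (linear_rep (T z)) ?u" if z: "z \<in> carrier \<Gamma>" for z
  proof -
    have "is_glider ?H (linear_glider (T z))"
      by (rule S.Hg.is_glider_linear) (use T_one[OF z] T_mult[OF z] subsetD[OF S.subset] in simp_all)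
    from S.Hg.glider_cls_line[OF this, of ?u] show "glider_cls ?H (linear_glider (T z)) = S.Hg.kl (linear_rep (T z)) ?u"
      by (simp add: linear_glider_def line_glider_def)
    show "S.Hg.pointed (linear_rep (T z)) ?u"
      using T_pointed[OF z one_neq_zero] by (simp add: pointed_def S.Hg.pointed_def S.Hg_rep)
  qed
  show ?thesis
    unfolding red_module_sub_def red_module_def
  proof (rule mult_module_hom[OF S.Hg.RA.is_cring RA.is_cring finite_\<Gamma>])
    show "mod_nil ?H (scal ?H q) \<in> carrier S.Hg.RA" for q by (rule S.Hg.mod_nil_simps(1)[OF S.Hg.scal_closed])
    show "mod_nil G (scal G q) \<in> carrier RA" for q by (rule mod_nil_simps(1)[OF scal_closed])
    show "mod_nil ?H (glider_cls ?H (linear_glider (T z))) \<in> carrier S.Hg.RA" if "z \<in> carrier \<Gamma>" for z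
      unfolding lin[OF that] by (rule S.Hg.mod_nil_simps(1)[OF S.Hg.kl_closed[OF linp[OF that]]])
    show "mod_nil G (M_cls G T {z} {}) \<in> carrier RA" if "z \<in> carrier \<Gamma>" for z by (rule act.c_closed[OF that])
    fix C assume "C \<in> carrier S.Hg.RA"
    then obtain x where x: "x \<in> carrier S.Hg.GA" "C = mod_nil ?H x" unfolding S.Hg.carrier_RA by blast
    note ix = S.ind_closed[of x]
    show "ind_map_red G H C \<in> carrier RA"
      unfolding x(2) S.ind_map_red_mod_nil[OF x(1)] by (rule mod_nil_simps(1)[OF ix])
    show "ind_map_red G H (C \<oplus>\<^bsub>S.Hg.RA\<^esub> D) = ind_map_red G H C \<oplus>\<^bsub>RA\<^esub> ind_map_red G H D"
      if "D \<in> carrier S.Hg.RA" for D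
    proof -
      obtain y where y: "y \<in> carrier S.Hg.GA" "D = mod_nil ?H y" using \<open>D \<in> carrier S.Hg.RA\<close> unfolding S.Hg.carrier_RA by blast
      show ?thesis
        unfolding x(2) y(2) S.Hg.mod_nil_simps(2)[OF x(1) y(1)] S.ind_map_red_mod_nil[OF x(1)]
          S.ind_map_red_mod_nil[OF y(1)] S.ind_map_red_mod_nil[OF S.Hg.A.a_closed[OF x(1) y(1)]]
          S.ind_add[OF x(1) y(1)] mod_nil_simps(2)[OF ix S.ind_closed] by (rule refl)
    qed
    show "ind_map_red G H (mod_nil ?H (scal ?H q) \<otimes>\<^bsub>S.Hg.RA\<^esub> C) = mod_nil G (scal G q) \<otimes>\<^bsub>RA\<^esub> ind_map_red G H C" for q
      unfolding x(2) S.Hg.mod_nil_simps(3)[OF S.Hg.scal_closed x(1)] S.ind_map_red_mod_nil[OF x(1)]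
        S.ind_map_red_mod_nil[OF S.Hg.A.m_closed[OF S.Hg.scal_closed x(1)]] S.ind_scale[OF x(1)]
        mod_nil_simps(3)[OF scal_closed ix] by (rule refl)
    show "ind_map_red G H (mod_nil ?H (glider_cls ?H (linear_glider (T z))) \<otimes>\<^bsub>S.Hg.RA\<^esub> C) =
        mod_nil G (M_cls G T {z} {}) \<otimes>\<^bsub>RA\<^esub> ind_map_red G H C" if z: "z \<in> carrier \<Gamma>" for z
      unfolding x(2) lin[OF z] S.Hg.mod_nil_simps(3)[OF S.Hg.kl_closed[OF linp[OF z]] x(1)] S.ind_map_red_mod_nil[OF x(1)]
        S.ind_map_red_mod_nil[OF S.Hg.A.m_closed[OF S.Hg.kl_closed[OF linp[OF z]] x(1)]]
        S.mod_nil_ind_linear[OF T_pointed[OF z one_neq_zero] x(1)] M_cls_linear[OF z, unfolded Lz_def]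
        mod_nil_simps(3)[OF Lz_closed[OF z, unfolded Lz_def] ix] by (rule refl)
  qed
qed

text \<open>A type with nonzero sum in an induced element has its stabilizer inside the subgroup, so
  it violates \<open>Rt\<close> by \<open>not_Rt\<close>. Conversely \<open>not_Rt\<close> provides
  a subgroup, and restriction followed by induction returns the same type.\<close>

lemma left_part_eq: "left_part G T I = mod_nil G ` kspan (\<lambda>t. \<not> Rt t)" (is "_ = ?X")
proof -
  let ?S = "mod_nil G ` E_mod G T I \<union> mod_nil G ` P_mod G T I \<union>
     (\<Union>H\<in>intermediate G. ind_map_red G H ` carrier (red_alg (G\<lparr>carrier := H\<rparr>)))"
  note c = subsetD[OF kspan_closed]
  have EP: "mod_nil G ` E_mod G T I = {\<zero>\<^bsub>RA\<^esub>}" "mod_nil G ` P_mod G T I = {\<zero>\<^bsub>RA\<^esub>}"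
    by (simp_all add: E_mod_zero P_mod_zero mod_nil_zero)
  have ind: "C \<in> ?X" if H: "H \<in> intermediate G" and C: "C \<in> ind_map_red G H ` carrier (red_alg (G\<lparr>carrier := H\<rparr>))" for H C
  proof -
    interpret S: glider_sub G K H by (rule glider_sub_intermediate[OF H])
    obtain x where x: "x \<in> carrier S.Hg.GA" "C = mod_nil G (S.ind x)"
      using C S.ind_map_red_mod_nil unfolding S.Hg.carrier_RA by force
    have "tsum t (S.ind x) = 0" if R: "Rt t" for t
    proof (cases "Domain t \<subseteq> H")
      case True
      then have "Domain t \<subseteq> carrier G" using S.subset by blast
      then show ?thesis using not_Rt H True R by blast
    next
      case False
      then show ?thesis using S.tsum_ind[OF x(1)] S.tsum_Hg_zero[OF x(1)] by simp
    qed
    then show ?thesis unfolding x(2) mod_nil_kspan[OF S.ind_closed] by blast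
  qed
  have zeroX: "\<zero>\<^bsub>RA\<^esub> \<in> ?X" unfolding mod_nil_zero using kspan_zero by blast
  have SX: "?S \<subseteq> ?X"
  proof (intro Un_least UN_least subsetI)
    show "C \<in> ?X" if "C \<in> mod_nil G ` E_mod G T I" for C using that zeroX unfolding EP by simp
    show "C \<in> ?X" if "C \<in> mod_nil G ` P_mod G T I" for C using that zeroX unfolding EP by simp
  qed (rule ind)
  have XR: "?X \<subseteq> carrier RA" using mod_nil_simps(1)[OF c] by blast
  have "left_part G T I \<subseteq> ?X"
    unfolding left_part_def
  proof (rule RA.add_span_least[OF SX zeroX])
    show "\<ominus>\<^bsub>RA\<^esub> C \<in> ?X" if C: "C \<in> ?X" for C
      using C by (elim imageE) (simp add: mod_nil_simps(4)[OF c] kspan_minus)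
    show "C \<oplus>\<^bsub>RA\<^esub> D \<in> ?X" if C: "C \<in> ?X" and D: "D \<in> ?X" for C D
      using C D by (elim imageE) (simp add: mod_nil_simps(2)[OF c c] kspan_add)
  qed
  moreover have "mod_nil G x \<in> left_part G T I" if "x \<in> kspan (\<lambda>t. \<not> Rt t)" for x
    using that
  proof (induction rule: kspan_induct)
    case zero
    then show ?case unfolding left_part_def mod_nil_zero[symmetric] by (rule RA.add_span_zero)
  next
    case (base q V v)
    have "Domain (gr V v) \<subseteq> carrier G" using gr_carrier[of _ _ V v] by blast
    then obtain H where H: "H \<in> intermediate G" "Domain (gr V v) \<subseteq> H" using not_Rt base(2) by blast
    interpret S: glider_sub G K H by (rule glider_sub_intermediate[OF H(1)])
    note r = S.gr_restrict[OF base(1) H(2)]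
    let ?x = "scal (G\<lparr>carrier := H\<rparr>) q \<otimes>\<^bsub>S.Hg.GA\<^esub> S.Hg.kl V v"
    have x: "?x \<in> carrier S.Hg.GA" by (rule S.Hg.A.m_closed[OF S.Hg.scal_closed S.Hg.kl_closed[OF r(1)]])
    have "mod_nil G (scal G q \<otimes>\<^bsub>GA\<^esub> kl V v) = ind_map_red G H (mod_nil (G\<lparr>carrier := H\<rparr>) ?x)"
      unfolding S.ind_map_red_mod_nil[OF x] by (rule S.mod_nil_restrict[OF base(1) H(2)])
    then have "mod_nil G (scal G q \<otimes>\<^bsub>GA\<^esub> kl V v) \<in> ?S"
      using H(1) S.Hg.mod_nil_simps(1)[OF x] by blast
    then show ?case unfolding left_part_def by (rule generate.incl)
  next
    case (add x y)
    then show ?case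
      unfolding left_part_def mod_nil_simps(2)[OF c[OF add(1)] c[OF add(2)], symmetric] by (intro RA.add_span_add)
  qed
  ultimately show ?thesis by blast
qed

text \<open>\<open>proj Rt\<close> passed to the quotient. The union over members collapses because
  \<open>proj\<close> acts on the type sums one type at a time.\<close>

definition rproj :: "('a, 'k) rat_elem set \<Rightarrow> ('a, 'k) rat_elem set"
  where "rproj C = (\<Union>x\<in>C. mod_nil G (proj Rt x))"

lemma rproj:
  assumes x: "x \<in> carrier GA"
  shows "rproj (mod_nil G x) = mod_nil G (proj Rt x)"
proof -
  have "mod_nil G (proj Rt y) = mod_nil G (proj Rt x)" if y: "y \<in> mod_nil G x" for y
  proof -
    have y': "y \<in> carrier GA" "mod_nil G y = mod_nil G x" using mod_nil_members[OF x y] by simp_all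
    then show ?thesis
      unfolding mod_nil_eq[OF proj_closed proj_closed] tsum_proj[OF y'(1)] tsum_proj[OF x]
      using mod_nil_eq[OF y'(1) x] by simp
  qed
  then show ?thesis unfolding rproj_def using mod_nil_self[OF x] by blast
qed

lemma rproj_hom: "rproj \<in> mod_hom (group_alg \<Gamma>) (red_module G T) (red_module G T)"
  unfolding red_module_eq
proof (rule mult_module_hom[OF RA.is_cring RA.is_cring finite_\<Gamma>])
  show "mod_nil G (scal G q) \<in> carrier RA" for q by (rule act.s_closed)
  show "mod_nil G (scal G q) \<in> carrier RA" for q by (rule act.s_closed)
  show "mod_nil G (M_cls G T {z} {}) \<in> carrier RA" if "z \<in> carrier \<Gamma>" for z by (rule act.c_closed[OF that])
  show "mod_nil G (M_cls G T {z} {}) \<in> carrier RA" if "z \<in> carrier \<Gamma>" for z by (rule act.c_closed[OF that])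
  fix C assume "C \<in> carrier RA"
  then obtain x where x: "x \<in> carrier GA" "C = mod_nil G x" unfolding carrier_RA by blast
  show "rproj C \<in> carrier RA" unfolding x(2) rproj[OF x(1)] by (rule mod_nil_simps(1)[OF proj_closed])
  show "rproj (C \<oplus>\<^bsub>RA\<^esub> D) = rproj C \<oplus>\<^bsub>RA\<^esub> rproj D" if "D \<in> carrier RA" for D
  proof -
    obtain y where y: "y \<in> carrier GA" "D = mod_nil G y" using \<open>D \<in> carrier RA\<close> unfolding carrier_RA by blast
    show ?thesis
      unfolding x(2) y(2) mod_nil_simps(2)[OF x(1) y(1)] rproj[OF x(1)] rproj[OF y(1)] rproj[OF A.a_closed[OF x(1) y(1)]]
        proj_add[OF x(1) y(1)] mod_nil_simps(2)[OF proj_closed proj_closed] by (rule refl)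
  qed
  show "rproj (mod_nil G (scal G q) \<otimes>\<^bsub>RA\<^esub> C) = mod_nil G (scal G q) \<otimes>\<^bsub>RA\<^esub> rproj C" for q
    unfolding x(2) mod_nil_simps(3)[OF scal_closed x(1)] rproj[OF x(1)] rproj[OF A.m_closed[OF scal_closed x(1)]]
      proj_scale[OF x(1)] mod_nil_simps(3)[OF scal_closed proj_closed] by (rule refl)
  show "rproj (mod_nil G (M_cls G T {z} {}) \<otimes>\<^bsub>RA\<^esub> C) = mod_nil G (M_cls G T {z} {}) \<otimes>\<^bsub>RA\<^esub> rproj C"
    if z: "z \<in> carrier \<Gamma>" for z
  proof -
    have "proj Rt (Lz z \<otimes>\<^bsub>GA\<^esub> x) = Lz z \<otimes>\<^bsub>GA\<^esub> proj Rt x"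
      unfolding Lz_def by (rule proj_mult_kl[OF T_pointed[OF z one_neq_zero] Rt_Domain[OF Domain_linear_tensor[OF z]] x(1)])
    then show ?thesis
      unfolding x(2) M_cls_linear[OF z] mod_nil_simps(3)[OF Lz_closed[OF z] x(1)] rproj[OF x(1)]
        rproj[OF A.m_closed[OF Lz_closed[OF z] x(1)]] mod_nil_simps(3)[OF Lz_closed[OF z] proj_closed] by simp
  qed
qed

text \<open>In the coordinates given by type sums, \<open>rproj\<close> keeps those in
  \<open>Rt\<close> and deletes the others. Its kernel is the left module by
  \<open>left_part_eq\<close>, its image the right one by \<open>R_mod_eq\<close>.\<close>

lemma exact_sequence:
  "short_exact (group_alg \<Gamma>) ((red_module G T)\<lparr>carrier := left_part G T I\<rparr>) (red_module G T)
    ((red_module G T)\<lparr>carrier := mod_nil G ` R_mod G T I\<rparr>) (\<lambda>x. x) rproj"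
proof -
  let ?M = "red_module G T"
  have M: "module (group_alg \<Gamma>) ?M" unfolding red_module_eq by (rule act.module_MM)
  have L: "submodule (left_part G T I) (group_alg \<Gamma>) ?M"
    unfolding left_part_eq by (rule submodule_kspan, rule arg_cong[where f = Not], rule Rt_Domain)
  have R: "submodule (mod_nil G ` R_mod G T I) (group_alg \<Gamma>) ?M"
    unfolding R_mod_eq by (rule submodule_kspan) (rule Rt_Domain)
  have cM: "carrier ?M = mod_nil G ` carrier GA" unfolding red_module_eq act.MM_simps by (rule carrier_RA)
  have zM: "\<zero>\<^bsub>?M\<^esub> = mod_nil G \<zero>\<^bsub>GA\<^esub>" unfolding red_module_eq act.MM_simps by (rule mod_nil_zero)
  have img: "rproj ` carrier ?M = mod_nil G ` R_mod G T I"
  proof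
    show "rproj ` carrier ?M \<subseteq> mod_nil G ` R_mod G T I"
    proof
      fix C assume "C \<in> rproj ` carrier ?M"
      then obtain x where x: "x \<in> carrier GA" "C = rproj (mod_nil G x)" unfolding cM by blast
      show "C \<in> mod_nil G ` R_mod G T I"
        unfolding x(2) rproj[OF x(1)] R_mod_eq by (rule imageI[OF proj_kspan[OF x(1)]])
    qed
    show "mod_nil G ` R_mod G T I \<subseteq> rproj ` carrier ?M"
    proof
      fix C assume "C \<in> mod_nil G ` R_mod G T I"
      then obtain x where x: "x \<in> kspan Rt" "C = mod_nil G x" unfolding R_mod_eq by blast
      have xc: "x \<in> carrier GA" using x(1) kspan_closed by blast
      have "C = rproj (mod_nil G x)" unfolding rproj[OF xc] proj_id[OF x(1)] by (rule x(2))
      then show "C \<in> rproj ` carrier ?M" unfolding cM using xc by blast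
    qed
  qed
  have ker: "mod_nil G x \<in> left_part G T I \<longleftrightarrow> rproj (mod_nil G x) = \<zero>\<^bsub>?M\<^esub>" if x: "x \<in> carrier GA" for x
    unfolding left_part_eq mod_nil_kspan[OF x] rproj[OF x] zM mod_nil_eq[OF proj_closed A.zero_closed] tsum_proj[OF x]
      A.tsum_zero by simp
  have sub: "left_part G T I \<subseteq> carrier ?M" unfolding left_part_eq cM using kspan_closed by blast
  show ?thesis
    unfolding short_exact_def
  proof (intro conjI)
    show "module (group_alg \<Gamma>) (?M\<lparr>carrier := left_part G T I\<rparr>)" by (rule submodule.submodule_is_module[OF L M])
    show "module (group_alg \<Gamma>) (?M\<lparr>carrier := mod_nil G ` R_mod G T I\<rparr>)" by (rule submodule.submodule_is_module[OF R M])
    show "(\<lambda>x. x) \<in> mod_hom (group_alg \<Gamma>) (?M\<lparr>carrier := left_part G T I\<rparr>) ?M"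
      unfolding mod_hom_def using sub by auto
    show "rproj \<in> mod_hom (group_alg \<Gamma>) ?M (?M\<lparr>carrier := mod_nil G ` R_mod G T I\<rparr>)"
      using rproj_hom img unfolding mod_hom_def by auto
    show "(\<lambda>x. x) ` carrier (?M\<lparr>carrier := left_part G T I\<rparr>) =
        {x \<in> carrier ?M. rproj x = \<zero>\<^bsub>?M\<lparr>carrier := mod_nil G ` R_mod G T I\<rparr>\<^esub>}"
    proof (rule Set.set_eqI)
      fix C
      show "C \<in> (\<lambda>x. x) ` carrier (?M\<lparr>carrier := left_part G T I\<rparr>) \<longleftrightarrow>
          C \<in> {x \<in> carrier ?M. rproj x = \<zero>\<^bsub>?M\<lparr>carrier := mod_nil G ` R_mod G T I\<rparr>\<^esub>}"
      proof (cases "C \<in> carrier ?M")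
        case True
        then obtain x where "x \<in> carrier GA" "C = mod_nil G x" unfolding cM by blast
        then show ?thesis using ker True by simp
      next
        case False
        then show ?thesis using sub by auto
      qed
    qed
    show "rproj ` carrier ?M = carrier (?M\<lparr>carrier := mod_nil G ` R_mod G T I\<rparr>)" using img by simp
  qed (use M in simp_all)
qed

text \<open>Serves for \<open>E_mod\<close> and \<open>P_mod\<close> alike, both being zero; it is
  the case of an empty set of types.\<close>

lemma zero_submodule: "submodule (mod_nil G ` {\<zero>\<^bsub>GA\<^esub>}) (group_alg \<Gamma>) (red_module G T)"
  using submodule_kspan[of "\<lambda>t. False"] unfolding kspan_False by simp

end

theorem theorem2:
  fixes G :: "'g monoid"
    and T :: "'g set \<Rightarrow> 'g \<Rightarrow> 'k::{alg_closed_field, field_char_0}"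
    and I :: "('g, 'k) rep set"
  assumes "group G" and "finite (carrier G)"
    and "T \<in> iso (abelianization G) (linear_characters G)"
    and "irr_system G I"
  shows "submodule (mod_nil G ` E_mod G T I) (group_alg (abelianization G)) (red_module G T) \<and>
    submodule (mod_nil G ` P_mod G T I) (group_alg (abelianization G)) (red_module G T) \<and>
    (\<forall>H\<in>intermediate G.
       ind_map_red G H \<in>
         mod_hom (group_alg (abelianization G)) (red_module_sub G T H) (red_module G T)) \<and>
    (\<exists>\<pi>. short_exact (group_alg (abelianization G))
       ((red_module G T)\<lparr>carrier := left_part G T I\<rparr>)
       (red_module G T)
       ((red_module G T)\<lparr>carrier := mod_nil G ` R_mod G T I\<rparr>)
       (\<lambda>x. x) \<pi>)"
proof -
  interpret glider_param G "TYPE('k)" T I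
    by (intro glider_param.intro glider_ctx.intro fin_grp.intro fin_grp_axioms.intro glider_param_axioms.intro assms)
  show ?thesis
    unfolding E_mod_zero P_mod_zero using zero_submodule ind_map_red_hom exact_sequence by blast
qed

end
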